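(* Let $\Omega$ be a domain in $\mathbb{C}$, and suppose $Q:\Omega\to\mathbb{R}$ is $C^4$-smooth with $\Delta Q>0$ on $\Omega$ and $$\sup_{\Omega}\frac{1}{\Delta Q}\,\Delta\log\frac{1}{\Delta Q}<+\infty .$$ Suppose, in addition, that $Q$ is real-analytic in a neighborhood of a point $z_0\in\Omega$. For $\xi,\eta\in\mathbb{C}$ and $m>0$ put $$\xi':=[2m\,\Delta Q(z_0)]^{-1/2}\xi,\qquad \eta':=[2m\,\Delta Q(z_0)]^{-1/2}\eta .$$ Then for every compact set $S\subset\mathbb{C}^2$ there exist constants $m_0>0$ and $C>0$ such that for all real $m\ge m_0$ and all $(\xi,\eta)\in S$ the points $z_0+\xi'$ and $z_0+\eta'$ lie in $\Omega$ and $$\left|\frac{1}{2m\,\Delta Q(z_0)}\,\bigl|K_{2,m}(z_0+\xi',z_0+\eta')\bigr|\,e^{-mQ(z_0+\xi')-mQ(z_0+\eta')}-\frac{\bigl|2-|\xi-\eta|^2\bigr|}{\pi}\,e^{-\frac12|\xi-\eta|^2}\right|\le C\,m^{-1/2}.$$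
   Context: Notation: $\Delta:=\partial_z\bar\partial_z=\frac14\bigl(\frac{\partial^2}{\partial x^2}+\frac{\partial^2}{\partial y^2}\bigr)$ is the normalized (quarter) Laplacian, and $dA(z)=dx\,dy$ is Lebesgue area measure. A function $f$ on $\Omega$ is bianalytic ($2$-analytic) if $\bar\partial_z^2f=0$ on $\Omega$. For real $m>0$, $\mathrm{PA}^2_{2,m}$ is the closed subspace of $L^2(\Omega,e^{-2mQ})$ (norm $\|f\|^2=\int_\Omega|f|^2e^{-2mQ}dA$) consisting of bianalytic functions on $\Omega$; point evaluations are bounded on it. $K_{2,m}(z,w)$ denotes its reproducing kernel: $K_{2,m}(\cdot,w)\in\mathrm{PA}^2_{2,m}$ and $f(w)=\int_\Omega f(z)\overline{K_{2,m}(z,w)}e^{-2mQ(z)}dA(z)$ for all $f\in\mathrm{PA}^2_{2,m}$, $w\in\Omega$. *)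

theory Defs
  imports "HOL-Analysis.Analysis"
begin

definition partial_x :: "(complex \<Rightarrow> 'a::real_normed_vector) \<Rightarrow> complex \<Rightarrow> 'a" where
  "partial_x f z = frechet_derivative f (at z) 1"

definition partial_y :: "(complex \<Rightarrow> 'a::real_normed_vector) \<Rightarrow> complex \<Rightarrow> 'a" where
  "partial_y f z = frechet_derivative f (at z) \<i>"

text \<open>Real \<open>C\<^sup>k\<close>-smoothness in the variables \<open>x\<close>, \<open>y\<close>; meant for open \<open>S\<close>.\<close>

primrec Ck_on :: "nat \<Rightarrow> (complex \<Rightarrow> 'a::real_normed_vector) \<Rightarrow> complex set \<Rightarrow> bool" where
  "Ck_on 0 f S \<longleftrightarrow> continuous_on S f"
| "Ck_on (Suc k) f S \<longleftrightarrow>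
     f differentiable_on S \<and> Ck_on k (partial_x f) S \<and> Ck_on k (partial_y f) S"

text \<open>The normalized Laplacian, one quarter of the usual one.\<close>

definition qlaplacian :: "(complex \<Rightarrow> real) \<Rightarrow> complex \<Rightarrow> real" where
  "qlaplacian f z = (partial_x (partial_x f) z + partial_y (partial_y f) z) / 4"

definition dbar :: "(complex \<Rightarrow> complex) \<Rightarrow> complex \<Rightarrow> complex" where
  "dbar f z = (partial_x f z + \<i> * partial_y f z) / 2"

text \<open>The equation \<open>dbar (dbar f) = 0\<close> is read classically. The \<open>C\<^sup>2\<close> requirement is part
  of this reading: \<^const>\<open>frechet_derivative\<close> has no meaning at points where the function is
  not differentiable.\<close>

definition bianalytic_on :: "(complex \<Rightarrow> complex) \<Rightarrow> complex set \<Rightarrow> bool" where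
  "bianalytic_on f S \<longleftrightarrow> Ck_on 2 f S \<and> (\<forall>z\<in>S. dbar (dbar f) z = 0)"

text \<open>Since \<open>nat \<times> nat\<close> carries no preferred order, \<^const>\<open>has_sum\<close> makes this absolute
  convergence of the double power series in \<open>x\<close> and \<open>y\<close>.\<close>

definition real_analytic_at :: "(complex \<Rightarrow> real) \<Rightarrow> complex \<Rightarrow> bool" where
  "real_analytic_at f a \<longleftrightarrow>
     (\<exists>c :: nat \<Rightarrow> nat \<Rightarrow> real. \<exists>r>0. \<forall>z\<in>ball a r.
        ((\<lambda>(j, k). c j k * Re (z - a) ^ j * Im (z - a) ^ k) has_sum f z) UNIV)"

definition real_analytic_on :: "(complex \<Rightarrow> real) \<Rightarrow> complex set \<Rightarrow> bool" where
  "real_analytic_on f U \<longleftrightarrow> (\<forall>a\<in>U. real_analytic_at f a)"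

text \<open>Each class of the weighted \<open>L\<^sup>2\<close> space that contains a bianalytic function is
  represented by that function, which is unique on the open set \<open>\<Omega>\<close>. Values off \<open>\<Omega>\<close> are
  unconstrained.\<close>

definition PA2 :: "complex set \<Rightarrow> (complex \<Rightarrow> real) \<Rightarrow> real \<Rightarrow> (complex \<Rightarrow> complex) set" where
  "PA2 \<Omega> Q m = {f. bianalytic_on f \<Omega> \<and>
     set_integrable lborel \<Omega> (\<lambda>z. (cmod (f z))\<^sup>2 * exp (- 2 * m * Q z))}"

text \<open>These conditions determine \<open>K\<close> uniquely on \<open>\<Omega> \<times> \<Omega>\<close>.\<close>

definition is_PA2_kernel ::
  "complex set \<Rightarrow> (complex \<Rightarrow> real) \<Rightarrow> real \<Rightarrow> (complex \<Rightarrow> complex \<Rightarrow> complex) \<Rightarrow> bool" where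
  "is_PA2_kernel \<Omega> Q m K \<longleftrightarrow>
     (\<forall>w\<in>\<Omega>. (\<lambda>z. K z w) \<in> PA2 \<Omega> Q m \<and>
        (\<forall>f\<in>PA2 \<Omega> Q m.
           f w = (LINT z:\<Omega>|lborel. f z * cnj (K z w) * complex_of_real (exp (- 2 * m * Q z)))))"

end

theory Submission
  imports Defs "HOL-Complex_Analysis.Complex_Analysis"
begin

text \<open>Near \<open>z0\<close> the weight \<open>\<phi> = 2 m Q\<close> differs from a pluriharmonic function by
  \<open>N |z - w|\<^sup>2\<close> with \<open>N = 2 m \<Delta>Q(z0)\<close>, up to an error of relative size \<open>1 / sqrt N\<close> on the scale
  \<open>1 / sqrt N\<close>. For an exactly quadratic weight the bianalytic reproducing kernel is explicit and
  contains the factor \<open>2 - N |z - w|\<^sup>2\<close>; cut off, it is the model kernel \<open>k\<close>. Two facts compare it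
  with the Bergman kernel \<open>K\<close>.

  Pairing a bianalytic \<open>f\<close> with \<open>k\<close> gives \<open>f w\<close> up to a small multiple of the norm of \<open>f\<close>, by
  integration by parts. Moreover, applying the integrated inequality
  \<open>\<integral> \<Delta>\<Phi> e\<^sup>\<Phi> |\<psi>|\<^sup>2 \<le> \<integral> e\<^sup>\<Phi> |d-bar \<psi>|\<^sup>2\<close> first with \<open>\<Phi> = \<phi> + ln \<Delta>Q\<close> and then with \<open>\<Phi> = \<phi>\<close> yields an estimate for
  the square of d-bar, where the bound on \<open>\<Delta> log (1 / \<Delta>Q) / \<Delta>Q\<close> makes the first step work; by duality
  there is a bianalytic \<open>U\<close> on the whole domain with \<open>U - k\<close> small in norm. Testing the reproducing
  property of \<open>K\<close> on \<open>f = U - K(\<cdot>, w)\<close> bounds the norm of \<open>f\<close>, and a mean value estimate at scale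
  \<open>1 / sqrt N\<close> turns the norm bounds for \<open>f\<close> and \<open>U - k\<close> into a pointwise bound for \<open>K - k\<close>.\<close>

section \<open>Wirtinger calculus for smooth functions\<close>

text \<open>The rate is a count of powers of N. At w the weighted model kernel has size N. The norms
  of \<open>U - k\<close> and \<open>U - K(\<cdot>, w)\<close> are at most a constant times
  exp(\<phi>(w)/2), and point evaluation at scale 1/sqrt N costs one factor sqrt N. The weighted
  error is thus O(sqrt N), of relative size 1/sqrt N. The function U mediates because the cut-off k
  is bianalytic only near w: \<open>k - K(\<cdot>, w)\<close> cannot be inserted into the
  reproducing identity, \<open>U - K(\<cdot>, w)\<close> can, and \<open>U - k\<close> may be
  evaluated at z because z stays where the cutoff is 1. The d-bar-squared data of k live in a fixed
  annulus, where the Gaussian beats every power of N. Test functions under the weighted form are an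
  incomplete space, while \<open>PA2\<close> asks for honest C^2 functions. Approximate minimisers
  therefore replace an exact dual solution, and the limit is built pointwise through kernels. The
  pluriharmonic part 2 Re H of the weight enters k as exp(H). Its modulus cancels against the
  weights at z and w, and its phase is lost because only |K| is compared.\<close>

definition pd :: "complex \<Rightarrow> (complex \<Rightarrow> 'a::real_normed_vector) \<Rightarrow> complex \<Rightarrow> 'a" where
  "pd v f z = frechet_derivative f (at z) v"

lemma partial_x_pd: "partial_x f = pd 1 f" and partial_y_pd: "partial_y f = pd \<i> f"
  by (auto simp: partial_x_def partial_y_def pd_def fun_eq_iff)

lemma pd_eqI: "(f has_derivative D) (at z) \<Longrightarrow> pd v f z = D v"
  unfolding pd_def by (metis frechet_derivative_at)

lemma pd_cong:
  assumes "open S" "z \<in> S" "\<And>u. u \<in> S \<Longrightarrow> f u = g u" "f differentiable at z"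
  shows "pd v f z = pd v g z"
  unfolding pd_def using frechet_derivative_transform_within_open[OF assms(4,1,2,3)] by simp

lemma differentiable_on_atD: "f differentiable_on S \<Longrightarrow> open S \<Longrightarrow> z \<in> S \<Longrightarrow> f differentiable at z"
  by (metis at_within_open differentiable_on_def)

lemma differentiable_on_atI: "(\<And>z. z \<in> S \<Longrightarrow> f differentiable at z) \<Longrightarrow> f differentiable_on S"
  by (simp add: differentiable_at_withinI differentiable_on_def)

lemma has_derivative_imp_differentiable_on:
  "(\<And>z. z \<in> S \<Longrightarrow> (f has_derivative D z) (at z)) \<Longrightarrow> f differentiable_on S"
  by (meson differentiable_on_atI differentiable_def)

text \<open>Quantifying over the two directions lets every closure proof below treat x and y at
  once; this form replaces the defining equation in simplification.\<close>

lemma Ck_on_Suc_pd: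
  "Ck_on (Suc k) f S \<longleftrightarrow> f differentiable_on S \<and> (\<forall>v\<in>{1,\<i>}. Ck_on k (pd v f) S)"
  by (simp add: partial_x_pd partial_y_pd)

declare Ck_on.simps(2) [simp del]

lemma Ck_on_Suc_differentiable: "Ck_on (Suc k) f S \<Longrightarrow> open S \<Longrightarrow> z \<in> S \<Longrightarrow> f differentiable at z"
  by (auto simp: Ck_on_Suc_pd dest: differentiable_on_atD)

lemma Ck_on_cong:
  assumes "open S" "Ck_on k f S" "\<And>z. z \<in> S \<Longrightarrow> f z = g z"
  shows "Ck_on k g S"
  using assms(2,3)
proof (induction k arbitrary: f g)
  case 0
  then show ?case by (metis Ck_on.simps(1) continuous_on_cong)
next
  case (Suc k)
  have d: "f differentiable at z" if "z \<in> S" for z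
    using Suc.prems(1) assms(1) that by (rule Ck_on_Suc_differentiable)
  have "g differentiable at z" if "z \<in> S" for z
    using d[OF that] Suc.prems(2) assms(1) that unfolding differentiable_def
    by (metis has_derivative_transform_within_open)
  moreover have "Ck_on k (pd v g) S" if "v \<in> {1,\<i>}" for v
    using Suc.IH[of "pd v f" "pd v g"] Suc.prems that pd_cong[OF assms(1) _ Suc.prems(2) d]
    by (auto simp: Ck_on_Suc_pd)
  ultimately show ?case
    by (auto simp: Ck_on_Suc_pd intro: differentiable_on_atI)
qed

lemma Ck_on_Suc_imp: "Ck_on (Suc k) f S \<Longrightarrow> Ck_on k f S"
proof (induction k arbitrary: f)
  case 0
  then show ?case by (simp add: Ck_on_Suc_pd differentiable_imp_continuous_on)
next
  case (Suc k)
  then show ?case using Ck_on_Suc_pd by blast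
qed

lemma Ck_on_mono: "Ck_on l f S \<Longrightarrow> k \<le> l \<Longrightarrow> Ck_on k f S"
  by (induction l) (auto simp: le_Suc_eq dest: Ck_on_Suc_imp)

lemma Ck_on_continuous: "Ck_on k f S \<Longrightarrow> continuous_on S f"
  using Ck_on_mono[of k f S 0] by simp

lemma Ck_on_subset: "Ck_on k f S \<Longrightarrow> T \<subseteq> S \<Longrightarrow> Ck_on k f T"
  by (induction k arbitrary: f)
     (auto simp: Ck_on_Suc_pd intro: continuous_on_subset differentiable_on_subset)

text \<open>Serves functions glued from pieces, above all products extended by zero beyond a compact
  support.\<close>

lemma Ck_on_local:
  assumes "\<And>z. z \<in> S \<Longrightarrow> \<exists>T. open T \<and> z \<in> T \<and> Ck_on k f T"
  shows "Ck_on k f S"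
  using assms
proof (induction k arbitrary: f)
  case 0
  have "isCont f z" if zS: "z \<in> S" for z
  proof -
    obtain T where "open T" "z \<in> T" "continuous_on T f" using 0[OF zS] by auto
    then show ?thesis by (simp add: continuous_on_eq_continuous_at)
  qed
  then show ?case by (simp add: continuous_at_imp_continuous_on)
next
  case (Suc k)
  have "f differentiable_on S"
  proof (rule differentiable_on_atI)
    fix z assume "z \<in> S"
    then obtain T where "open T" "z \<in> T" "Ck_on (Suc k) f T" using Suc.prems[of z] by blast
    then show "f differentiable at z" using Ck_on_Suc_differentiable by auto
  qed
  moreover have "Ck_on k (pd v f) S" if "v \<in> {1,\<i>}" for v
  proof (rule Suc.IH)
    fix z assume "z \<in> S"
    then obtain T where "open T" "z \<in> T" "Ck_on (Suc k) f T" using Suc.prems[of z] by blast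
    then show "\<exists>T. open T \<and> z \<in> T \<and> Ck_on k (pd v f) T"
      using that unfolding Ck_on_Suc_pd by blast
  qed
  ultimately show ?case by (simp add: Ck_on_Suc_pd)
qed

lemma Ck_on_const: "Ck_on k (\<lambda>z. c) S"
proof (induction k arbitrary: c)
  case (Suc k)
  have "pd v (\<lambda>z. c) = (\<lambda>z. 0)" for v
    using pd_eqI[OF has_derivative_const, of v c] by (simp add: fun_eq_iff)
  then show ?case using Suc by (simp add: Ck_on_Suc_pd)
qed auto

lemma Ck_on_add:
  assumes "open S" "Ck_on k f S" "Ck_on k g S"
  shows "Ck_on k (\<lambda>z. f z + g z) S"
  using assms(2,3)
proof (induction k arbitrary: f g)
  case (Suc k)
  note d = Ck_on_Suc_differentiable[OF _ assms(1)]
  have p: "pd v f z + pd v g z = pd v (\<lambda>z. f z + g z) z" if "z \<in> S" for v z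
    using d[OF Suc.prems(1) that] d[OF Suc.prems(2) that]
    by (auto simp: frechet_derivative_works pd_def intro!: pd_eqI[unfolded pd_def, symmetric] derivative_eq_intros)
  have "Ck_on k (pd v (\<lambda>z. f z + g z)) S" if "v \<in> {1,\<i>}" for v
    using Ck_on_cong[OF assms(1) Suc.IH[of "pd v f" "pd v g"] p] Suc.prems that
    by (auto simp: Ck_on_Suc_pd)
  then show ?case using Suc.prems by (simp add: Ck_on_Suc_pd)
qed (auto intro: continuous_intros)

lemma Ck_on_bounded_bilinear:
  assumes "bounded_bilinear B" "open S" "Ck_on k f S" "Ck_on k g S"
  shows "Ck_on k (\<lambda>z. B (f z) (g z)) S"
  using assms(3,4)
proof (induction k arbitrary: f g)
  case 0
  then show ?case by (simp add: bounded_bilinear.continuous_on[OF assms(1)])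
next
  case (Suc k)
  note d = Ck_on_Suc_differentiable[OF _ assms(2)]
  have D: "((\<lambda>z. B (f z) (g z)) has_derivative
      (\<lambda>h. B (f z) (frechet_derivative g (at z) h) + B (frechet_derivative f (at z) h) (g z))) (at z)"
    if "z \<in> S" for z
    using bounded_bilinear.FDERIV[OF assms(1)] d[OF Suc.prems(1) that] d[OF Suc.prems(2) that]
    by (simp add: frechet_derivative_works)
  have p: "B (f z) (pd v g z) + B (pd v f z) (g z) = pd v (\<lambda>z. B (f z) (g z)) z" if "z \<in> S" for v z
    using pd_eqI[OF D[OF that], of v] by (simp add: pd_def)
  have "Ck_on k (pd v (\<lambda>z. B (f z) (g z))) S" if v: "v \<in> {1,\<i>}" for v
  proof (rule Ck_on_cong[OF assms(2) _ p])
    have "Ck_on k f S" "Ck_on k g S" "Ck_on k (pd v f) S" "Ck_on k (pd v g) S"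
      using Suc.prems v Ck_on_Suc_imp by (auto simp: Ck_on_Suc_pd)
    then show "Ck_on k (\<lambda>z. B (f z) (pd v g z) + B (pd v f z) (g z)) S"
      by (intro Ck_on_add[OF assms(2)] Suc.IH)
  qed
  moreover have "(\<lambda>z. B (f z) (g z)) differentiable_on S"
    using D by (rule has_derivative_imp_differentiable_on)
  ultimately show ?case by (simp add: Ck_on_Suc_pd)
qed

lemmas Ck_on_mult = Ck_on_bounded_bilinear[OF bounded_bilinear_mult]

lemma Ck_on_bounded_linear:
  assumes "bounded_linear L" "open S" "Ck_on k f S"
  shows "Ck_on k (\<lambda>z. L (f z)) S"
  using assms(3)
proof (induction k arbitrary: f)
  case 0
  then show ?case by (simp add: bounded_linear.continuous_on[OF assms(1)])
next
  case (Suc k)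
  have D: "((\<lambda>z. L (f z)) has_derivative (\<lambda>h. L (frechet_derivative f (at z) h))) (at z)" if "z \<in> S" for z
    using bounded_linear.has_derivative[OF assms(1)] Ck_on_Suc_differentiable[OF Suc.prems assms(2) that]
    by (simp add: frechet_derivative_works)
  have p: "L (pd v f z) = pd v (\<lambda>z. L (f z)) z" if "z \<in> S" for v z
    using pd_eqI[OF D[OF that], of v] by (simp add: pd_def)
  have "Ck_on k (pd v (\<lambda>z. L (f z))) S" if v: "v \<in> {1,\<i>}" for v
    using Ck_on_cong[OF assms(2) Suc.IH p] Suc.prems v by (auto simp: Ck_on_Suc_pd)
  moreover have "(\<lambda>z. L (f z)) differentiable_on S"
    using D by (rule has_derivative_imp_differentiable_on)
  ultimately show ?case by (simp add: Ck_on_Suc_pd)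
qed

lemmas Ck_on_cnj = Ck_on_bounded_linear[OF bounded_linear_cnj]
  and Ck_on_of_real = Ck_on_bounded_linear[OF bounded_linear_of_real]
  and Ck_on_minus = Ck_on_bounded_linear[OF bounded_linear_minus[OF bounded_linear_ident]]

lemma Ck_on_diff: "open S \<Longrightarrow> Ck_on k f S \<Longrightarrow> Ck_on k g S \<Longrightarrow> Ck_on k (\<lambda>z. f z - g z) S"
  using Ck_on_add[of S k f "\<lambda>z. - g z"] Ck_on_minus[of S k g] by simp

text \<open>The outer function comes with its whole chain of derivatives \<open>G 0\<close>,
  \<open>G 1\<close>, ..., \<open>G k\<close>. The derivative of the composite is \<open>G 1\<close>
  of f times a partial of f, so the induction simply shifts the chain by one.\<close>

lemma Ck_on_compose_real:
  fixes f :: "complex \<Rightarrow> real" and G :: "nat \<Rightarrow> real \<Rightarrow> real"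
  assumes "open S" "Ck_on k f S"
    and "\<And>i x. i < k \<Longrightarrow> x \<in> f ` S \<Longrightarrow> (G i has_real_derivative G (Suc i) x) (at x)"
    and "continuous_on (f ` S) (G k)"
  shows "Ck_on k (\<lambda>z. G 0 (f z)) S"
  using assms(2-)
proof (induction k arbitrary: G)
  case 0
  then show ?case by (auto intro: continuous_on_compose2)
next
  case (Suc k)
  have D: "((\<lambda>z. G 0 (f z)) has_derivative (\<lambda>h. G 1 (f z) * frechet_derivative f (at z) h)) (at z)"
    if "z \<in> S" for z
    using Suc.prems(2)[of 0 "f z"] Ck_on_Suc_differentiable[OF Suc.prems(1) assms(1) that] that
    unfolding has_field_derivative_def frechet_derivative_works
    by (auto intro: has_derivative_compose)
  have p: "G 1 (f z) * pd v f z = pd v (\<lambda>z. G 0 (f z)) z" if "z \<in> S" for v z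
    using pd_eqI[OF D[OF that], of v] by (simp add: pd_def)
  have "Ck_on k (\<lambda>z. (\<lambda>i. G (Suc i)) 0 (f z)) S"
    by (rule Suc.IH) (use Suc.prems in \<open>auto intro: Ck_on_Suc_imp\<close>)
  then have "Ck_on k (pd v (\<lambda>z. G 0 (f z))) S" if v: "v \<in> {1,\<i>}" for v
    using Suc.prems(1) v
    by (intro Ck_on_cong[OF assms(1) _ p] Ck_on_mult[OF assms(1)]) (auto simp: Ck_on_Suc_pd)
  moreover have "(\<lambda>z. G 0 (f z)) differentiable_on S"
    using D by (rule has_derivative_imp_differentiable_on)
  ultimately show ?case by (simp add: Ck_on_Suc_pd)
qed

lemma Ck_on_exp:
  fixes f :: "complex \<Rightarrow> real"
  assumes "open S" "Ck_on k f S"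
  shows "Ck_on k (\<lambda>z. exp (f z)) S"
  by (rule Ck_on_compose_real[OF assms, of "\<lambda>i. exp"])
     (auto intro: derivative_eq_intros continuous_intros)

lemma Ck_on_ln:
  fixes f :: "complex \<Rightarrow> real"
  assumes "open S" "Ck_on k f S" and pos: "\<And>z. z \<in> S \<Longrightarrow> f z > 0"
  shows "Ck_on k (\<lambda>z. ln (f z)) S"
proof -
  \<comment> \<open>For \<open>Suc j\<close> this is the j-th derivative of 1/x, that is (-1)^j j! /
    x^(j+1).\<close>
  define G :: "nat \<Rightarrow> real \<Rightarrow> real" where
    "G i = (case i of 0 \<Rightarrow> ln | Suc j \<Rightarrow> (\<lambda>x. (-1) ^ j * fact j * (inverse x) ^ Suc j))" for i
  have "(G i has_real_derivative G (Suc i) x) (at x)" if "x > 0" for i x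
  proof (cases i)
    case 0
    then show ?thesis using that by (auto simp: G_def field_simps intro!: derivative_eq_intros)
  next
    case (Suc j)
    have "((\<lambda>x. inverse x) has_real_derivative - (inverse x * inverse x)) (at x)"
      using that by (auto intro!: derivative_eq_intros)
    from DERIV_cmult[OF DERIV_power[OF this, of "Suc j"], of "(-1) ^ j * fact j"]
    show ?thesis by (simp add: G_def Suc mult_ac)
  qed
  moreover have "continuous_on (f ` S) (G k)"
    using pos by (cases k) (force simp: G_def intro!: continuous_intros)+
  ultimately have "Ck_on k (\<lambda>z. G 0 (f z)) S"
    using pos by (intro Ck_on_compose_real[OF assms(1,2)]) auto
  then show ?thesis by (simp add: G_def)
qed

lemma Ck_on_holomorphic:
  assumes "f holomorphic_on S" "open S"
  shows "Ck_on k f S"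
  using assms(1)
proof (induction k arbitrary: f)
  case 0
  then show ?case by (simp add: holomorphic_on_imp_continuous_on)
next
  case (Suc k)
  have D: "(f has_derivative (\<lambda>h. deriv f z * h)) (at z)" if "z \<in> S" for z
    using holomorphic_derivI[OF Suc.prems assms(2) that] by (simp add: has_field_derivative_def)
  have p: "deriv f z * v = pd v f z" if "z \<in> S" for v z
    using pd_eqI[OF D[OF that], of v] by simp
  have "Ck_on k (pd v f) S" for v
    by (rule Ck_on_cong[OF assms(2) _ p])
       (intro Suc.IH holomorphic_intros Suc.prems assms(2))
  moreover have "f differentiable_on S"
    using D by (rule has_derivative_imp_differentiable_on)
  ultimately show ?case by (simp add: Ck_on_Suc_pd)
qed

section \<open>Wirtinger derivatives and the structure of bianalytic functions\<close>

definition dz :: "(complex \<Rightarrow> complex) \<Rightarrow> complex \<Rightarrow> complex" where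
  "dz f z = (partial_x f z - \<i> * partial_y f z) / 2"

text \<open>The real differential in Wirtinger form: \<open>a\<close> and \<open>b\<close> are the values of
  \<open>\<partial>\<close> and \<open>\<partial>\<close>-bar.\<close>

definition wirtinger :: "(complex \<Rightarrow> complex) \<Rightarrow> complex \<Rightarrow> complex \<Rightarrow> complex \<Rightarrow> bool" where
  "wirtinger f z a b \<longleftrightarrow> (f has_derivative (\<lambda>h. a * h + b * cnj h)) (at z)"

lemma wirtinger_unique:
  assumes "wirtinger f z a b"
  shows "dz f z = a" and "dbar f z = b"
proof -
  have *: "partial_x f z = a + b" "partial_y f z = \<i> * (a - b)"
    using pd_eqI[OF assms[unfolded wirtinger_def]]
    by (auto simp: partial_x_pd partial_y_pd algebra_simps)
  show "dz f z = a" "dbar f z = b"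
    unfolding dz_def dbar_def * by (simp_all add: algebra_simps)
qed

lemma wirtinger_dz_dbar:
  assumes "f differentiable at z"
  shows "wirtinger f z (dz f z) (dbar f z)"
proof -
  let ?D = "frechet_derivative f (at z)"
  have D: "(f has_derivative ?D) (at z)"
    using assms by (simp add: frechet_derivative_works)
  then have l: "linear ?D" by (rule has_derivative_linear)
  have "?D h = dz f z * h + dbar f z * cnj h" for h
  proof -
    have "?D (Re h *\<^sub>R 1 + Im h *\<^sub>R \<i>) = Re h *\<^sub>R ?D 1 + Im h *\<^sub>R ?D \<i>"
      by (simp add: linear_add[OF l] linear_scale[OF l])
    moreover have "Re h *\<^sub>R 1 + Im h *\<^sub>R \<i> = h" by (simp add: complex_eq_iff)
    ultimately have "?D h = Re h *\<^sub>R ?D 1 + Im h *\<^sub>R ?D \<i>" by simp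
    then show ?thesis
      by (simp add: dz_def dbar_def partial_x_def partial_y_def complex_eq_iff field_simps)
  qed
  then have "?D = (\<lambda>h. dz f z * h + dbar f z * cnj h)" by (rule ext)
  then show ?thesis using D unfolding wirtinger_def by simp
qed

lemma wirtinger_const: "wirtinger (\<lambda>z. c) z 0 0"
  by (simp add: wirtinger_def)

lemma wirtinger_add: "wirtinger f z a b \<Longrightarrow> wirtinger g z c d \<Longrightarrow> wirtinger (\<lambda>z. f z + g z) z (a + c) (b + d)"
  unfolding wirtinger_def by (drule (1) has_derivative_add) (simp add: algebra_simps)

lemma wirtinger_diff: "wirtinger f z a b \<Longrightarrow> wirtinger g z c d \<Longrightarrow> wirtinger (\<lambda>z. f z - g z) z (a - c) (b - d)"
  unfolding wirtinger_def by (drule (1) has_derivative_diff) (simp add: algebra_simps)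

lemma wirtinger_mult:
  "wirtinger f z a b \<Longrightarrow> wirtinger g z c d \<Longrightarrow>
    wirtinger (\<lambda>z. f z * g z) z (f z * c + a * g z) (f z * d + b * g z)"
  unfolding wirtinger_def by (drule (1) has_derivative_mult) (simp add: algebra_simps)

lemma wirtinger_cnj: "wirtinger f z a b \<Longrightarrow> wirtinger (\<lambda>z. cnj (f z)) z (cnj b) (cnj a)"
  unfolding wirtinger_def by (drule has_derivative_cnj) (simp add: algebra_simps)

lemma wirtinger_field_derivative: "(f has_field_derivative a) (at z) \<Longrightarrow> wirtinger f z a 0"
  by (simp add: wirtinger_def has_field_derivative_def)

lemma wirtinger_compose_real:
  assumes "wirtinger (\<lambda>u. of_real (f u)) z a (cnj a)" "(G has_real_derivative g) (at (f z))"
  shows "wirtinger (\<lambda>u. of_real (G (f u))) z (of_real g * a) (of_real g * cnj a)"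
proof -
  have "((\<lambda>u. Re (of_real (f u))) has_derivative (\<lambda>h. Re (a * h + cnj a * cnj h))) (at z)"
    using assms(1) unfolding wirtinger_def by (rule has_derivative_Re)
  then have "((\<lambda>u. G (f u)) has_derivative (\<lambda>h. g * Re (a * h + cnj a * cnj h))) (at z)"
    using has_derivative_compose[of "\<lambda>u. Re (of_real (f u))" _ z UNIV G "(*) g"] assms(2)
    unfolding has_field_derivative_def by simp
  then have "((\<lambda>u. of_real (G (f u))) has_derivative (\<lambda>h. complex_of_real (g * Re (a * h + cnj a * cnj h)))) (at z)"
    by (rule has_derivative_of_real)
  moreover have "complex_of_real (g * Re (a * h + cnj a * cnj h)) = of_real g * a * h + of_real g * cnj a * cnj h" for h
    by (simp add: complex_eq_iff algebra_simps)
  ultimately show ?thesis by (simp add: wirtinger_def)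
qed

lemma wirtinger_cong:
  "wirtinger f z a b \<Longrightarrow> open S \<Longrightarrow> z \<in> S \<Longrightarrow> (\<And>u. u \<in> S \<Longrightarrow> f u = g u) \<Longrightarrow> wirtinger g z a b"
  unfolding wirtinger_def by (rule has_derivative_transform_within_open)

lemma Ck_on_wirtinger: "Ck_on (Suc k) f S \<Longrightarrow> open S \<Longrightarrow> z \<in> S \<Longrightarrow> wirtinger f z (dz f z) (dbar f z)"
  by (intro wirtinger_dz_dbar Ck_on_Suc_differentiable)

lemma Ck_on_dbar: "Ck_on (Suc k) f S \<Longrightarrow> open S \<Longrightarrow> Ck_on k (dbar f) S"
  and Ck_on_dz: "Ck_on (Suc k) f S \<Longrightarrow> open S \<Longrightarrow> Ck_on k (dz f) S"
proof -
  have *: "dbar f = (\<lambda>z. (1/2) * (pd 1 f z + \<i> * pd \<i> f z))" "dz f = (\<lambda>z. (1/2) * (pd 1 f z - \<i> * pd \<i> f z))"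
    by (auto simp: dbar_def dz_def partial_x_pd partial_y_pd)
  assume f: "Ck_on (Suc k) f S" and S: "open S"
  have p: "Ck_on k (pd 1 f) S" "Ck_on k (pd \<i> f) S"
    using f by (auto simp: Ck_on_Suc_pd)
  show "Ck_on k (dbar f) S" "Ck_on k (dz f) S"
    unfolding * by (intro Ck_on_mult Ck_on_add Ck_on_diff Ck_on_const S p)+
qed

text \<open>Take \<open>f1 = dbar f\<close> and \<open>f0 = f - cnj z * dbar f\<close>. Both are
  annihilated by d-bar, the second because the derivative of \<open>cnj z\<close> contributes
  exactly the \<open>dbar f\<close> that has to be cancelled.\<close>

lemma bianalytic_on_decompose:
  assumes "bianalytic_on f S" "open S"
  obtains f0 f1 where "f0 holomorphic_on S" "f1 holomorphic_on S"
    "\<And>z. z \<in> S \<Longrightarrow> f z = f0 z + cnj z * f1 z"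
proof -
  have C: "Ck_on (Suc (Suc 0)) f S" and 0: "\<And>z. z \<in> S \<Longrightarrow> dbar (dbar f) z = 0"
    using assms by (auto simp: bianalytic_on_def numeral_2_eq_2)
  have hol: "g holomorphic_on S" if "\<And>z. z \<in> S \<Longrightarrow> \<exists>a. wirtinger g z a 0" for g
    unfolding holomorphic_on_open[OF assms(2)]
    using that by (simp add: wirtinger_def has_field_derivative_def)
  have W: "wirtinger f z (dz f z) (dbar f z)" "wirtinger (dbar f) z (dz (dbar f) z) 0" if "z \<in> S" for z
    using Ck_on_wirtinger[OF C assms(2) that]
      Ck_on_wirtinger[OF Ck_on_dbar[OF C assms(2)] assms(2) that] 0[OF that] by auto
  show ?thesis
  proof (rule that)
    have "wirtinger (\<lambda>z. f z - cnj z * dbar f z) z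
       (dz f z - (cnj z * dz (dbar f) z + cnj 0 * dbar f z)) (dbar f z - (cnj z * 0 + cnj 1 * dbar f z))" if "z \<in> S" for z
      by (intro wirtinger_diff wirtinger_mult wirtinger_cnj W that wirtinger_field_derivative DERIV_ident)
    then show "(\<lambda>z. f z - cnj z * dbar f z) holomorphic_on S" by (intro hol) auto
    show "dbar f holomorphic_on S" using W by (intro hol) auto
  qed auto
qed

lemma Ck_on_cnj_ident: "Ck_on k cnj S"
  using Ck_on_subset[OF Ck_on_cnj[OF open_UNIV Ck_on_holomorphic[OF holomorphic_on_ident open_UNIV]]]
  by auto

lemma bianalytic_onI:
  assumes "f0 holomorphic_on S" "f1 holomorphic_on S" "open S"
    "\<And>z. z \<in> S \<Longrightarrow> f z = f0 z + cnj z * f1 z"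
  shows "bianalytic_on f S"
proof -
  have C: "Ck_on 2 (\<lambda>z. f0 z + cnj z * f1 z) S"
    by (intro Ck_on_add Ck_on_mult Ck_on_cnj_ident Ck_on_holomorphic assms)
  have W: "wirtinger f z (deriv f0 z + (cnj z * deriv f1 z + cnj 0 * f1 z)) (f1 z)" if "z \<in> S" for z
  proof (rule wirtinger_cong[OF _ assms(3) that])
    have "wirtinger (\<lambda>z. f0 z + cnj z * f1 z) z (deriv f0 z + (cnj z * deriv f1 z + cnj 0 * f1 z))
        (0 + (cnj z * 0 + cnj 1 * f1 z))"
      by (intro wirtinger_add wirtinger_mult wirtinger_cnj wirtinger_field_derivative DERIV_ident)
         (rule holomorphic_derivI[OF _ assms(3) that], fact)+
    then show "wirtinger (\<lambda>z. f0 z + cnj z * f1 z) z (deriv f0 z + (cnj z * deriv f1 z + cnj 0 * f1 z)) (f1 z)"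
      by simp
  qed (use assms in auto)
  have "dbar (dbar f) z = 0" if "z \<in> S" for z
  proof -
    have "wirtinger f1 z (deriv f1 z) 0"
      by (rule wirtinger_field_derivative[OF holomorphic_derivI[OF assms(2,3) that]])
    then have "wirtinger (dbar f) z (deriv f1 z) 0"
      by (rule wirtinger_cong[OF _ assms(3) that]) (simp add: wirtinger_unique(2)[OF W])
    then show ?thesis by (rule wirtinger_unique)
  qed
  moreover have "Ck_on 2 f S" by (rule Ck_on_cong[OF assms(3) C]) (simp add: assms(4))
  ultimately show ?thesis by (simp add: bianalytic_on_def)
qed

section \<open>Compactly supported functions\<close>

text \<open>Two mean value theorems: one in direction u for the increment of f along v, then one in
  direction v for \<open>pd u f\<close>. The left side is symmetric in u and v, which is what makes
  it useful.\<close>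

lemma second_difference_pd:
  fixes f :: "complex \<Rightarrow> real"
  assumes S: "open S" and f: "Ck_on 2 f S" and uv: "u \<in> {1,\<i>}" "v \<in> {1,\<i>}"
    and h: "h > 0" and sub: "cball z (2 * h) \<subseteq> S"
  shows "\<exists>p\<in>cball z (2 * h). f (z + h *\<^sub>R u + h *\<^sub>R v) - f (z + h *\<^sub>R u) - f (z + h *\<^sub>R v) + f z
      = h\<^sup>2 * pd v (pd u f) p"
proof -
  have n: "norm u = 1" "norm v = 1" using uv by auto
  have inS: "z + s *\<^sub>R u + t *\<^sub>R v \<in> cball z (2 * h)" if "0 \<le> s" "s \<le> h" "0 \<le> t" "t \<le> h" for s t
    using norm_triangle_ineq[of "s *\<^sub>R u" "t *\<^sub>R v"] n that by (simp add: dist_norm add.assoc norm_minus_commute add.commute[of "t *\<^sub>R v"])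
  have f2: "Ck_on (Suc (Suc 0)) f S" using f by (simp add: numeral_2_eq_2)
  then have fu: "Ck_on (Suc 0) (pd u f) S" using uv(1) unfolding Ck_on_Suc_pd[of "Suc 0"] by blast
  have D: "((\<lambda>s. g (a + s *\<^sub>R w)) has_real_derivative pd w g (a + s *\<^sub>R w)) (at s)"
    if "Ck_on (Suc k) g S" "a + s *\<^sub>R w \<in> S" for g :: "complex \<Rightarrow> real" and k a s w
  proof -
    have "(g has_derivative frechet_derivative g (at (a + s *\<^sub>R w))) (at (a + s *\<^sub>R w))"
      using Ck_on_Suc_differentiable[OF that(1) S that(2)] by (simp add: frechet_derivative_works)
    moreover have "((\<lambda>s. a + s *\<^sub>R w) has_derivative (\<lambda>h. h *\<^sub>R w)) (at s)"
      by (auto intro!: derivative_eq_intros)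
    ultimately have "((\<lambda>s. g (a + s *\<^sub>R w)) has_derivative (\<lambda>h. frechet_derivative g (at (a + s *\<^sub>R w)) (h *\<^sub>R w))) (at s)"
      by (rule has_derivative_compose[rotated])
    moreover have "frechet_derivative g (at (a + s *\<^sub>R w)) (h *\<^sub>R w) = pd w g (a + s *\<^sub>R w) * h" for h
      using linear_scale[OF linear_frechet_derivative[OF Ck_on_Suc_differentiable[OF that(1) S that(2)]]]
      by (simp add: pd_def)
    ultimately show ?thesis by (simp add: has_field_derivative_def)
  qed
  let ?\<phi> = "\<lambda>s. f (z + h *\<^sub>R v + s *\<^sub>R u) - f (z + s *\<^sub>R u)"
  have "\<exists>\<xi>>0. \<xi> < h \<and> ?\<phi> h - ?\<phi> 0 = (h - 0) * (pd u f (z + h *\<^sub>R v + \<xi> *\<^sub>R u) - pd u f (z + \<xi> *\<^sub>R u))"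
  proof (rule MVT2[OF h])
    fix s assume s: "0 \<le> s" "s \<le> h"
    have "z + h *\<^sub>R v + s *\<^sub>R u \<in> S" "z + s *\<^sub>R u \<in> S"
      using inS[of s h] inS[of s 0] s h sub by (auto simp: algebra_simps)
    then show "(?\<phi> has_real_derivative pd u f (z + h *\<^sub>R v + s *\<^sub>R u) - pd u f (z + s *\<^sub>R u)) (at s)"
      by (intro DERIV_diff D[OF f2])
  qed
  then obtain \<xi> where \<xi>: "0 < \<xi>" "\<xi> < h"
    "?\<phi> h - ?\<phi> 0 = h * (pd u f (z + h *\<^sub>R v + \<xi> *\<^sub>R u) - pd u f (z + \<xi> *\<^sub>R u))" by auto
  let ?\<psi> = "\<lambda>t. pd u f (z + \<xi> *\<^sub>R u + t *\<^sub>R v)"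
  have "\<exists>\<eta>>0. \<eta> < h \<and> ?\<psi> h - ?\<psi> 0 = (h - 0) * pd v (pd u f) (z + \<xi> *\<^sub>R u + \<eta> *\<^sub>R v)"
  proof (rule MVT2[OF h])
    fix t assume "0 \<le> t" "t \<le> h"
    then show "(?\<psi> has_real_derivative pd v (pd u f) (z + \<xi> *\<^sub>R u + t *\<^sub>R v)) (at t)"
      using inS[of \<xi> t] \<xi> sub by (intro D[OF fu]) auto
  qed
  then obtain \<eta> where \<eta>: "0 < \<eta>" "\<eta> < h"
    "?\<psi> h - ?\<psi> 0 = h * pd v (pd u f) (z + \<xi> *\<^sub>R u + \<eta> *\<^sub>R v)" by auto
  have "f (z + h *\<^sub>R u + h *\<^sub>R v) - f (z + h *\<^sub>R u) - f (z + h *\<^sub>R v) + f z = ?\<phi> h - ?\<phi> 0"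
    by (simp add: algebra_simps)
  also have "\<dots> = h * (?\<psi> h - ?\<psi> 0)" unfolding \<xi>(3) by (simp add: algebra_simps)
  also have "\<dots> = h\<^sup>2 * pd v (pd u f) (z + \<xi> *\<^sub>R u + \<eta> *\<^sub>R v)" unfolding \<eta>(3) by (simp add: power2_eq_square)
  finally show ?thesis using inS[of \<xi> \<eta>] \<xi> \<eta> by force
qed

text \<open>Both orders of differentiation equal the same second difference divided by h^2, at
  points that shrink to z with h; continuity of the second derivatives identifies the
  limits.\<close>

lemma pd_commute_real:
  fixes f :: "complex \<Rightarrow> real"
  assumes S: "open S" and f: "Ck_on 2 f S" and z: "z \<in> S"
  shows "pd 1 (pd \<i> f) z = pd \<i> (pd 1 f) z"
proof -
  obtain r where r: "r > 0" "ball z r \<subseteq> S" using S z open_contains_ball by blast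
  define h where "h n = r / (3 * real (Suc n))" for n
  have h: "h n > 0" "cball z (2 * h n) \<subseteq> S" for n
  proof -
    show "h n > 0" using r by (simp add: h_def)
    have "2 * h n < r" using r by (simp add: h_def divide_simps)
    then show "cball z (2 * h n) \<subseteq> S" using r by auto
  qed
  have "\<exists>p\<in>cball z (2 * h n). \<exists>q\<in>cball z (2 * h n). pd \<i> (pd 1 f) p = pd 1 (pd \<i> f) q" for n
    using second_difference_pd[OF S f, of 1 \<i> "h n" z] second_difference_pd[OF S f, of \<i> 1 "h n" z] h[of n]
    by (force simp: algebra_simps)
  then obtain p q where pq: "\<And>n. p n \<in> cball z (2 * h n)" "\<And>n. q n \<in> cball z (2 * h n)"
    "\<And>n. pd \<i> (pd 1 f) (p n) = pd 1 (pd \<i> f) (q n)" by metis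
  have h0: "(\<lambda>n. 2 * h n) \<longlonglongrightarrow> 0" unfolding h_def by real_asymp
  have "p \<longlonglongrightarrow> z" "q \<longlonglongrightarrow> z"
    using pq(1,2) by (auto simp: tendsto_dist_iff[of p] tendsto_dist_iff[of q] dist_commute
        intro!: tendsto_sandwich[OF _ _ tendsto_const h0])
  moreover have "isCont (pd \<i> (pd 1 f)) z" "isCont (pd 1 (pd \<i> f)) z"
    using f S z by (auto simp: numeral_2_eq_2 Ck_on_Suc_pd continuous_on_eq_continuous_at)
  ultimately have "(\<lambda>n. pd \<i> (pd 1 f) (p n)) \<longlonglongrightarrow> pd \<i> (pd 1 f) z" "(\<lambda>n. pd 1 (pd \<i> f) (q n)) \<longlonglongrightarrow> pd 1 (pd \<i> f) z"
    by (auto intro: isCont_tendsto_compose)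
  then show ?thesis unfolding pq(3) using LIMSEQ_unique by blast
qed

lemma pd_bounded_linear:
  assumes "bounded_linear L" "f differentiable at z"
  shows "pd v (\<lambda>z. L (f z)) z = L (pd v f z)"
  using pd_eqI[OF bounded_linear.has_derivative[OF assms(1)]] assms(2)
  by (simp add: frechet_derivative_works pd_def)

lemma dz_dbar_commute:
  assumes S: "open S" and f: "Ck_on 2 f S" and z: "z \<in> S"
  shows "dz (dbar f) z = dbar (dz f) z"
proof -
  have f2: "Ck_on (Suc (Suc 0)) f S" using f by (simp add: numeral_2_eq_2)
  have d0: "f differentiable at w" if "w \<in> S" for w by (rule Ck_on_Suc_differentiable[OF f2 S that])
  have d1: "pd v f differentiable at z" if "v \<in> {1,\<i>}" for v
    using f2 that by (auto simp: Ck_on_Suc_pd[of "Suc 0"] intro: Ck_on_Suc_differentiable[OF _ S z])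
  \<comment> \<open>A real functional commutes with directional derivatives. Applied to the real and
    the imaginary part it reduces the complex case to the real one.\<close>
  have L: "L (pd 1 (pd \<i> f) z) = L (pd \<i> (pd 1 f) z)" if bl: "bounded_linear L" for L :: "complex \<Rightarrow> real"
  proof -
    have 1: "pd v (\<lambda>z. L (f z)) w = L (pd v f w)" if "w \<in> S" for v w
      by (rule pd_bounded_linear[OF bl d0[OF that]])
    have 2: "pd u (pd v (\<lambda>z. L (f z))) z = L (pd u (pd v f) z)" if "v \<in> {1,\<i>}" for u v
    proof -
      have "pd u (\<lambda>z. L (pd v f z)) z = pd u (pd v (\<lambda>z. L (f z))) z"
      proof (rule pd_cong[OF S z])
        show "(\<lambda>z. L (pd v f z)) differentiable at z"
          using bounded_linear.has_derivative[OF bl] d1[OF that] by (auto simp: differentiable_def)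
      qed (simp add: 1)
      then show ?thesis using pd_bounded_linear[OF bl d1[OF that]] by simp
    qed
    show ?thesis
      using pd_commute_real[OF S Ck_on_bounded_linear[OF bl S f] z] by (simp add: 2)
  qed
  have c: "pd 1 (pd \<i> f) z = pd \<i> (pd 1 f) z"
    using L[OF bounded_linear_Re] L[OF bounded_linear_Im] by (simp add: complex_eq_iff)
  have *: "dbar f = (\<lambda>z. (1/2) * (pd 1 f z + \<i> * pd \<i> f z))" "dz f = (\<lambda>z. (1/2) * (pd 1 f z - \<i> * pd \<i> f z))"
    by (auto simp: dbar_def dz_def partial_x_pd partial_y_pd)
  have D: "(pd v f has_derivative frechet_derivative (pd v f) (at z)) (at z)" if "v \<in> {1,\<i>}" for v
    using d1[OF that] by (simp add: frechet_derivative_works)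
  have "((\<lambda>z. (1/2) * (pd 1 f z + \<i> * pd \<i> f z)) has_derivative
     (\<lambda>h. (1/2) * (frechet_derivative (pd 1 f) (at z) h + \<i> * frechet_derivative (pd \<i> f) (at z) h))) (at z)"
    "((\<lambda>z. (1/2) * (pd 1 f z - \<i> * pd \<i> f z)) has_derivative
     (\<lambda>h. (1/2) * (frechet_derivative (pd 1 f) (at z) h - \<i> * frechet_derivative (pd \<i> f) (at z) h))) (at z)"
    by (auto intro!: derivative_eq_intros D)
  from this[THEN pd_eqI] have **: "pd v (dbar f) z = (1/2) * (pd v (pd 1 f) z + \<i> * pd v (pd \<i> f) z)"
    "pd v (dz f) z = (1/2) * (pd v (pd 1 f) z - \<i> * pd v (pd \<i> f) z)" for v
    unfolding * by (simp_all add: pd_def)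
  show ?thesis
    unfolding dz_def[of "dbar f"] dbar_def[of "dz f"] partial_x_pd partial_y_pd **
    by (simp add: c algebra_simps)
qed

section \<open>Compact support and integration by parts\<close>

text \<open>Smoothness is required on the whole plane and only the support is tied to S. Integrals
  can then run over the plane without boundary terms, while coefficients may be defined on S
  alone.\<close>

definition Ckc :: "nat \<Rightarrow> complex set \<Rightarrow> (complex \<Rightarrow> 'a::real_normed_vector) \<Rightarrow> bool" where
  "Ckc k S f \<longleftrightarrow> Ck_on k f UNIV \<and> (\<exists>C. compact C \<and> C \<subseteq> S \<and> (\<forall>z. z \<notin> C \<longrightarrow> f z = 0))"

lemma Ckc_Ck_on: "Ckc k S f \<Longrightarrow> Ck_on k f T"
  by (auto simp: Ckc_def intro: Ck_on_subset[OF _ subset_UNIV])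

lemma Ckc_mono: "Ckc l S f \<Longrightarrow> k \<le> l \<Longrightarrow> S \<subseteq> T \<Longrightarrow> Ckc k T f"
  by (meson Ckc_def Ck_on_mono subset_trans)

lemma Ckc_outside: "Ckc k S f \<Longrightarrow> z \<notin> S \<Longrightarrow> f z = 0"
  unfolding Ckc_def by blast

lemma Ckc_continuous: "Ckc k S f \<Longrightarrow> continuous_on T f"
  using Ckc_Ck_on Ck_on_continuous by blast

lemma Ckc_integrable:
  fixes f :: "complex \<Rightarrow> 'a::{banach, second_countable_topology}"
  assumes "Ckc k S f" shows "integrable lborel f"
proof -
  obtain C where C: "compact C" "\<And>z. z \<notin> C \<Longrightarrow> f z = 0" using assms by (auto simp: Ckc_def)
  have "integrable lborel (\<lambda>x. indicator C x *\<^sub>R f x)"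
    by (rule borel_integrable_compact[OF C(1) Ckc_continuous[OF assms]])
  moreover have "(\<lambda>x. indicator C x *\<^sub>R f x) = f" using C by (auto simp: indicator_def)
  ultimately show ?thesis by simp
qed

text \<open>The coefficient g is controlled only on S. Off the support of f the product is
  identically zero, so it is smooth on S and on the complement of the support, and these two open
  sets cover the plane.\<close>

lemma Ckc_bilinear:
  assumes "bounded_bilinear B" "open S" "Ck_on k g S" "Ckc k S f"
  shows "Ckc k S (\<lambda>z. B (g z) (f z))"
proof -
  obtain C where C: "compact C" "C \<subseteq> S" "\<And>z. z \<notin> C \<Longrightarrow> f z = 0" using assms by (auto simp: Ckc_def)
  have z0: "B x 0 = 0" for x by (rule bounded_bilinear.zero_right[OF assms(1)])
  have "Ck_on k (\<lambda>z. B (g z) (f z)) UNIV"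
  proof (rule Ck_on_local)
    fix z
    show "\<exists>T. open T \<and> z \<in> T \<and> Ck_on k (\<lambda>z. B (g z) (f z)) T"
    proof (cases "z \<in> S")
      case True
      then show ?thesis using Ck_on_bounded_bilinear[OF assms(1-3) Ckc_Ck_on[OF assms(4)]] assms(2) by blast
    next
      case False
      have o: "open (- C)" using C(1) by (simp add: compact_imp_closed open_Compl)
      have "Ck_on k (\<lambda>z. B (g z) (f z)) (- C)"
        by (rule Ck_on_cong[OF o Ck_on_const[of k 0]]) (use C z0 in auto)
      then show ?thesis using False C o by blast
    qed
  qed
  then show ?thesis using C z0 unfolding Ckc_def by metis
qed

lemmas Ckc_mult = Ckc_bilinear[OF bounded_bilinear_mult]
  and Ckc_mult_right = Ckc_bilinear[OF bounded_bilinear.flip[OF bounded_bilinear_mult]]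

lemma Ckc_linear:
  assumes "bounded_linear L" "Ckc k S f" shows "Ckc k S (\<lambda>z. L (f z))"
proof -
  have "L 0 = 0" by (rule linear_0[OF bounded_linear.linear[OF assms(1)]])
  then show ?thesis
    using Ck_on_bounded_linear[OF assms(1) open_UNIV] assms(2) unfolding Ckc_def by metis
qed

lemmas Ckc_cnj = Ckc_linear[OF bounded_linear_cnj]
  and Ckc_of_real = Ckc_linear[OF bounded_linear_of_real]

lemma Ckc_add:
  assumes "Ckc k S f" "Ckc k S g" shows "Ckc k S (\<lambda>z. f z + g z)"
proof -
  obtain C where C: "compact C" "C \<subseteq> S" "\<And>z. z \<notin> C \<Longrightarrow> f z = 0" using assms by (auto simp: Ckc_def)
  obtain D where D: "compact D" "D \<subseteq> S" "\<And>z. z \<notin> D \<Longrightarrow> g z = 0" using assms by (auto simp: Ckc_def)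
  have "compact (C \<union> D)" "C \<union> D \<subseteq> S" "\<And>z. z \<notin> C \<union> D \<Longrightarrow> f z + g z = 0" using C D by auto
  then show ?thesis using assms Ck_on_add[OF open_UNIV] unfolding Ckc_def by blast
qed

lemma Ckc_diff: "Ckc k S f \<Longrightarrow> Ckc k S g \<Longrightarrow> Ckc k S (\<lambda>z. f z - g z)"
  using Ckc_add[of k S f "\<lambda>z. - g z"] Ckc_linear[OF bounded_linear_minus[OF bounded_linear_ident], of k S g]
  by simp

lemma Ckc_dbar: "Ckc (Suc k) S f \<Longrightarrow> Ckc k S (dbar f)"
  and Ckc_dz: "Ckc (Suc k) S f \<Longrightarrow> Ckc k S (dz f)"
proof -
  assume f: "Ckc (Suc k) S f"
  then obtain C where C: "compact C" "C \<subseteq> S" "\<And>z. z \<notin> C \<Longrightarrow> f z = 0" by (auto simp: Ckc_def)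
  have o: "open (- C)" using C(1) by (simp add: compact_imp_closed open_Compl)
  have "wirtinger f z 0 0" if "z \<notin> C" for z
    by (rule wirtinger_cong[OF wirtinger_const[of 0] o]) (use C that in auto)
  then have "dbar f z = 0" "dz f z = 0" if "z \<notin> C" for z
    using that wirtinger_unique by metis+
  then show "Ckc k S (dbar f)" "Ckc k S (dz f)"
    using C f Ck_on_dbar[OF _ open_UNIV] Ck_on_dz[OF _ open_UNIV] unfolding Ckc_def by blast+
qed

text \<open>Translation invariance of area measure: every difference quotient of f in direction v
  integrates to zero, and dominated convergence passes to the directional derivative, written here
  as dz f * v + dbar f * cnj v.\<close>

lemma integral_pd_eq_0:
  fixes f :: "complex \<Rightarrow> complex"
  assumes f: "Ckc (Suc 0) S f"
  shows "(LINT z|lborel. dbar f z * cnj v + dz f z * v) = 0"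
proof -
  obtain C where C: "compact C" "\<And>z. z \<notin> C \<Longrightarrow> f z = 0" using f by (auto simp: Ckc_def)
  obtain R where R: "C \<subseteq> ball 0 R" "R > 0" using C(1) by (meson bounded_subset_ballD compact_imp_bounded)
  have W: "wirtinger f z (dz f z) (dbar f z)" for z
    by (rule Ck_on_wirtinger[OF Ckc_Ck_on[OF f] open_UNIV UNIV_I])
  have c: "continuous_on UNIV (dbar f)" "continuous_on UNIV (dz f)" "continuous_on UNIV f"
    using Ckc_dbar[OF f] Ckc_dz[OF f] f by (auto intro: Ckc_continuous)
  have bd: "\<exists>B. \<forall>z. norm (g z) \<le> B" if g: "Ckc k S g" for g :: "complex \<Rightarrow> complex" and k
  proof -
    obtain C where C: "compact C" "\<And>z. z \<notin> C \<Longrightarrow> g z = 0" using g by (auto simp: Ckc_def)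
    have "bounded (g ` C)" by (intro compact_imp_bounded compact_continuous_image Ckc_continuous[OF g] C)
    then obtain B where "\<forall>z\<in>C. norm (g z) \<le> B" by (auto simp: bounded_iff)
    then have "norm (g z) \<le> max B 0" for z using C(2)[of z] by (cases "z \<in> C") auto
    then show ?thesis by blast
  qed
  obtain B1 B2 where B: "\<And>z. norm (dbar f z) \<le> B1" "\<And>z. norm (dz f z) \<le> B2"
    using bd[OF Ckc_dbar[OF f]] bd[OF Ckc_dz[OF f]] by metis
  \<comment> \<open>The Lipschitz constant supplies the dominating function. Since
    \<open>h n \<le> 1\<close>, all difference quotients vanish outside the ball of radius R +
    |v|.\<close>
  have lip: "norm (f y - f x) \<le> (B1 + B2) * norm (y - x)" for x y
  proof (rule differentiable_bound[of UNIV f "\<lambda>z h. dz f z * h + dbar f z * cnj h"])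
    show "onorm (\<lambda>h. dz f z * h + dbar f z * cnj h) \<le> B1 + B2" for z
    proof (rule onorm_le)
      fix h
      have "norm (dz f z * h + dbar f z * cnj h) \<le> norm (dz f z) * norm h + norm (dbar f z) * norm h"
        by (metis complex_mod_cnj norm_mult norm_triangle_ineq)
      also have "\<dots> \<le> B2 * norm h + B1 * norm h" by (intro add_mono mult_right_mono B) auto
      finally show "norm (dz f z * h + dbar f z * cnj h) \<le> (B1 + B2) * norm h" by (simp add: algebra_simps)
    qed
  qed (use W in \<open>auto simp: wirtinger_def\<close>)
  define h where "h n = 1 / real (Suc n)" for n
  have h: "0 < h n" "h n \<le> 1" for n by (auto simp: h_def)
  define g where "g n z = (f (z + h n *\<^sub>R v) - f z) /\<^sub>R h n" for n z
  have int: "(\<lambda>n. LINT z|lborel. g n z) \<longlonglongrightarrow> (LINT z|lborel. dbar f z * cnj v + dz f z * v)"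
  proof (rule integral_dominated_convergence)
    show "(\<lambda>z. dbar f z * cnj v + dz f z * v) \<in> borel_measurable lborel" "g n \<in> borel_measurable lborel" for n
      unfolding g_def
      by (auto intro!: borel_measurable_continuous_onI continuous_intros c continuous_on_compose2[OF c(3)])
    have "integrable lborel (\<lambda>z. indicator (cball 0 (R + norm v)) z *\<^sub>R ((B1 + B2) * norm v))"
      by (intro borel_integrable_compact continuous_intros) auto
    then show "integrable lborel (\<lambda>z::complex. indicator (cball 0 (R + norm v)) z * ((B1 + B2) * norm v))"
      by simp
    show "AE z in lborel. (\<lambda>n. g n z) \<longlonglongrightarrow> dbar f z * cnj v + dz f z * v"
    proof (rule AE_I2)
      fix z
      have 1: "((\<lambda>t. z + t *\<^sub>R v) has_derivative (\<lambda>t. t *\<^sub>R v)) (at 0)"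
        by (auto intro!: derivative_eq_intros)
      have 2: "(f has_derivative (\<lambda>h. dz f z * h + dbar f z * cnj h)) (at (z + 0 *\<^sub>R v))"
        using W[of z] by (simp add: wirtinger_def)
      have "((\<lambda>t. f (z + t *\<^sub>R v)) has_derivative (\<lambda>t. dz f z * (t *\<^sub>R v) + dbar f z * cnj (t *\<^sub>R v))) (at 0)"
        by (rule has_derivative_compose[OF 1 2])
      then have "((\<lambda>y. norm (f (z + y *\<^sub>R v) - f z - (dz f z * (y *\<^sub>R v) + dbar f z * cnj (y *\<^sub>R v))) / norm y) \<longlongrightarrow> 0) (at 0)"
        by (simp add: has_derivative_at)
      moreover have "\<forall>\<^sub>F y in at 0. norm (f (z + y *\<^sub>R v) - f z - (dz f z * (y *\<^sub>R v) + dbar f z * cnj (y *\<^sub>R v))) / norm y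
          = norm ((f (z + y *\<^sub>R v) - f z) /\<^sub>R y - (dbar f z * cnj v + dz f z * v))"
        unfolding eventually_at_filter
      proof (intro always_eventually allI impI)
        fix y :: real assume "y \<noteq> 0"
        then have "(f (z + y *\<^sub>R v) - f z) /\<^sub>R y - (dbar f z * cnj v + dz f z * v)
            = (f (z + y *\<^sub>R v) - f z - (dz f z * (y *\<^sub>R v) + dbar f z * cnj (y *\<^sub>R v))) /\<^sub>R y"
          by (simp add: scaleR_conv_of_real field_simps)
        then show "norm (f (z + y *\<^sub>R v) - f z - (dz f z * (y *\<^sub>R v) + dbar f z * cnj (y *\<^sub>R v))) / norm y
          = norm ((f (z + y *\<^sub>R v) - f z) /\<^sub>R y - (dbar f z * cnj v + dz f z * v))"
          by (simp add: divide_inverse_commute)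
      qed
      ultimately have L: "((\<lambda>y. (f (z + y *\<^sub>R v) - f z) /\<^sub>R y) \<longlongrightarrow> dbar f z * cnj v + dz f z * v) (at 0)"
        by (subst LIM_zero_iff[symmetric], subst tendsto_norm_zero_iff[symmetric]) (rule Lim_transform_eventually)
      have "h \<longlonglongrightarrow> 0" unfolding h_def by real_asymp
      then have "filterlim h (at 0) sequentially"
        using h by (intro filterlim_atI) (auto simp: less_imp_neq[symmetric] intro!: always_eventually)
      from filterlim_compose[OF L this]
      show "(\<lambda>n. g n z) \<longlonglongrightarrow> dbar f z * cnj v + dz f z * v" by (simp add: g_def)
    qed
    show "AE z in lborel. norm (g n z) \<le> indicator (cball 0 (R + norm v)) z * ((B1 + B2) * norm v)" for n
    proof (rule AE_I2)
      fix z
      show "norm (g n z) \<le> indicator (cball 0 (R + norm v)) z * ((B1 + B2) * norm v)"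
      proof (cases "z \<in> cball 0 (R + norm v)")
        case True
        have "norm (g n z) \<le> (B1 + B2) * norm (h n *\<^sub>R v) / h n"
          using lip[of "z + h n *\<^sub>R v" z] h[of n] by (simp add: g_def divide_inverse_commute mult_left_mono)
        then show ?thesis using True h[of n] by simp
      next
        case False
        then have z: "norm z > R + norm v" by simp
        have "norm (h n *\<^sub>R v) \<le> norm v" using h[of n] by (simp add: mult_left_le_one_le)
        then have "norm (z + h n *\<^sub>R v) > R" using z norm_triangle_ineq4[of "z + h n *\<^sub>R v" "h n *\<^sub>R v"] by simp
        moreover have "norm z > R" using z by (smt (verit) norm_ge_zero)
        ultimately have "z \<notin> C" "z + h n *\<^sub>R v \<notin> C" using R(1) by force+
        then have "f z = 0" "f (z + h n *\<^sub>R v) = 0" using C(2) by blast+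
        then show ?thesis using False by (simp add: g_def)
      qed
    qed
  qed
  have "(LINT z|lborel. g n z) = 0" for n
  proof -
    have i: "integrable lborel f" by (rule Ckc_integrable[OF f])
    have i2: "integrable lborel (\<lambda>z. f (z + h n *\<^sub>R v))"
      using integrable_distr[of "(+) (h n *\<^sub>R v)" lborel borel f] i
      by (simp add: lborel_distr_plus add.commute)
    have "(LINT z|lborel. f (h n *\<^sub>R v + z)) = integral\<^sup>L (distr lborel borel ((+) (h n *\<^sub>R v))) f"
      by (rule integral_distr[symmetric]) (auto intro!: borel_measurable_continuous_onI c)
    also have "\<dots> = (LINT z|lborel. f z)" by (simp add: lborel_distr_plus)
    finally show ?thesis using i i2 by (simp add: g_def add.commute)
  qed
  then have "(\<lambda>n. LINT z|lborel. g n z) \<longlonglongrightarrow> 0" by simp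
  then show ?thesis using int LIMSEQ_unique by blast
qed

lemma integral_dbar_eq_0: "Ckc (Suc 0) S f \<Longrightarrow> (LINT z|lborel. dbar f z) = 0"
  and integral_dz_eq_0: "Ckc (Suc 0) S f \<Longrightarrow> (LINT z|lborel. dz f z) = 0"
proof -
  assume f: "Ckc (Suc 0) S f"
  have i: "integrable lborel (dbar f)" "integrable lborel (dz f)"
    by (rule Ckc_integrable, rule Ckc_dbar Ckc_dz, rule f)+
  show "(LINT z|lborel. dbar f z) = 0" "(LINT z|lborel. dz f z) = 0"
    using integral_pd_eq_0[OF f, of 1] integral_pd_eq_0[OF f, of \<i>] i
    by (auto simp: eq_neg_iff_add_eq_0[symmetric])
qed

text \<open>The field r dbar V - (dbar r) V has compact support, and in its d-bar derivative the two
  products of first derivatives cancel, leaving exactly the difference of the two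
  integrands.\<close>

lemma integral_dbar2_by_parts:
  assumes S: "open S" and r: "Ck_on 2 r S" and V: "Ckc 2 S V"
  shows "(LINT z|lborel. r z * dbar (dbar V) z) = (LINT z|lborel. dbar (dbar r) z * V z)"
proof -
  have r2: "Ck_on (Suc (Suc 0)) r S" and V2: "Ckc (Suc (Suc 0)) S V"
    using r V by (auto simp: numeral_2_eq_2)
  note r1 = Ck_on_dbar[OF r2 S] and V1 = Ckc_dbar[OF V2]
  note r0 = Ck_on_dbar[OF r1 S] and V0 = Ckc_dbar[OF V1]
  let ?X = "\<lambda>z. r z * dbar V z - dbar r z * V z"
  have X: "Ckc (Suc 0) S ?X"
    using Ckc_mono[OF V2, of "Suc 0"] by (intro Ckc_diff Ckc_mult S r1 V1 Ck_on_Suc_imp[OF r2]) auto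
  have "dbar ?X z = r z * dbar (dbar V) z - dbar (dbar r) z * V z" for z
  proof (cases "z \<in> S")
    case True
    have "wirtinger ?X z (r z * dz (dbar V) z + dz r z * dbar V z - (dbar r z * dz V z + dz (dbar r) z * V z))
       (r z * dbar (dbar V) z + dbar r z * dbar V z - (dbar r z * dbar V z + dbar (dbar r) z * V z))"
      by (intro wirtinger_diff wirtinger_mult Ck_on_wirtinger[OF r2 S True] Ck_on_wirtinger[OF r1 S True]
          Ck_on_wirtinger[OF Ckc_Ck_on[OF V1] S True] Ck_on_wirtinger[OF Ckc_Ck_on[OF V2] S True])
    from wirtinger_unique(2)[OF this] show ?thesis by simp
  next
    case False
    then show ?thesis
      using Ckc_outside[OF Ckc_dbar[OF X]] Ckc_outside[OF V0] Ckc_outside[OF V2] by simp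
  qed
  then have "(LINT z|lborel. r z * dbar (dbar V) z - dbar (dbar r) z * V z) = 0"
    using integral_dbar_eq_0[OF X] by simp
  moreover have "integrable lborel (\<lambda>z. r z * dbar (dbar V) z)" "integrable lborel (\<lambda>z. dbar (dbar r) z * V z)"
    using Ckc_mono[OF V2, of 0] Ck_on_mono[OF r, of 0]
    by (auto intro!: Ckc_integrable[of 0 S] Ckc_mult S V0 r0 simp del: Ck_on.simps)
  ultimately show ?thesis by simp
qed

section \<open>Weighted inequalities for d-bar and its square\<close>

lemma Ckc_0I:
  assumes "open S" "continuous_on S f" "compact C" "C \<subseteq> S" "\<And>z. z \<notin> C \<Longrightarrow> f z = 0"
  shows "Ckc 0 S f"
proof -
  have "Ck_on 0 f UNIV"
  proof (rule Ck_on_local)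
    fix z
    have o: "open (- C)" using assms(3) by (simp add: compact_imp_closed open_Compl)
    have "Ck_on 0 f (- C)" by (rule Ck_on_cong[OF o Ck_on_const[of 0 0]]) (simp add: assms)
    then show "\<exists>T. open T \<and> z \<in> T \<and> Ck_on 0 f T"
      using assms o by (cases "z \<in> S") (auto intro: exI[of _ S] exI[of _ "- C"])
  qed
  then show ?thesis using assms unfolding Ckc_def by blast
qed

lemma Ckc_weighted_square:
  fixes f :: "complex \<Rightarrow> 'a::real_normed_vector" and g :: "complex \<Rightarrow> real"
  assumes "open S" "Ckc k S f" "continuous_on S g"
  shows "Ckc 0 S (\<lambda>z. g z * (norm (f z))\<^sup>2)"
proof -
  obtain C where "compact C" "C \<subseteq> S" "\<And>z. z \<notin> C \<Longrightarrow> f z = 0" using assms(2) by (auto simp: Ckc_def)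
  then show ?thesis
    by (intro Ckc_0I[where C = C] assms continuous_intros Ckc_continuous[OF assms(2)]) auto
qed

lemmas integrable_weighted_square = Ckc_integrable[OF Ckc_weighted_square]

section \<open>The normalized Laplacian in Wirtinger form\<close>

lemma qlaplacian_pd: "qlaplacian f z = (pd 1 (pd 1 f) z + pd \<i> (pd \<i> f) z) / 4"
  by (simp add: qlaplacian_def partial_x_pd partial_y_pd)

lemma Ck_on_qlaplacian:
  assumes "open S" "Ck_on (k + 2) f S" shows "Ck_on k (qlaplacian f) S"
proof -
  have f: "Ck_on (Suc (Suc k)) f S" using assms by simp
  then have "Ck_on k (pd 1 (pd 1 f)) S" "Ck_on k (pd \<i> (pd \<i> f)) S"
    by (simp_all add: Ck_on_Suc_pd[of "Suc k"] Ck_on_Suc_pd[of k])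
  then have "Ck_on k (\<lambda>z. (1/4) * (pd 1 (pd 1 f) z + pd \<i> (pd \<i> f) z)) S"
    by (intro Ck_on_mult Ck_on_add Ck_on_const assms(1))
  moreover have "qlaplacian f = (\<lambda>z. (1/4) * (pd 1 (pd 1 f) z + pd \<i> (pd \<i> f) z))"
    by (auto simp: qlaplacian_pd)
  ultimately show ?thesis by simp
qed

lemma pd_lincomb:
  fixes f g :: "complex \<Rightarrow> real"
  assumes "f differentiable at z" "g differentiable at z"
  shows "pd v (\<lambda>z. a * f z + b * g z) z = a * pd v f z + b * pd v g z"
proof -
  have "((\<lambda>z. a * f z + b * g z) has_derivative
      (\<lambda>h. a * frechet_derivative f (at z) h + b * frechet_derivative g (at z) h)) (at z)"
    using assms unfolding frechet_derivative_works by (auto intro!: derivative_eq_intros)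
  from pd_eqI[OF this] show ?thesis by (simp add: pd_def)
qed

lemma qlaplacian_lincomb:
  assumes S: "open S" "z \<in> S" and f: "Ck_on 2 f S" and g: "Ck_on 2 g S"
  shows "qlaplacian (\<lambda>z. a * f z + b * g z) z = a * qlaplacian f z + b * qlaplacian g z"
proof -
  have f2: "Ck_on (Suc (Suc 0)) f S" and g2: "Ck_on (Suc (Suc 0)) g S"
    using f g by (auto simp: numeral_2_eq_2)
  have p: "pd v (pd v (\<lambda>z. a * f z + b * g z)) z = a * pd v (pd v f) z + b * pd v (pd v g) z"
    if v: "v \<in> {1,\<i>}" for v
  proof -
    have d: "pd v f differentiable at z" "pd v g differentiable at z"
      using f2 g2 v unfolding Ck_on_Suc_pd[of "Suc 0"] by (blast intro: Ck_on_Suc_differentiable S)+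
    have "pd v (\<lambda>w. a * pd v f w + b * pd v g w) z = pd v (pd v (\<lambda>z. a * f z + b * g z)) z"
    proof (rule pd_cong[OF S])
      show "a * pd v f w + b * pd v g w = pd v (\<lambda>z. a * f z + b * g z) w" if "w \<in> S" for w
        using pd_lincomb Ck_on_Suc_differentiable[OF f2 S(1) that] Ck_on_Suc_differentiable[OF g2 S(1) that]
        by metis
    qed (use d in auto)
    then show ?thesis using pd_lincomb[OF d] by simp
  qed
  show ?thesis by (simp add: qlaplacian_pd p field_simps)
qed

lemma qlaplacian_cong:
  assumes S: "open S" "z \<in> S" and f: "Ck_on 2 f S" and eq: "\<And>z. z \<in> S \<Longrightarrow> f z = g z"
  shows "qlaplacian f z = qlaplacian g z"
proof -
  have f2: "Ck_on (Suc (Suc 0)) f S" using f by (auto simp: numeral_2_eq_2)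
  have "pd v (pd v f) z = pd v (pd v g) z" if v: "v \<in> {1,\<i>}" for v
  proof (rule pd_cong[OF S])
    show "pd v f w = pd v g w" if "w \<in> S" for w
      by (rule pd_cong[OF S(1) that eq Ck_on_Suc_differentiable[OF f2 S(1) that]])
    show "pd v f differentiable at z"
      using f2 v unfolding Ck_on_Suc_pd[of "Suc 0"] by (blast intro: Ck_on_Suc_differentiable S)
  qed
  then show ?thesis by (simp add: qlaplacian_pd)
qed

lemma wirtinger_of_real:
  fixes f :: "complex \<Rightarrow> real"
  assumes "f differentiable at z"
  shows "wirtinger (\<lambda>z. of_real (f z)) z ((pd 1 f z - \<i> * pd \<i> f z) / 2) ((pd 1 f z + \<i> * pd \<i> f z) / 2)"
proof -
  have d: "(\<lambda>z. complex_of_real (f z)) differentiable at z"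
    using assms by (auto simp: differentiable_def intro: has_derivative_of_real)
  have "pd v (\<lambda>z. complex_of_real (f z)) z = of_real (pd v f z)" for v
    by (rule pd_bounded_linear[OF bounded_linear_of_real assms])
  then show ?thesis
    using wirtinger_dz_dbar[OF d] by (simp add: dz_def dbar_def partial_x_pd partial_y_pd)
qed

text \<open>The mixed partials enter only the imaginary part, so the real part consists of the two
  pure second derivatives.\<close>

lemma Re_dbar_dz_of_real:
  fixes f :: "complex \<Rightarrow> real"
  assumes S: "open S" "z \<in> S" and f: "Ck_on 2 f S"
  shows "Re (dbar (dz (\<lambda>z. of_real (f z))) z) = qlaplacian f z"
proof -
  have f2: "Ck_on (Suc (Suc 0)) f S" using f by (auto simp: numeral_2_eq_2)
  have d: "pd 1 f differentiable at z" "pd \<i> f differentiable at z"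
    using f2 unfolding Ck_on_Suc_pd[of "Suc 0"] by (blast intro: Ck_on_Suc_differentiable S)+
  let ?p = "\<lambda>w. 1/2 * (complex_of_real (pd 1 f w) - \<i> * complex_of_real (pd \<i> f w))"
  note w = d[THEN wirtinger_of_real]
  have "wirtinger (dz (\<lambda>z. of_real (f z))) z a b" if "wirtinger ?p z a b" for a b
    by (rule wirtinger_cong[OF that S])
       (simp add: wirtinger_unique(1)[OF wirtinger_of_real[OF Ck_on_Suc_differentiable[OF f2 S(1)]]])
  note W = this[OF wirtinger_mult[OF wirtinger_const wirtinger_diff[OF w(1) wirtinger_mult[OF wirtinger_const w(2)]]]]
  show ?thesis unfolding wirtinger_unique(2)[OF W] qlaplacian_pd by simp
qed

text \<open>The identity \<open>|\<partial>\<psi>|\<^sup>2 e\<^sup>\<Phi> - |D\<psi>|\<^sup>2 e\<^sup>\<Phi> - \<Delta>\<Phi> |\<psi>|\<^sup>2 e\<^sup>\<Phi>\<close> = divergence, where the first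
  derivative is d-bar and \<open>D\<psi> = \<partial>\<psi> + \<psi> \<partial>\<Phi>\<close>, integrates to the estimate.\<close>

lemma weighted_dbar_inequality:
  fixes \<Phi> :: "complex \<Rightarrow> real"
  assumes S: "open S" and \<Phi>: "Ck_on 2 \<Phi> S" and \<psi>: "Ckc 2 S \<psi>"
  shows "(LINT z|lborel. qlaplacian \<Phi> z * exp (\<Phi> z) * (cmod (\<psi> z))\<^sup>2)
    \<le> (LINT z|lborel. exp (\<Phi> z) * (cmod (dbar \<psi> z))\<^sup>2)"
proof -
  define p where "p = dz (\<lambda>z. of_real (\<Phi> z))"
  define E where "E z = complex_of_real (exp (\<Phi> z))" for z
  have \<Phi>2: "Ck_on (Suc (Suc 0)) \<Phi> S" and \<psi>2: "Ckc (Suc (Suc 0)) S \<psi>"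
    using \<Phi> \<psi> by (auto simp: numeral_2_eq_2)
  have \<psi>1: "Ckc (Suc 0) S \<psi>" using Ckc_mono[OF \<psi>2] by simp
  have \<Phi>c: "Ck_on (Suc (Suc 0)) (\<lambda>z. complex_of_real (\<Phi> z)) S" by (rule Ck_on_of_real[OF S \<Phi>2])
  have p1: "Ck_on (Suc 0) p S" unfolding p_def by (rule Ck_on_dz[OF \<Phi>c S])
  have E1: "Ck_on (Suc 0) E S" unfolding E_def
    by (intro Ck_on_of_real Ck_on_exp S Ck_on_Suc_imp[OF \<Phi>2])
  define D where "D z = dz \<psi> z + \<psi> z * p z" for z
  have D1: "Ckc (Suc 0) S D" unfolding D_def
    by (intro Ckc_add Ckc_dz \<psi>2 Ckc_mult_right S p1 \<psi>1)
  \<comment> \<open>Pair the conjugate of \<psi> with dbar \<psi> and with D. In dz W1 - dbar W2 the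
    mixed second derivatives of \<psi> cancel by commutation; besides the two squares only
    |\<psi>|^2 times dbar p survives, and the real part of dbar p is the Laplacian of
    \<Phi>.\<close>
  define W1 where "W1 z = (dbar \<psi> z * E z) * cnj (\<psi> z)" for z
  define W2 where "W2 z = (D z * E z) * cnj (\<psi> z)" for z
  have W1c: "Ckc (Suc 0) S W1" unfolding W1_def
    by (intro Ckc_mult Ckc_cnj \<psi>1 S Ck_on_mult E1 Ckc_Ck_on[OF Ckc_dbar[OF \<psi>2]])
  have W2c: "Ckc (Suc 0) S W2" unfolding W2_def
    by (intro Ckc_mult Ckc_cnj \<psi>1 S Ck_on_mult E1 Ckc_Ck_on[OF D1])
  have id: "Re (dz W1 z) - Re (dbar W2 z)
      = exp (\<Phi> z) * (cmod (dbar \<psi> z))\<^sup>2 - exp (\<Phi> z) * (cmod (D z))\<^sup>2 - qlaplacian \<Phi> z * exp (\<Phi> z) * (cmod (\<psi> z))\<^sup>2"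
    for z
  proof (cases "z \<in> S")
    case False
    then show ?thesis
      using Ckc_outside[OF Ckc_dz[OF W1c]] Ckc_outside[OF Ckc_dbar[OF W2c]] Ckc_outside[OF D1]
        Ckc_outside[OF \<psi>2] Ckc_outside[OF Ckc_dbar[OF \<psi>2]] by simp
  next
    case z: True
    have dbc: "dbar (\<lambda>z. of_real (\<Phi> z)) z = cnj (p z)"
      unfolding p_def wirtinger_unique[OF wirtinger_of_real[OF Ck_on_Suc_differentiable[OF \<Phi>2 S z]]] by simp
    have w\<Phi>: "wirtinger (\<lambda>z. of_real (\<Phi> z)) z (p z) (cnj (p z))"
      using Ck_on_wirtinger[OF \<Phi>c S z] by (simp add: p_def dbc)
    have wE: "wirtinger E z (E z * p z) (E z * cnj (p z))"
      unfolding E_def by (rule wirtinger_compose_real[OF w\<Phi>]) (rule DERIV_exp)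
    note w\<psi> = Ck_on_wirtinger[OF Ckc_Ck_on[OF \<psi>2] S z]
    note wb = Ck_on_wirtinger[OF Ckc_Ck_on[OF Ckc_dbar[OF \<psi>2]] S z]
    note wd = Ck_on_wirtinger[OF Ckc_Ck_on[OF Ckc_dz[OF \<psi>2]] S z]
    note wp = Ck_on_wirtinger[OF p1 S z]
    have comm: "dz (dbar \<psi>) z = dbar (dz \<psi>) z"
      by (rule dz_dbar_commute[OF S Ckc_Ck_on[OF \<psi>] z])
    have dD: "dbar D z = dbar (dz \<psi>) z + (\<psi> z * dbar p z + dbar \<psi> z * p z)"
      unfolding D_def using wirtinger_unique(2)[OF wirtinger_add[OF wd wirtinger_mult[OF w\<psi> wp]]] .
    note wD = Ck_on_wirtinger[OF Ckc_Ck_on[OF D1] S z]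
    have 1: "dz W1 z = dbar \<psi> z * E z * cnj (dbar \<psi> z) + (dbar \<psi> z * (E z * p z) + dz (dbar \<psi>) z * E z) * cnj (\<psi> z)"
      unfolding W1_def
      using wirtinger_unique(1)[OF wirtinger_mult[OF wirtinger_mult[OF wb wE] wirtinger_cnj[OF w\<psi>]]] .
    have 2: "dbar W2 z = D z * E z * cnj (dz \<psi> z) + (D z * (E z * cnj (p z)) + dbar D z * E z) * cnj (\<psi> z)"
      unfolding W2_def
      using wirtinger_unique(2)[OF wirtinger_mult[OF wirtinger_mult[OF wD wE] wirtinger_cnj[OF w\<psi>]]] .
    have "dz W1 z - dbar W2 z = E z * (dbar \<psi> z * cnj (dbar \<psi> z)) - E z * (D z * cnj (D z)) - E z * (\<psi> z * cnj (\<psi> z)) * dbar p z"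
      unfolding 1 2 dD comm by (simp add: D_def algebra_simps)
    also have "\<dots> = complex_of_real (exp (\<Phi> z) * (cmod (dbar \<psi> z))\<^sup>2 - exp (\<Phi> z) * (cmod (D z))\<^sup>2) - complex_of_real (exp (\<Phi> z) * (cmod (\<psi> z))\<^sup>2) * dbar p z"
      by (simp add: complex_norm_square[symmetric] E_def)
    finally have "Re (dz W1 z - dbar W2 z) = exp (\<Phi> z) * (cmod (dbar \<psi> z))\<^sup>2 - exp (\<Phi> z) * (cmod (D z))\<^sup>2 - exp (\<Phi> z) * (cmod (\<psi> z))\<^sup>2 * Re (dbar p z)"
      by simp
    moreover have "Re (dbar p z) = qlaplacian \<Phi> z"
      unfolding p_def by (rule Re_dbar_dz_of_real[OF S z \<Phi>])
    ultimately show ?thesis by (simp add: mult_ac)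
  qed
  have c: "continuous_on S (\<lambda>z. exp (\<Phi> z))" "continuous_on S (qlaplacian \<Phi>)"
    using Ck_on_continuous[OF \<Phi>] Ck_on_continuous[OF Ck_on_qlaplacian[of S 0 \<Phi>]] \<Phi> S
    by (auto intro: continuous_intros simp: numeral_2_eq_2)
  have i: "integrable lborel (\<lambda>z. exp (\<Phi> z) * (cmod (dbar \<psi> z))\<^sup>2)" "integrable lborel (\<lambda>z. exp (\<Phi> z) * (cmod (D z))\<^sup>2)"
    "integrable lborel (\<lambda>z. qlaplacian \<Phi> z * exp (\<Phi> z) * (cmod (\<psi> z))\<^sup>2)"
    by (rule integrable_weighted_square, rule S, rule Ckc_dbar[OF \<psi>2] D1 \<psi>, intro continuous_intros c)+
  have j: "integrable lborel (dz W1)" "integrable lborel (dbar W2)"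
    using Ckc_integrable[OF Ckc_dz[OF W1c]] Ckc_integrable[OF Ckc_dbar[OF W2c]] by auto
  have "0 = (LINT z|lborel. Re (dz W1 z) - Re (dbar W2 z))"
    using integral_dz_eq_0[OF W1c] integral_dbar_eq_0[OF W2c] j by simp
  also have "\<dots> = (LINT z|lborel. exp (\<Phi> z) * (cmod (dbar \<psi> z))\<^sup>2) - (LINT z|lborel. exp (\<Phi> z) * (cmod (D z))\<^sup>2)
     - (LINT z|lborel. qlaplacian \<Phi> z * exp (\<Phi> z) * (cmod (\<psi> z))\<^sup>2)"
    unfolding id using i by simp
  finally have "(LINT z|lborel. qlaplacian \<Phi> z * exp (\<Phi> z) * (cmod (\<psi> z))\<^sup>2)
    = (LINT z|lborel. exp (\<Phi> z) * (cmod (dbar \<psi> z))\<^sup>2) - (LINT z|lborel. exp (\<Phi> z) * (cmod (D z))\<^sup>2)" by simp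
  moreover have "0 \<le> (LINT z|lborel. exp (\<Phi> z) * (cmod (D z))\<^sup>2)"
    by (rule Bochner_Integration.integral_nonneg) simp
  ultimately show ?thesis by linarith
qed

text \<open>Adding ln \<Delta>Q to the weight produces a factor \<Delta>Q on the right side of the
  first inequality. Up to 2m this is the left side of the second inequality, applied to dbar \<psi>,
  because the Laplacian of 2mQ is 2m \<Delta>Q; so the two estimates chain.\<close>

lemma weighted_dbar2_inequality:
  fixes Q :: "complex \<Rightarrow> real"
  assumes S: "open S" and Q: "Ck_on 4 Q S" and pos: "\<And>z. z \<in> S \<Longrightarrow> qlaplacian Q z > 0"
    and B: "\<And>z. z \<in> S \<Longrightarrow> 1 / qlaplacian Q z * qlaplacian (\<lambda>u. ln (1 / qlaplacian Q u)) z \<le> B"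
    and m: "m > 0" "m \<ge> B" and \<psi>: "Ckc 3 S \<psi>"
  shows "2 * m\<^sup>2 * (LINT z|lborel. (qlaplacian Q z)\<^sup>2 * exp (2 * m * Q z) * (cmod (\<psi> z))\<^sup>2)
    \<le> (LINT z|lborel. exp (2 * m * Q z) * (cmod (dbar (dbar \<psi>) z))\<^sup>2)"
proof -
  let ?L = "qlaplacian Q"
  have Q2: "Ck_on 2 Q S" using Ck_on_mono[OF Q] by simp
  have L2: "Ck_on 2 ?L S" using Ck_on_qlaplacian[of S 2 Q] S Q by simp
  have ln2: "Ck_on 2 (\<lambda>z. ln (?L z)) S" by (rule Ck_on_ln[OF S L2 pos])
  have \<psi>3: "Ckc (Suc 2) S \<psi>" using \<psi> by (simp add: numeral_3_eq_3 numeral_2_eq_2)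
  have \<psi>2: "Ckc 2 S \<psi>" using Ckc_mono[OF \<psi>3] by simp
  let ?F = "\<lambda>z. 2 * m * Q z + 1 * ln (?L z)"
  \<comment> \<open>The summand \<open>0 * Q z\<close> is padding that gives the weight the shape of
    a linear combination of two functions.\<close>
  have F1: "Ck_on 2 (\<lambda>z. 2 * m * Q z + 0 * Q z) S" and F2: "Ck_on 2 ?F S"
    by (intro Ck_on_add Ck_on_mult Ck_on_const S Q2 ln2)+
  have q1: "qlaplacian (\<lambda>z. 2 * m * Q z + 0 * Q z) z = 2 * m * ?L z" if "z \<in> S" for z
    using qlaplacian_lincomb[OF S that Q2 Q2, of "2 * m" 0] by simp
  \<comment> \<open>The curvature hypothesis says \<Delta> ln \<Delta>Q \<ge> - B \<Delta>Q, so the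
    Laplacian of the weight is at least (2m - B) \<Delta>Q, which is at least m \<Delta>Q once m
    \<ge> B.\<close>
  have q2: "qlaplacian ?F z \<ge> m * ?L z" if z: "z \<in> S" for z
  proof -
    have "qlaplacian (\<lambda>z. (-1) * ln (?L z) + 0 * Q z) z = qlaplacian (\<lambda>u. ln (1 / ?L u)) z"
      by (rule qlaplacian_cong[OF S z]) (auto intro!: Ck_on_minus ln2 S simp: ln_div pos)
    then have "qlaplacian (\<lambda>u. ln (1 / ?L u)) z = - qlaplacian (\<lambda>z. ln (?L z)) z"
      using qlaplacian_lincomb[OF S z ln2 Q2, of "-1" 0] by simp
    then have "- qlaplacian (\<lambda>z. ln (?L z)) z \<le> B * ?L z"
      using B[OF z] pos[OF z] by (simp add: divide_simps)
    moreover have "B * ?L z \<le> m * ?L z" using m pos[OF z] by simp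
    ultimately show ?thesis using qlaplacian_lincomb[OF S z Q2 ln2, of "2*m" 1] by (simp add: algebra_simps)
  qed
  have cQ: "continuous_on S Q" "continuous_on S ?L" "continuous_on S (qlaplacian ?F)"
    using Ck_on_continuous[OF Q2] Ck_on_continuous[OF L2] Ck_on_continuous[OF Ck_on_qlaplacian[of S 0 ?F]] S F2
    by (auto simp: numeral_2_eq_2)
  have e: "exp (?F z) = exp (2 * m * Q z) * ?L z" if "z \<in> S" for z
    using pos[OF that] by (simp add: exp_add)
  note o = Ckc_outside[OF \<psi>2] Ckc_outside[OF Ckc_dbar[OF \<psi>3]]
  have "m * (LINT z|lborel. (?L z)\<^sup>2 * exp (2 * m * Q z) * (cmod (\<psi> z))\<^sup>2)
     = (LINT z|lborel. (m * (?L z)\<^sup>2 * exp (2 * m * Q z)) * (cmod (\<psi> z))\<^sup>2)"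
    by (simp add: mult.assoc)
  also have "\<dots> \<le> (LINT z|lborel. qlaplacian ?F z * exp (?F z) * (cmod (\<psi> z))\<^sup>2)"
  proof (rule integral_mono)
    show "integrable lborel (\<lambda>z. (m * (?L z)\<^sup>2 * exp (2 * m * Q z)) * (cmod (\<psi> z))\<^sup>2)"
      "integrable lborel (\<lambda>z. qlaplacian ?F z * exp (?F z) * (cmod (\<psi> z))\<^sup>2)"
      by (rule integrable_weighted_square[OF S \<psi>2], intro continuous_intros cQ Ck_on_continuous[OF F2])+
    show "(m * (?L z)\<^sup>2 * exp (2 * m * Q z)) * (cmod (\<psi> z))\<^sup>2 \<le> qlaplacian ?F z * exp (?F z) * (cmod (\<psi> z))\<^sup>2" for z
    proof (cases "z \<in> S")
      case True
      have "m * (?L z)\<^sup>2 * exp (2 * m * Q z) = (m * ?L z) * exp (?F z)"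
        unfolding e[OF True] by (simp add: power2_eq_square)
      also have "\<dots> \<le> qlaplacian ?F z * exp (?F z)" using q2[OF True] by simp
      finally show ?thesis by (simp add: mult_right_mono)
    qed (simp add: o)
  qed
  also have "\<dots> \<le> (LINT z|lborel. exp (?F z) * (cmod (dbar \<psi> z))\<^sup>2)"
    by (rule weighted_dbar_inequality[OF S F2 \<psi>2])
  finally have "2 * m\<^sup>2 * (LINT z|lborel. (?L z)\<^sup>2 * exp (2 * m * Q z) * (cmod (\<psi> z))\<^sup>2)
     \<le> 2 * m * (LINT z|lborel. exp (?F z) * (cmod (dbar \<psi> z))\<^sup>2)"
    using m by (simp add: power2_eq_square)
  also have "\<dots> = (LINT z|lborel. 2 * m * (exp (?F z) * (cmod (dbar \<psi> z))\<^sup>2))"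
    by simp
  also have "\<dots> = (LINT z|lborel. qlaplacian (\<lambda>z. 2 * m * Q z + 0 * Q z) z * exp (2 * m * Q z + 0 * Q z) * (cmod (dbar \<psi> z))\<^sup>2)"
  proof (rule Bochner_Integration.integral_cong)
    show "2 * m * (exp (?F z) * (cmod (dbar \<psi> z))\<^sup>2) = qlaplacian (\<lambda>z. 2 * m * Q z + 0 * Q z) z * exp (2 * m * Q z + 0 * Q z) * (cmod (dbar \<psi> z))\<^sup>2" for z
      using q1[of z] e[of z] o(2)[of z] by (cases "z \<in> S") (auto simp: mult_ac)
  qed simp
  also have "\<dots> \<le> (LINT z|lborel. exp (2 * m * Q z + 0 * Q z) * (cmod (dbar (dbar \<psi>) z))\<^sup>2)"
    by (rule weighted_dbar_inequality[OF S F1 Ckc_dbar[OF \<psi>3]])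
  finally show ?thesis by simp
qed

section \<open>Radial reproducing formulas\<close>

text \<open>The squared modulus pushes area to pi times length on the half line. The minus sign
  turns discs into preimages of upper rays, which have finite mass, so that the two measures can be
  compared on such rays.\<close>

lemma distr_neg_cmod_square:
  "distr lborel borel (\<lambda>s::complex. - (cmod s)\<^sup>2) = density lborel (\<lambda>x. ennreal pi * indicator {..0} x)"
proof (rule measure_eqI_lessThan)
  have e: "emeasure (distr lborel borel (\<lambda>s::complex. - (cmod s)\<^sup>2)) {x<..} = ennreal (pi * max 0 (-x))" for x
  proof -
    have "emeasure (distr lborel borel (\<lambda>s::complex. - (cmod s)\<^sup>2)) {x<..}
       = emeasure lborel {s::complex. (cmod s)\<^sup>2 < - x}"
      by (subst emeasure_distr) (auto intro!: arg_cong[where f = "emeasure lborel"] simp: minus_less_iff[of x] )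
    also have "{s::complex. (cmod s)\<^sup>2 < - x} = ball 0 (sqrt (max 0 (-x)))"
    proof (cases "x < 0")
      case True
      have "(cmod s)\<^sup>2 < - x \<longleftrightarrow> cmod s < sqrt (- x)" for s
        by (metis real_sqrt_less_iff real_sqrt_abs abs_norm_cancel)
      then show ?thesis using True by (simp only: set_eq_iff mem_Collect_eq mem_ball dist_0_norm max_absorb2 neg_0_le_iff_le less_imp_le) simp
    next
      case False
      have "\<not> (cmod s)\<^sup>2 < - x" for s using False zero_le_power2[of "cmod s"] by linarith
      then show ?thesis using False by auto
    qed
    also have "emeasure lborel (ball (0::complex) (sqrt (max 0 (-x)))) = ennreal (pi * max 0 (-x))"
      by (subst emeasure_ball) (auto simp: unit_ball_vol_2)
    finally show ?thesis .
  qed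
  show "emeasure (distr lborel borel (\<lambda>s::complex. - (cmod s)\<^sup>2)) {x<..} < \<infinity>" for x
    unfolding e by simp
  show "emeasure (distr lborel borel (\<lambda>s::complex. - (cmod s)\<^sup>2)) {x<..}
     = emeasure (density lborel (\<lambda>x. ennreal pi * indicator {..0} x)) {x<..}" for x
  proof -
    have "emeasure (density lborel (\<lambda>x. ennreal pi * indicator {..0} x)) {x<..}
        = (\<integral>\<^sup>+y. ennreal pi * indicator {x<..0} y \<partial>lborel)"
      by (subst emeasure_density) (auto intro!: nn_integral_cong simp: indicator_def)
    also have "\<dots> = ennreal pi * emeasure lborel {x<..0}" by (simp add: nn_integral_cmult)
    also have "emeasure lborel {x<..0} = ennreal (max 0 (-x))"
      by (cases "x \<le> 0") auto
    also have "ennreal pi * ennreal (max 0 (-x)) = ennreal (pi * max 0 (-x))"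
      by (simp add: ennreal_mult')
    finally show ?thesis by (simp add: e)
  qed
qed auto

lemma nn_integral_radial:
  fixes f :: "real \<Rightarrow> ennreal"
  assumes [measurable]: "f \<in> borel_measurable borel"
  shows "(\<integral>\<^sup>+s. f ((cmod (s - w))\<^sup>2) \<partial>lborel) = ennreal pi * (\<integral>\<^sup>+x. f x * indicator {0..} x \<partial>lborel)"
proof -
  have "(\<integral>\<^sup>+s. f ((cmod (s - w))\<^sup>2) \<partial>lborel) = (\<integral>\<^sup>+s. f ((cmod (s - w))\<^sup>2) \<partial>(distr lborel borel ((+) w)))"
    by (simp add: lborel_distr_plus)
  also have "\<dots> = (\<integral>\<^sup>+s. f (- (- (cmod s)\<^sup>2)) \<partial>lborel)"
    by (subst nn_integral_distr) auto
  also have "\<dots> = (\<integral>\<^sup>+y. f (- y) \<partial>(distr lborel borel (\<lambda>s::complex. - (cmod s)\<^sup>2)))"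
    by (subst nn_integral_distr) auto
  also have "\<dots> = (\<integral>\<^sup>+y. ennreal pi * indicator {..0} y * f (- y) \<partial>lborel)"
    unfolding distr_neg_cmod_square by (subst nn_integral_density) auto
  also have "\<dots> = (\<integral>\<^sup>+y. ennreal pi * indicator {..0} (-y) * f (-(-y)) \<partial>lborel)"
    by (subst lborel_distr_uminus[symmetric], subst nn_integral_distr) auto
  also have "\<dots> = (\<integral>\<^sup>+x. ennreal pi * (f x * indicator {0..} x) \<partial>lborel)"
    by (auto intro!: nn_integral_cong simp: indicator_def)
  finally show ?thesis by (simp add: nn_integral_cmult)
qed

lemma integral_radial:
  fixes f :: "real \<Rightarrow> real"
  assumes [measurable]: "f \<in> borel_measurable borel"
  shows "(LINT s|lborel. f ((cmod (s - w))\<^sup>2)) = pi * (LINT x|lborel. indicator {0..} x * f x)"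
proof -
  have "(LINT s|lborel. f ((cmod (s - w))\<^sup>2)) = (LINT s|distr lborel borel ((+) w). f ((cmod (s - w))\<^sup>2))"
    by (simp add: lborel_distr_plus)
  also have "\<dots> = (LINT s|lborel. f (- (- (cmod s)\<^sup>2)))"
    by (subst integral_distr) auto
  also have "\<dots> = (LINT y|distr lborel borel (\<lambda>s::complex. - (cmod s)\<^sup>2). f (- y))"
    by (subst integral_distr) auto
  also have "density lborel (\<lambda>x. ennreal pi * indicator {..0} x) = density lborel (\<lambda>x::real. ennreal (pi * indicator {..0} x))"
    by (intro arg_cong[where f = "density lborel"]) (auto simp: indicator_def)
  then have "(LINT y|distr lborel borel (\<lambda>s::complex. - (cmod s)\<^sup>2). f (- y))
      = (LINT y|lborel. (pi * indicator {..0} y) *\<^sub>R f (- y))"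
    unfolding distr_neg_cmod_square by (simp only:) (rule integral_density, auto simp: AE_I2)
  also have "\<dots> = (LINT y|lborel. (pi * indicator {..0} (-y)) *\<^sub>R f (-(-y)))"
    by (subst lborel_distr_uminus[symmetric], subst integral_distr) auto
  also have "\<dots> = (LINT x|lborel. pi * (indicator {0..} x * f x))"
    by (rule Bochner_Integration.integral_cong) (auto simp: indicator_def)
  finally show ?thesis by (simp only: integral_mult_right_zero)
qed

lemma cmod_square_mult_cnj: "complex_of_real ((cmod (u - w))\<^sup>2) = (u - w) * cnj (u - w)"
  by (rule complex_norm_square)

lemma wirtinger_ident_diff: "wirtinger (\<lambda>u. u - w) z 1 0"
  by (rule wirtinger_field_derivative) (auto intro!: derivative_eq_intros)

lemma wirtinger_cnj_diff: "wirtinger (\<lambda>u. cnj (u - w)) z 0 1"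
  using wirtinger_cnj[OF wirtinger_ident_diff] by simp

lemma wirtinger_radial:
  assumes "(G has_real_derivative g) (at ((cmod (z - w))\<^sup>2))"
  shows "wirtinger (\<lambda>u. of_real (G ((cmod (u - w))\<^sup>2))) z (of_real g * cnj (z - w)) (of_real g * (z - w))"
proof -
  have "wirtinger (\<lambda>u. complex_of_real ((cmod (u - w))\<^sup>2)) z (cnj (z - w)) (cnj (cnj (z - w)))"
    using wirtinger_mult[OF wirtinger_ident_diff[of w z] wirtinger_cnj_diff[of w z]]
    unfolding cmod_square_mult_cnj by simp
  from wirtinger_compose_real[OF this assms] show ?thesis by simp
qed

lemma Ck_on_ident_diff: "Ck_on k (\<lambda>u::complex. u - w) S" and Ck_on_cnj_diff: "Ck_on k (\<lambda>u. cnj (u - w)) S"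
proof -
  have "Ck_on k (\<lambda>u::complex. u - w) UNIV"
    by (intro Ck_on_holomorphic holomorphic_intros open_UNIV)
  from Ck_on_subset[OF this subset_UNIV] Ck_on_subset[OF Ck_on_cnj[OF open_UNIV this] subset_UNIV]
  show "Ck_on k (\<lambda>u::complex. u - w) S" "Ck_on k (\<lambda>u. cnj (u - w)) S" .
qed

lemma Ck_on_cmod_square: "Ck_on k (\<lambda>u. (cmod (u - w))\<^sup>2) S"
proof -
  have "Ck_on k (\<lambda>u. Re ((u - w) * cnj (u - w))) UNIV"
    by (intro Ck_on_bounded_linear[OF bounded_linear_Re] Ck_on_mult Ck_on_ident_diff Ck_on_cnj_diff open_UNIV)
  moreover have "(\<lambda>u. Re ((u - w) * cnj (u - w))) = (\<lambda>u. (cmod (u - w))\<^sup>2)"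
    unfolding cmod_square_mult_cnj[symmetric] by simp
  ultimately have "Ck_on k (\<lambda>u. (cmod (u - w))\<^sup>2) UNIV" by simp
  from Ck_on_subset[OF this subset_UNIV] show ?thesis .
qed

lemma Ck_on_radial:
  fixes G :: "nat \<Rightarrow> real \<Rightarrow> real"
  assumes "\<And>i x. i < k \<Longrightarrow> (G i has_real_derivative G (Suc i) x) (at x)" "continuous_on UNIV (G k)"
  shows "Ck_on k (\<lambda>u. complex_of_real (G 0 ((cmod (u - w))\<^sup>2))) S"
proof -
  have "Ck_on k (\<lambda>u. G 0 ((cmod (u - w))\<^sup>2)) UNIV"
    by (rule Ck_on_compose_real[where G = G, OF open_UNIV Ck_on_cmod_square assms(1)])
       (auto intro: continuous_on_subset[OF assms(2)])
  from Ck_on_subset[OF Ck_on_of_real[OF open_UNIV this] subset_UNIV] show ?thesis .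
qed

lemma Ckc_radial:
  fixes G :: "nat \<Rightarrow> real \<Rightarrow> real"
  assumes "\<And>i x. i < k \<Longrightarrow> (G i has_real_derivative G (Suc i) x) (at x)" "continuous_on UNIV (G k)"
    and "\<And>x. x \<ge> r\<^sup>2 \<Longrightarrow> G 0 x = 0" "cball w r \<subseteq> S" "r > 0"
  shows "Ckc k S (\<lambda>u. complex_of_real (G 0 ((cmod (u - w))\<^sup>2)))"
  unfolding Ckc_def
proof (intro conjI Ck_on_radial[of k G] assms(1,2))
  have "G 0 ((cmod (z - w))\<^sup>2) = 0" if "z \<notin> cball w r" for z
    using that assms(5) by (intro assms(3) power_mono) (auto simp: dist_norm norm_minus_commute)
  then show "\<exists>C. compact C \<and> C \<subseteq> S \<and> (\<forall>z. z \<notin> C \<longrightarrow> complex_of_real (G 0 ((cmod (z - w))\<^sup>2)) = 0)"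
    using assms(4) by (intro exI[of _ "cball w r"]) auto
qed

lemma difference_quotient_holomorphic:
  assumes "f holomorphic_on S" "open S" "w \<in> S"
  obtains q where "q holomorphic_on S" "\<And>z. z \<in> S \<Longrightarrow> f z = f w + (z - w) * q z"
proof
  let ?q = "\<lambda>z. if z = w then deriv f w else (f z - f w) / (z - w)"
  show "?q holomorphic_on S"
  proof (rule pole_theorem_open_0[where a = w and g = "\<lambda>z. f z - f w"])
    have "deriv (\<lambda>z. f z - f w) w = deriv f w"
      using assms by (subst deriv_diff) (auto intro: holomorphic_on_imp_differentiable_at)
    then show "?q w = deriv (\<lambda>z. f z - f w) w" by simp
  qed (use assms in \<open>auto intro!: holomorphic_intros\<close>)
qed auto

text \<open>Split \<open>g = g w + c cnj s + s r\<close> with \<open>s = \<zeta> - w\<close> and \<open>r\<close> bianalytic. The last term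
  integrates to zero because \<open>s (2 F' + x F'')\<close> is d-bar squared of \<open>cnj s F(|s|\<^sup>2)\<close>.\<close>

lemma radial_reproducing:
  fixes F F1 F2 :: "real \<Rightarrow> real" and g :: "complex \<Rightarrow> complex"
  assumes F: "\<And>x. (F has_real_derivative F1 x) (at x)" "\<And>x. (F1 has_real_derivative F2 x) (at x)"
    "continuous_on UNIV F2"
    and van: "\<And>x. x \<ge> r\<^sup>2 \<Longrightarrow> F x = 0" "\<And>x. x \<ge> r\<^sup>2 \<Longrightarrow> F1 x = 0" "\<And>x. x \<ge> r\<^sup>2 \<Longrightarrow> F2 x = 0"
    and r: "0 < r" "r < R" and g: "bianalytic_on g (ball w R)"
  shows "(LINT z|lborel. g z * of_real (2 * F1 ((cmod (z - w))\<^sup>2) + (cmod (z - w))\<^sup>2 * F2 ((cmod (z - w))\<^sup>2)))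
      = - of_real (pi * F 0) * g w"
proof -
  let ?B = "ball w R"
  have wB: "w \<in> ?B" and sub: "cball w r \<subseteq> ?B" and B: "open ?B" using r by auto
  define \<theta> where "\<theta> x = 2 * F1 x + x * F2 x" for x
  define t where "t z = complex_of_real (\<theta> ((cmod (z - w))\<^sup>2))" for z
  have c\<theta>: "continuous_on UNIV \<theta>"
    unfolding \<theta>_def using F(2) by (intro continuous_intros F(3) DERIV_continuous_on)
  have tc: "Ckc 0 ?B t"
    unfolding t_def
    by (rule Ckc_radial[of 0 "\<lambda>i. \<theta>" r, OF _ c\<theta> _ sub]) (auto simp: \<theta>_def van r)
  \<comment> \<open>One function serves all three integrals: G is an antiderivative of \<theta>, dz
    of G(|s|^2) is cnj s times t, and G(|s|^2) is dbar of the function V introduced below.\<close>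
  define G where "G x = F x + x * F1 x" for x
  have G: "(G has_real_derivative \<theta> x) (at x)" for x
    unfolding G_def \<theta>_def by (auto intro!: derivative_eq_intros F)
  have intt: "(LINT z|lborel. t z) = - of_real (pi * F 0)"
  proof -
    have "(LINT z|lborel. \<theta> ((cmod (z - w))\<^sup>2)) = pi * (LINT x|lborel. indicator {0..} x * \<theta> x)"
      by (rule integral_radial) (rule borel_measurable_continuous_onI[OF c\<theta>])
    also have "(LINT x|lborel. indicator {0..} x * \<theta> x) = (LINT x|lborel. indicator {0..r\<^sup>2} x *\<^sub>R \<theta> x)"
      by (auto intro!: Bochner_Integration.integral_cong simp: indicator_def \<theta>_def van)
    also have "\<dots> = G (r\<^sup>2) - G 0"
      by (rule integral_FTC_Icc) (auto intro!: continuous_on_subset[OF c\<theta>]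
           has_field_derivative_at_within G simp: has_real_derivative_iff_has_vector_derivative[symmetric])
    also have "\<dots> = - F 0" by (simp add: G_def van)
    finally show ?thesis by (simp add: t_def)
  qed
  have intct: "(LINT z|lborel. cnj (z - w) * t z) = 0"
  proof -
    have Gc: "Ckc (Suc 0) ?B (\<lambda>z. complex_of_real (G ((cmod (z - w))\<^sup>2)))"
      by (rule Ckc_radial[of "Suc 0" "\<lambda>i. if i = 0 then G else \<theta>" r, simplified, OF G c\<theta> _ sub])
         (auto simp: G_def van r)
    have "dz (\<lambda>z. complex_of_real (G ((cmod (z - w))\<^sup>2))) z = cnj (z - w) * t z" for z
      using wirtinger_unique(1)[OF wirtinger_radial[OF G]] by (simp add: t_def)
    then show ?thesis using integral_dz_eq_0[OF Gc] by simp
  qed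
  obtain g0 g1 where g01: "g0 holomorphic_on ?B" "g1 holomorphic_on ?B"
    "\<And>z. z \<in> ?B \<Longrightarrow> g z = g0 z + cnj z * g1 z" using bianalytic_on_decompose[OF g B] by metis
  have h0: "(\<lambda>z. g0 z + cnj w * g1 z) holomorphic_on ?B" by (intro holomorphic_intros g01)
  obtain q0 where q0: "q0 holomorphic_on ?B"
    "\<And>z. z \<in> ?B \<Longrightarrow> g0 z + cnj w * g1 z = g0 w + cnj w * g1 w + (z - w) * q0 z"
    using difference_quotient_holomorphic[OF h0 B wB] by metis
  obtain q1 where q1: "q1 holomorphic_on ?B" "\<And>z. z \<in> ?B \<Longrightarrow> g1 z = g1 w + (z - w) * q1 z"
    using difference_quotient_holomorphic[OF g01(2) B wB] by metis
  define \<rho> where "\<rho> z = q0 z + cnj (z - w) * q1 z" for z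
  have \<rho>: "bianalytic_on \<rho> ?B"
    by (rule bianalytic_onI[of "\<lambda>z. q0 z - cnj w * q1 z" _ q1])
       (auto intro!: holomorphic_intros q0 q1 simp: \<rho>_def algebra_simps)
  have split: "g z = g w + g1 w * cnj (z - w) + \<rho> z * (z - w)" if "z \<in> ?B" for z
  proof -
    have "g z = (g0 z + cnj w * g1 z) + cnj (z - w) * g1 z" using g01(3)[OF that] by (simp add: algebra_simps)
    also have "\<dots> = g0 w + cnj w * g1 w + (z - w) * q0 z + cnj (z - w) * (g1 w + (z - w) * q1 z)"
      using q0(2)[OF that] q1(2)[OF that] by simp
    also have "\<dots> = g w + g1 w * cnj (z - w) + \<rho> z * (z - w)"
      using g01(3)[OF wB] by (simp add: \<rho>_def algebra_simps)
    finally show ?thesis .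
  qed
  define V where "V z = cnj (z - w) * complex_of_real (F ((cmod (z - w))\<^sup>2))" for z
  have Vc: "Ckc 2 ?B V"
    unfolding V_def
  proof (intro Ckc_mult B Ck_on_cnj_diff)
    show "Ckc 2 ?B (\<lambda>z. complex_of_real (F ((cmod (z - w))\<^sup>2)))"
      by (rule Ckc_radial[of 2 "\<lambda>i. if i = 0 then F else if i = 1 then F1 else F2" r, simplified, OF _ F(3) _ sub])
         (use F in \<open>auto simp: van r less_2_cases_iff\<close>)
  qed
  have "(cnj z - cnj w) * (z - w) = (complex_of_real (cmod (z - w)))\<^sup>2" for z
    by (metis cmod_square_mult_cnj complex_cnj_diff mult.commute of_real_power)
  then have "dbar V z = G ((cmod (z - w))\<^sup>2)" for z
    using wirtinger_unique(2)[OF wirtinger_mult[OF wirtinger_cnj_diff[of w z] wirtinger_radial[OF F(1), of w z]]]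
    by (simp add: V_def[abs_def] G_def mult.left_commute[of "cnj z - cnj w"])
  then have "dbar V = (\<lambda>z. complex_of_real (G ((cmod (z - w))\<^sup>2)))" by auto
  then have dV: "dbar (dbar V) z = (z - w) * t z" for z
    using wirtinger_unique(2)[OF wirtinger_radial[OF G]] by (simp add: t_def)
  have "Ck_on 2 \<rho> ?B" and d\<rho>: "\<And>z. z \<in> ?B \<Longrightarrow> dbar (dbar \<rho>) z = 0"
    using \<rho> by (auto simp: bianalytic_on_def)
  then have "(LINT z|lborel. \<rho> z * dbar (dbar V) z) = (LINT z|lborel. dbar (dbar \<rho>) z * V z)"
    by (intro integral_dbar2_by_parts[OF B _ Vc])
  also have "(\<lambda>z. dbar (dbar \<rho>) z * V z) = (\<lambda>z. 0)"
    using d\<rho> Ckc_outside[OF Vc] by (metis mult_eq_0_iff)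
  finally have int3: "(LINT z|lborel. \<rho> z * ((z - w) * t z)) = 0" by (simp add: dV)
  have i: "integrable lborel t" "integrable lborel (\<lambda>z. cnj (z - w) * t z)" "integrable lborel (\<lambda>z. \<rho> z * ((z - w) * t z))"
    by (intro Ckc_integrable[of 0 ?B] tc Ckc_mult[OF B] Ck_on_cnj_diff Ck_on_ident_diff Ck_on_mono[OF \<open>Ck_on 2 \<rho> ?B\<close>] order_refl zero_le)+
  have "(LINT z|lborel. g z * t z) = (LINT z|lborel. g w * t z + g1 w * (cnj (z - w) * t z) + \<rho> z * ((z - w) * t z))"
  proof (rule Bochner_Integration.integral_cong)
    show "g z * t z = g w * t z + g1 w * (cnj (z - w) * t z) + \<rho> z * ((z - w) * t z)" for z
    proof (cases "z \<in> ?B")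
      case True
      show ?thesis unfolding split[OF True] by (simp add: algebra_simps)
    qed (simp add: Ckc_outside[OF tc])
  qed simp
  also have "\<dots> = g w * (LINT z|lborel. t z) + g1 w * (LINT z|lborel. cnj (z - w) * t z) + (LINT z|lborel. \<rho> z * ((z - w) * t z))"
    using i by simp
  finally show ?thesis using intt intct int3 by (simp add: t_def \<theta>_def)
qed

text \<open>One minus the cumulative distribution of a cubic B-spline, together with its derivatives:
  \<open>cutoff 0\<close> is \<open>C\<^sup>3\<close>, equals 1 on \<open>(-\<infinity>, 1]\<close> and 0 on \<open>[2, \<infinity>)\<close>.\<close>

definition cutoff :: "nat \<Rightarrow> real \<Rightarrow> real" where
  "cutoff i x = (if i = 0 then 1 else 0) - (4 ^ i / fact (4 - i)) *
     (\<Sum>j\<le>4. (-1) ^ j * of_nat (4 choose j) * (max 0 (4 * (x - 1) - of_nat j)) ^ (4 - i))"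

lemma DERIV_max_0_power:
  assumes "n \<ge> 1"
  shows "((\<lambda>x::real. (max 0 x) ^ Suc n) has_real_derivative real (Suc n) * (max 0 x) ^ n) (at x)"
proof -
  consider "x > 0" | "x < 0" | "x = 0" by linarith
  then show ?thesis
  proof cases
    case 1
    have "((\<lambda>x::real. x ^ Suc n) has_real_derivative real (Suc n) * x ^ n) (at x)"
      using DERIV_pow[of "Suc n" x UNIV] by simp
    then have "((\<lambda>x::real. (max 0 x) ^ Suc n) has_real_derivative real (Suc n) * x ^ n) (at x)"
      by (rule has_field_derivative_transform_within_open[of _ _ _ "{0<..}"]) (use 1 in auto)
    then show ?thesis using 1 by simp
  next
    case 2
    have "((\<lambda>x::real. (max 0 x) ^ Suc n) has_real_derivative 0) (at x)"
      by (rule has_field_derivative_transform_within_open[of "\<lambda>_. 0" _ _ "{..<0}"]) (use 2 in auto)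
    then show ?thesis using 2 assms by (simp add: power_0_left)
  next
    case 3
    have "((\<lambda>h. (max 0 h) ^ Suc n / h) \<longlongrightarrow> 0) (at (0::real))"
    proof (rule tendsto_sandwich[of "\<lambda>h. 0" _ _ "\<lambda>h. \<bar>h\<bar> ^ n"])
      have "0 \<le> (max 0 h) ^ Suc n / h \<and> (max 0 h) ^ Suc n / h \<le> \<bar>h\<bar> ^ n" for h :: real
        by (cases "h > 0") auto
      then show "\<forall>\<^sub>F h in at 0. 0 \<le> (max 0 h) ^ Suc n / (h::real)"
        "\<forall>\<^sub>F h in at 0. (max 0 h) ^ Suc n / (h::real) \<le> \<bar>h\<bar> ^ n" by auto
      have "((\<lambda>h::real. \<bar>h\<bar> ^ n) \<longlongrightarrow> \<bar>0\<bar> ^ n) (at 0)" by (intro tendsto_intros)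
      then show "((\<lambda>h::real. \<bar>h\<bar> ^ n) \<longlongrightarrow> 0) (at 0)" using assms by (simp add: zero_power)
    qed auto
    then show ?thesis using 3 assms by (simp add: has_field_derivative_iff zero_power)
  qed
qed

text \<open>For i < 3 the truncated powers have exponent at least 2 and are differentiable at the
  knots. At i = 3 they are piecewise linear, which ends the chain at class C^3.\<close>

lemma DERIV_cutoff:
  assumes "i < 3"
  shows "(cutoff i has_real_derivative cutoff (Suc i) x) (at x)"
proof -
  obtain n where n: "4 - i = Suc n" "4 - Suc i = n" "n \<ge> 1"
    using assms by (cases "4 - i") auto
  have D: "((\<lambda>x. (max 0 (4 * (x - 1) - of_nat j)) ^ Suc n) has_real_derivative
     (real (Suc n) * (max 0 (4 * (x - 1) - of_nat j)) ^ n) * 4) (at x)" for j :: nat and x :: real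
    by (rule DERIV_chain2[OF DERIV_max_0_power[OF n(3)]]) (auto intro!: derivative_eq_intros)
  have "((\<lambda>x. (if i = 0 then 1 else 0) - (4 ^ i / fact (Suc n)) *
     (\<Sum>j\<le>4. (-1) ^ j * of_nat (4 choose j) * (max 0 (4 * (x - 1) - of_nat j)) ^ Suc n)) has_real_derivative
     0 - (4 ^ i / fact (Suc n)) * (\<Sum>j\<le>4. (-1) ^ j * of_nat (4 choose j) * ((real (Suc n) * (max 0 (4 * (x - 1) - of_nat j)) ^ n) * 4))) (at x)"
    by (intro DERIV_diff DERIV_const DERIV_cmult DERIV_sum D)
  also have "0 - (4 ^ i / fact (Suc n)) * (\<Sum>j\<le>4. (-1) ^ j * of_nat (4 choose j) * ((real (Suc n) * (max 0 (4 * (x - 1) - of_nat j)) ^ n) * 4))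
     = 0 - (4 ^ i / fact (Suc n)) * (real (Suc n) * 4) * (\<Sum>j\<le>4. (-1) ^ j * of_nat (4 choose j) * (max 0 (4 * (x - 1) - of_nat j)) ^ n)"
    by (simp only: sum_distrib_left mult_ac)
  also have "(4 ^ i / fact (Suc n)) * (real (Suc n) * 4) = (4 ^ Suc i / fact n :: real)"
    by (simp add: divide_simps del: of_nat_Suc)
  finally show ?thesis unfolding cutoff_def[abs_def] n by (simp only: Suc_not_Zero if_False)
qed

lemma continuous_cutoff: "continuous_on A (cutoff i)"
  unfolding cutoff_def by (intro continuous_intros)

lemma cutoff_le_1: "x \<le> 1 \<Longrightarrow> i \<le> 3 \<Longrightarrow> cutoff i x = (if i = 0 then 1 else 0)"
  by (auto simp: cutoff_def max_def zero_power intro!: sum.neutral)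

text \<open>Beyond all knots every truncation is inactive and the sum is a fourth finite difference:
  it equals 4! on the fourth power, which cancels the leading 1 for i = 0, and vanishes on the lower
  powers that occur for i > 0.\<close>

lemma cutoff_ge_2:
  assumes "x \<ge> 2" "i \<le> 3" shows "cutoff i x = 0"
proof -
  define y where "y = 4 * (x - 1)"
  have y: "y \<ge> 4" using assms by (simp add: y_def)
  have *: "{..4::nat} = {0,1,2,3,4}" by auto
  have "i = 0 \<or> i = 1 \<or> i = 2 \<or> i = 3" using assms by auto
  then show ?thesis
    unfolding cutoff_def y_def[symmetric] *
    using y by (elim disjE) (simp_all add: max_def numeral_eq_Suc binomial_eq_0 fact_numeral algebra_simps power2_eq_square)
qed

lemma cutoff_bounded: "\<exists>M>0. \<forall>i\<le>3. \<forall>x. \<bar>cutoff i x\<bar> \<le> M"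
proof -
  have "\<exists>M. \<forall>x\<in>{1..2}. \<bar>cutoff i x\<bar> \<le> M" for i
  proof -
    have "compact (cutoff i ` {1..2})" by (intro compact_continuous_image continuous_cutoff) auto
    then show ?thesis using compact_imp_bounded[of "cutoff i ` {1..2}"] by (auto simp: bounded_iff)
  qed
  then obtain M where M: "\<And>i x. x \<in> {1..2} \<Longrightarrow> \<bar>cutoff i x\<bar> \<le> M i" by metis
  let ?M = "1 + (\<Sum>i\<le>3. \<bar>M i\<bar>)"
  have "\<bar>cutoff i x\<bar> \<le> ?M" if i: "i \<le> 3" for i x
  proof -
    have "\<bar>M i\<bar> \<le> (\<Sum>i\<le>3. \<bar>M i\<bar>)" using i by (intro member_le_sum) auto
    moreover have "\<bar>cutoff i x\<bar> \<le> 1 + \<bar>M i\<bar>"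
    proof -
      consider "x \<le> 1" | "x \<ge> 2" | "x \<in> {1..2}" by fastforce
      then show ?thesis
      proof cases
        case 3
        then show ?thesis using M[OF 3, of i] by linarith
      qed (use cutoff_le_1[of x i] cutoff_ge_2[of x i] i in auto)
    qed
    ultimately show ?thesis by linarith
  qed
  moreover have "0 < ?M" by (intro add_pos_nonneg sum_nonneg) auto
  ultimately show ?thesis by blast
qed

section \<open>Rescaled cutoffs and compactly supported reproducing kernels\<close>

text \<open>The argument is a squared distance, which keeps the bump smooth at its centre. The
  transition takes place for x between r^2/2 and r^2, and i counts derivatives in x.\<close>

definition rcut :: "real \<Rightarrow> nat \<Rightarrow> real \<Rightarrow> real" where
  "rcut r i x = (2 / r\<^sup>2) ^ i * cutoff i (2 / r\<^sup>2 * x)"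

lemma DERIV_rcut:
  assumes "i < 3" shows "(rcut r i has_real_derivative rcut r (Suc i) x) (at x)"
proof -
  have "((\<lambda>x. cutoff i (2 / r\<^sup>2 * x)) has_real_derivative cutoff (Suc i) (2 / r\<^sup>2 * x) * (2 / r\<^sup>2)) (at x)"
    by (rule DERIV_chain2[OF DERIV_cutoff[OF assms]]) (rule DERIV_cmult_Id)
  from DERIV_cmult[OF this, of "(2 / r\<^sup>2) ^ i"] show ?thesis
    by (simp add: rcut_def[abs_def] mult_ac)
qed

lemma continuous_rcut: "continuous_on A (rcut r i)"
  unfolding rcut_def by (intro continuous_intros continuous_on_compose2[OF continuous_cutoff[of UNIV]]) auto

lemma rcut_inside:
  assumes "r > 0" "x \<le> r\<^sup>2 / 2" "i \<le> 3" shows "rcut r i x = (if i = 0 then 1 else 0)"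
proof -
  have "2 / r\<^sup>2 * x \<le> 1" using assms by (simp add: divide_simps)
  then show ?thesis using assms by (simp add: rcut_def cutoff_le_1)
qed

lemma rcut_outside:
  assumes "r > 0" "x \<ge> r\<^sup>2" "i \<le> 3" shows "rcut r i x = 0"
proof -
  have "2 / r\<^sup>2 * x \<ge> 2" using assms by (simp add: divide_simps)
  then show ?thesis using assms by (simp add: rcut_def cutoff_ge_2)
qed

definition bump :: "complex \<Rightarrow> real \<Rightarrow> complex \<Rightarrow> complex" where
  "bump a r z = of_real (rcut r 0 ((cmod (z - a))\<^sup>2))"

lemma Ckc_bump: "cball a r \<subseteq> S \<Longrightarrow> r > 0 \<Longrightarrow> Ckc 3 S (bump a r)"
  unfolding bump_def[abs_def]
  by (rule Ckc_radial[of 3 "rcut r" r]) (auto intro: DERIV_rcut continuous_rcut rcut_outside)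

lemma bump_inside: "r > 0 \<Longrightarrow> (cmod (z - a))\<^sup>2 \<le> r\<^sup>2 / 2 \<Longrightarrow> bump a r z = 1"
  by (simp add: bump_def rcut_inside)

lemma dbar_bump: "dbar (bump a r) z = of_real (rcut r 1 ((cmod (z - a))\<^sup>2)) * (z - a)"
  unfolding bump_def[abs_def] using wirtinger_unique(2)[OF wirtinger_radial[OF DERIV_rcut, of 0]] by simp

lemma wirtinger_dbar_bump:
  "wirtinger (dbar (bump a r)) z (of_real (rcut r 1 ((cmod (z - a))\<^sup>2)) + of_real (rcut r 2 ((cmod (z - a))\<^sup>2)) * cnj (z - a) * (z - a))
     (of_real (rcut r 2 ((cmod (z - a))\<^sup>2)) * (z - a)\<^sup>2)"
proof -
  have "dbar (bump a r) = (\<lambda>z. of_real (rcut r 1 ((cmod (z - a))\<^sup>2)) * (z - a))" by (auto simp: dbar_bump)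
  then show ?thesis
    using wirtinger_mult[OF wirtinger_radial[OF DERIV_rcut[of 1 r "(cmod (z - a))\<^sup>2"]] wirtinger_ident_diff[of a z]]
    by (simp add: numeral_2_eq_2 power2_eq_square mult_ac)
qed

lemma dbar2_bump: "dbar (dbar (bump a r)) z = of_real (rcut r 2 ((cmod (z - a))\<^sup>2)) * (z - a)\<^sup>2"
  by (rule wirtinger_unique(2)[OF wirtinger_dbar_bump])

text \<open>Up to the factor \<open>-\<pi>\<close> this is a reproducing kernel of bianalytic functions at \<open>z\<close>: it is d-bar
  squared of \<open>bump a r * cnj (\<zeta> - z) / (\<zeta> - z)\<close> away from \<open>z\<close>.\<close>

definition bkernel :: "complex \<Rightarrow> real \<Rightarrow> complex \<Rightarrow> complex \<Rightarrow> complex" where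
  "bkernel a r z \<zeta> = (dbar (dbar (bump a r)) \<zeta> * cnj (\<zeta> - z) + 2 * dbar (bump a r) \<zeta>) / (\<zeta> - z)"

text \<open>When the bump is centred at the evaluation point, dbar of the bump contains the factor
  \<zeta> - z and the singularity cancels. What remains is the density of
  \<open>radial_reproducing\<close> for \<open>F = rcut r 0\<close>.\<close>

lemma bkernel_center:
  assumes "r > 0"
  shows "bkernel z r z \<zeta> = of_real (2 * rcut r 1 ((cmod (\<zeta> - z))\<^sup>2) + (cmod (\<zeta> - z))\<^sup>2 * rcut r 2 ((cmod (\<zeta> - z))\<^sup>2))"
proof (cases "\<zeta> = z")
  \<comment> \<open>At \<zeta> = z the quotient has denominator zero and hence the value 0; the
    right side is 0 as well, since the derivatives of \<open>rcut\<close> vanish near 0.\<close>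
  case True
  then show ?thesis using assms by (simp add: bkernel_def rcut_inside)
next
  case False
  then show ?thesis
    unfolding bkernel_def dbar2_bump dbar_bump of_real_add of_real_mult cmod_square_mult_cnj
    by (simp add: field_simps power2_eq_square)
qed

lemma bkernel_reproducing:
  assumes "0 < r" "r < R" "bianalytic_on g (ball w R)"
  shows "(LINT z|lborel. g z * bkernel w r w z) = - of_real pi * g w"
  unfolding bkernel_center[OF assms(1)]
  using radial_reproducing[of "rcut r 0" "rcut r 1" "rcut r 2" r R g w] assms
    DERIV_rcut[of 0 r] DERIV_rcut[of 1 r]
  by (simp add: continuous_rcut rcut_outside rcut_inside numeral_2_eq_2)

text \<open>Each derivative of \<open>rcut\<close> costs 2/r^2 while x is at most r^2 on the
  support, so both terms scale like 1/r^2. One constant M serves all radii.\<close>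

lemma bkernel_center_bound:
  "\<exists>M>0. \<forall>z r \<zeta>. r > 0 \<longrightarrow> cmod (bkernel z r z \<zeta>) \<le> M / r\<^sup>2 * indicator (cball z r) \<zeta>"
proof -
  obtain M where M: "M > 0" "\<And>i x. i \<le> 3 \<Longrightarrow> \<bar>cutoff i x\<bar> \<le> M" using cutoff_bounded by blast
  have "cmod (bkernel z r z \<zeta>) \<le> (8 * M) / r\<^sup>2 * indicator (cball z r) \<zeta>" if r: "r > 0" for z r \<zeta>
  proof (cases "\<zeta> \<in> cball z r")
    case False
    then have "(cmod (\<zeta> - z))\<^sup>2 \<ge> r\<^sup>2"
      using r by (intro power_mono) (auto simp: dist_norm norm_minus_commute)
    then show ?thesis using r False by (simp add: bkernel_center rcut_outside)
  next
    case True
    define x where "x = (cmod (\<zeta> - z))\<^sup>2"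
    have x: "0 \<le> x" "x \<le> r\<^sup>2"
      using True by (auto simp: x_def dist_norm norm_minus_commute intro!: power_mono)
    have "\<bar>2 * rcut r 1 x + x * rcut r 2 x\<bar> \<le> 2 * \<bar>rcut r 1 x\<bar> + x * \<bar>rcut r 2 x\<bar>"
      using x by (intro order_trans[OF abs_triangle_ineq]) (simp add: abs_mult)
    also have "\<dots> \<le> 2 * (2 / r\<^sup>2 * M) + r\<^sup>2 * ((2 / r\<^sup>2)\<^sup>2 * M)"
    proof (intro add_mono mult_mono x order_refl)
      show "\<bar>rcut r 1 x\<bar> \<le> 2 / r\<^sup>2 * M" using M(2)[of 1] r by (simp add: rcut_def abs_mult mult_left_mono divide_right_mono)
      show "\<bar>rcut r 2 x\<bar> \<le> (2 / r\<^sup>2)\<^sup>2 * M" using M(2)[of 2] r by (simp add: rcut_def abs_mult mult_left_mono divide_right_mono)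
    qed auto
    also have "\<dots> = 8 * M / r\<^sup>2" using r by (simp add: field_simps power2_eq_square)
    finally show ?thesis using True by (simp add: bkernel_center[OF r] x_def[symmetric] norm_of_real del: of_real_add of_real_mult)
  qed
  then show ?thesis using M(1) by (intro exI[of _ "8 * M"]) auto
qed

text \<open>Multiply the difference of the two bumps by cnj(\<zeta> - z)/(\<zeta> - z). Both bumps
  equal 1 near z, so the singularity is wiped out and a genuine test function results. Kernels with
  different centres are thus equivalent for anything annihilated weakly by d-bar squared.\<close>

lemma bkernel_difference:
  assumes S: "cball a r \<subseteq> S" "cball z e \<subseteq> S" and r: "r > 0" "e > 0" and z: "z \<in> ball a (r / 2)"
  shows "\<exists>\<sigma>. Ckc 3 S \<sigma> \<and> (\<forall>\<zeta>. dbar (dbar \<sigma>) \<zeta> = bkernel a r z \<zeta> - bkernel z e z \<zeta>)"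
proof -
  define b where "b \<zeta> = bump a r \<zeta> - bump z e \<zeta>" for \<zeta>
  define \<sigma> where "\<sigma> \<zeta> = b \<zeta> * (cnj (\<zeta> - z) * inverse (\<zeta> - z))" for \<zeta>
  \<comment> \<open>With |\<zeta> - z| < r/6 and |z - a| < r/2 the distance to a is below 2r/3, and
    4/9 < 1/2 puts \<zeta> where the first bump is 1; e/2 does the same for the second.\<close>
  define d where "d = min (r / 6) (e / 2)"
  have d: "d > 0" using r by (simp add: d_def)
  have b0: "b \<zeta> = 0" if "\<zeta> \<in> ball z d" for \<zeta>
  proof -
    have 1: "cmod (\<zeta> - z) < r / 6" "cmod (\<zeta> - z) < e / 2"
      using that by (auto simp: d_def dist_norm norm_minus_commute)
    have "cmod (\<zeta> - a) \<le> 2 * r / 3"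
      using norm_triangle_ineq[of "\<zeta> - z" "z - a"] 1 z by (simp add: dist_norm norm_minus_commute)
    then have "(cmod (\<zeta> - a))\<^sup>2 \<le> (2 * r / 3)\<^sup>2" by (intro power_mono) auto
    also have "\<dots> \<le> r\<^sup>2 / 2" by (simp add: power2_eq_square)
    finally have "bump a r \<zeta> = 1" using r by (intro bump_inside)
    have "(cmod (\<zeta> - z))\<^sup>2 \<le> (e / 2)\<^sup>2" using 1 by (intro power_mono) auto
    also have "\<dots> \<le> e\<^sup>2 / 2" by (simp add: power2_eq_square)
    finally have "bump z e \<zeta> = 1" using r by (intro bump_inside)
    with \<open>bump a r \<zeta> = 1\<close> show ?thesis by (simp add: b_def)
  qed
  then have \<sigma>0: "\<sigma> \<zeta> = 0" if "\<zeta> \<in> ball z d" for \<zeta> using that by (simp add: \<sigma>_def)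
  have bc: "Ckc 3 S b" unfolding b_def[abs_def] by (intro Ckc_diff Ckc_bump S r)
  have o: "open (- {z})" by auto
  have q: "Ck_on k (\<lambda>\<zeta>. inverse (\<zeta> - z)) (- {z})" for k
    by (intro Ck_on_holomorphic holomorphic_intros o) auto
  have "Ck_on 3 \<sigma> UNIV"
  proof (rule Ck_on_local)
    fix \<zeta>
    have "Ck_on 3 \<sigma> (ball z d)" by (rule Ck_on_cong[OF open_ball Ck_on_const[of 3 0]]) (simp add: \<sigma>0)
    moreover have "Ck_on 3 \<sigma> (- {z})"
      unfolding \<sigma>_def[abs_def] by (intro Ck_on_mult o q Ck_on_cnj_diff Ckc_Ck_on[OF bc])
    moreover have "\<zeta> \<in> ball z d \<or> \<zeta> \<in> - {z}" using d by auto
    ultimately show "\<exists>T. open T \<and> \<zeta> \<in> T \<and> Ck_on 3 \<sigma> T" using o open_ball by blast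
  qed
  moreover obtain C where "compact C" "C \<subseteq> S" "\<And>\<zeta>. \<zeta> \<notin> C \<Longrightarrow> b \<zeta> = 0" using bc by (auto simp: Ckc_def)
  ultimately have \<sigma>c: "Ckc 3 S \<sigma>" unfolding Ckc_def \<sigma>_def by (metis mult_zero_left)
  have "dbar (dbar \<sigma>) \<zeta> = bkernel a r z \<zeta> - bkernel z e z \<zeta>" for \<zeta>
  proof (cases "\<zeta> = z")
    case True
    have "wirtinger \<sigma> u 0 0" if "u \<in> ball z d" for u
      by (rule wirtinger_cong[OF wirtinger_const[of 0] open_ball that]) (simp add: \<sigma>0)
    then have "dbar \<sigma> u = 0" if "u \<in> ball z d" for u using wirtinger_unique(2) that by blast
    then have "wirtinger (dbar \<sigma>) z 0 0"
      using d by (intro wirtinger_cong[OF wirtinger_const[of 0] open_ball, of z z d]) auto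
    then show ?thesis using wirtinger_unique(2) True by (simp add: bkernel_def)
  next
    case False
    have wb: "wirtinger b u (dz (bump a r) u - dz (bump z e) u) (dbar (bump a r) u - dbar (bump z e) u)" for u
    proof -
      have "Ckc (Suc 2) UNIV (bump a r)" "Ckc (Suc 2) UNIV (bump z e)"
        using Ckc_bump[of a r UNIV] Ckc_bump[of z e UNIV] r by (auto simp: numeral_3_eq_3 numeral_2_eq_2)
      note * = this[THEN Ckc_Ck_on, of UNIV]
      show ?thesis unfolding b_def[abs_def]
        by (rule wirtinger_diff[OF Ck_on_wirtinger[OF *(1) open_UNIV UNIV_I] Ck_on_wirtinger[OF *(2) open_UNIV UNIV_I]])
    qed
    have wi: "wirtinger (\<lambda>\<zeta>. inverse (\<zeta> - z)) u (- inverse (u - z) * inverse (u - z)) 0" if "u \<noteq> z" for u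
      using that by (intro wirtinger_field_derivative) (auto intro!: derivative_eq_intros)
    let ?db = "\<lambda>u. dbar (bump a r) u - dbar (bump z e) u"
    have d1: "dbar \<sigma> u = b u * inverse (u - z) + ?db u * (cnj (u - z) * inverse (u - z))" if "u \<noteq> z" for u
      using wirtinger_unique(2)[OF wirtinger_mult[OF wb wirtinger_mult[OF wirtinger_cnj_diff wi[OF that]]]]
      by (simp add: \<sigma>_def[abs_def])
    note wdb = wirtinger_diff[OF wirtinger_dbar_bump[of a r \<zeta>] wirtinger_dbar_bump[of z e \<zeta>]]
    note W = wirtinger_add[OF wirtinger_mult[OF wb[of \<zeta>] wi[OF False]]
        wirtinger_mult[OF wdb wirtinger_mult[OF wirtinger_cnj_diff[of z \<zeta>] wi[OF False]]]]
    have "wirtinger (dbar \<sigma>) \<zeta> A B" if "wirtinger (\<lambda>u. b u * inverse (u - z) + ?db u * (cnj (u - z) * inverse (u - z))) \<zeta> A B" for A B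
      by (rule wirtinger_cong[OF that o]) (use False d1 in auto)
    from wirtinger_unique(2)[OF this[OF W]]
    show ?thesis using False unfolding bkernel_def dbar2_bump
      by (simp add: divide_inverse algebra_simps)
  qed
  then show ?thesis using \<sigma>c by blast
qed

section \<open>Solving the inhomogeneous equation with a weighted estimate\<close>

text \<open>The infimum of b(x,x) - 2 l(x) need not be attained without completeness. A point within
  e^2 of it still makes the quadratic polynomial in s, obtained by moving along y, nonnegative; its
  discriminant gives the near-representation. \<open>comb x s y\<close> stands for x + s y.\<close>

lemma almost_riesz:
  fixes b :: "'a \<Rightarrow> 'a \<Rightarrow> real" and l :: "'a \<Rightarrow> real" and comb :: "'a \<Rightarrow> real \<Rightarrow> 'a \<Rightarrow> 'a"
  assumes "x0 \<in> V" and comb: "\<And>x y s. x \<in> V \<Longrightarrow> y \<in> V \<Longrightarrow> comb x s y \<in> V"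
    and b: "\<And>x y s. x \<in> V \<Longrightarrow> y \<in> V \<Longrightarrow> b (comb x s y) (comb x s y) = b x x + 2 * s * b x y + s\<^sup>2 * b y y"
    and l: "\<And>x y s. x \<in> V \<Longrightarrow> y \<in> V \<Longrightarrow> l (comb x s y) = l x + s * l y"
    and bd: "\<And>x. x \<in> V \<Longrightarrow> \<bar>l x\<bar> \<le> c * sqrt (b x x)" and nonneg: "\<And>x. x \<in> V \<Longrightarrow> b x x \<ge> 0"
    and c: "c \<ge> 0" and e: "e > 0"
  shows "\<exists>x\<in>V. sqrt (b x x) \<le> c + e \<and> (\<forall>y\<in>V. \<bar>l y - b x y\<bar> \<le> e * sqrt (b y y))"
proof -
  define I where "I x = b x x - 2 * l x" for x
  have I: "I x \<ge> - c\<^sup>2" if "x \<in> V" for x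
  proof -
    have "0 \<le> (sqrt (b x x) - c)\<^sup>2" by simp
    then show ?thesis using bd[OF that] nonneg[OF that] by (simp add: I_def power2_diff algebra_simps)
  qed
  have bb: "bdd_below (I ` V)" using I by (auto intro!: bdd_belowI)
  have "Inf (I ` V) < Inf (I ` V) + e\<^sup>2" using e by simp
  then obtain x where x: "x \<in> V" "I x < Inf (I ` V) + e\<^sup>2"
    using cInf_lessD[of "I ` V"] \<open>x0 \<in> V\<close> by blast
  have key: "\<bar>l y - b x y\<bar> \<le> e * sqrt (b y y)" if y: "y \<in> V" for y
  proof -
    define d where "d = b x y - l y"
    have q: "0 \<le> s\<^sup>2 * b y y + 2 * s * d + e\<^sup>2" for s
    proof -
      have "Inf (I ` V) \<le> I (comb x s y)" using cInf_lower[OF _ bb] comb[OF x(1) y] by blast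
      then have "I x - e\<^sup>2 \<le> I (comb x s y)" using x(2) by linarith
      then show ?thesis using b[OF x(1) y] l[OF x(1) y] by (simp add: I_def d_def algebra_simps)
    qed
    show ?thesis
    proof (cases "b y y = 0")
      case True
      have "d = 0"
      proof (rule ccontr)
        assume "d \<noteq> 0"
        \<comment> \<open>With b(y,y) = 0 this choice of s turns the polynomial into -2 e^2 + e^2,
          which is negative.\<close>
        then show False using q[of "- (e\<^sup>2 / d)"] True e by simp
      qed
      then show ?thesis using True by (simp add: d_def)
    next
      case False
      then have B: "b y y > 0" using nonneg[OF y] by simp
      have "0 \<le> (d / b y y)\<^sup>2 * b y y - 2 * (d / b y y) * d + e\<^sup>2"
        using q[of "- (d / b y y)"] by simp
      also have "\<dots> = e\<^sup>2 - d\<^sup>2 / b y y" using B by (simp add: power2_eq_square field_simps)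
      finally have "d\<^sup>2 \<le> e\<^sup>2 * b y y" using B by (simp add: field_simps)
      then have "sqrt (d\<^sup>2) \<le> sqrt (e\<^sup>2 * b y y)" by (rule real_sqrt_le_mono)
      then show ?thesis using e by (simp add: real_sqrt_mult d_def abs_minus_commute)
    qed
  qed
  have "sqrt (b x x) \<le> c + e"
  proof (cases "b x x = 0")
    case True
    then show ?thesis using c e by simp
  next
    case False
    then have B: "sqrt (b x x) > 0" using nonneg[OF x(1)] by simp
    have "b x x \<le> \<bar>l x\<bar> + e * sqrt (b x x)" using key[OF x(1)] by linarith
    also have "\<dots> \<le> (c + e) * sqrt (b x x)" using bd[OF x(1)] by (simp add: algebra_simps)
    finally have "sqrt (b x x) * sqrt (b x x) \<le> (c + e) * sqrt (b x x)" using nonneg[OF x(1)] by simp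
    then show ?thesis using mult_right_le_imp_le B by blast
  qed
  then show ?thesis using key x(1) by blast
qed

lemma Cauchy_Schwarz_integral:
  fixes f g :: "'a \<Rightarrow> complex"
  assumes [measurable]: "f \<in> borel_measurable M" "g \<in> borel_measurable M"
    and i: "integrable M (\<lambda>x. (cmod (f x))\<^sup>2)" "integrable M (\<lambda>x. (cmod (g x))\<^sup>2)"
  shows "integrable M (\<lambda>x. f x * g x)"
    and "(LINT x|M. cmod (f x * g x)) \<le> sqrt (LINT x|M. (cmod (f x))\<^sup>2) * sqrt (LINT x|M. (cmod (g x))\<^sup>2)"
    and "cmod (LINT x|M. f x * g x) \<le> sqrt (LINT x|M. (cmod (f x))\<^sup>2) * sqrt (LINT x|M. (cmod (g x))\<^sup>2)"
proof -
  show I: "integrable M (\<lambda>x. f x * g x)"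
  proof (rule Bochner_Integration.integrable_bound)
    show "integrable M (\<lambda>x. (cmod (f x))\<^sup>2 + (cmod (g x))\<^sup>2)" using i by simp
    have "cmod (f x) * cmod (g x) \<le> (cmod (f x))\<^sup>2 + (cmod (g x))\<^sup>2" for x
      using sum_squares_bound[of "cmod (f x)" "cmod (g x)"] zero_le_power2[of "cmod (f x)"] zero_le_power2[of "cmod (g x)"]
        mult_nonneg_nonneg[OF norm_ge_zero[of "f x"] norm_ge_zero[of "g x"]] by linarith
    then show "AE x in M. norm (f x * g x) \<le> norm ((cmod (f x))\<^sup>2 + (cmod (g x))\<^sup>2)"
      by (simp add: norm_mult)
  qed measurable
  let ?A = "LINT x|M. (cmod (f x))\<^sup>2" and ?B = "LINT x|M. (cmod (g x))\<^sup>2" and ?C = "LINT x|M. cmod (f x * g x)"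
  have nn: "?A \<ge> 0" "?B \<ge> 0" "?C \<ge> 0" by simp_all
  have "(\<integral>\<^sup>+x. ennreal (cmod (f x)) * ennreal (cmod (g x)) \<partial>M)\<^sup>2
     \<le> (\<integral>\<^sup>+x. (ennreal (cmod (f x)))\<^sup>2 \<partial>M) * (\<integral>\<^sup>+x. (ennreal (cmod (g x)))\<^sup>2 \<partial>M)"
    by (rule Cauchy_Schwarz_nn_integral) measurable
  moreover have "(\<integral>\<^sup>+x. ennreal (cmod (f x)) * ennreal (cmod (g x)) \<partial>M) = ennreal ?C"
    using nn_integral_eq_integral[OF integrable_norm[OF I]] by (simp add: norm_mult ennreal_mult)
  moreover have "(\<integral>\<^sup>+x. (ennreal (cmod (f x)))\<^sup>2 \<partial>M) = ennreal ?A" "(\<integral>\<^sup>+x. (ennreal (cmod (g x)))\<^sup>2 \<partial>M) = ennreal ?B"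
    using nn_integral_eq_integral[OF i(1)] nn_integral_eq_integral[OF i(2)] by (simp_all add: ennreal_power)
  ultimately have "ennreal (?C\<^sup>2) \<le> ennreal (?A * ?B)"
    using nn by (simp add: ennreal_power ennreal_mult)
  then have "?C\<^sup>2 \<le> ?A * ?B" using nn by simp
  then have "sqrt (?C\<^sup>2) \<le> sqrt (?A * ?B)" by (rule real_sqrt_le_mono)
  then show C: "?C \<le> sqrt ?A * sqrt ?B" using nn by (simp add: real_sqrt_mult)
  show "cmod (LINT x|M. f x * g x) \<le> sqrt ?A * sqrt ?B"
    using integral_norm_bound[of M "\<lambda>x. f x * g x"] C by linarith
qed

section \<open>Cauchy-type integrals and their limits\<close>

text \<open>The density stays at distance d from all poles, so the remainder of the difference
  quotient, (w - z) h / ((\<zeta> - z)^2 (\<zeta> - w)), is at most |w - z| |h| / d^3. This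
  differentiates under the integral directly.\<close>

lemma Cauchy_transform_holomorphic:
  assumes h: "integrable lborel h" and d: "d > 0" and D: "open D"
    and sep: "\<And>\<zeta> z. z \<in> D \<Longrightarrow> h \<zeta> \<noteq> 0 \<Longrightarrow> d \<le> cmod (\<zeta> - z)"
  shows "(\<lambda>z. LINT \<zeta>|lborel. h \<zeta> / (\<zeta> - z)) holomorphic_on D"
proof -
  note [measurable] = borel_measurable_integrable[OF h]
  have i: "integrable lborel (\<lambda>\<zeta>. h \<zeta> / ((\<zeta> - z) ^ j * (\<zeta> - w) ^ k))" if "z \<in> D" "w \<in> D" for z w j k
  proof (rule Bochner_Integration.integrable_bound)
    show "integrable lborel (\<lambda>\<zeta>. (1 / (d ^ j * d ^ k)) * cmod (h \<zeta>))"
      by (intro integrable_mult_right integrable_norm h)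
    have "cmod (h \<zeta> / ((\<zeta> - z) ^ j * (\<zeta> - w) ^ k)) \<le> (1 / (d ^ j * d ^ k)) * cmod (h \<zeta>)" for \<zeta>
    proof (cases "h \<zeta> = 0")
      case False
      have "d ^ j * d ^ k \<le> cmod (\<zeta> - z) ^ j * cmod (\<zeta> - w) ^ k"
        using sep[OF that(1) False] sep[OF that(2) False] d by (intro mult_mono power_mono) auto
      then have "cmod (h \<zeta>) / (cmod (\<zeta> - z) ^ j * cmod (\<zeta> - w) ^ k) \<le> cmod (h \<zeta>) / (d ^ j * d ^ k)"
        using d by (intro frac_le) auto
      then show ?thesis by (simp add: norm_divide norm_mult norm_power)
    qed simp
    then show "AE \<zeta> in lborel. norm (h \<zeta> / ((\<zeta> - z) ^ j * (\<zeta> - w) ^ k)) \<le> norm ((1 / (d ^ j * d ^ k)) * cmod (h \<zeta>))"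
      using d by (auto intro!: AE_I2)
  qed measurable
  have "((\<lambda>z. LINT \<zeta>|lborel. h \<zeta> / (\<zeta> - z)) has_field_derivative (LINT \<zeta>|lborel. h \<zeta> / (\<zeta> - z)\<^sup>2)) (at z)" if z: "z \<in> D" for z
  proof -
    let ?f = "\<lambda>z. LINT \<zeta>|lborel. h \<zeta> / (\<zeta> - z)" and ?L = "LINT \<zeta>|lborel. h \<zeta> / (\<zeta> - z)\<^sup>2"
    have bd: "cmod ((?f w - ?f z) / (w - z) - ?L) \<le> cmod (w - z) * ((1 / d ^ 3) * (LINT \<zeta>|lborel. cmod (h \<zeta>)))"
      if w: "w \<in> D" "w \<noteq> z" for w
    proof -
      have "h \<zeta> / (\<zeta> - w) - h \<zeta> / (\<zeta> - z) = (w - z) * (h \<zeta> / (\<zeta> - z)\<^sup>2) + (w - z)\<^sup>2 * (h \<zeta> / ((\<zeta> - z)\<^sup>2 * (\<zeta> - w)))" for \<zeta>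
      proof (cases "h \<zeta> = 0")
        case False
        then have "\<zeta> - w \<noteq> 0" "\<zeta> - z \<noteq> 0" using sep[OF z False] sep[OF w(1) False] d by auto
        then show ?thesis by (simp add: divide_simps power2_eq_square) (simp add: algebra_simps)
      qed simp
      then have "(LINT \<zeta>|lborel. h \<zeta> / (\<zeta> - w) - h \<zeta> / (\<zeta> - z))
          = (LINT \<zeta>|lborel. (w - z) * (h \<zeta> / (\<zeta> - z)\<^sup>2) + (w - z)\<^sup>2 * (h \<zeta> / ((\<zeta> - z)\<^sup>2 * (\<zeta> - w))))"
        by simp
      moreover have "(LINT \<zeta>|lborel. h \<zeta> / (\<zeta> - w) - h \<zeta> / (\<zeta> - z)) = ?f w - ?f z"
        using i[OF z w(1), of 1 0] i[OF z w(1), of 0 1] by simp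
      moreover have "(LINT \<zeta>|lborel. (w - z) * P \<zeta> + (w - z)\<^sup>2 * R \<zeta>) = (w - z) * (LINT \<zeta>|lborel. P \<zeta>) + (w - z)\<^sup>2 * (LINT \<zeta>|lborel. R \<zeta>)"
        if "integrable lborel P" "integrable lborel R" for P R :: "complex \<Rightarrow> complex"
        using that by simp
      note this[of "\<lambda>\<zeta>. h \<zeta> / (\<zeta> - z)\<^sup>2" "\<lambda>\<zeta>. h \<zeta> / ((\<zeta> - z)\<^sup>2 * (\<zeta> - w))"]
      ultimately have "?f w - ?f z = (w - z) * ?L + (w - z)\<^sup>2 * (LINT \<zeta>|lborel. h \<zeta> / ((\<zeta> - z)\<^sup>2 * (\<zeta> - w)))"
        using i[OF z w(1), of 2 0] i[OF z w(1), of 2 1] by (simp only: power_0 mult_1_right power_one_right)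
      then have "(?f w - ?f z) / (w - z) - ?L = (w - z) * (LINT \<zeta>|lborel. h \<zeta> / ((\<zeta> - z)\<^sup>2 * (\<zeta> - w)))"
        using w(2) by (simp add: field_simps power2_eq_square)
      moreover have "cmod (LINT \<zeta>|lborel. h \<zeta> / ((\<zeta> - z)\<^sup>2 * (\<zeta> - w))) \<le> (LINT \<zeta>|lborel. (1 / d ^ 3) * cmod (h \<zeta>))"
      proof (rule Bochner_Integration.integral_norm_bound_integral)
        show "integrable lborel (\<lambda>\<zeta>. h \<zeta> / ((\<zeta> - z)\<^sup>2 * (\<zeta> - w)))" using i[OF z w(1), of 2 1] by simp
        show "integrable lborel (\<lambda>\<zeta>. (1 / d ^ 3) * cmod (h \<zeta>))" by (intro integrable_mult_right integrable_norm h)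
        show "norm (h \<zeta> / ((\<zeta> - z)\<^sup>2 * (\<zeta> - w))) \<le> (1 / d ^ 3) * cmod (h \<zeta>)" for \<zeta>
        proof (cases "h \<zeta> = 0")
          case False
          have "d ^ 2 * d \<le> (cmod (\<zeta> - z))\<^sup>2 * cmod (\<zeta> - w)"
            using sep[OF z False] sep[OF w(1) False] d by (intro mult_mono power_mono) auto
          then have "d ^ 3 \<le> cmod ((\<zeta> - z)\<^sup>2 * (\<zeta> - w))"
            by (simp add: norm_mult norm_power power3_eq_cube power2_eq_square)
          then show ?thesis using d
            unfolding norm_divide by (simp add: frac_le)
        qed simp
      qed
      ultimately show ?thesis
        using mult_left_mono[of _ _ "cmod (w - z)"] by (simp only: norm_mult integral_mult_right_zero norm_ge_zero)
    qed
    show ?thesis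
      unfolding has_field_derivative_iff
    proof (rule LIM_zero_cancel, rule Lim_null_comparison)
      show "\<forall>\<^sub>F w in at z. norm ((?f w - ?f z) / (w - z) - ?L) \<le> cmod (w - z) * ((1 / d ^ 3) * (LINT \<zeta>|lborel. cmod (h \<zeta>)))"
        using eventually_at_in_open'[OF D z] eventually_neq_at_within[of z]
        by eventually_elim (rule bd)
      show "((\<lambda>w. cmod (w - z) * ((1 / d ^ 3) * (LINT \<zeta>|lborel. cmod (h \<zeta>)))) \<longlongrightarrow> 0) (at z)"
        by (rule tendsto_eq_intros | simp)+
    qed
  qed
  then show ?thesis using D by (auto simp: holomorphic_on_open)
qed

lemma uniform_limit_of_Cauchy:
  fixes X :: "nat \<Rightarrow> 'a \<Rightarrow> 'b::complete_space"
  assumes "\<And>n m z. z \<in> D \<Longrightarrow> dist (X n z) (X m z) \<le> K * (1 / real (Suc n) + 1 / real (Suc m))"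
  shows "\<exists>g. uniform_limit D X g sequentially"
proof -
  have "uniformly_Cauchy_on D X"
  proof (rule uniformly_Cauchy_onI)
    fix e :: real assume e: "e > 0"
    obtain N where N: "2 * \<bar>K\<bar> / e < real N" using reals_Archimedean2 by blast
    have N0: "\<bar>K\<bar> * (1 / real (Suc n)) < e / 2" if "n \<ge> N" for n
    proof -
      have "2 * \<bar>K\<bar> < e * real (Suc n)"
        using N e that by (simp add: pos_divide_less_eq) (smt (verit) mult.commute mult_left_mono of_nat_mono)
      then show ?thesis by (simp add: divide_simps mult.commute)
    qed
    show "\<exists>M. \<forall>x\<in>D. \<forall>m\<ge>M. \<forall>n\<ge>M. dist (X m x) (X n x) < e"
    proof (intro exI ballI allI impI)
      fix z m n assume z: "z \<in> D" and mn: "m \<ge> N" "n \<ge> N"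
      have "dist (X m z) (X n z) \<le> K * (1 / real (Suc m) + 1 / real (Suc n))" using assms z by blast
      also have "\<dots> \<le> \<bar>K\<bar> * (1 / real (Suc m) + 1 / real (Suc n))" by (intro mult_right_mono) auto
      also have "\<dots> < e" unfolding distrib_left using N0[OF mn(1)] N0[OF mn(2)] by linarith
      finally show "dist (X m z) (X n z) < e" .
    qed
  qed
  then show ?thesis by (auto simp: Cauchy_uniformly_convergent uniformly_convergent_on_def
        dest!: Cauchy_uniformly_convergent)
qed

lemma dbar2_lincomb:
  assumes f: "Ckc (Suc (Suc k)) S f" and g: "Ckc (Suc (Suc k)) S g"
  shows "dbar (dbar (\<lambda>z. f z + s * g z)) z = dbar (dbar f) z + s * dbar (dbar g) z"
proof -
  have *: "dbar (\<lambda>z. f z + s * g z) w = dbar f w + s * dbar g w" if f: "Ckc (Suc k) S f" and g: "Ckc (Suc k) S g" for f g k w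
  proof -
    note w = Ck_on_wirtinger[OF Ckc_Ck_on[OF f] open_UNIV UNIV_I] Ck_on_wirtinger[OF Ckc_Ck_on[OF g] open_UNIV UNIV_I]
    show ?thesis
      using wirtinger_unique(2)[OF wirtinger_add[OF w(1) wirtinger_mult[OF wirtinger_const w(2)]], of s] by simp
  qed
  have "dbar (\<lambda>z. f z + s * g z) = (\<lambda>z. dbar f z + s * dbar g z)" using *[OF f g] by auto
  then show ?thesis using *[OF Ckc_dbar[OF f] Ckc_dbar[OF g]] by simp
qed

lemma bianalytic_on_local:
  assumes "\<And>z. z \<in> S \<Longrightarrow> \<exists>T. open T \<and> z \<in> T \<and> bianalytic_on f T"
  shows "bianalytic_on f S"
  using assms unfolding bianalytic_on_def by (meson Ck_on_local)

lemma bianalytic_on_cmult_cong: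
  assumes "bianalytic_on f S" "open S" "\<And>z. z \<in> S \<Longrightarrow> g z = c * f z"
  shows "bianalytic_on g S"
proof -
  obtain f0 f1 where "f0 holomorphic_on S" "f1 holomorphic_on S" "\<And>z. z \<in> S \<Longrightarrow> f z = f0 z + cnj z * f1 z"
    using bianalytic_on_decompose[OF assms(1,2)] by metis
  then show ?thesis
    by (intro bianalytic_onI[of "\<lambda>z. c * f0 z" S "\<lambda>z. c * f1 z"] holomorphic_intros assms(2))
       (auto simp: assms(3) algebra_simps)
qed

section \<open>The dual problem\<close>

text \<open>The sign of the exponent is opposite to that in \<open>PA2\<close>: test functions are
  measured in the dual weight exp(\<phi>), and through their second d-bar derivative, which is the
  form to be inverted.\<close>

definition wnorm2 :: "(complex \<Rightarrow> real) \<Rightarrow> (complex \<Rightarrow> complex) \<Rightarrow> real" where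
  "wnorm2 \<phi> \<psi> = (LINT z|lborel. exp (\<phi> z) * (cmod (dbar (dbar \<psi>) z))\<^sup>2)"

lemma wnorm2_nonneg: "wnorm2 \<phi> \<psi> \<ge> 0"
  by (simp add: wnorm2_def)

lemma Ckc_dbar2: "Ckc (Suc (Suc k)) S f \<Longrightarrow> Ckc k S (dbar (dbar f))"
  by (intro Ckc_dbar)

lemma wnorm2_complex:
  "complex_of_real (wnorm2 \<phi> \<psi>) = (LINT z|lborel. of_real (exp (\<phi> z)) * (cnj (dbar (dbar \<psi>) z) * dbar (dbar \<psi>) z))"
proof -
  have "complex_of_real (wnorm2 \<phi> \<psi>) = (LINT z|lborel. complex_of_real (exp (\<phi> z) * (cmod (dbar (dbar \<psi>) z))\<^sup>2))"
    unfolding wnorm2_def by (rule integral_complex_of_real[symmetric])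
  also have "\<dots> = (LINT z|lborel. of_real (exp (\<phi> z)) * (cnj (dbar (dbar \<psi>) z) * dbar (dbar \<psi>) z))"
    by (intro Bochner_Integration.integral_cong refl) (simp only: of_real_mult complex_norm_square mult_ac)
  finally show ?thesis .
qed

text \<open>Represent the functional of integration against k approximately by the form behind
  \<open>wnorm2\<close>. The residual of k after subtracting exp(\<phi>) cnj(dbar^2 \<psi>_n) is
  then almost annihilated by d-bar squared in the weak sense, with error of order 1/n.\<close>

lemma almost_orthogonal_sequence:
  fixes \<phi> :: "complex \<Rightarrow> real" and k :: "complex \<Rightarrow> complex"
  assumes S: "open S" and \<phi>: "continuous_on S \<phi>" and k: "Ckc 0 S k" and c: "c \<ge> 0"
    and bd: "\<And>\<psi>. Ckc 3 S \<psi> \<Longrightarrow> cmod (LINT z|lborel. k z * dbar (dbar \<psi>) z) \<le> c * sqrt (wnorm2 \<phi> \<psi>)"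
  obtains \<psi> where "\<And>n. Ckc 3 S (\<psi> n)" "\<And>n. sqrt (wnorm2 \<phi> (\<psi> n)) \<le> c + 1 / real (Suc n)"
    "\<And>n \<theta>. Ckc 3 S \<theta> \<Longrightarrow>
       cmod (LINT z|lborel. (k z - of_real (exp (\<phi> z)) * cnj (dbar (dbar (\<psi> n)) z)) * dbar (dbar \<theta>) z)
         \<le> 2 / real (Suc n) * sqrt (wnorm2 \<phi> \<theta>)"
proof -
  define E where "E z = complex_of_real (exp (\<phi> z))" for z
  have E: "Ck_on 0 E S" unfolding E_def using \<phi> by (auto intro!: continuous_intros)
  define V where "V = {\<psi>. Ckc (Suc (Suc (Suc 0))) S (\<psi> :: complex \<Rightarrow> complex)}"
  have V3: "x \<in> V \<longleftrightarrow> Ckc 3 S x" for x by (simp add: V_def numeral_3_eq_3)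
  have D: "Ckc 0 S (dbar (dbar x))" if "x \<in> V" for x
    using Ckc_mono[OF Ckc_dbar2, of 1 S x 0 S] that by (simp add: V_def)
  define comb :: "(complex \<Rightarrow> complex) \<Rightarrow> complex \<Rightarrow> (complex \<Rightarrow> complex) \<Rightarrow> complex \<Rightarrow> complex"
    where "comb x s y z = x z + s * y z" for x s y z
  have combV: "comb x s y \<in> V" if "x \<in> V" "y \<in> V" for x s y
    using that Ckc_add[of "Suc (Suc (Suc 0))" S x "\<lambda>z. s * y z"] Ckc_mult[OF S Ck_on_const, of "Suc (Suc (Suc 0))" y s]
    by (auto simp: V_def comb_def[abs_def])
  have dcomb: "dbar (dbar (comb x s y)) z = dbar (dbar x) z + s * dbar (dbar y) z" if "x \<in> V" "y \<in> V" for x s y z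
    using that unfolding V_def comb_def[abs_def] by (auto intro: dbar2_lincomb)
  define ip where "ip x y = (LINT z|lborel. E z * (cnj (dbar (dbar x) z) * dbar (dbar y) z))" for x y
  define L where "L y = (LINT z|lborel. k z * dbar (dbar y) z)" for y
  have i: "integrable lborel (\<lambda>z. E z * (cnj (dbar (dbar x) z) * dbar (dbar y) z))" if "x \<in> V" "y \<in> V" for x y
    using that by (intro Ckc_integrable[of 0 S] Ckc_mult S E Ckc_cnj D Ckc_Ck_on[OF Ckc_cnj[OF D]])
  have iL: "integrable lborel (\<lambda>z. k z * dbar (dbar y) z)" if "y \<in> V" for y
    using that by (intro Ckc_integrable[of 0 S] Ckc_mult S D Ckc_Ck_on[OF k])
  have ipcnj: "Re (ip y x) = Re (ip x y)" if "x \<in> V" "y \<in> V" for x y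
  proof -
    have "ip y x = (LINT z|lborel. cnj (E z * (cnj (dbar (dbar x) z) * dbar (dbar y) z)))"
      by (simp add: ip_def E_def mult_ac)
    also have "\<dots> = cnj (ip x y)" unfolding ip_def
      by (rule integral_bounded_linear'[OF bounded_linear_cnj bounded_linear_cnj]) simp
    finally show ?thesis by simp
  qed
  have ipxx: "ip x x = of_real (wnorm2 \<phi> x)" for x
    by (simp add: ip_def E_def wnorm2_complex)
  have lcomb: "L (comb x s y) = L x + s * L y" if "x \<in> V" "y \<in> V" for x s y
  proof -
    have "L (comb x s y) = (LINT z|lborel. k z * dbar (dbar x) z + s * (k z * dbar (dbar y) z))"
      unfolding L_def by (intro Bochner_Integration.integral_cong refl) (simp add: dcomb[OF that] algebra_simps)
    then show ?thesis using iL that by (simp add: L_def)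
  qed
  have ipcomb: "ip (comb x (of_real s) y) (comb x (of_real s) y)
      = ip x x + of_real s * (ip x y + ip y x) + of_real (s\<^sup>2) * ip y y" if "x \<in> V" "y \<in> V" for x s y
  proof -
    have "ip (comb x (of_real s) y) (comb x (of_real s) y) = (LINT z|lborel. E z * (cnj (dbar (dbar x) z) * dbar (dbar x) z)
         + of_real s * (E z * (cnj (dbar (dbar x) z) * dbar (dbar y) z) + E z * (cnj (dbar (dbar y) z) * dbar (dbar x) z))
         + of_real (s\<^sup>2) * (E z * (cnj (dbar (dbar y) z) * dbar (dbar y) z)))"
      unfolding ip_def by (intro Bochner_Integration.integral_cong refl) (simp add: dcomb[OF that] algebra_simps power2_eq_square)
    then show ?thesis using i that by (simp add: ip_def)
  qed
  have "\<exists>x\<in>V. sqrt (Re (ip x x)) \<le> c + e \<and> (\<forall>y\<in>V. \<bar>Re (L y) - Re (ip x y)\<bar> \<le> e * sqrt (Re (ip y y)))" if "e > 0" for e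
  proof (rule almost_riesz[where comb = "\<lambda>x s y. comb x (of_real s) y" and b = "\<lambda>x y. Re (ip x y)" and l = "\<lambda>y. Re (L y)"])
    show "(\<lambda>z. 0) \<in> V" unfolding V_def Ckc_def by (auto intro: Ck_on_const)
    show "\<bar>Re (L x)\<bar> \<le> c * sqrt (Re (ip x x))" if "x \<in> V" for x
      using bd[of x] that abs_Re_le_cmod[of "L x"] by (simp add: V3 ipxx L_def)
    show "Re (ip (comb x (of_real s) y) (comb x (of_real s) y)) = Re (ip x x) + 2 * s * Re (ip x y) + s\<^sup>2 * Re (ip y y)"
      if "x \<in> V" "y \<in> V" for x y s
      unfolding ipcomb[OF that] using ipcnj[OF that] by simp
    show "Re (ip x x) \<ge> 0" for x by (simp add: ipxx wnorm2_nonneg)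
  qed (use that c in \<open>auto simp: combV lcomb\<close>)
  then have "\<exists>x\<in>V. sqrt (Re (ip x x)) \<le> c + 1 / real (Suc n) \<and> (\<forall>y\<in>V. \<bar>Re (L y) - Re (ip x y)\<bar> \<le> 1 / real (Suc n) * sqrt (Re (ip y y)))" for n
    by (metis zero_less_divide_1_iff of_nat_0_less_iff zero_less_Suc)
  then obtain \<psi> where \<psi>: "\<And>n. \<psi> n \<in> V" "\<And>n. sqrt (Re (ip (\<psi> n) (\<psi> n))) \<le> c + 1 / real (Suc n)"
    "\<And>n y. y \<in> V \<Longrightarrow> \<bar>Re (L y) - Re (ip (\<psi> n) y)\<bar> \<le> 1 / real (Suc n) * sqrt (Re (ip y y))" by metis
  show ?thesis
  proof (rule that)
    show "Ckc 3 S (\<psi> n)" for n using \<psi>(1) V3 by blast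
    show "sqrt (wnorm2 \<phi> (\<psi> n)) \<le> c + 1 / real (Suc n)" for n using \<psi>(2)[of n] by (simp add: ipxx)
    fix n and \<theta> :: "complex \<Rightarrow> complex" assume "Ckc 3 S \<theta>"
    then have \<theta>: "\<theta> \<in> V" by (simp add: V3)
    let ?W = "LINT z|lborel. (k z - of_real (exp (\<phi> z)) * cnj (dbar (dbar (\<psi> n)) z)) * dbar (dbar \<theta>) z"
    have W: "?W = L \<theta> - ip (\<psi> n) \<theta>"
    proof -
      have "?W = (LINT z|lborel. k z * dbar (dbar \<theta>) z - E z * (cnj (dbar (dbar (\<psi> n)) z) * dbar (dbar \<theta>) z))"
        by (intro Bochner_Integration.integral_cong refl) (simp add: E_def algebra_simps)
      then show ?thesis using i[OF \<psi>(1) \<theta>] iL[OF \<theta>] by (simp add: L_def ip_def)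
    qed
    \<comment> \<open>The real variational lemma controls only real parts. Testing with -i \<theta>
      turns the imaginary part into a real one; the sum of both accounts for the factor 2.\<close>
    define z0 where "z0 = comb (\<lambda>z. 0) (- \<i>) \<theta>"
    have 0: "(\<lambda>z. 0) \<in> V" unfolding V_def Ckc_def by (auto intro: Ck_on_const)
    have d0: "dbar (dbar (\<lambda>z. 0)) z = 0" for z
    proof -
      have "dbar (\<lambda>z. 0) = (\<lambda>z. 0)" using wirtinger_unique(2)[OF wirtinger_const] by blast
      then show ?thesis using wirtinger_unique(2)[OF wirtinger_const] by metis
    qed
    have z0: "z0 \<in> V" unfolding z0_def by (rule combV[OF 0 \<theta>])
    have dz0: "dbar (dbar z0) z = - \<i> * dbar (dbar \<theta>) z" for z
      using dcomb[OF 0 \<theta>] d0 by (simp add: z0_def)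
    have "L z0 = - \<i> * L \<theta>" "ip (\<psi> n) z0 = - \<i> * ip (\<psi> n) \<theta>"
      by (simp_all add: L_def ip_def dz0 mult.left_commute[of _ \<i>])
    then have "Re (L z0) - Re (ip (\<psi> n) z0) = Im (L \<theta>) - Im (ip (\<psi> n) \<theta>)" by simp
    moreover have "ip z0 z0 = ip \<theta> \<theta>" by (simp add: ip_def dz0 mult_ac)
    ultimately have "\<bar>Im (L \<theta>) - Im (ip (\<psi> n) \<theta>)\<bar> \<le> 1 / real (Suc n) * sqrt (wnorm2 \<phi> \<theta>)"
      using \<psi>(3)[OF z0, of n] by (simp add: ipxx)
    moreover have "\<bar>Re (L \<theta>) - Re (ip (\<psi> n) \<theta>)\<bar> \<le> 1 / real (Suc n) * sqrt (wnorm2 \<phi> \<theta>)"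
      using \<psi>(3)[OF \<theta>, of n] by (simp add: ipxx)
    moreover have "cmod ?W \<le> \<bar>Re ?W\<bar> + \<bar>Im ?W\<bar>" by (rule cmod_le)
    ultimately have "cmod ?W \<le> 1 / real (Suc n) * sqrt (wnorm2 \<phi> \<theta>) + 1 / real (Suc n) * sqrt (wnorm2 \<phi> \<theta>)"
      unfolding W by simp
    then show "cmod ?W \<le> 2 / real (Suc n) * sqrt (wnorm2 \<phi> \<theta>)" by simp
  qed
qed

lemma rcut_bkernel_continuous: "continuous_on UNIV (\<lambda>x. 2 * rcut r 1 x + x * rcut r 2 x)"
  by (intro continuous_intros continuous_rcut)

lemma Ckc_bkernel:
  assumes "e > 0" "cball z e \<subseteq> S" shows "Ckc 0 S (bkernel z e z)"
proof -
  have "Ckc 0 S (\<lambda>\<zeta>. complex_of_real ((\<lambda>x. 2 * rcut e 1 x + x * rcut e 2 x) ((cmod (\<zeta> - z))\<^sup>2)))"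
    by (rule Ckc_radial[of 0 "\<lambda>i x. 2 * rcut e 1 x + x * rcut e 2 x" e, OF _ rcut_bkernel_continuous _ assms(2,1)])
       (auto simp: rcut_outside assms)
  moreover have "bkernel z e z = (\<lambda>\<zeta>. complex_of_real ((\<lambda>x. 2 * rcut e 1 x + x * rcut e 2 x) ((cmod (\<zeta> - z))\<^sup>2)))"
    by (rule ext) (rule bkernel_center[OF assms(1)])
  ultimately show ?thesis by simp
qed

text \<open>Weak convergence in the weighted norm gives locally uniform convergence of the Cauchy-type
  integrals, hence a limit of the form \<open>A + cnj z B\<close> with holomorphic \<open>A\<close> and \<open>B\<close>.\<close>

lemma bkernel_limit_bianalytic:
  fixes F :: "nat \<Rightarrow> complex \<Rightarrow> complex"
  assumes S: "open S" and r: "r > 0" "cball a r \<subseteq> S" and F: "\<And>n. Ckc 0 S (F n)"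
    and Cauchy: "\<And>h. Ckc 0 S h \<Longrightarrow> \<exists>K\<ge>0. \<forall>n m. (LINT z|lborel. cmod ((F n z - F m z) * h z)) \<le> K * (1 / real (Suc n) + 1 / real (Suc m))"
  shows "\<exists>u. bianalytic_on u (ball a (r / 2)) \<and>
    (\<forall>z\<in>ball a (r / 2). (\<lambda>n. LINT \<zeta>|lborel. F n \<zeta> * bkernel a r z \<zeta>) \<longlonglongrightarrow> u z)"
proof -
  let ?D = "ball a (r / 2)"
  have lim: "\<exists>G. G holomorphic_on ?D \<and> (\<forall>z\<in>?D. (\<lambda>n. LINT \<zeta>|lborel. F n \<zeta> * \<beta> \<zeta> / (\<zeta> - z)) \<longlonglongrightarrow> G z)
      \<and> (\<forall>z\<in>?D. \<forall>n. integrable lborel (\<lambda>\<zeta>. F n \<zeta> * \<beta> \<zeta> / (\<zeta> - z)))"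
    if \<beta>: "Ckc 0 S \<beta>" "\<And>\<zeta>. (cmod (\<zeta> - a))\<^sup>2 \<le> r\<^sup>2 / 2 \<Longrightarrow> \<beta> \<zeta> = 0" for \<beta>
  proof -
    \<comment> \<open>For z within r/2 of a and \<zeta> within r/5 of z, \<zeta> is within 7r/10 of
      a. Since 49/100 < 1/2, the density \<beta> vanishes there.\<close>
    define d where "d = r / 5"
    have d: "d > 0" using r by (simp add: d_def)
    have sep: "d \<le> cmod (\<zeta> - z)" if "z \<in> ?D" "\<beta> \<zeta> \<noteq> 0" for \<zeta> z
    proof (rule ccontr)
      assume "\<not> d \<le> cmod (\<zeta> - z)"
      then have "cmod (\<zeta> - a) \<le> 7 / 10 * r"
        using norm_triangle_ineq[of "\<zeta> - z" "z - a"] that(1) by (simp add: d_def dist_norm norm_minus_commute)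
      then have "(cmod (\<zeta> - a))\<^sup>2 \<le> (7 / 10 * r)\<^sup>2" by (intro power_mono) auto
      also have "\<dots> \<le> r\<^sup>2 / 2" by (simp add: power2_eq_square)
      finally show False using \<beta>(2) that(2) by blast
    qed
    have hc: "Ckc 0 S (\<lambda>\<zeta>. F n \<zeta> * \<beta> \<zeta>)" for n
      by (intro Ckc_mult S \<beta>(1) Ckc_Ck_on[OF F])
    note hi = Ckc_integrable[OF hc]
    define X where "X n z = (LINT \<zeta>|lborel. F n \<zeta> * \<beta> \<zeta> / (\<zeta> - z))" for n z
    have ii: "integrable lborel (\<lambda>\<zeta>. F n \<zeta> * \<beta> \<zeta> / (\<zeta> - z))" if z: "z \<in> ?D" for n z
    proof (rule Bochner_Integration.integrable_bound)
      show "integrable lborel (\<lambda>\<zeta>. (1 / d) * cmod (F n \<zeta> * \<beta> \<zeta>))"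
        by (intro integrable_mult_right integrable_norm hi)
      show "(\<lambda>\<zeta>. F n \<zeta> * \<beta> \<zeta> / (\<zeta> - z)) \<in> borel_measurable lborel"
        using borel_measurable_integrable[OF hi, of n] by measurable
      have "cmod (F n \<zeta> * \<beta> \<zeta> / (\<zeta> - z)) \<le> (1 / d) * cmod (F n \<zeta> * \<beta> \<zeta>)" for \<zeta>
      proof (cases "\<beta> \<zeta> = 0")
        case False
        show ?thesis using frac_le[of "cmod (F n \<zeta> * \<beta> \<zeta>)" "cmod (F n \<zeta> * \<beta> \<zeta>)" d "cmod (\<zeta> - z)"] sep[OF z False] d
          by (simp add: norm_divide)
      qed simp
      then show "AE \<zeta> in lborel. norm (F n \<zeta> * \<beta> \<zeta> / (\<zeta> - z)) \<le> norm ((1 / d) * cmod (F n \<zeta> * \<beta> \<zeta>))"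
        using d by (auto intro!: AE_I2)
    qed
    have hol: "X n holomorphic_on ?D" for n
      unfolding X_def by (rule Cauchy_transform_holomorphic[OF hi d open_ball]) (use sep in auto)
    obtain K where K: "K \<ge> 0" "\<And>n m. (LINT z|lborel. cmod ((F n z - F m z) * \<beta> z)) \<le> K * (1 / real (Suc n) + 1 / real (Suc m))"
      using Cauchy[OF \<beta>(1)] by blast
    have "dist (X n z) (X m z) \<le> (K / d) * (1 / real (Suc n) + 1 / real (Suc m))" if z: "z \<in> ?D" for n m z
    proof -
      have eq: "F n \<zeta> * \<beta> \<zeta> / (\<zeta> - z) - F m \<zeta> * \<beta> \<zeta> / (\<zeta> - z) = (F n \<zeta> - F m \<zeta>) * \<beta> \<zeta> / (\<zeta> - z)" for \<zeta>
        by (simp add: diff_divide_distrib left_diff_distrib)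
      have "X n z - X m z = (LINT \<zeta>|lborel. (F n \<zeta> - F m \<zeta>) * \<beta> \<zeta> / (\<zeta> - z))"
        using Bochner_Integration.integral_diff[OF ii[OF z, of n] ii[OF z, of m]] by (simp add: X_def eq)
      also have "cmod \<dots> \<le> (LINT \<zeta>|lborel. (1 / d) * cmod ((F n \<zeta> - F m \<zeta>) * \<beta> \<zeta>))"
      proof (rule Bochner_Integration.integral_norm_bound_integral)
        show "integrable lborel (\<lambda>\<zeta>. (F n \<zeta> - F m \<zeta>) * \<beta> \<zeta> / (\<zeta> - z))"
          using Bochner_Integration.integrable_diff[OF ii[OF z, of n] ii[OF z, of m]] by (simp add: eq)
        show "integrable lborel (\<lambda>\<zeta>. (1 / d) * cmod ((F n \<zeta> - F m \<zeta>) * \<beta> \<zeta>))"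
          using Bochner_Integration.integrable_diff[OF hi[of n] hi[of m]]
          by (intro integrable_mult_right integrable_norm) (simp add: left_diff_distrib)
        show "norm ((F n \<zeta> - F m \<zeta>) * \<beta> \<zeta> / (\<zeta> - z)) \<le> (1 / d) * cmod ((F n \<zeta> - F m \<zeta>) * \<beta> \<zeta>)" for \<zeta>
        proof (cases "\<beta> \<zeta> = 0")
          case False
          show ?thesis using frac_le[of "cmod ((F n \<zeta> - F m \<zeta>) * \<beta> \<zeta>)" "cmod ((F n \<zeta> - F m \<zeta>) * \<beta> \<zeta>)" d "cmod (\<zeta> - z)"] sep[OF z False] d
            by (simp add: norm_divide)
        qed simp
      qed
      also have "\<dots> \<le> (1 / d) * (K * (1 / real (Suc n) + 1 / real (Suc m)))"
        using K(2)[of n m] d by (simp add: divide_right_mono)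
      finally show ?thesis by (simp add: dist_norm)
    qed
    then obtain G where G: "uniform_limit ?D X G sequentially" using uniform_limit_of_Cauchy by metis
    have "G holomorphic_on ?D"
    proof (rule holomorphic_uniform_sequence[OF open_ball hol])
      fix z assume "z \<in> ?D"
      then obtain e where "e > 0" "cball z e \<subseteq> ?D" by (metis open_ball open_contains_cball)
      then show "\<exists>d>0. cball z d \<subseteq> ?D \<and> uniform_limit (cball z d) X G sequentially"
        using uniform_limit_on_subset[OF G] by blast
    qed
    moreover have "(\<lambda>n. X n z) \<longlonglongrightarrow> G z" if "z \<in> ?D" for z by (rule tendsto_uniform_limitI[OF G that])
    ultimately show ?thesis using ii by (auto simp: X_def)
  qed
  have b3: "Ckc (Suc (Suc (Suc 0))) S (bump a r)" using Ckc_bump[OF r(2,1)] by (simp add: numeral_3_eq_3)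
  define \<beta>1 where "\<beta>1 \<zeta> = dbar (bump a r) \<zeta>" for \<zeta>
  define \<beta>2 where "\<beta>2 \<zeta> = dbar (dbar (bump a r)) \<zeta>" for \<zeta>
  have c1: "Ckc 0 S \<beta>1" and c2: "Ckc 0 S \<beta>2" unfolding \<beta>1_def[abs_def] \<beta>2_def[abs_def]
    using Ckc_mono[OF Ckc_dbar[OF b3], of 0] Ckc_mono[OF Ckc_dbar2[OF b3], of 0] by auto
  have v: "\<beta>1 \<zeta> = 0" "\<beta>2 \<zeta> = 0" if "(cmod (\<zeta> - a))\<^sup>2 \<le> r\<^sup>2 / 2" for \<zeta>
    using that r(1) by (auto simp: \<beta>1_def \<beta>2_def dbar_bump dbar2_bump rcut_inside)
  \<comment> \<open>Writing cnj(\<zeta> - z) as cnj \<zeta> - cnj z splits the kernel into two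
    Cauchy kernels whose densities are free of z. Their limits are the holomorphic coefficients of 1
    and of - cnj z.\<close>
  obtain A where A: "A holomorphic_on ?D" "\<And>z. z \<in> ?D \<Longrightarrow> (\<lambda>n. LINT \<zeta>|lborel. F n \<zeta> * (cnj \<zeta> * \<beta>2 \<zeta> + 2 * \<beta>1 \<zeta>) / (\<zeta> - z)) \<longlonglongrightarrow> A z"
    "\<And>z n. z \<in> ?D \<Longrightarrow> integrable lborel (\<lambda>\<zeta>. F n \<zeta> * (cnj \<zeta> * \<beta>2 \<zeta> + 2 * \<beta>1 \<zeta>) / (\<zeta> - z))"
    using lim[of "\<lambda>\<zeta>. cnj \<zeta> * \<beta>2 \<zeta> + 2 * \<beta>1 \<zeta>"] v
      Ckc_add[OF Ckc_mult[OF S Ck_on_cnj_ident c2] Ckc_mult[OF S Ck_on_const c1, of 2]] by auto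
  obtain B where B: "B holomorphic_on ?D" "\<And>z. z \<in> ?D \<Longrightarrow> (\<lambda>n. LINT \<zeta>|lborel. F n \<zeta> * \<beta>2 \<zeta> / (\<zeta> - z)) \<longlonglongrightarrow> B z"
    "\<And>z n. z \<in> ?D \<Longrightarrow> integrable lborel (\<lambda>\<zeta>. F n \<zeta> * \<beta>2 \<zeta> / (\<zeta> - z))"
    using lim[of \<beta>2] v c2 by auto
  have "(\<lambda>n. LINT \<zeta>|lborel. F n \<zeta> * bkernel a r z \<zeta>) \<longlonglongrightarrow> A z + cnj z * (- B z)" if z: "z \<in> ?D" for z
  proof -
    have "F n \<zeta> * bkernel a r z \<zeta> = F n \<zeta> * (cnj \<zeta> * \<beta>2 \<zeta> + 2 * \<beta>1 \<zeta>) / (\<zeta> - z) - cnj z * (F n \<zeta> * \<beta>2 \<zeta> / (\<zeta> - z))" for n \<zeta>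
      by (simp add: bkernel_def \<beta>1_def \<beta>2_def divide_inverse algebra_simps)
    then have "(LINT \<zeta>|lborel. F n \<zeta> * bkernel a r z \<zeta>)
       = (LINT \<zeta>|lborel. F n \<zeta> * (cnj \<zeta> * \<beta>2 \<zeta> + 2 * \<beta>1 \<zeta>) / (\<zeta> - z)) - cnj z * (LINT \<zeta>|lborel. F n \<zeta> * \<beta>2 \<zeta> / (\<zeta> - z))" for n
      using Bochner_Integration.integral_diff[OF A(3)[OF z, of n] integrable_mult_right[OF B(3)[OF z, of n], of "cnj z"]]
      by (simp only: integral_mult_right_zero)
    then show ?thesis
      using tendsto_diff[OF A(2)[OF z] tendsto_mult_left[OF B(2)[OF z], of "cnj z"]] by simp
  qed
  moreover have "bianalytic_on (\<lambda>z. A z + cnj z * (- B z)) ?D"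
    by (rule bianalytic_onI[OF A(1), of "\<lambda>z. - B z"]) (auto intro!: holomorphic_intros B(1))
  ultimately show ?thesis by blast
qed

section \<open>Averaging at small scales\<close>

text \<open>Uniform continuity on a compact neighbourhood gives one radius for all of C. Over discs
  of this radius exp(\<phi>) grows by at most the factor e above its value at the centre, so a local
  average can be compared with the weight at its centre.\<close>

lemma compact_uniform_radius:
  fixes \<phi> :: "complex \<Rightarrow> real"
  assumes S: "open S" and \<phi>: "continuous_on S \<phi>" and C: "compact C" "C \<subseteq> S" and d: "d > 0"
  shows "\<exists>e>0. e < d \<and> (\<forall>z\<in>C. cball z e \<subseteq> S \<and> (\<forall>\<zeta>\<in>cball z e. \<phi> \<zeta> \<le> \<phi> z + 1))"
proof -
  obtain \<epsilon> where \<epsilon>: "\<epsilon> > 0" "(\<Union>z\<in>C. cball z \<epsilon>) \<subseteq> S"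
    using compact_subset_open_imp_cball_epsilon_subset[OF C(1) S C(2)] by blast
  have K: "(\<Union>z\<in>C. cball z \<epsilon>) = {x + y | x y. x \<in> C \<and> y \<in> cball 0 \<epsilon>}" (is "?K = ?R")
  proof
    show "?K \<subseteq> ?R"
    proof
      fix \<zeta> assume "\<zeta> \<in> ?K"
      then obtain z where "z \<in> C" "dist z \<zeta> \<le> \<epsilon>" by auto
      then show "\<zeta> \<in> ?R" by (intro CollectI exI[of _ z] exI[of _ "\<zeta> - z"]) (auto simp: dist_norm norm_minus_commute)
    qed
    show "?R \<subseteq> ?K" by (auto simp: dist_norm)
  qed
  have "compact ?K" unfolding K by (rule compact_sums[OF C(1) compact_cball])
  then have "uniformly_continuous_on ?K \<phi>"
    using continuous_on_subset[OF \<phi> \<epsilon>(2)] compact_uniformly_continuous by blast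
  then obtain \<delta> where \<delta>: "\<delta> > 0" "\<And>x y. x \<in> ?K \<Longrightarrow> y \<in> ?K \<Longrightarrow> dist y x < \<delta> \<Longrightarrow> dist (\<phi> y) (\<phi> x) < 1"
    unfolding uniformly_continuous_on_def by (metis zero_less_one)
  define e where "e = min (\<delta> / 2) (min \<epsilon> (d / 2))"
  have e: "e > 0" "e < d" "e < \<delta>" "e \<le> \<epsilon>" using \<delta>(1) \<epsilon>(1) d by (auto simp: e_def)
  have "cball z e \<subseteq> S \<and> (\<forall>\<zeta>\<in>cball z e. \<phi> \<zeta> \<le> \<phi> z + 1)" if z: "z \<in> C" for z
  proof (intro conjI ballI)
    have sub: "cball z e \<subseteq> ?K" using z e(4) by auto
    then show "cball z e \<subseteq> S" using \<epsilon>(2) by blast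
    fix \<zeta> assume \<zeta>: "\<zeta> \<in> cball z e"
    have "z \<in> ?K" "\<zeta> \<in> ?K" using sub \<zeta> e(1) by (meson centre_in_cball less_imp_le subsetD)+
    moreover have "dist \<zeta> z < \<delta>" using \<zeta> e by (simp add: dist_commute)
    ultimately have "dist (\<phi> \<zeta>) (\<phi> z) < 1" by (rule \<delta>(2))
    then show "\<phi> \<zeta> \<le> \<phi> z + 1" by (simp add: dist_real_def)
  qed
  then show ?thesis using e by blast
qed

lemma compact_exhaustion:
  fixes S :: "complex set"
  assumes "open S"
  shows "\<exists>C::nat \<Rightarrow> complex set. (\<forall>j. compact (C j)) \<and> (\<forall>j. C j \<subseteq> S) \<and> (\<forall>z\<in>S. \<exists>N. \<forall>j\<ge>N. z \<in> C j)"
proof (rule open_Union_compact_subsets[OF assms])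
  fix C :: "nat \<Rightarrow> complex set"
  assume C: "\<And>n. compact (C n)" "\<And>n. C n \<subseteq> S" "\<And>K. compact K \<Longrightarrow> K \<subseteq> S \<Longrightarrow> \<exists>N. \<forall>n\<ge>N. K \<subseteq> C n"
  have "\<exists>N. \<forall>j\<ge>N. z \<in> C j" if "z \<in> S" for z
    using C(3)[of "{z}"] that by auto
  with C(1,2) show ?thesis by blast
qed

lemma weighted_Cauchy_Schwarz:
  fixes \<phi> :: "complex \<Rightarrow> real"
  assumes S: "open S" and \<phi>: "continuous_on S \<phi>" and X: "Ckc 0 S X" and h: "Ckc 0 S h"
  shows "(LINT z|lborel. cmod (of_real (exp (\<phi> z)) * X z * h z))
     \<le> sqrt (LINT z|lborel. exp (\<phi> z) * (cmod (X z))\<^sup>2) * sqrt (LINT z|lborel. exp (\<phi> z) * (cmod (h z))\<^sup>2)"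
proof -
  define G where "G z = complex_of_real (exp (\<phi> z / 2))" for z
  have G: "Ck_on 0 G S" unfolding G_def using \<phi> by (auto intro!: continuous_intros)
  have GG: "G z * G z = of_real (exp (\<phi> z))" for z
    by (simp add: G_def of_real_mult[symmetric] exp_add[symmetric] del: of_real_mult)
  have sq: "(cmod (G z * x))\<^sup>2 = exp (\<phi> z) * (cmod x)\<^sup>2" for z x
    using arg_cong[OF GG[of z], of cmod] by (simp add: norm_mult power_mult_distrib power2_eq_square)
  have m: "(\<lambda>z. G z * X z) \<in> borel_measurable lborel" "(\<lambda>z. G z * h z) \<in> borel_measurable lborel"
    using Ckc_integrable[OF Ckc_mult[OF S G X]] Ckc_integrable[OF Ckc_mult[OF S G h]] by auto
  have e: "continuous_on S (\<lambda>z. exp (\<phi> z))" by (intro continuous_intros \<phi>)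
  have i: "integrable lborel (\<lambda>z. (cmod (G z * X z))\<^sup>2)" "integrable lborel (\<lambda>z. (cmod (G z * h z))\<^sup>2)"
    unfolding sq using integrable_weighted_square[OF S X e] integrable_weighted_square[OF S h e] by auto
  have eq: "(G z * X z) * (G z * h z) = of_real (exp (\<phi> z)) * X z * h z" for z
    by (simp add: GG[symmetric] mult_ac)
  show ?thesis
    using Cauchy_Schwarz_integral(2)[OF m i] unfolding sq eq .
qed

lemma emeasure_cball_complex: "e \<ge> 0 \<Longrightarrow> emeasure lborel (cball (z::complex) e) = ennreal (pi * e\<^sup>2)"
  by (subst emeasure_cball) (auto simp: unit_ball_vol_2 mult.commute)

text \<open>Cauchy-Schwarz on the disc of radius e. The kernel contributes (M/e^2)^2 times the area
  pi e^2, and exp 1 bounds the growth of exp(\<phi>) over the disc, after which exp(-\<phi>(z))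
  cancels the weight at the centre.\<close>

lemma bkernel_pairing_bound:
  fixes \<phi> :: "complex \<Rightarrow> real"
  assumes M: "M > 0" "\<And>\<zeta>. cmod (bkernel z e z \<zeta>) \<le> M / e\<^sup>2 * indicator (cball z e) \<zeta>"
    and S: "open S" and \<phi>: "continuous_on S \<phi>" and X: "Ckc 0 S X"
    and e: "e > 0" "cball z e \<subseteq> S" "\<And>\<zeta>. \<zeta> \<in> cball z e \<Longrightarrow> \<phi> \<zeta> \<le> \<phi> z + 1"
  shows "ennreal ((cmod (LINT \<zeta>|lborel. of_real (exp (\<phi> \<zeta>)) * X \<zeta> * bkernel z e z \<zeta>))\<^sup>2 * exp (- \<phi> z))
    \<le> ennreal (M\<^sup>2 * pi * exp 1 / e\<^sup>2) * (\<integral>\<^sup>+\<zeta>. (if dist z \<zeta> \<le> e then ennreal (exp (\<phi> \<zeta>) * (cmod (X \<zeta>))\<^sup>2) else 0) \<partial>lborel)"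
proof -
  define G where "G z = complex_of_real (exp (\<phi> z / 2))" for z
  have G: "Ck_on 0 G S" unfolding G_def using \<phi> by (auto intro!: continuous_intros)
  have GG: "G z * G z = of_real (exp (\<phi> z))" for z
    by (simp add: G_def of_real_mult[symmetric] exp_add[symmetric] del: of_real_mult)
  have sq: "(cmod (G z * x))\<^sup>2 = exp (\<phi> z) * (cmod x)\<^sup>2" for z x
    using arg_cong[OF GG[of z], of cmod] by (simp add: norm_mult power_mult_distrib power2_eq_square)
  let ?I = "indicator (cball z e) :: complex \<Rightarrow> real"
  let ?b = "bkernel z e z"
  have bc: "Ckc 0 S ?b" by (rule Ckc_bkernel[OF e(1,2)])
  have b0: "?b \<zeta> = 0" if "\<zeta> \<notin> cball z e" for \<zeta> using M(2)[of \<zeta>] that by simp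
  have ec: "continuous_on S (\<lambda>z. exp (\<phi> z))" by (intro continuous_intros \<phi>)
  have GXi: "integrable lborel (\<lambda>z. G z * X z)" by (rule Ckc_integrable[OF Ckc_mult[OF S G X]])
  note [measurable] = borel_measurable_integrable[OF GXi]
  have Xi: "integrable lborel (\<lambda>z. exp (\<phi> z) * (cmod (X z))\<^sup>2)" by (rule integrable_weighted_square[OF S X ec])
  have m: "(\<lambda>\<zeta>. ?I \<zeta> *\<^sub>R (G \<zeta> * X \<zeta>)) \<in> borel_measurable lborel" "(\<lambda>z. G z * ?b z) \<in> borel_measurable lborel"
  proof -
    show "(\<lambda>\<zeta>. ?I \<zeta> *\<^sub>R (G \<zeta> * X \<zeta>)) \<in> borel_measurable lborel"
      by (intro borel_measurable_scaleR borel_measurable_indicator borel_measurable_integrable[OF GXi]) auto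
    show "(\<lambda>z. G z * ?b z) \<in> borel_measurable lborel"
      using Ckc_integrable[OF Ckc_mult[OF S G bc]] by auto
  qed
  have sqI: "(cmod (?I \<zeta> *\<^sub>R (G \<zeta> * X \<zeta>)))\<^sup>2 = ?I \<zeta> * (exp (\<phi> \<zeta>) * (cmod (X \<zeta>))\<^sup>2)" for \<zeta>
    using sq[of \<zeta> "X \<zeta>"] by (auto simp: indicator_def)
  have iI: "integrable lborel (\<lambda>\<zeta>. ?I \<zeta> * (exp (\<phi> \<zeta>) * (cmod (X \<zeta>))\<^sup>2))"
    using integrable_mult_indicator[OF _ Xi, of "cball z e"] by simp
  have i: "integrable lborel (\<lambda>\<zeta>. (cmod (?I \<zeta> *\<^sub>R (G \<zeta> * X \<zeta>)))\<^sup>2)" "integrable lborel (\<lambda>z. (cmod (G z * ?b z))\<^sup>2)"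
    unfolding sqI unfolding sq using iI integrable_weighted_square[OF S bc ec] by auto
  have eq: "(?I \<zeta> *\<^sub>R (G \<zeta> * X \<zeta>)) * (G \<zeta> * ?b \<zeta>) = of_real (exp (\<phi> \<zeta>)) * X \<zeta> * ?b \<zeta>" for \<zeta>
    using b0[of \<zeta>] by (cases "\<zeta> \<in> cball z e") (auto simp: GG[symmetric] mult_ac)
  let ?A = "LINT \<zeta>|lborel. ?I \<zeta> * (exp (\<phi> \<zeta>) * (cmod (X \<zeta>))\<^sup>2)"
  let ?B = "LINT \<zeta>|lborel. exp (\<phi> \<zeta>) * (cmod (?b \<zeta>))\<^sup>2"
  let ?W = "cmod (LINT \<zeta>|lborel. of_real (exp (\<phi> \<zeta>)) * X \<zeta> * ?b \<zeta>)"
  have W: "?W \<le> sqrt ?A * sqrt ?B"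
    using Cauchy_Schwarz_integral(3)[OF m i] unfolding eq sqI unfolding sq .
  have A0: "?A \<ge> 0" and B0: "?B \<ge> 0" by simp_all
  have B: "?B \<le> M\<^sup>2 * pi * exp 1 / e\<^sup>2 * exp (\<phi> z)"
  proof -
    have "?B \<le> (LINT \<zeta>|lborel. (exp (\<phi> z + 1) * (M / e\<^sup>2)\<^sup>2) * ?I \<zeta>)"
    proof (rule integral_mono)
      show "integrable lborel (\<lambda>\<zeta>. exp (\<phi> \<zeta>) * (cmod (?b \<zeta>))\<^sup>2)" by (rule integrable_weighted_square[OF S bc ec])
      show "integrable lborel (\<lambda>\<zeta>. (exp (\<phi> z + 1) * (M / e\<^sup>2)\<^sup>2) * ?I \<zeta>)"
        using emeasure_cball_complex[of e z] e(1)
        by (intro integrable_mult_right integrable_real_indicator) auto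
      fix \<zeta>
      show "exp (\<phi> \<zeta>) * (cmod (?b \<zeta>))\<^sup>2 \<le> exp (\<phi> z + 1) * (M / e\<^sup>2)\<^sup>2 * ?I \<zeta>"
      proof (cases "\<zeta> \<in> cball z e")
        case True
        have "exp (\<phi> \<zeta>) * (cmod (?b \<zeta>))\<^sup>2 \<le> exp (\<phi> z + 1) * (M / e\<^sup>2)\<^sup>2"
          using M(2)[of \<zeta>] True e(3)[OF True] by (intro mult_mono power_mono) auto
        then show ?thesis using True by simp
      qed (simp add: b0)
    qed
    also have "\<dots> = (exp (\<phi> z + 1) * (M / e\<^sup>2)\<^sup>2) * (pi * e\<^sup>2)"
      using emeasure_cball_complex[of e z] e(1) by (simp add: measure_def)
    also have "\<dots> = M\<^sup>2 * pi * exp 1 / e\<^sup>2 * exp (\<phi> z)"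
      using e(1) by (simp add: exp_add power2_eq_square field_simps)
    finally show ?thesis .
  qed
  have "?W\<^sup>2 \<le> (sqrt ?A * sqrt ?B)\<^sup>2" using W by (intro power_mono) auto
  also have "\<dots> = ?A * ?B" using A0 B0 by (simp add: power_mult_distrib)
  also have "\<dots> \<le> ?A * (M\<^sup>2 * pi * exp 1 / e\<^sup>2 * exp (\<phi> z))" using B A0 by (rule mult_left_mono)
  finally have "?W\<^sup>2 * exp (- \<phi> z) \<le> ?A * (M\<^sup>2 * pi * exp 1 / e\<^sup>2 * exp (\<phi> z)) * exp (- \<phi> z)"
    by (rule mult_right_mono) simp
  also have "\<dots> = (M\<^sup>2 * pi * exp 1 / e\<^sup>2) * ?A" by (simp add: exp_minus field_simps)
  finally have "ennreal (?W\<^sup>2 * exp (- \<phi> z)) \<le> ennreal ((M\<^sup>2 * pi * exp 1 / e\<^sup>2) * ?A)" by (rule ennreal_leI)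
  also have "\<dots> = ennreal (M\<^sup>2 * pi * exp 1 / e\<^sup>2) * ennreal ?A" by (rule ennreal_mult) (use A0 in auto)
  also have "ennreal ?A = (\<integral>\<^sup>+\<zeta>. ennreal (?I \<zeta> * (exp (\<phi> \<zeta>) * (cmod (X \<zeta>))\<^sup>2)) \<partial>lborel)"
    by (rule nn_integral_eq_integral[OF iI, symmetric]) (simp add: AE_I2)
  also have "\<dots> = (\<integral>\<^sup>+\<zeta>. (if dist z \<zeta> \<le> e then ennreal (exp (\<phi> \<zeta>) * (cmod (X \<zeta>))\<^sup>2) else 0) \<partial>lborel)"
    by (intro nn_integral_cong) (simp add: indicator_def)
  finally show ?thesis .
qed

text \<open>Tonelli: each \<zeta> is counted on a disc of area pi e^2. This area cancels the 1/e^2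
  of the pairing bound, which is why the global constant does not depend on the averaging
  radius.\<close>

lemma nn_integral_average:
  fixes p :: "complex \<Rightarrow> ennreal"
  assumes [measurable]: "p \<in> borel_measurable borel" and e: "e > 0"
  shows "(\<integral>\<^sup>+z. (\<integral>\<^sup>+\<zeta>. (if dist z \<zeta> \<le> e then p \<zeta> else 0) \<partial>lborel) \<partial>lborel) = ennreal (pi * e\<^sup>2) * (\<integral>\<^sup>+\<zeta>. p \<zeta> \<partial>lborel)"
    and "(\<lambda>z. \<integral>\<^sup>+\<zeta>. (if dist z \<zeta> \<le> e then p \<zeta> else 0) \<partial>lborel) \<in> borel_measurable lborel"
proof -
  have m: "(\<lambda>(z, \<zeta>). if dist z \<zeta> \<le> e then p \<zeta> else 0) \<in> borel_measurable (lborel \<Otimes>\<^sub>M lborel)"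
    by measurable
  show "(\<lambda>z. \<integral>\<^sup>+\<zeta>. (if dist z \<zeta> \<le> e then p \<zeta> else 0) \<partial>lborel) \<in> borel_measurable lborel"
    using lborel.borel_measurable_nn_integral_fst[OF m] by simp
  have "(\<integral>\<^sup>+z. (\<integral>\<^sup>+\<zeta>. (if dist z \<zeta> \<le> e then p \<zeta> else 0) \<partial>lborel) \<partial>lborel)
     = (\<integral>\<^sup>+\<zeta>. (\<integral>\<^sup>+z. (if dist z \<zeta> \<le> e then p \<zeta> else 0) \<partial>lborel) \<partial>lborel)"
    using lborel_pair.Fubini'[OF m] by simp
  also have "\<dots> = (\<integral>\<^sup>+\<zeta>. ennreal (pi * e\<^sup>2) * p \<zeta> \<partial>lborel)"
  proof (rule nn_integral_cong)
    fix \<zeta>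
    have "(\<integral>\<^sup>+z. (if dist z \<zeta> \<le> e then p \<zeta> else 0) \<partial>lborel) = (\<integral>\<^sup>+z. p \<zeta> * indicator (cball \<zeta> e) z \<partial>lborel)"
      by (intro nn_integral_cong) (simp add: indicator_def dist_commute)
    also have "\<dots> = p \<zeta> * emeasure lborel (cball \<zeta> e)" by (rule nn_integral_cmult_indicator) simp
    finally show "(\<integral>\<^sup>+z. (if dist z \<zeta> \<le> e then p \<zeta> else 0) \<partial>lborel) = ennreal (pi * e\<^sup>2) * p \<zeta>"
      using e by (simp add: emeasure_cball_complex mult.commute)
  qed
  also have "\<dots> = ennreal (pi * e\<^sup>2) * (\<integral>\<^sup>+\<zeta>. p \<zeta> \<partial>lborel)" by (simp add: nn_integral_cmult)
  finally show "(\<integral>\<^sup>+z. (\<integral>\<^sup>+\<zeta>. (if dist z \<zeta> \<le> e then p \<zeta> else 0) \<partial>lborel) \<partial>lborel) = ennreal (pi * e\<^sup>2) * (\<integral>\<^sup>+\<zeta>. p \<zeta> \<partial>lborel)" .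
qed

text \<open>Although the kernels are not nonnegative, they have L^1 norm at most M pi and integrate
  constants to -pi; continuity of k at z then suffices.\<close>

lemma bkernel_approximate_identity:
  assumes M: "M > 0" "\<And>z e \<zeta>. e > 0 \<Longrightarrow> cmod (bkernel z e z \<zeta>) \<le> M / e\<^sup>2 * indicator (cball z e) \<zeta>"
    and S: "open S" "z \<in> S" and k: "Ckc 0 S k" and e: "\<And>j. e j > 0" "e \<longlonglongrightarrow> 0"
  shows "(\<lambda>j. LINT \<zeta>|lborel. k \<zeta> * bkernel z (e j) z \<zeta>) \<longlonglongrightarrow> - of_real pi * k z"
proof (rule LIMSEQ_I)
  fix \<epsilon> :: real assume \<epsilon>: "\<epsilon> > 0"
  have "isCont k z" using Ckc_continuous[OF k, of UNIV] by (simp add: continuous_on_eq_continuous_at)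
  then obtain d where d: "d > 0" "\<And>\<zeta>. dist \<zeta> z < d \<Longrightarrow> dist (k \<zeta>) (k z) < \<epsilon> / (2 * M * pi)"
    unfolding continuous_at_eps_delta using \<epsilon> M(1) by (metis divide_pos_pos mult_pos_pos pi_gt_zero zero_less_numeral)
  obtain N where N: "\<And>j. j \<ge> N \<Longrightarrow> e j < d"
    using order_tendstoD(2)[OF e(2) d(1)] by (auto simp: eventually_sequentially)
  have "cmod ((LINT \<zeta>|lborel. k \<zeta> * bkernel z (e j) z \<zeta>) - (- of_real pi * k z)) < \<epsilon>" if j: "j \<ge> N" for j
  proof -
    let ?b = "bkernel z (e j) z" and ?B = "cball z (e j)"
    have bc: "Ckc 0 UNIV ?b" by (rule Ckc_bkernel[OF e(1)]) simp
    have "bianalytic_on (\<lambda>_. k z) (ball z (e j + 1))"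
      by (rule bianalytic_onI[of "\<lambda>_. k z" _ "\<lambda>_. 0"]) auto
    then have 1: "(LINT \<zeta>|lborel. k z * ?b \<zeta>) = - of_real pi * k z"
      by (intro bkernel_reproducing[OF e(1)]) auto
    have i: "integrable lborel (\<lambda>\<zeta>. k \<zeta> * ?b \<zeta>)" "integrable lborel (\<lambda>\<zeta>. k z * ?b \<zeta>)"
      by (intro Ckc_integrable[of 0 UNIV] Ckc_mult open_UNIV bc Ckc_Ck_on[OF k] Ck_on_const)+
    have "(LINT \<zeta>|lborel. k \<zeta> * ?b \<zeta>) - (- of_real pi * k z) = (LINT \<zeta>|lborel. (k \<zeta> - k z) * ?b \<zeta>)"
      using i unfolding 1[symmetric] by (simp add: left_diff_distrib)
    also have "cmod \<dots> \<le> (LINT \<zeta>|lborel. (\<epsilon> / (2 * M * pi) * (M / (e j)\<^sup>2)) * indicator ?B \<zeta>)"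
    proof (rule Bochner_Integration.integral_norm_bound_integral)
      show "integrable lborel (\<lambda>\<zeta>. (k \<zeta> - k z) * ?b \<zeta>)" using i by (simp add: left_diff_distrib)
      show "integrable lborel (\<lambda>\<zeta>. (\<epsilon> / (2 * M * pi) * (M / (e j)\<^sup>2)) * indicator ?B \<zeta>)"
        using emeasure_cball_complex[of "e j" z] e(1)[of j]
        by (intro integrable_mult_right integrable_real_indicator) auto
      fix \<zeta>
      show "norm ((k \<zeta> - k z) * ?b \<zeta>) \<le> (\<epsilon> / (2 * M * pi) * (M / (e j)\<^sup>2)) * indicator ?B \<zeta>"
      proof (cases "\<zeta> \<in> ?B")
        case True
        then have "dist (k \<zeta>) (k z) < \<epsilon> / (2 * M * pi)"
          using N[OF j] by (intro d(2)) (auto simp: dist_commute)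
        then have "norm (k \<zeta> - k z) * norm (?b \<zeta>) \<le> \<epsilon> / (2 * M * pi) * (M / (e j)\<^sup>2)"
          using M(2)[OF e(1), of z j \<zeta>] True \<epsilon> M(1) by (intro mult_mono) (auto simp: dist_norm)
        then show ?thesis using True by (simp add: norm_mult)
      next
        case False
        then show ?thesis using M(2)[OF e(1), of z j \<zeta>] by simp
      qed
    qed
    also have "\<dots> = (\<epsilon> / (2 * M * pi) * (M / (e j)\<^sup>2)) * (pi * (e j)\<^sup>2)"
      using emeasure_cball_complex[of "e j" z] e(1)[of j] by (simp add: measure_def)
    also have "\<dots> = \<epsilon> / 2" using M(1) e(1)[of j] by (simp add: field_simps)
    finally show ?thesis using \<epsilon> by simp
  qed
  then show "\<exists>N. \<forall>j\<ge>N. norm ((LINT \<zeta>|lborel. k \<zeta> * bkernel z (e j) z \<zeta>) - (- of_real pi * k z)) < \<epsilon>" by auto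
qed

text \<open>The minimal element is reached by a sequence \<open>F n\<close> that is almost orthogonal to all \<open>e\<^sup>\<phi>\<close>-multiples of conjugated d-bar-squared
  derivatives of test functions; pairing \<open>F n\<close> with the kernels \<open>bkernel\<close> gives a limit that does not depend on the cutoff
  and is bianalytic, which replaces Weyl's lemma.\<close>

lemma weighted_bianalytic_approximation:
  "\<exists>M>0. \<forall>S (\<phi> :: complex \<Rightarrow> real) k c. open S \<longrightarrow> continuous_on S \<phi> \<longrightarrow> Ckc 0 S k \<longrightarrow> c \<ge> 0 \<longrightarrow>
    (\<forall>\<psi>. Ckc 3 S \<psi> \<longrightarrow> cmod (LINT z|lborel. k z * dbar (dbar \<psi>) z) \<le> c * sqrt (wnorm2 \<phi> \<psi>)) \<longrightarrow>
    (\<exists>U. bianalytic_on U S \<and>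
      (\<integral>\<^sup>+z. ennreal ((cmod (U z - k z))\<^sup>2 * exp (- \<phi> z)) * indicator S z \<partial>lborel) \<le> ennreal (M * c\<^sup>2))"
proof -
  obtain M0 where M0: "M0 > 0" "\<And>z e \<zeta>. e > 0 \<Longrightarrow> cmod (bkernel z e z \<zeta>) \<le> M0 / e\<^sup>2 * indicator (cball z e) \<zeta>"
    using bkernel_center_bound by blast
  \<comment> \<open>Product of the pairing constant M0^2 pi exp 1 / e^2, the factor 1/pi^2 from the
    normalisation of U, and the disc area pi e^2.\<close>
  define M where "M = M0\<^sup>2 * exp 1"
  have "\<exists>U. bianalytic_on U S \<and>
      (\<integral>\<^sup>+z. ennreal ((cmod (U z - k z))\<^sup>2 * exp (- \<phi> z)) * indicator S z \<partial>lborel) \<le> ennreal (M * c\<^sup>2)"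
    if S: "open S" and \<phi>: "continuous_on S \<phi>" and k: "Ckc 0 S k" and c: "c \<ge> 0"
      and bd: "\<And>\<psi>. Ckc 3 S \<psi> \<Longrightarrow> cmod (LINT z|lborel. k z * dbar (dbar \<psi>) z) \<le> c * sqrt (wnorm2 \<phi> \<psi>)"
    for S k c and \<phi> :: "complex \<Rightarrow> real"
  proof -
    obtain \<psi> where \<psi>: "\<And>n. Ckc 3 S (\<psi> n)" "\<And>n. sqrt (wnorm2 \<phi> (\<psi> n)) \<le> c + 1 / real (Suc n)"
      "\<And>n \<theta>. Ckc 3 S \<theta> \<Longrightarrow>
       cmod (LINT z|lborel. (k z - of_real (exp (\<phi> z)) * cnj (dbar (dbar (\<psi> n)) z)) * dbar (dbar \<theta>) z)
         \<le> 2 / real (Suc n) * sqrt (wnorm2 \<phi> \<theta>)"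
      using almost_orthogonal_sequence[OF S \<phi> k c bd] by blast
    define E where "E z = complex_of_real (exp (\<phi> z))" for z
    have E: "Ck_on 0 E S" unfolding E_def using \<phi> by (auto intro!: continuous_intros)
    have D: "Ckc 0 S (dbar (dbar \<theta>))" if "Ckc 3 S \<theta>" for \<theta>
      using Ckc_mono[OF Ckc_dbar2, of 1 S \<theta> 0 S] that by (simp add: numeral_3_eq_3)
    define X where "X n z = cnj (dbar (dbar (\<psi> n)) z)" for n z
    have Xc: "Ckc 0 S (X n)" for n unfolding X_def[abs_def] by (intro Ckc_cnj D \<psi>(1))
    have EX: "Ckc 0 S (\<lambda>z. E z * X n z)" for n by (rule Ckc_mult[OF S E Xc])
    define F where "F n z = k z - E z * X n z" for n z
    have Fc: "Ckc 0 S (F n)" for n unfolding F_def[abs_def] by (intro Ckc_diff k EX)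
    have orth: "cmod (LINT z|lborel. F n z * dbar (dbar \<theta>) z) \<le> 2 / real (Suc n) * sqrt (wnorm2 \<phi> \<theta>)" if "Ckc 3 S \<theta>" for n \<theta>
      using \<psi>(3)[OF that, of n] by (simp add: F_def E_def X_def)
    have iF: "integrable lborel (\<lambda>z. F n z * h z)" if "Ckc 0 S h" for n h
      by (intro Ckc_integrable[of 0 S] Ckc_mult S that Ckc_Ck_on[OF Fc])
    have diff: "sqrt (wnorm2 \<phi> (\<lambda>z. \<psi> m z + (-1) * \<psi> n z)) \<le> 2 * (1 / real (Suc n) + 1 / real (Suc m))"
      and FX: "F n z - F m z = E z * cnj (dbar (dbar (\<lambda>z. \<psi> m z + (-1) * \<psi> n z)) z)"
      and dc: "Ckc 3 S (\<lambda>z. \<psi> m z + (-1) * \<psi> n z)" for n m z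
    proof -
      let ?\<delta> = "\<lambda>z. \<psi> m z + (-1) * \<psi> n z"
      have \<psi>3: "Ckc (Suc (Suc 1)) S (\<psi> n)" for n using \<psi>(1)[of n] by (simp add: numeral_3_eq_3)
      show dc: "Ckc 3 S ?\<delta>" by (intro Ckc_add Ckc_mult S \<psi>(1) Ck_on_const)
      have dd: "dbar (dbar ?\<delta>) z = dbar (dbar (\<psi> m)) z + (-1) * dbar (dbar (\<psi> n)) z" for z
        by (rule dbar2_lincomb[OF \<psi>3 \<psi>3])
      show FX: "F n z - F m z = E z * cnj (dbar (dbar ?\<delta>) z)" for z
        unfolding dd by (simp add: F_def X_def algebra_simps)
      have eq: "F n z * dbar (dbar ?\<delta>) z - F m z * dbar (dbar ?\<delta>) z = E z * (cnj (dbar (dbar ?\<delta>) z) * dbar (dbar ?\<delta>) z)" for z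
        unfolding left_diff_distrib[symmetric] FX by (simp add: mult.assoc)
      \<comment> \<open>The difference of two residuals is exp(\<phi>) times the conjugate of dbar^2
        \<delta>. Testing the near-orthogonality of both against \<delta> itself returns the norm of
        \<delta>, which makes the sequence Cauchy.\<close>
      have "complex_of_real (wnorm2 \<phi> ?\<delta>) = (LINT z|lborel. F n z * dbar (dbar ?\<delta>) z) - (LINT z|lborel. F m z * dbar (dbar ?\<delta>) z)"
        using Bochner_Integration.integral_diff[OF iF[OF D[OF dc]] iF[OF D[OF dc]], of n m] unfolding eq wnorm2_complex E_def by simp
      then have "cmod (complex_of_real (wnorm2 \<phi> ?\<delta>)) \<le> cmod (LINT z|lborel. F n z * dbar (dbar ?\<delta>) z) + cmod (LINT z|lborel. F m z * dbar (dbar ?\<delta>) z)"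
        by (simp only: norm_triangle_ineq4)
      also have "\<dots> \<le> 2 / real (Suc n) * sqrt (wnorm2 \<phi> ?\<delta>) + 2 / real (Suc m) * sqrt (wnorm2 \<phi> ?\<delta>)"
        by (intro add_mono orth dc)
      finally have le: "wnorm2 \<phi> ?\<delta> \<le> (2 * (1 / real (Suc n) + 1 / real (Suc m))) * sqrt (wnorm2 \<phi> ?\<delta>)"
        using wnorm2_nonneg[of \<phi> ?\<delta>] by (simp add: algebra_simps)
      show "sqrt (wnorm2 \<phi> ?\<delta>) \<le> 2 * (1 / real (Suc n) + 1 / real (Suc m))"
      proof (cases "wnorm2 \<phi> ?\<delta> = 0")
        case False
        then have p: "sqrt (wnorm2 \<phi> ?\<delta>) > 0" using wnorm2_nonneg[of \<phi> ?\<delta>] by simp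
        have "sqrt (wnorm2 \<phi> ?\<delta>) * sqrt (wnorm2 \<phi> ?\<delta>) \<le> (2 * (1 / real (Suc n) + 1 / real (Suc m))) * sqrt (wnorm2 \<phi> ?\<delta>)"
          using le wnorm2_nonneg[of \<phi> ?\<delta>] by simp
        then show ?thesis using p mult_right_le_imp_le by blast
      qed simp
    qed
    have Cauchy: "\<exists>K\<ge>0. \<forall>n m. (LINT z|lborel. cmod ((F n z - F m z) * h z)) \<le> K * (1 / real (Suc n) + 1 / real (Suc m))"
      if h: "Ckc 0 S h" for h
    proof (intro exI conjI allI)
      let ?H = "sqrt (LINT z|lborel. exp (\<phi> z) * (cmod (h z))\<^sup>2)"
      show "0 \<le> 2 * ?H" by simp
      fix n m
      let ?\<delta> = "\<lambda>z. \<psi> m z + (-1) * \<psi> n z"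
      have "(LINT z|lborel. cmod ((F n z - F m z) * h z)) \<le> sqrt (wnorm2 \<phi> ?\<delta>) * ?H"
        using weighted_Cauchy_Schwarz[OF S \<phi> Ckc_cnj[OF D[OF dc[of m n]]] h]
        unfolding FX by (simp add: wnorm2_def E_def)
      also have "\<dots> \<le> (2 * (1 / real (Suc n) + 1 / real (Suc m))) * ?H"
        by (intro mult_right_mono diff) simp
      also have "\<dots> = 2 * ?H * (1 / real (Suc n) + 1 / real (Suc m))" by (simp only: mult_ac)
      finally show "(LINT z|lborel. cmod ((F n z - F m z) * h z)) \<le> 2 * ?H * (1 / real (Suc n) + 1 / real (Suc m))" .
    qed
    note local = bkernel_limit_bianalytic[OF S _ _ Fc Cauchy]
    \<comment> \<open>A kernel with fixed centre a depends on z in a bianalytic way on the smaller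
      disc; a kernel centred at z allows local averaging. They differ by dbar^2 of a test function,
      against which the residuals tend to 0, so both limits agree.\<close>
    have indep: "(\<lambda>n. LINT \<zeta>|lborel. F n \<zeta> * bkernel z e z \<zeta>) \<longlonglongrightarrow> L"
      if r: "r > 0" "cball a r \<subseteq> S" and z: "z \<in> ball a (r / 2)" and e: "e > 0" "cball z e \<subseteq> S"
        and lim: "(\<lambda>n. LINT \<zeta>|lborel. F n \<zeta> * bkernel a r z \<zeta>) \<longlonglongrightarrow> L" for a r z e L
    proof -
      obtain \<sigma> where \<sigma>: "Ckc 3 S \<sigma>" "\<And>\<zeta>. dbar (dbar \<sigma>) \<zeta> = bkernel a r z \<zeta> - bkernel z e z \<zeta>"
        using bkernel_difference[OF r(2) e(2) r(1) e(1) z] by blast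
      have eq: "(LINT \<zeta>|lborel. F n \<zeta> * bkernel a r z \<zeta>) - (LINT \<zeta>|lborel. F n \<zeta> * dbar (dbar \<sigma>) \<zeta>) = (LINT \<zeta>|lborel. F n \<zeta> * bkernel z e z \<zeta>)" for n
      proof -
        have "(LINT \<zeta>|lborel. F n \<zeta> * bkernel a r z \<zeta>) = (LINT \<zeta>|lborel. F n \<zeta> * bkernel z e z \<zeta> + F n \<zeta> * dbar (dbar \<sigma>) \<zeta>)"
          unfolding \<sigma>(2) by (simp add: algebra_simps)
        also have "\<dots> = (LINT \<zeta>|lborel. F n \<zeta> * bkernel z e z \<zeta>) + (LINT \<zeta>|lborel. F n \<zeta> * dbar (dbar \<sigma>) \<zeta>)"
          by (intro Bochner_Integration.integral_add iF Ckc_bkernel e D \<sigma>(1))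
        finally show ?thesis by simp
      qed
      have "(\<lambda>n. LINT \<zeta>|lborel. F n \<zeta> * dbar (dbar \<sigma>) \<zeta>) \<longlonglongrightarrow> 0"
      proof (rule Lim_null_comparison[OF always_eventually])
        show "\<forall>n. norm (LINT \<zeta>|lborel. F n \<zeta> * dbar (dbar \<sigma>) \<zeta>) \<le> 2 / real (Suc n) * sqrt (wnorm2 \<phi> \<sigma>)"
          using orth[OF \<sigma>(1)] by blast
        have "(\<lambda>n. 2 / real (Suc n)) \<longlonglongrightarrow> 0" by real_asymp
        then show "(\<lambda>n. 2 / real (Suc n) * sqrt (wnorm2 \<phi> \<sigma>)) \<longlonglongrightarrow> 0" by (rule tendsto_mult_left_zero)
      qed
      from tendsto_diff[OF lim this] show ?thesis unfolding eq by simp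
    qed
    have "\<exists>L. \<forall>e>0. cball z e \<subseteq> S \<longrightarrow> (\<lambda>n. LINT \<zeta>|lborel. F n \<zeta> * bkernel z e z \<zeta>) \<longlonglongrightarrow> L" if z: "z \<in> S" for z
    proof -
      obtain r where r: "r > 0" "cball z r \<subseteq> S" using S z open_contains_cball by blast
      have zb: "z \<in> ball z (r / 2)" using r by simp
      obtain u where "(\<lambda>n. LINT \<zeta>|lborel. F n \<zeta> * bkernel z r z \<zeta>) \<longlonglongrightarrow> u z" using local[OF r] zb by blast
      then show ?thesis using indep[OF r zb] by blast
    qed
    then obtain l where l: "\<And>z e. z \<in> S \<Longrightarrow> e > 0 \<Longrightarrow> cball z e \<subseteq> S \<Longrightarrow> (\<lambda>n. LINT \<zeta>|lborel. F n \<zeta> * bkernel z e z \<zeta>) \<longlonglongrightarrow> l z"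
      by metis
    \<comment> \<open>The factor -1/pi inverts the normalisation in
      \<open>bkernel_reproducing\<close>.\<close>
    define U where "U z = - (1 / of_real pi) * l z" for z
    have U: "bianalytic_on U S"
    proof (rule bianalytic_on_local)
      fix a assume a: "a \<in> S"
      obtain r where r: "r > 0" "cball a r \<subseteq> S" using S a open_contains_cball by blast
      obtain u where u: "bianalytic_on u (ball a (r / 2))"
        "\<And>z. z \<in> ball a (r / 2) \<Longrightarrow> (\<lambda>n. LINT \<zeta>|lborel. F n \<zeta> * bkernel a r z \<zeta>) \<longlonglongrightarrow> u z"
        using local[OF r] by blast
      have "l z = u z" if z: "z \<in> ball a (r / 2)" for z
      proof -
        have "z \<in> S" using z r by (auto simp: subset_eq)
        moreover obtain e where e: "e > 0" "cball z e \<subseteq> S" using S \<open>z \<in> S\<close> open_contains_cball by blast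
        ultimately show ?thesis using l[of z e] indep[OF r z e u(2)[OF z]] LIMSEQ_unique by blast
      qed
      then have "bianalytic_on U (ball a (r / 2))"
        by (intro bianalytic_on_cmult_cong[OF u(1) open_ball, of U "- (1 / of_real pi)"]) (simp add: U_def)
      then show "\<exists>T. open T \<and> a \<in> T \<and> bianalytic_on U T" using r(1) by (intro exI[of _ "ball a (r / 2)"]) auto
    qed
    obtain C :: "nat \<Rightarrow> complex set" where C: "\<And>j. compact (C j)" "\<And>j. C j \<subseteq> S" "\<And>z. z \<in> S \<Longrightarrow> \<exists>N. \<forall>j\<ge>N. z \<in> C j"
      using compact_exhaustion[OF S] by metis
    have "\<exists>e>0. e < 1 / real (Suc j) \<and> (\<forall>z\<in>C j. cball z e \<subseteq> S \<and> (\<forall>\<zeta>\<in>cball z e. \<phi> \<zeta> \<le> \<phi> z + 1))" for j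
      by (rule compact_uniform_radius[OF S \<phi> C(1,2)]) simp
    then obtain e where e: "\<And>j. e j > 0" "\<And>j. e j < 1 / real (Suc j)" "\<And>j z. z \<in> C j \<Longrightarrow> cball z (e j) \<subseteq> S"
      "\<And>j z \<zeta>. z \<in> C j \<Longrightarrow> \<zeta> \<in> cball z (e j) \<Longrightarrow> \<phi> \<zeta> \<le> \<phi> z + 1" by metis
    have e0: "e \<longlonglongrightarrow> 0"
    proof (rule tendsto_sandwich[of "\<lambda>_. 0" e _ "\<lambda>j. 1 / real (Suc j)"])
      show "(\<lambda>j. 1 / real (Suc j)) \<longlonglongrightarrow> 0" by real_asymp
      show "\<forall>\<^sub>F j in sequentially. 0 \<le> e j" using e(1) by (simp add: less_imp_le)
      show "\<forall>\<^sub>F j in sequentially. e j \<le> 1 / real (Suc j)" using e(2) less_imp_le by (intro always_eventually) blast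
    qed auto
    \<comment> \<open>This is k smoothed at scale \<open>e j\<close>. For z in \<open>C j\<close>
      the difference of U and \<open>kh j\<close> is the limit over n of averages of exp(\<phi>)
      \<open>X n\<close>, so it is controlled by the norms of \<psi> n.\<close>
    define kh where "kh j z = - (1 / of_real pi) * (LINT \<zeta>|lborel. k \<zeta> * bkernel z (e j) z \<zeta>)" for j z
    define p where "p n \<zeta> = ennreal (exp (\<phi> \<zeta>) * (cmod (X n \<zeta>))\<^sup>2)" for n \<zeta>
    have pi': "integrable lborel (\<lambda>\<zeta>. exp (\<phi> \<zeta>) * (cmod (X n \<zeta>))\<^sup>2)" for n
      by (rule integrable_weighted_square[OF S Xc]) (intro continuous_intros \<phi>)
    have pm: "p n \<in> borel_measurable borel" for n
      unfolding p_def[abs_def] using borel_measurable_integrable[OF pi'] by simp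
    have pint: "(\<integral>\<^sup>+\<zeta>. p n \<zeta> \<partial>lborel) \<le> ennreal ((c + 1 / real (Suc n))\<^sup>2)" for n
    proof -
      have "(\<integral>\<^sup>+\<zeta>. p n \<zeta> \<partial>lborel) = ennreal (wnorm2 \<phi> (\<psi> n))"
        unfolding p_def using nn_integral_eq_integral[OF pi'] by (simp add: wnorm2_def X_def)
      also have "wnorm2 \<phi> (\<psi> n) = (sqrt (wnorm2 \<phi> (\<psi> n)))\<^sup>2" using wnorm2_nonneg by simp
      also have "\<dots> \<le> (c + 1 / real (Suc n))\<^sup>2" using \<psi>(2) wnorm2_nonneg by (intro power_mono) auto
      finally show ?thesis by (simp add: ennreal_leI)
    qed
    define v where "v j n z = ennreal (M / (pi * (e j)\<^sup>2)) * (\<integral>\<^sup>+\<zeta>. (if dist z \<zeta> \<le> e j then p n \<zeta> else 0) \<partial>lborel)" for j n z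
    have vm: "v j n \<in> borel_measurable lborel" for j n
      unfolding v_def[abs_def] using nn_integral_average(2)[OF pm e(1)] by (intro borel_measurable_times_ennreal) auto
    have M: "M > 0" using M0 by (simp add: M_def)
    have vint: "(\<integral>\<^sup>+z. v j n z \<partial>lborel) \<le> ennreal (M * (c + 1 / real (Suc n))\<^sup>2)" for j n
    proof -
      have "(\<integral>\<^sup>+z. v j n z \<partial>lborel) = ennreal (M / (pi * (e j)\<^sup>2)) * (ennreal (pi * (e j)\<^sup>2) * (\<integral>\<^sup>+\<zeta>. p n \<zeta> \<partial>lborel))"
        unfolding v_def nn_integral_average(1)[OF pm e(1), symmetric]
        by (rule nn_integral_cmult) (rule nn_integral_average(2)[OF pm e(1)])
      also have "\<dots> = ennreal M * (\<integral>\<^sup>+\<zeta>. p n \<zeta> \<partial>lborel)"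
        using M e(1)[of j] by (simp add: mult.assoc[symmetric] ennreal_mult[symmetric])
      also have "\<dots> \<le> ennreal M * ennreal ((c + 1 / real (Suc n))\<^sup>2)" by (intro mult_left_mono pint) simp
      finally show ?thesis using M by (simp add: ennreal_mult)
    qed
    \<comment> \<open>Fatou is used twice: over n at a fixed smoothing radius, which gives the bound
      by M c^2, and then over j, when the radii shrink and the sets \<open>C j\<close> exhaust
      S.\<close>
    define w where "w j z = liminf (\<lambda>n. v j n z)" for j z
    have wm: "w j \<in> borel_measurable lborel" for j
      unfolding w_def[abs_def] using vm by (intro borel_measurable_liminf)
    have wint: "(\<integral>\<^sup>+z. w j z \<partial>lborel) \<le> ennreal (M * c\<^sup>2)" for j
    proof -
      have "(\<integral>\<^sup>+z. w j z \<partial>lborel) \<le> liminf (\<lambda>n. \<integral>\<^sup>+z. v j n z \<partial>lborel)"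
        unfolding w_def by (rule nn_integral_liminf[OF vm])
      also have "\<dots> \<le> liminf (\<lambda>n. ennreal (M * (c + 1 / real (Suc n))\<^sup>2))"
        by (intro Liminf_mono always_eventually allI vint)
      also have "\<dots> = ennreal (M * c\<^sup>2)"
      proof (rule lim_imp_Liminf)
        have "(\<lambda>n. M * (c + 1 / real (Suc n))\<^sup>2) \<longlonglongrightarrow> M * (c + 0)\<^sup>2"
          by (intro tendsto_intros) real_asymp
        then show "(\<lambda>n. ennreal (M * (c + 1 / real (Suc n))\<^sup>2)) \<longlonglongrightarrow> ennreal (M * c\<^sup>2)"
          by (intro tendsto_ennrealI) simp
      qed simp
      finally show ?thesis .
    qed
    have Uw: "ennreal ((cmod (U z - kh j z))\<^sup>2 * exp (- \<phi> z)) \<le> w j z" if z: "z \<in> C j" for j z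
    proof -
      have zS: "z \<in> S" using z C(2) by blast
      let ?b = "bkernel z (e j) z"
      have bc: "Ckc 0 S ?b" by (rule Ckc_bkernel[OF e(1) e(3)[OF z]])
      define T where "T n = (LINT \<zeta>|lborel. E \<zeta> * X n \<zeta> * ?b \<zeta>)" for n
      have T: "(LINT \<zeta>|lborel. F n \<zeta> * ?b \<zeta>) = (LINT \<zeta>|lborel. k \<zeta> * ?b \<zeta>) - T n" for n
      proof -
        have "integrable lborel (\<lambda>\<zeta>. k \<zeta> * ?b \<zeta>)" "integrable lborel (\<lambda>\<zeta>. E \<zeta> * X n \<zeta> * ?b \<zeta>)"
          by (intro Ckc_integrable[of 0 S] Ckc_mult S bc Ckc_Ck_on[OF k] Ckc_Ck_on[OF EX])+
        then show ?thesis by (simp add: F_def T_def left_diff_distrib)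
      qed
      have "(\<lambda>n. LINT \<zeta>|lborel. F n \<zeta> * ?b \<zeta>) \<longlonglongrightarrow> l z" by (rule l[OF zS e(1) e(3)[OF z]])
      then have "(\<lambda>n. (1 / of_real pi) * ((LINT \<zeta>|lborel. k \<zeta> * ?b \<zeta>) - (LINT \<zeta>|lborel. F n \<zeta> * ?b \<zeta>))) \<longlonglongrightarrow> (1 / of_real pi) * ((LINT \<zeta>|lborel. k \<zeta> * ?b \<zeta>) - l z)"
        by (intro tendsto_intros)
      then have "(\<lambda>n. (1 / of_real pi) * T n) \<longlonglongrightarrow> U z - kh j z"
        unfolding T by (simp add: U_def kh_def algebra_simps)
      then have "(\<lambda>n. ennreal ((cmod ((1 / of_real pi) * T n))\<^sup>2 * exp (- \<phi> z))) \<longlonglongrightarrow> ennreal ((cmod (U z - kh j z))\<^sup>2 * exp (- \<phi> z))"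
        by (intro tendsto_ennrealI tendsto_intros)
      then have "ennreal ((cmod (U z - kh j z))\<^sup>2 * exp (- \<phi> z)) = liminf (\<lambda>n. ennreal ((cmod ((1 / of_real pi) * T n))\<^sup>2 * exp (- \<phi> z)))"
        by (rule lim_imp_Liminf[OF sequentially_bot, symmetric])
      also have "\<dots> \<le> liminf (\<lambda>n. v j n z)"
      proof (intro Liminf_mono always_eventually allI)
        fix n
        have "ennreal ((cmod ((1 / of_real pi) * T n))\<^sup>2 * exp (- \<phi> z)) = ennreal (1 / pi\<^sup>2) * ennreal ((cmod (T n))\<^sup>2 * exp (- \<phi> z))"
          by (simp add: ennreal_mult[symmetric] norm_divide power_divide)
        also have "\<dots> \<le> ennreal (1 / pi\<^sup>2) * (ennreal (M0\<^sup>2 * pi * exp 1 / (e j)\<^sup>2) * (\<integral>\<^sup>+\<zeta>. (if dist z \<zeta> \<le> e j then p n \<zeta> else 0) \<partial>lborel))"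
          unfolding T_def E_def p_def
          by (intro mult_left_mono bkernel_pairing_bound[OF M0(1) M0(2)[OF e(1)] S \<phi> Xc e(1) e(3)[OF z] e(4)[OF z]]) auto
        also have "\<dots> = v j n z"
          unfolding v_def M_def using M0 e(1)[of j]
          by (simp add: mult.assoc[symmetric] ennreal_mult[symmetric]) (simp add: power2_eq_square mult_ac)
        finally show "ennreal ((cmod ((1 / of_real pi) * T n))\<^sup>2 * exp (- \<phi> z)) \<le> v j n z" .
      qed
      finally show ?thesis by (simp add: w_def)
    qed
    have pw: "ennreal ((cmod (U z - k z))\<^sup>2 * exp (- \<phi> z)) * indicator S z \<le> liminf (\<lambda>j. w j z)" for z
    proof (cases "z \<in> S")
      case True
      have "(\<lambda>j. kh j z) \<longlonglongrightarrow> - (1 / of_real pi) * (- of_real pi * k z)"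
        unfolding kh_def by (intro tendsto_intros bkernel_approximate_identity[OF M0 S True k e(1) e0])
      then have "(\<lambda>j. kh j z) \<longlonglongrightarrow> k z" by simp
      then have "(\<lambda>j. ennreal ((cmod (U z - kh j z))\<^sup>2 * exp (- \<phi> z))) \<longlonglongrightarrow> ennreal ((cmod (U z - k z))\<^sup>2 * exp (- \<phi> z))"
        by (intro tendsto_ennrealI tendsto_intros)
      then have "ennreal ((cmod (U z - k z))\<^sup>2 * exp (- \<phi> z)) = liminf (\<lambda>j. ennreal ((cmod (U z - kh j z))\<^sup>2 * exp (- \<phi> z)))"
        by (rule lim_imp_Liminf[OF sequentially_bot, symmetric])
      also have "\<dots> \<le> liminf (\<lambda>j. w j z)"
      proof (rule Liminf_mono)
        obtain N where "\<forall>j\<ge>N. z \<in> C j" using C(3)[OF True] by blast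
        then show "\<forall>\<^sub>F j in sequentially. ennreal ((cmod (U z - kh j z))\<^sup>2 * exp (- \<phi> z)) \<le> w j z"
          using Uw by (auto simp: eventually_sequentially)
      qed
      finally show ?thesis using True by simp
    qed simp
    have "(\<integral>\<^sup>+z. ennreal ((cmod (U z - k z))\<^sup>2 * exp (- \<phi> z)) * indicator S z \<partial>lborel) \<le> (\<integral>\<^sup>+z. liminf (\<lambda>j. w j z) \<partial>lborel)"
      by (intro nn_integral_mono pw)
    also have "\<dots> \<le> liminf (\<lambda>j. \<integral>\<^sup>+z. w j z \<partial>lborel)" by (rule nn_integral_liminf[OF wm])
    also have "\<dots> \<le> liminf (\<lambda>j::nat. ennreal (M * c\<^sup>2))"
      by (intro Liminf_mono always_eventually allI wint)
    also have "\<dots> = ennreal (M * c\<^sup>2)" by (rule lim_imp_Liminf) auto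
    finally show ?thesis using U by blast
  qed
  moreover have "M > 0" using M0 by (simp add: M_def)
  ultimately show ?thesis by blast
qed

section \<open>Quadratic weights and point bounds\<close>

lemma Ck_on_Lipschitz:
  fixes f :: "complex \<Rightarrow> real"
  assumes S: "open S" and f: "Ck_on (Suc 0) f S" and K: "compact K" "convex K" "K \<subseteq> S"
  shows "\<exists>L\<ge>0. \<forall>x\<in>K. \<forall>y\<in>K. \<bar>f x - f y\<bar> \<le> L * cmod (x - y)"
proof -
  have c: "continuous_on K (pd 1 f)" "continuous_on K (pd \<i> f)"
    using f K(3) by (auto simp: Ck_on_Suc_pd intro: continuous_on_subset)
  have "bounded (pd 1 f ` K)" "bounded (pd \<i> f ` K)"
    by (intro compact_imp_bounded compact_continuous_image c K(1))+
  then obtain B1 B2 where B: "\<And>z. z \<in> K \<Longrightarrow> \<bar>pd 1 f z\<bar> \<le> B1" "\<And>z. z \<in> K \<Longrightarrow> \<bar>pd \<i> f z\<bar> \<le> B2"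
    by (auto simp: bounded_iff)
  let ?L = "max 0 (B1 + B2)"
  have "norm (f x - f y) \<le> ?L * norm (x - y)" if xy: "x \<in> K" "y \<in> K" for x y
  proof (rule differentiable_bound[OF K(2) _ _ xy])
    fix z assume z: "z \<in> K"
    have d: "f differentiable at z" using Ck_on_Suc_differentiable[OF f S] z K(3) by blast
    show "(f has_derivative frechet_derivative f (at z)) (at z within K)"
      using d by (simp add: frechet_derivative_works has_derivative_at_withinI)
    show "onorm (frechet_derivative f (at z)) \<le> ?L"
    proof (rule onorm_le)
      fix h
      have "frechet_derivative f (at z) (Re h *\<^sub>R 1 + Im h *\<^sub>R \<i>) = Re h * pd 1 f z + Im h * pd \<i> f z"
        using linear_frechet_derivative[OF d] by (simp add: linear_add linear_scale pd_def)
      moreover have "Re h *\<^sub>R 1 + Im h *\<^sub>R \<i> = h" by (simp add: complex_eq_iff)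
      ultimately have "\<bar>frechet_derivative f (at z) h\<bar> \<le> \<bar>Re h\<bar> * \<bar>pd 1 f z\<bar> + \<bar>Im h\<bar> * \<bar>pd \<i> f z\<bar>"
        by (metis abs_mult abs_triangle_ineq)
      also have "\<dots> \<le> cmod h * B1 + cmod h * B2"
        using B z by (intro add_mono mult_mono abs_Re_le_cmod abs_Im_le_cmod) auto
      also have "\<dots> \<le> ?L * cmod h" using mult_right_mono[of "B1 + B2" ?L "cmod h"] by (simp add: algebra_simps)
      finally show "norm (frechet_derivative f (at z) h) \<le> ?L * norm h" by simp
    qed
  qed
  then show ?thesis by (intro exI[of _ ?L]) auto
qed

lemma DERIV_along_line:
  fixes f :: "complex \<Rightarrow> real"
  assumes "f differentiable at (w + of_real t * s)"
  shows "((\<lambda>t. f (w + of_real t * s)) has_real_derivative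
     (Re s * pd 1 f (w + of_real t * s) + Im s * pd \<i> f (w + of_real t * s))) (at t)"
proof -
  let ?z = "w + of_real t * s" and ?D = "frechet_derivative f (at (w + of_real t * s))"
  have 1: "((\<lambda>t. w + of_real t * s) has_derivative (\<lambda>h. of_real h * s)) (at t)"
    by (auto intro!: derivative_eq_intros)
  have 2: "(f has_derivative ?D) (at ?z)" using assms by (simp add: frechet_derivative_works)
  have l: "linear ?D" by (rule linear_frechet_derivative[OF assms])
  have "?D (of_real h * s) = (Re s * pd 1 f ?z + Im s * pd \<i> f ?z) * h" for h
  proof -
    have "of_real h * s = (h * Re s) *\<^sub>R 1 + (h * Im s) *\<^sub>R \<i>" by (simp add: complex_eq_iff)
    then have "?D (of_real h * s) = (h * Re s) *\<^sub>R ?D 1 + (h * Im s) *\<^sub>R ?D \<i>"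
      by (simp only: linear_add[OF l] linear_scale[OF l])
    then show ?thesis by (simp add: pd_def algebra_simps)
  qed
  then have "?D \<circ> (\<lambda>h. of_real h * s) = (*) (Re s * pd 1 f ?z + Im s * pd \<i> f ?z)" by (auto simp: o_def)
  then show ?thesis
    using has_derivative_compose[OF 1 2] unfolding has_field_derivative_def by (simp add: o_def)
qed

text \<open>The Hessian form at w splits into the real part of a holomorphic square and \<Delta>Q(w)
  |s|^2. The error has two sources: second derivatives at an intermediate point, of order |s|^3, and
  the replacement of \<Delta>Q(w) by its value at z0, of order |w - z0| |s|^2.\<close>

lemma quadratic_taylor:
  fixes Q :: "complex \<Rightarrow> real"
  assumes S: "open S" and Q: "Ck_on 3 Q S" and z0: "z0 \<in> S"
  shows "\<exists>r>0. \<exists>C>0. cball z0 (2 * r) \<subseteq> S \<and> (\<forall>w\<in>cball z0 r. \<exists>h1 h2. \<forall>s. cmod s \<le> r \<longrightarrow>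
     \<bar>Q (w + s) - Q w - Re (h1 * s + h2 * s\<^sup>2) - qlaplacian Q z0 * (cmod s)\<^sup>2\<bar> \<le> C * (cmod s + cmod (w - z0)) * (cmod s)\<^sup>2)"
proof -
  obtain r' where r': "r' > 0" "cball z0 r' \<subseteq> S" using S z0 open_contains_cball by blast
  define r where "r = r' / 2"
  let ?K = "cball z0 (2 * r)"
  have r: "r > 0" "?K \<subseteq> S" using r' by (auto simp: r_def)
  have Q3: "Ck_on (Suc (Suc (Suc 0))) Q S" using Q by (simp add: numeral_3_eq_3)
  have Q2: "Ck_on (Suc (Suc 0)) (pd v Q) S" if "v \<in> {1,\<i>}" for v
    using Q3 that unfolding Ck_on_Suc_pd[of "Suc (Suc 0)"] by blast
  have Q1: "Ck_on (Suc 0) (pd u (pd v Q)) S" if "u \<in> {1,\<i>}" "v \<in> {1,\<i>}" for u v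
    using Q2[OF that(2)] that(1) unfolding Ck_on_Suc_pd[of "Suc 0"] by blast
  define P where "P u v L \<longleftrightarrow> L \<ge> 0 \<and> (\<forall>x\<in>?K. \<forall>y\<in>?K. \<bar>pd u (pd v Q) x - pd u (pd v Q) y\<bar> \<le> L * cmod (x - y))" for u v L
  define L0 where "L0 u v = (SOME L. P u v L)" for u v
  have P: "P u v (L0 u v)" if "u \<in> {1,\<i>}" "v \<in> {1,\<i>}" for u v
  proof -
    have "\<exists>L. P u v L"
      using Ck_on_Lipschitz[OF S Q1[OF that] compact_cball convex_cball r(2)] unfolding P_def by blast
    then show ?thesis unfolding L0_def by (rule someI_ex)
  qed
  have L0: "L0 u v \<ge> 0" if "u \<in> {1,\<i>}" "v \<in> {1,\<i>}" for u v
    using P[OF that] unfolding P_def by blast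
  have L0': "\<bar>pd u (pd v Q) x - pd u (pd v Q) y\<bar> \<le> L0 u v * cmod (x - y)"
    if "u \<in> {1,\<i>}" "v \<in> {1,\<i>}" "x \<in> ?K" "y \<in> ?K" for u v x y
    using P[OF that(1,2)] that(3,4) unfolding P_def by blast
  note L00 = L0[of 1 1, simplified] L0[of 1 \<i>, simplified] L0[of \<i> 1, simplified] L0[of \<i> \<i>, simplified]
  define L where "L = 1 + (L0 1 1 + L0 1 \<i> + L0 \<i> 1 + L0 \<i> \<i>)"
  have Lpos: "L > 0" using L00 by (simp add: L_def)
  have L: "\<bar>pd u (pd v Q) x - pd u (pd v Q) y\<bar> \<le> L * cmod (x - y)"
    if uv: "u \<in> {1,\<i>}" "v \<in> {1,\<i>}" and xy: "x \<in> ?K" "y \<in> ?K" for u v x y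
  proof -
    have "L0 u v \<le> L"
      using uv L00 by (auto simp: L_def)
    then have "L0 u v * cmod (x - y) \<le> L * cmod (x - y)" by (rule mult_right_mono) simp
    then show ?thesis using L0'[OF uv xy] by linarith
  qed
  have "\<exists>h1 h2. \<forall>s. cmod s \<le> r \<longrightarrow>
     \<bar>Q (w + s) - Q w - Re (h1 * s + h2 * s\<^sup>2) - qlaplacian Q z0 * (cmod s)\<^sup>2\<bar> \<le> L * (cmod s + cmod (w - z0)) * (cmod s)\<^sup>2"
    if w: "w \<in> cball z0 r" for w
  proof (intro exI allI impI)
    \<comment> \<open>h1 is twice dz Q at w and h2 is its second dz derivative, with the mixed
      partial averaged over both orders.\<close>
    let ?h1 = "Complex (pd 1 Q w) (- pd \<i> Q w)"
    let ?h2 = "Complex ((pd 1 (pd 1 Q) w - pd \<i> (pd \<i> Q) w) / 4) (- (pd 1 (pd \<i> Q) w + pd \<i> (pd 1 Q) w) / 4)"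
    fix s assume s: "cmod s \<le> r"
    have wK: "w \<in> ?K" "z0 \<in> ?K" using w r by auto
    have inK: "w + of_real t * s \<in> ?K" if "0 \<le> t" "t \<le> 1" for t
    proof -
      have "cmod (of_real t * s) \<le> r" using that s r by (simp add: norm_mult mult_left_le_one_le order_trans[OF _ s])
      moreover have "cmod (w - z0) \<le> r" using w by (simp add: dist_norm norm_minus_commute)
      ultimately have "cmod ((w - z0) + of_real t * s) \<le> 2 * r" using norm_triangle_ineq[of "w - z0" "of_real t * s"] by linarith
      then show ?thesis by (simp add: dist_norm norm_minus_commute algebra_simps)
    qed
    define a b where "a = Re s" and "b = Im s"
    define H where "H p = a * (a * pd 1 (pd 1 Q) p + b * pd \<i> (pd 1 Q) p) + b * (a * pd 1 (pd \<i> Q) p + b * pd \<i> (pd \<i> Q) p)" for p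
    define diff where "diff n = (if n = 0 then (\<lambda>t. Q (w + of_real t * s))
        else if n = 1 then (\<lambda>t. a * pd 1 Q (w + of_real t * s) + b * pd \<i> Q (w + of_real t * s))
        else (\<lambda>t. H (w + of_real t * s)))" for n :: nat
    have df: "pd v Q differentiable at (w + of_real t * s)" "Q differentiable at (w + of_real t * s)"
      if "0 \<le> t" "t \<le> 1" "v \<in> {1,\<i>}" for t v
      using Ck_on_Suc_differentiable[OF Q2[OF that(3)] S] Ck_on_Suc_differentiable[OF Q3 S] inK[OF that(1,2)] r(2) by blast+
    have "\<exists>t. 0 < t \<and> t < 1 \<and> diff 0 1 = (\<Sum>m<2. diff m 0 / fact m * 1 ^ m) + diff 2 t / fact 2 * 1 ^ 2"
    proof (rule Maclaurin)
      show "\<forall>m t. m < 2 \<and> 0 \<le> t \<and> t \<le> 1 \<longrightarrow> DERIV (diff m) t :> diff (Suc m) t"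
      proof (intro allI impI)
        fix m :: nat and t :: real assume mt: "m < 2 \<and> 0 \<le> t \<and> t \<le> 1"
        show "DERIV (diff m) t :> diff (Suc m) t"
        proof (cases "m = 0")
          case True
          then show ?thesis using DERIV_along_line[OF df(2)[of t 1]] mt by (simp add: diff_def a_def b_def)
        next
          case False
          then have "m = 1" using mt by linarith
          have "((\<lambda>t. a * pd 1 Q (w + of_real t * s) + b * pd \<i> Q (w + of_real t * s)) has_real_derivative H (w + of_real t * s)) (at t)"
            unfolding H_def a_def b_def
            by (intro DERIV_add DERIV_cmult DERIV_along_line df(1)) (use mt in auto)
          then show ?thesis using \<open>m = 1\<close> by (simp add: diff_def)
        qed
      qed
    qed auto
    then obtain t where t: "0 < t" "t < 1" "diff 0 1 = diff 0 0 + diff 1 0 + diff 2 t / 2"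
      by (auto simp: numeral_2_eq_2)
    have T: "Q (w + s) = Q w + (a * pd 1 Q w + b * pd \<i> Q w) + H (w + of_real t * s) / 2"
      using t(3) by (simp add: diff_def)
    have ab: "a\<^sup>2 + b\<^sup>2 = (cmod s)\<^sup>2" by (simp add: cmod_power2 a_def b_def)
    have h: "Re (?h1 * s + ?h2 * s\<^sup>2) = (a * pd 1 Q w + b * pd \<i> Q w)
       + ((pd 1 (pd 1 Q) w - pd \<i> (pd \<i> Q) w) / 4 * (a\<^sup>2 - b\<^sup>2) + (pd 1 (pd \<i> Q) w + pd \<i> (pd 1 Q) w) / 4 * (2 * a * b))"
      by (simp add: a_def b_def power2_eq_square field_simps)
    have Hw: "H w / 2 = ((pd 1 (pd 1 Q) w - pd \<i> (pd \<i> Q) w) / 4 * (a\<^sup>2 - b\<^sup>2) + (pd 1 (pd \<i> Q) w + pd \<i> (pd 1 Q) w) / 4 * (2 * a * b))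
       + qlaplacian Q w * (cmod s)\<^sup>2"
      unfolding ab[symmetric] qlaplacian_pd H_def by (simp add: power2_eq_square field_simps)
    let ?p = "w + of_real t * s"
    have pK: "?p \<in> ?K" using inK t by simp
    have eq: "Q (w + s) - Q w - Re (?h1 * s + ?h2 * s\<^sup>2) - qlaplacian Q z0 * (cmod s)\<^sup>2
      = (H ?p - H w) / 2 + (qlaplacian Q w - qlaplacian Q z0) * (cmod s)\<^sup>2"
    proof -
      have "(H ?p - H w) / 2 + (qlaplacian Q w - qlaplacian Q z0) * (cmod s)\<^sup>2
          = H ?p / 2 - H w / 2 + (qlaplacian Q w * (cmod s)\<^sup>2 - qlaplacian Q z0 * (cmod s)\<^sup>2)"
        by (simp only: left_diff_distrib diff_divide_distrib)
      then show ?thesis using T h Hw by linarith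
    qed
    have ps: "cmod (?p - w) \<le> cmod s" using t by (simp add: norm_mult mult_left_le_one_le)
    have d: "\<bar>pd u (pd v Q) ?p - pd u (pd v Q) w\<bar> \<le> L * cmod s" if "u \<in> {1,\<i>}" "v \<in> {1,\<i>}" for u v
      using L[OF that pK wK(1)] mult_left_mono[OF ps, of L] Lpos by linarith
    have e1: "\<bar>H ?p - H w\<bar> \<le> 2 * (L * cmod s * (cmod s)\<^sup>2)"
    proof -
      have "H ?p - H w = a * a * (pd 1 (pd 1 Q) ?p - pd 1 (pd 1 Q) w) + a * b * (pd \<i> (pd 1 Q) ?p - pd \<i> (pd 1 Q) w)
         + a * b * (pd 1 (pd \<i> Q) ?p - pd 1 (pd \<i> Q) w) + b * b * (pd \<i> (pd \<i> Q) ?p - pd \<i> (pd \<i> Q) w)"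
        by (simp add: H_def algebra_simps)
      also have "\<bar>\<dots>\<bar> \<le> \<bar>a * a\<bar> * (L * cmod s) + \<bar>a * b\<bar> * (L * cmod s) + \<bar>a * b\<bar> * (L * cmod s) + \<bar>b * b\<bar> * (L * cmod s)"
        by (intro order_trans[OF abs_triangle_ineq] add_mono) (auto simp only: abs_mult[of "_ * _"] intro!: mult_left_mono d)
      also have "\<dots> = (a\<^sup>2 + b\<^sup>2 + 2 * \<bar>a * b\<bar>) * (L * cmod s)" by (simp add: power2_eq_square algebra_simps)
      also have "\<dots> \<le> (2 * (a\<^sup>2 + b\<^sup>2)) * (L * cmod s)"
      proof (rule mult_right_mono)
        have "2 * \<bar>a * b\<bar> \<le> a\<^sup>2 + b\<^sup>2" using sum_squares_bound[of "\<bar>a\<bar>" "\<bar>b\<bar>"] by (simp add: abs_mult)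
        then show "a\<^sup>2 + b\<^sup>2 + 2 * \<bar>a * b\<bar> \<le> 2 * (a\<^sup>2 + b\<^sup>2)" by simp
      qed (use Lpos in simp)
      finally show ?thesis unfolding ab by (simp add: mult_ac)
    qed
    have e2: "\<bar>qlaplacian Q w - qlaplacian Q z0\<bar> \<le> L * cmod (w - z0)"
    proof -
      have "\<bar>pd 1 (pd 1 Q) w - pd 1 (pd 1 Q) z0\<bar> \<le> L * cmod (w - z0)" "\<bar>pd \<i> (pd \<i> Q) w - pd \<i> (pd \<i> Q) z0\<bar> \<le> L * cmod (w - z0)"
        by (rule L[OF _ _ wK]; simp)+
      moreover have "0 \<le> L * cmod (w - z0)" using Lpos by simp
      moreover have "\<bar>(p + q) / 4 - (p' + q') / 4\<bar> \<le> l" if "\<bar>p - p'\<bar> \<le> l" "\<bar>q - q'\<bar> \<le> l" "0 \<le> l" for p q p' q' l :: real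
      proof -
        have eq: "(p + q) / 4 - (p' + q') / 4 = ((p - p') + (q - q')) / 4" by (simp add: field_simps)
        have "\<bar>((p - p') + (q - q')) / 4\<bar> = \<bar>(p - p') + (q - q')\<bar> / 4" by simp
        also have "\<dots> \<le> (l + l) / 4"
          by (intro divide_right_mono order_trans[OF abs_triangle_ineq add_mono[OF that(1,2)]]) simp
        also have "\<dots> \<le> l" using that(3) by simp
        finally show ?thesis unfolding eq .
      qed
      ultimately show ?thesis unfolding qlaplacian_pd by blast
    qed
    have "\<bar>(H ?p - H w) / 2 + (qlaplacian Q w - qlaplacian Q z0) * (cmod s)\<^sup>2\<bar>
      \<le> \<bar>H ?p - H w\<bar> / 2 + \<bar>qlaplacian Q w - qlaplacian Q z0\<bar> * (cmod s)\<^sup>2"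
      by (rule order_trans[OF abs_triangle_ineq]) (simp add: abs_mult)
    also have "\<dots> \<le> L * cmod s * (cmod s)\<^sup>2 + L * cmod (w - z0) * (cmod s)\<^sup>2"
      using e1 e2 by (intro add_mono mult_right_mono) auto
    finally show "\<bar>Q (w + s) - Q w - Re (?h1 * s + ?h2 * s\<^sup>2) - qlaplacian Q z0 * (cmod s)\<^sup>2\<bar> \<le> L * (cmod s + cmod (w - z0)) * (cmod s)\<^sup>2"
      unfolding eq by (simp add: algebra_simps)
  qed
  then show ?thesis using r Lpos by blast
qed

text \<open>After subtracting a pluriharmonic part the weight is \<open>N |\<zeta> - w|\<^sup>2\<close> up to an error that is
  dominated by the quadratic term and is small of order \<open>1 / sqrt N\<close> in the rescaled variable.\<close>

definition quadratic_weight ::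
  "(complex \<Rightarrow> real) \<Rightarrow> real \<Rightarrow> complex \<Rightarrow> real \<Rightarrow> real \<Rightarrow> (complex \<Rightarrow> complex) \<Rightarrow> bool" where
  "quadratic_weight \<phi> N w r c \<H> \<longleftrightarrow> \<H> holomorphic_on UNIV \<and> \<H> w = 0 \<and>
    (\<forall>\<zeta>\<in>cball w r. let e = \<bar>\<phi> \<zeta> - \<phi> w - 2 * Re (\<H> \<zeta>) - N * (cmod (\<zeta> - w))\<^sup>2\<bar>; y = N * (cmod (\<zeta> - w))\<^sup>2
       in e \<le> y / 4 \<and> e \<le> c / sqrt N * ((1 + y) * y))"

lemma quadratic_weightD:
  assumes "quadratic_weight \<phi> N w r c \<H>" "\<zeta> \<in> cball w r"
  obtains e where "\<phi> \<zeta> = \<phi> w + 2 * Re (\<H> \<zeta>) + N * (cmod (\<zeta> - w))\<^sup>2 + e"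
    "\<bar>e\<bar> \<le> N * (cmod (\<zeta> - w))\<^sup>2 / 4" "\<bar>e\<bar> \<le> c / sqrt N * ((1 + N * (cmod (\<zeta> - w))\<^sup>2) * (N * (cmod (\<zeta> - w))\<^sup>2))"
  using assms that[of "\<phi> \<zeta> - \<phi> w - 2 * Re (\<H> \<zeta>) - N * (cmod (\<zeta> - w))\<^sup>2"]
  by (auto simp: quadratic_weight_def Let_def)

lemma quadratic_weight_exists:
  fixes Q :: "complex \<Rightarrow> real"
  assumes S: "open S" and Q: "Ck_on 3 Q S" and z0: "z0 \<in> S" and D: "qlaplacian Q z0 > 0" and A: "A > 0"
  shows "\<exists>r0>0. \<forall>r. 0 < r \<and> r \<le> r0 \<longrightarrow> (\<exists>c>0. \<exists>m0>0. \<forall>m\<ge>m0. \<forall>w. cmod (w - z0) \<le> A / sqrt (2 * m * qlaplacian Q z0) \<longrightarrow>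
     cmod (w - z0) \<le> r \<and> (\<exists>\<H>. quadratic_weight (\<lambda>z. 2 * m * Q z) (2 * m * qlaplacian Q z0) w r c \<H>))"
proof -
  let ?D = "qlaplacian Q z0"
  obtain r1 C where r1: "r1 > 0" "C > 0" "\<And>w. w \<in> cball z0 r1 \<Longrightarrow> \<exists>h1 h2. \<forall>s. cmod s \<le> r1 \<longrightarrow>
     \<bar>Q (w + s) - Q w - Re (h1 * s + h2 * s\<^sup>2) - ?D * (cmod s)\<^sup>2\<bar> \<le> C * (cmod s + cmod (w - z0)) * (cmod s)\<^sup>2"
    using quadratic_taylor[OF S Q z0] by blast
  \<comment> \<open>With |s| and |w - z0| at most r0, the relative error C (|s| + |w - z0|) /
    \<Delta>Q(z0) is at most 1/4, the bound required by \<open>quadratic_weight\<close>.\<close>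
  define r0 where "r0 = min r1 (?D / (8 * C))"
  have r0: "r0 > 0" "r0 \<le> r1" "C * r0 \<le> ?D / 8"
  proof -
    show "r0 > 0" "r0 \<le> r1" using r1 D by (auto simp: r0_def)
    have "C * r0 \<le> C * (?D / (8 * C))" using r1 by (intro mult_left_mono) (auto simp: r0_def)
    then show "C * r0 \<le> ?D / 8" using r1 by simp
  qed
  have "\<exists>c>0. \<exists>m0>0. \<forall>m\<ge>m0. \<forall>w. cmod (w - z0) \<le> A / sqrt (2 * m * ?D) \<longrightarrow>
     cmod (w - z0) \<le> r \<and> (\<exists>\<H>. quadratic_weight (\<lambda>z. 2 * m * Q z) (2 * m * ?D) w r c \<H>)"
    if r: "0 < r" "r \<le> r0" for r
  proof -
    \<comment> \<open>From |s| = sqrt y / sqrt N and |w - z0| \<le> A / sqrt N the sum is at most (1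
      + A)(1 + y) / sqrt N, using sqrt y \<le> 1 + y.\<close>
    define c where "c = C / ?D * (1 + A)"
    \<comment> \<open>Chosen so that N \<ge> (A/r)^2, which puts all admissible w within r of
      z0.\<close>
    define m0 where "m0 = (A / r)\<^sup>2 / (2 * ?D)"
    have m0: "m0 > 0" using A r D by (simp add: m0_def)
    have c: "c > 0" using r1 D A by (simp add: c_def)
    have "cmod (w - z0) \<le> r \<and> (\<exists>\<H>. quadratic_weight (\<lambda>z. 2 * m * Q z) (2 * m * ?D) w r c \<H>)"
      if m: "m \<ge> m0" and w: "cmod (w - z0) \<le> A / sqrt (2 * m * ?D)" for m w
    proof -
      define N where "N = 2 * m * ?D"
      have mpos: "m > 0" using m m0 by linarith
      have N: "N > 0" using mpos D by (simp add: N_def)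
      have "(A / r)\<^sup>2 \<le> m * (2 * ?D)" using m D unfolding m0_def by (subst (asm) pos_divide_le_eq) auto
      then have "(A / r)\<^sup>2 \<le> N" by (simp add: N_def mult_ac)
      then have "A / r \<le> sqrt N" by (rule real_le_rsqrt)
      then have "A / sqrt N \<le> r" using A r N by (simp add: field_simps)
      then have wr: "cmod (w - z0) \<le> r" using w by (simp add: N_def)
      then have "w \<in> cball z0 r1" using r r0 by (simp add: dist_norm norm_minus_commute)
      then obtain h1 h2 where h: "\<And>s. cmod s \<le> r1 \<Longrightarrow>
         \<bar>Q (w + s) - Q w - Re (h1 * s + h2 * s\<^sup>2) - ?D * (cmod s)\<^sup>2\<bar> \<le> C * (cmod s + cmod (w - z0)) * (cmod s)\<^sup>2"
        using r1(3) by blast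
      define \<H> where "\<H> \<zeta> = of_real m * (h1 * (\<zeta> - w) + h2 * (\<zeta> - w)\<^sup>2)" for \<zeta>
      have "quadratic_weight (\<lambda>z. 2 * m * Q z) N w r c \<H>"
        unfolding quadratic_weight_def
      proof (intro conjI ballI)
        show "\<H> holomorphic_on UNIV" unfolding \<H>_def by (intro holomorphic_intros)
        show "\<H> w = 0" by (simp add: \<H>_def)
        fix \<zeta> assume \<zeta>: "\<zeta> \<in> cball w r"
        define s where "s = \<zeta> - w"
        have s: "cmod s \<le> r" using \<zeta> by (simp add: s_def dist_norm norm_minus_commute)
        define y where "y = N * (cmod s)\<^sup>2"
        define e where "e = \<bar>2 * m * Q \<zeta> - 2 * m * Q w - 2 * Re (\<H> \<zeta>) - N * (cmod (\<zeta> - w))\<^sup>2\<bar>"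
        have "2 * m * Q \<zeta> - 2 * m * Q w - 2 * Re (\<H> \<zeta>) - N * (cmod (\<zeta> - w))\<^sup>2
           = 2 * m * (Q (w + s) - Q w - Re (h1 * s + h2 * s\<^sup>2) - ?D * (cmod s)\<^sup>2)"
          by (simp add: s_def \<H>_def N_def algebra_simps)
        then have "e = 2 * m * \<bar>Q (w + s) - Q w - Re (h1 * s + h2 * s\<^sup>2) - ?D * (cmod s)\<^sup>2\<bar>"
          using mpos by (simp add: e_def abs_mult)
        also have "\<dots> \<le> 2 * m * (C * (cmod s + cmod (w - z0)) * (cmod s)\<^sup>2)"
          using h[of s] s r r0 mpos by (intro mult_left_mono) auto
        also have "\<dots> = C / ?D * (cmod s + cmod (w - z0)) * y"
          using D by (simp add: y_def N_def field_simps)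
        finally have e: "e \<le> C / ?D * (cmod s + cmod (w - z0)) * y" .
        have y0: "y \<ge> 0" using N by (simp add: y_def)
        have "C / ?D * (cmod s + cmod (w - z0)) \<le> C / ?D * (2 * r0)"
          using s wr r r1 D by (intro mult_left_mono) auto
        also have "\<dots> \<le> 1 / 4" using r0(3) D by (simp add: field_simps)
        finally have "e \<le> 1 / 4 * y" using e y0 by (meson mult_right_mono order_trans)
        moreover have "e \<le> c / sqrt N * ((1 + y) * y)"
        proof -
          have sy: "sqrt N * cmod s = sqrt y" using N by (simp add: y_def real_sqrt_mult)
          have "sqrt y \<le> 1 + y"
          proof -
            have "(sqrt y)\<^sup>2 \<le> (1 + y)\<^sup>2" using y0 by (simp add: power2_eq_square algebra_simps)
            then show ?thesis using y0 by (rule_tac power2_le_imp_le) auto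
          qed
          moreover have "A \<le> A * (1 + y)" using A y0 by simp
          ultimately have "sqrt y + A \<le> (1 + A) * (1 + y)" by (simp add: distrib_right)
          moreover have "cmod s + cmod (w - z0) \<le> (sqrt y + A) / sqrt N"
            using w N by (simp add: sy[symmetric] N_def[symmetric] add_divide_distrib)
          ultimately have "cmod s + cmod (w - z0) \<le> (1 + A) * (1 + y) / sqrt N"
            using N by (meson divide_right_mono order_trans real_sqrt_ge_zero less_imp_le)
          then have "C / ?D * (cmod s + cmod (w - z0)) * y \<le> C / ?D * ((1 + A) * (1 + y) / sqrt N) * y"
            using y0 r1 D by (intro mult_right_mono mult_left_mono) auto
          also have "\<dots> = c / sqrt N * ((1 + y) * y)" by (simp add: c_def)
          finally show ?thesis using e by linarith
        qed
        ultimately show "let e = \<bar>2 * m * Q \<zeta> - 2 * m * Q w - 2 * Re (\<H> \<zeta>) - N * (cmod (\<zeta> - w))\<^sup>2\<bar>; y = N * (cmod (\<zeta> - w))\<^sup>2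
           in e \<le> y / 4 \<and> e \<le> c / sqrt N * ((1 + y) * y)"
          unfolding Let_def e_def y_def s_def by simp
      qed
      then show ?thesis using wr unfolding N_def by blast
    qed
    then show ?thesis using c m0 by blast
  qed
  then show ?thesis using r0(1) by blast
qed

section \<open>Point evaluation of bianalytic functions\<close>

lemma bianalytic_on_mult_holomorphic:
  assumes "bianalytic_on f S" "open S" "h holomorphic_on S"
  shows "bianalytic_on (\<lambda>z. f z * h z) S"
proof -
  obtain f0 f1 where "f0 holomorphic_on S" "f1 holomorphic_on S" "\<And>z. z \<in> S \<Longrightarrow> f z = f0 z + cnj z * f1 z"
    using bianalytic_on_decompose[OF assms(1,2)] by metis
  then show ?thesis
    by (intro bianalytic_onI[of "\<lambda>z. f0 z * h z" S "\<lambda>z. f1 z * h z"] holomorphic_intros assms)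
       (auto simp: algebra_simps)
qed

lemma bianalytic_on_subset: "bianalytic_on f S \<Longrightarrow> T \<subseteq> S \<Longrightarrow> bianalytic_on f T"
  by (auto simp: bianalytic_on_def intro: Ck_on_subset)

lemma bianalytic_on_diff:
  assumes "bianalytic_on f S" "bianalytic_on g S" "open S"
  shows "bianalytic_on (\<lambda>z. f z - g z) S"
proof -
  obtain f0 f1 where f: "f0 holomorphic_on S" "f1 holomorphic_on S" "\<And>z. z \<in> S \<Longrightarrow> f z = f0 z + cnj z * f1 z"
    using bianalytic_on_decompose[OF assms(1,3)] by metis
  obtain g0 g1 where g: "g0 holomorphic_on S" "g1 holomorphic_on S" "\<And>z. z \<in> S \<Longrightarrow> g z = g0 z + cnj z * g1 z"
    using bianalytic_on_decompose[OF assms(2,3)] by metis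
  show ?thesis
    by (intro bianalytic_onI[of "\<lambda>z. f0 z - g0 z" S "\<lambda>z. f1 z - g1 z"] holomorphic_intros f(1,2) g(1,2) assms(3))
       (auto simp: f(3) g(3) algebra_simps)
qed

lemma bianalytic_continuous_on: "bianalytic_on f S \<Longrightarrow> continuous_on S f"
  unfolding bianalytic_on_def using Ck_on_continuous by blast

text \<open>Pairing with \<open>bkernel\<close> reproduces g(z), and
  \<open>bkernel_pairing_bound\<close> with the zero weight performs the Cauchy-Schwarz step; K is
  its constant divided by pi^2.\<close>

lemma bianalytic_point_bound:
  "\<exists>K>0. \<forall>g z R \<tau>. bianalytic_on g (ball z R) \<longrightarrow> 0 < \<tau> \<longrightarrow> 2 * \<tau> < R \<longrightarrow>
     ennreal ((cmod (g z))\<^sup>2) \<le> ennreal (K / \<tau>\<^sup>2) * (\<integral>\<^sup>+\<zeta>. (if dist z \<zeta> \<le> \<tau> then ennreal ((cmod (g \<zeta>))\<^sup>2) else 0) \<partial>lborel)"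
proof -
  obtain M where M: "M > 0" "\<And>z e \<zeta>. e > 0 \<Longrightarrow> cmod (bkernel z e z \<zeta>) \<le> M / e\<^sup>2 * indicator (cball z e) \<zeta>"
    using bkernel_center_bound by blast
  define K where "K = M\<^sup>2 * exp 1 / pi"
  have "ennreal ((cmod (g z))\<^sup>2) \<le> ennreal (K / \<tau>\<^sup>2) * (\<integral>\<^sup>+\<zeta>. (if dist z \<zeta> \<le> \<tau> then ennreal ((cmod (g \<zeta>))\<^sup>2) else 0) \<partial>lborel)"
    if g: "bianalytic_on g (ball z R)" and \<tau>: "0 < \<tau>" "2 * \<tau> < R" for g z R \<tau>
  proof -
    let ?B = "ball z R" and ?b = "bkernel z \<tau> z"
    \<comment> \<open>The pairing bound wants compact support. The bump of radius 2\<tau> is 1 on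
      the disc of radius \<tau>, which carries the kernel, and 2\<tau> < R keeps its support inside
      the domain of g.\<close>
    define X where "X \<zeta> = g \<zeta> * bump z (2 * \<tau>) \<zeta>" for \<zeta>
    have sub: "cball z (2 * \<tau>) \<subseteq> ?B" "cball z \<tau> \<subseteq> ?B" using \<tau> by auto
    have "Ckc 0 ?B (bump z (2 * \<tau>))" using Ckc_mono[OF Ckc_bump[OF sub(1)], of 0 ?B] \<tau> by simp
    then have Xc: "Ckc 0 ?B X"
      unfolding X_def[abs_def] using bianalytic_continuous_on[OF g] by (intro Ckc_mult) auto
    have Xg: "X \<zeta> = g \<zeta>" if "\<zeta> \<in> cball z \<tau>" for \<zeta>
    proof -
      have "cmod (\<zeta> - z) \<le> \<tau>" using that by (simp add: dist_norm norm_minus_commute)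
      then have "(cmod (\<zeta> - z))\<^sup>2 \<le> \<tau>\<^sup>2" by (rule power_mono) simp
      moreover have "(2 * \<tau>)\<^sup>2 / 2 = 2 * \<tau>\<^sup>2" by (simp add: power_mult_distrib)
      ultimately have "(cmod (\<zeta> - z))\<^sup>2 \<le> (2 * \<tau>)\<^sup>2 / 2" using zero_le_power2[of \<tau>] by linarith
      then show ?thesis using \<tau> by (simp add: X_def bump_inside)
    qed
    have "g \<zeta> * ?b \<zeta> = of_real (exp 0) * X \<zeta> * ?b \<zeta>" for \<zeta>
      using M(2)[OF \<tau>(1), of z \<zeta>] Xg[of \<zeta>] by (cases "\<zeta> \<in> cball z \<tau>") auto
    then have "(LINT \<zeta>|lborel. g \<zeta> * ?b \<zeta>) = (LINT \<zeta>|lborel. of_real (exp 0) * X \<zeta> * ?b \<zeta>)"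
      by (intro Bochner_Integration.integral_cong refl)
    then have "- of_real pi * g z = (LINT \<zeta>|lborel. of_real (exp 0) * X \<zeta> * ?b \<zeta>)"
      using bkernel_reproducing[OF \<tau>(1) _ g] \<tau> by simp
    then have "(cmod (LINT \<zeta>|lborel. of_real (exp 0) * X \<zeta> * ?b \<zeta>))\<^sup>2 * exp (- 0) = pi\<^sup>2 * (cmod (g z))\<^sup>2"
      by (metis exp_zero minus_zero mult.right_neutral norm_minus_cancel norm_mult norm_of_real mult_minus_left abs_of_pos pi_gt_zero power_mult_distrib)
    then have "ennreal (pi\<^sup>2 * (cmod (g z))\<^sup>2) \<le> ennreal (M\<^sup>2 * pi * exp 1 / \<tau>\<^sup>2) * (\<integral>\<^sup>+\<zeta>. (if dist z \<zeta> \<le> \<tau> then ennreal (exp 0 * (cmod (X \<zeta>))\<^sup>2) else 0) \<partial>lborel)"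
      using bkernel_pairing_bound[OF M(1) M(2)[OF \<tau>(1)] open_ball _ Xc \<tau>(1) sub(2), of "\<lambda>_. 0"] by simp
    also have "(\<integral>\<^sup>+\<zeta>. (if dist z \<zeta> \<le> \<tau> then ennreal (exp 0 * (cmod (X \<zeta>))\<^sup>2) else 0) \<partial>lborel)
       = (\<integral>\<^sup>+\<zeta>. (if dist z \<zeta> \<le> \<tau> then ennreal ((cmod (g \<zeta>))\<^sup>2) else 0) \<partial>lborel)" (is "_ = ?I")
      by (intro nn_integral_cong) (simp add: Xg)
    finally have "ennreal (1 / pi\<^sup>2) * ennreal (pi\<^sup>2 * (cmod (g z))\<^sup>2) \<le> ennreal (1 / pi\<^sup>2) * (ennreal (M\<^sup>2 * pi * exp 1 / \<tau>\<^sup>2) * ?I)"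
      by (rule mult_left_mono) simp
    moreover have "ennreal (1 / pi\<^sup>2) * ennreal (pi\<^sup>2 * (cmod (g z))\<^sup>2) = ennreal ((cmod (g z))\<^sup>2)"
      by (simp add: ennreal_mult[symmetric])
    moreover have "ennreal (1 / pi\<^sup>2) * (ennreal (M\<^sup>2 * pi * exp 1 / \<tau>\<^sup>2) * ?I) = ennreal (K / \<tau>\<^sup>2) * ?I"
      by (simp add: mult.assoc[symmetric] ennreal_mult[symmetric] K_def power2_eq_square)
    ultimately show ?thesis by simp
  qed
  moreover have "K > 0" using M by (simp add: K_def)
  ultimately show ?thesis by blast
qed

text \<open>Multiplying u by exp(-H) keeps it bianalytic and removes the pluriharmonic part of the
  weight. On a disc of radius 1/sqrt N what is left of \<phi> oscillates by a bounded amount, so the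
  unweighted bound applies with \<tau> = 1/sqrt N.\<close>

lemma weighted_point_bound:
  "\<exists>K>0. \<forall>u z R \<phi> N r c \<H>. quadratic_weight \<phi> N z r c \<H> \<longrightarrow> N > 0 \<longrightarrow> 1 / sqrt N \<le> r \<longrightarrow> 2 / sqrt N < R \<longrightarrow>
     bianalytic_on u (ball z R) \<longrightarrow>
     ennreal ((cmod (u z))\<^sup>2 * exp (- \<phi> z)) \<le> ennreal (K * N) *
       (\<integral>\<^sup>+\<zeta>. ennreal ((cmod (u \<zeta>))\<^sup>2 * exp (- \<phi> \<zeta>)) * indicator (cball z (1 / sqrt N)) \<zeta> \<partial>lborel)"
proof -
  obtain K where K: "K > 0" "\<And>g z R \<tau>. bianalytic_on g (ball z R) \<Longrightarrow> 0 < \<tau> \<Longrightarrow> 2 * \<tau> < R \<Longrightarrow>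
     ennreal ((cmod (g z))\<^sup>2) \<le> ennreal (K / \<tau>\<^sup>2) * (\<integral>\<^sup>+\<zeta>. (if dist z \<zeta> \<le> \<tau> then ennreal ((cmod (g \<zeta>))\<^sup>2) else 0) \<partial>lborel)"
    using bianalytic_point_bound by blast
  have "ennreal ((cmod (u z))\<^sup>2 * exp (- \<phi> z)) \<le> ennreal (K * exp 2 * N) *
       (\<integral>\<^sup>+\<zeta>. ennreal ((cmod (u \<zeta>))\<^sup>2 * exp (- \<phi> \<zeta>)) * indicator (cball z (1 / sqrt N)) \<zeta> \<partial>lborel)"
    if q: "quadratic_weight \<phi> N z r c \<H>" and N: "N > 0" "1 / sqrt N \<le> r" "2 / sqrt N < R"
      and u: "bianalytic_on u (ball z R)" for u z R \<phi> N r c \<H>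
  proof -
    \<comment> \<open>The extra constant gives exp(-2) after squaring. It dominates exp(-(y + e)),
      since y \<le> 1 and |e| \<le> 1/4 on the disc; the factor exp 2 in the final constant pays it
      back.\<close>
    define g where "g \<zeta> = u \<zeta> * exp (- \<H> \<zeta> - of_real ((2 + \<phi> z) / 2))" for \<zeta>
    have \<H>: "\<H> holomorphic_on UNIV" "\<H> z = 0" using q by (auto simp: quadratic_weight_def)
    have g: "bianalytic_on g (ball z R)"
      unfolding g_def[abs_def]
      by (intro bianalytic_on_mult_holomorphic u open_ball holomorphic_intros holomorphic_on_subset[OF \<H>(1)]) auto
    let ?\<tau> = "1 / sqrt N"
    have sq: "(cmod (g \<zeta>))\<^sup>2 = (cmod (u \<zeta>))\<^sup>2 * exp (- 2 * Re (\<H> \<zeta>) - (2 + \<phi> z))" for \<zeta>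
    proof -
      have "(cmod (g \<zeta>))\<^sup>2 = (cmod (u \<zeta>))\<^sup>2 * exp (2 * Re (- \<H> \<zeta> - of_real ((2 + \<phi> z) / 2)))"
        by (simp only: g_def norm_mult power_mult_distrib norm_exp_eq_Re exp_double)
      moreover have "2 * Re (- \<H> \<zeta> - of_real ((2 + \<phi> z) / 2)) = - 2 * Re (\<H> \<zeta>) - (2 + \<phi> z)"
        by (simp add: field_simps)
      ultimately show ?thesis by (simp only:)
    qed
    have bound: "(cmod (g \<zeta>))\<^sup>2 \<le> (cmod (u \<zeta>))\<^sup>2 * exp (- \<phi> \<zeta>)" if \<zeta>: "\<zeta> \<in> cball z ?\<tau>" for \<zeta>
    proof -
      have \<zeta>r: "\<zeta> \<in> cball z r" using \<zeta> N(2) by auto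
      obtain e where e: "\<phi> \<zeta> = \<phi> z + 2 * Re (\<H> \<zeta>) + N * (cmod (\<zeta> - z))\<^sup>2 + e" "\<bar>e\<bar> \<le> N * (cmod (\<zeta> - z))\<^sup>2 / 4"
        using quadratic_weightD[OF q \<zeta>r] by metis
      have "cmod (\<zeta> - z) \<le> ?\<tau>" using \<zeta> by (simp add: dist_norm norm_minus_commute)
      then have "(cmod (\<zeta> - z))\<^sup>2 \<le> ?\<tau>\<^sup>2" by (rule power_mono) simp
      then have "N * (cmod (\<zeta> - z))\<^sup>2 \<le> 1" using N(1) by (simp add: power_divide field_simps)
      then have "- 2 * Re (\<H> \<zeta>) - (2 + \<phi> z) \<le> - \<phi> \<zeta>" using e by linarith
      then show ?thesis unfolding sq by (intro mult_left_mono) auto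
    qed
    let ?I = "\<integral>\<^sup>+\<zeta>. ennreal ((cmod (u \<zeta>))\<^sup>2 * exp (- \<phi> \<zeta>)) * indicator (cball z ?\<tau>) \<zeta> \<partial>lborel"
    have "exp 2 * (cmod (g z))\<^sup>2 = (cmod (u z))\<^sup>2 * (exp 2 * exp (- (2 + \<phi> z)))" by (simp add: sq \<H>)
    also have "exp 2 * exp (- (2 + \<phi> z)) = exp (- \<phi> z)" by (simp add: exp_add[symmetric])
    finally have "ennreal ((cmod (u z))\<^sup>2 * exp (- \<phi> z)) = ennreal (exp 2) * ennreal ((cmod (g z))\<^sup>2)"
      by (simp add: ennreal_mult[symmetric])
    also have "\<dots> \<le> ennreal (exp 2) * (ennreal (K / ?\<tau>\<^sup>2) * (\<integral>\<^sup>+\<zeta>. (if dist z \<zeta> \<le> ?\<tau> then ennreal ((cmod (g \<zeta>))\<^sup>2) else 0) \<partial>lborel))"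
      by (intro mult_left_mono K(2)[OF g]) (use N in auto)
    also have "\<dots> \<le> ennreal (exp 2) * (ennreal (K / ?\<tau>\<^sup>2) * ?I)"
    proof (intro mult_left_mono nn_integral_mono)
      show "(if dist z \<zeta> \<le> ?\<tau> then ennreal ((cmod (g \<zeta>))\<^sup>2) else 0)
          \<le> ennreal ((cmod (u \<zeta>))\<^sup>2 * exp (- \<phi> \<zeta>)) * indicator (cball z ?\<tau>) \<zeta>" for \<zeta>
        using ennreal_leI[OF bound[of \<zeta>]] by (cases "\<zeta> \<in> cball z ?\<tau>") auto
    qed auto
    also have "ennreal (exp 2) * (ennreal (K / ?\<tau>\<^sup>2) * ?I) = ennreal (K * exp 2 * N) * ?I"
    proof -
      have "K / ?\<tau>\<^sup>2 = K * N" using N(1) by (simp add: power_divide)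
      then have "ennreal (K * exp 2 * N) = ennreal (exp 2) * ennreal (K / ?\<tau>\<^sup>2)"
        using K(1) N(1) by (simp only: ennreal_mult[symmetric] exp_ge_zero mult_nonneg_nonneg less_imp_le) (simp only: mult_ac)
      then show ?thesis by (simp only: mult.assoc)
    qed
    finally show ?thesis .
  qed
  moreover have "K * exp 2 > 0" using K by simp
  ultimately show ?thesis by (intro exI[of _ "K * exp 2"]) blast
qed

section \<open>The model kernel\<close>

text \<open>Sacrifices half of the decay to absorb the cubic polynomial: one degree comes from the
  kernel factor 2 - y and two from the Taylor error (1 + y) y.\<close>

lemma cubic_exp_bound: "\<exists>K>0. \<forall>y\<ge>0. (2 + y) ^ 3 * exp (- y / 8) \<le> K * exp (- y / 16 :: real)"
proof -
  have "(2 + y) ^ 3 * exp (- y / 8) \<le> (16 ^ 3 * 27 * exp (1 / 8)) * exp (- y / 16)" if y: "y \<ge> 0" for y :: real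
  proof -
    define t where "t = (2 + y) / 16"
    have t: "t \<ge> 0" using y by (simp add: t_def)
    have "t / 3 \<le> exp (t / 3)" using exp_ge_add_one_self[of "t / 3"] by linarith
    then have "(t / 3) ^ 3 \<le> exp (t / 3) ^ 3" by (rule power_mono) (use t in simp)
    also have "exp (t / 3) ^ 3 = exp t" using exp_of_nat_mult[of 3 "t / 3"] by simp
    finally have "t ^ 3 \<le> 27 * exp t" by (simp add: power_divide)
    then have "(2 + y) ^ 3 \<le> 16 ^ 3 * (27 * exp t)" by (simp add: t_def power_divide)
    also have "exp t = exp (1 / 8) * exp (y / 16)" by (simp add: t_def exp_add[symmetric] add_divide_distrib)
    finally have "(2 + y) ^ 3 * exp (- y / 8) \<le> 16 ^ 3 * (27 * (exp (1 / 8) * exp (y / 16))) * exp (- y / 8)"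
      by (rule mult_right_mono) simp
    also have "\<dots> = 16 ^ 3 * 27 * exp (1 / 8) * (exp (y / 16) * exp (- y / 8))" by simp
    also have "exp (y / 16) * exp (- y / 8) = exp (- y / 16)" by (simp add: exp_add[symmetric])
    finally show ?thesis .
  qed
  then show ?thesis by (intro exI[of _ "16 ^ 3 * 27 * exp (1 / 8)"]) auto
qed

lemma rcut_bounded: "\<exists>M>0. \<forall>i\<le>3. \<forall>r x. r > 0 \<longrightarrow> \<bar>rcut r i x\<bar> \<le> (2 / r\<^sup>2) ^ i * M"
proof -
  obtain M where M: "M > 0" "\<And>i x. i \<le> 3 \<Longrightarrow> \<bar>cutoff i x\<bar> \<le> M" using cutoff_bounded by blast
  have "\<bar>rcut r i x\<bar> \<le> (2 / r\<^sup>2) ^ i * M" if "i \<le> 3" for i r x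
    unfolding rcut_def abs_mult using M(2)[OF that] by (intro mult_mono) auto
  then show ?thesis using M(1) by blast
qed

lemma nn_integral_gaussian:
  assumes "a > 0"
  shows "(\<integral>\<^sup>+\<zeta>. ennreal (exp (- a * (cmod (\<zeta> - w))\<^sup>2)) \<partial>lborel) = ennreal (pi / a)"
proof -
  have "(\<integral>\<^sup>+\<zeta>. ennreal (exp (- a * (cmod (\<zeta> - w))\<^sup>2)) \<partial>lborel)
     = ennreal pi * (\<integral>\<^sup>+x. ennreal (exp (- a * x)) * indicator {0..} x \<partial>lborel)"
    by (rule nn_integral_radial) measurable
  also have "(\<integral>\<^sup>+x. ennreal (exp (- a * x)) * indicator {0..} x \<partial>lborel) = ennreal (0 - (- (1 / a) * exp (- a * 0)))"
  proof (rule nn_integral_FTC_atLeast)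
    show "((\<lambda>x. - (1 / a) * exp (- a * x)) has_real_derivative exp (- a * x)) (at x)" for x
      using assms by (auto intro!: derivative_eq_intros)
    have "((\<lambda>x. exp (- a * x)) \<longlongrightarrow> 0) at_top" using assms by real_asymp
    then show "((\<lambda>x. - (1 / a) * exp (- a * x)) \<longlongrightarrow> 0) at_top" by (rule tendsto_mult_right_zero)
  qed auto
  finally show ?thesis using assms by (simp add: ennreal_mult[symmetric])
qed

text \<open>For the weight N |\<zeta> - w|^2 the bianalytic Fock kernel at w is N/pi times the
  associated Laguerre polynomial 2 - x at x = N |\<zeta> - w|^2. The factors exp(\<phi>(w)) and
  exp(H) carry it over to a weight that also contains \<phi>(w) + 2 Re H.\<close>

definition model_kernel ::
  "(complex \<Rightarrow> real) \<Rightarrow> real \<Rightarrow> complex \<Rightarrow> real \<Rightarrow> (complex \<Rightarrow> complex) \<Rightarrow> complex \<Rightarrow> complex" where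
  "model_kernel \<phi> N w r \<H> \<zeta> = (of_real (N / pi * exp (\<phi> w)) * exp (\<H> \<zeta>)) *
     of_real (rcut r 0 ((cmod (\<zeta> - w))\<^sup>2) * (2 - N * (cmod (\<zeta> - w))\<^sup>2))"

lemma Ck_on_exp_holomorphic: "\<H> holomorphic_on UNIV \<Longrightarrow> Ck_on k (\<lambda>\<zeta>. a * exp (\<H> \<zeta>)) S"
  using Ck_on_subset[OF Ck_on_holomorphic[of "\<lambda>\<zeta>. a * exp (\<H> \<zeta>)" UNIV k] subset_UNIV]
  by (simp add: holomorphic_intros)

lemma model_profile_DERIV:
  "((\<lambda>x. rcut r 0 x * (2 - N * x)) has_real_derivative rcut r 1 x * (2 - N * x) - N * rcut r 0 x) (at x)"
  "((\<lambda>x. rcut r 1 x * (2 - N * x) - N * rcut r 0 x) has_real_derivative rcut r 2 x * (2 - N * x) - 2 * N * rcut r 1 x) (at x)"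
  using DERIV_rcut[of 0 r x] DERIV_rcut[of 1 r x]
  by (auto intro!: derivative_eq_intros simp: numeral_2_eq_2)

lemma Ckc_model_kernel:
  assumes "S = UNIV \<or> open S" "cball w r \<subseteq> S" "r > 0" "\<H> holomorphic_on UNIV"
  shows "Ckc 2 S (model_kernel \<phi> N w r \<H>)"
proof -
  have S: "open S" using assms(1) by auto
  define G where "G i = (if i = 0 then (\<lambda>x. rcut r 0 x * (2 - N * x)) else if i = 1 then (\<lambda>x. rcut r 1 x * (2 - N * x) - N * rcut r 0 x)
         else (\<lambda>x. rcut r 2 x * (2 - N * x) - 2 * N * rcut r 1 x))" for i :: nat
  have "Ckc 2 S (\<lambda>\<zeta>. complex_of_real (G 0 ((cmod (\<zeta> - w))\<^sup>2)))"
  proof (rule Ckc_radial[where r = r, OF _ _ _ assms(2,3)])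
    show "(G i has_real_derivative G (Suc i) x) (at x)" if "i < 2" for i x
      using that model_profile_DERIV[of r N x] by (auto simp: G_def less_2_cases_iff)
    show "continuous_on UNIV (G 2)" by (auto simp: G_def intro!: continuous_intros continuous_rcut)
    show "G 0 x = 0" if "x \<ge> r\<^sup>2" for x using that assms(3) by (simp add: G_def rcut_outside)
  qed
  then show ?thesis unfolding model_kernel_def[abs_def] G_def
    by (intro Ckc_mult S Ck_on_exp_holomorphic assms(4)) simp
qed

text \<open>Without the cutoff the kernel is bianalytic, so every term on the right carries a
  derivative of \<open>rcut\<close> and vanishes unless |\<zeta> - w|^2 lies between r^2/2 and
  r^2.\<close>

lemma dbar2_model_kernel:
  assumes \<H>: "\<H> holomorphic_on UNIV"
  shows "dbar (dbar (model_kernel \<phi> N w r \<H>)) \<zeta> = (of_real (N / pi * exp (\<phi> w)) * exp (\<H> \<zeta>)) *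
     (of_real (rcut r 2 ((cmod (\<zeta> - w))\<^sup>2) * (2 - N * (cmod (\<zeta> - w))\<^sup>2) - 2 * N * rcut r 1 ((cmod (\<zeta> - w))\<^sup>2)) * (\<zeta> - w)\<^sup>2)"
proof -
  let ?h = "\<lambda>\<zeta>. of_real (N / pi * exp (\<phi> w)) * exp (\<H> \<zeta>)"
  have h: "wirtinger ?h \<zeta> (deriv ?h \<zeta>) 0" for \<zeta>
    by (rule wirtinger_field_derivative[OF holomorphic_derivI[of _ UNIV]]) (intro holomorphic_intros \<H>, auto)
  have 1: "dbar (model_kernel \<phi> N w r \<H>) \<zeta> = ?h \<zeta> * (of_real (rcut r 1 ((cmod (\<zeta> - w))\<^sup>2) * (2 - N * (cmod (\<zeta> - w))\<^sup>2) - N * rcut r 0 ((cmod (\<zeta> - w))\<^sup>2)) * (\<zeta> - w))" for \<zeta>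
    using wirtinger_unique(2)[OF wirtinger_mult[OF h wirtinger_radial[OF model_profile_DERIV(1)[of r N "(cmod (\<zeta> - w))\<^sup>2"]]]]
    unfolding model_kernel_def[abs_def] by simp
  then have "dbar (model_kernel \<phi> N w r \<H>) = (\<lambda>\<zeta>. ?h \<zeta> * (of_real (rcut r 1 ((cmod (\<zeta> - w))\<^sup>2) * (2 - N * (cmod (\<zeta> - w))\<^sup>2) - N * rcut r 0 ((cmod (\<zeta> - w))\<^sup>2)) * (\<zeta> - w)))"
    by (rule ext)
  then show ?thesis
    using wirtinger_unique(2)[OF wirtinger_mult[OF h wirtinger_mult[OF wirtinger_radial[OF model_profile_DERIV(2)[of r N "(cmod (\<zeta> - w))\<^sup>2"]] wirtinger_ident_diff]]]
    by (simp add: power2_eq_square mult_ac)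
qed

lemma model_kernel_inside:
  assumes "r > 0" "\<zeta> \<in> ball w (r / 2)"
  shows "model_kernel \<phi> N w r \<H> \<zeta> = (of_real (N / pi * exp (\<phi> w)) * exp (\<H> \<zeta>)) * of_real (2 - N * (cmod (\<zeta> - w))\<^sup>2)"
proof -
  have "cmod (\<zeta> - w) \<le> r / 2" using assms(2) by (simp add: dist_norm norm_minus_commute)
  then have "(cmod (\<zeta> - w))\<^sup>2 \<le> (r / 2)\<^sup>2" by (rule power_mono) simp
  also have "\<dots> \<le> r\<^sup>2 / 2" by (simp add: power_divide)
  finally show ?thesis using assms(1) by (simp add: model_kernel_def rcut_inside)
qed

lemma model_kernel_bianalytic:
  assumes "r > 0" "\<H> holomorphic_on UNIV"
  shows "bianalytic_on (model_kernel \<phi> N w r \<H>) (ball w (r / 2))"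
proof (rule bianalytic_onI)
  let ?h = "\<lambda>\<zeta>. of_real (N / pi * exp (\<phi> w)) * exp (\<H> \<zeta>)"
  show "(\<lambda>\<zeta>. ?h \<zeta> * (2 + of_real N * (\<zeta> - w) * cnj w)) holomorphic_on ball w (r / 2)"
    "(\<lambda>\<zeta>. ?h \<zeta> * (- of_real N * (\<zeta> - w))) holomorphic_on ball w (r / 2)"
    by (intro holomorphic_intros holomorphic_on_subset[OF assms(2)] subset_UNIV)+
  fix \<zeta> assume \<zeta>: "\<zeta> \<in> ball w (r / 2)"
  show "model_kernel \<phi> N w r \<H> \<zeta> = ?h \<zeta> * (2 + of_real N * (\<zeta> - w) * cnj w) + cnj \<zeta> * (?h \<zeta> * (- of_real N * (\<zeta> - w)))"
  proof -
    have "a * (2 - of_real N * ((\<zeta> - w) * cnj (\<zeta> - w))) = a * (2 + of_real N * (\<zeta> - w) * cnj w) + cnj \<zeta> * (a * (- of_real N * (\<zeta> - w)))" for a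
      by (simp add: algebra_simps)
    then show ?thesis
      unfolding model_kernel_inside[OF assms(1) \<zeta>] of_real_diff of_real_mult[of N "(cmod (\<zeta> - w))\<^sup>2"] cmod_square_mult_cnj of_real_numeral .
  qed
qed auto

lemma abs_exp_minus_1_le: "\<bar>1 - exp u\<bar> \<le> \<bar>u\<bar> * exp \<bar>u\<bar>" for u :: real
proof (cases "u \<ge> 0")
  case True
  have "exp u * (1 - u) \<le> exp u * exp (- u)" using exp_ge_add_one_self[of "- u"] by (intro mult_left_mono) auto
  then have "exp u - exp u * u \<le> 1" by (simp add: exp_add[symmetric] right_diff_distrib)
  then show ?thesis using True by (simp add: mult.commute)
next
  case False
  then have "1 - exp u \<le> - u" using exp_ge_add_one_self[of u] by linarith
  also have "\<dots> \<le> - u * exp (- u)" using False mult_left_mono[of 1 "exp (- u)" "- u"] by simp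
  finally show ?thesis using False by simp
qed

text \<open>For an exactly quadratic weight the cutoff-free model kernel is the reproducing kernel; the error
  collects the cutoff and the higher order part \<open>e\<close> of the weight, and is smaller by the factor
  \<open>1 / sqrt N\<close> than the kernel.\<close>

lemma model_kernel_error_bound:
  assumes r: "r > 0" and c: "c > 0"
  shows "\<exists>K>0. \<forall>\<phi> N w \<H> \<zeta>. N \<ge> 1 \<longrightarrow> quadratic_weight \<phi> N w r c \<H> \<longrightarrow> \<zeta> \<in> cball w r \<longrightarrow>
     cmod (of_real (exp (\<phi> \<zeta> / 2)) * (- (1 / of_real pi) * exp (- \<H> \<zeta>) *
        of_real (2 * ((rcut r 1 ((cmod (\<zeta> - w))\<^sup>2) - N * rcut r 0 ((cmod (\<zeta> - w))\<^sup>2)) * exp (- N * (cmod (\<zeta> - w))\<^sup>2))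
          + (cmod (\<zeta> - w))\<^sup>2 * ((rcut r 2 ((cmod (\<zeta> - w))\<^sup>2) - 2 * N * rcut r 1 ((cmod (\<zeta> - w))\<^sup>2) + N\<^sup>2 * rcut r 0 ((cmod (\<zeta> - w))\<^sup>2)) * exp (- N * (cmod (\<zeta> - w))\<^sup>2)))
       - cnj (model_kernel \<phi> N w r \<H> \<zeta>) * of_real (exp (- \<phi> \<zeta>))))
     \<le> K * exp (\<phi> w / 2) * sqrt N * exp (- (N * (cmod (\<zeta> - w))\<^sup>2) / 16)"
proof -
  obtain M where M': "M > 0 \<and> (\<forall>i\<le>3. \<forall>r x. r > 0 \<longrightarrow> \<bar>rcut r i x\<bar> \<le> (2 / r\<^sup>2) ^ i * M)"
    using rcut_bounded by (rule exE)
  have M0: "M > 0" using M' by simp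
  have M2: "\<bar>rcut r i x\<bar> \<le> (2 / r\<^sup>2) ^ i * M" if "i \<le> 3" for i x
    using M' r that by auto
  obtain K0 where K0': "K0 > 0 \<and> (\<forall>y\<ge>0. (2 + y) ^ 3 * exp (- y / 8) \<le> K0 * exp (- y / 16 :: real))"
    using cubic_exp_bound by (rule exE)
  have K00: "K0 > 0" using K0' by simp
  have K02: "(2 + y) ^ 3 * exp (- y / 8) \<le> K0 * exp (- y / 16)" if "y \<ge> 0" for y
    using K0' that by auto
  note M = M0 M2 and K0 = K00 K02
  define K where "K = (M * c + M / r\<^sup>2) * K0"
  have "cmod (of_real (exp (\<phi> \<zeta> / 2)) * (- (1 / of_real pi) * exp (- \<H> \<zeta>) *
        of_real (2 * ((rcut r 1 x - N * rcut r 0 x) * exp (- N * x)) + x * ((rcut r 2 x - 2 * N * rcut r 1 x + N\<^sup>2 * rcut r 0 x) * exp (- N * x)))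
       - cnj (model_kernel \<phi> N w r \<H> \<zeta>) * of_real (exp (- \<phi> \<zeta>))))
     \<le> K * exp (\<phi> w / 2) * sqrt N * exp (- (N * x) / 16)"
    if N: "N \<ge> 1" and q: "quadratic_weight \<phi> N w r c \<H>" and \<zeta>: "\<zeta> \<in> cball w r" and x: "x = (cmod (\<zeta> - w))\<^sup>2"
    for \<phi> N w \<H> \<zeta> x
  proof -
    define y where "y = N * x"
    obtain e where e: "\<phi> \<zeta> = \<phi> w + 2 * Re (\<H> \<zeta>) + y + e" "\<bar>e\<bar> \<le> y / 4" "\<bar>e\<bar> \<le> c / sqrt N * ((1 + y) * y)"
      by (rule quadratic_weightD[OF q \<zeta>, folded x, folded y_def])
    have x0: "0 \<le> x" by (simp add: x)
    have "cmod (\<zeta> - w) \<le> r" using \<zeta> by (simp add: dist_norm norm_minus_commute)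
    then have xr: "x \<le> r\<^sup>2" unfolding x by (rule power_mono) simp
    have y0: "y \<ge> 0" using N x0 by (simp add: y_def)
    define a0 a1 a2 where "a0 = rcut r 0 x" and "a1 = rcut r 1 x" and "a2 = rcut r 2 x"
    \<comment> \<open>Z collects the terms with derivatives of the cutoff. The rest of the density
      is -N a0 (2 - y), the model kernel itself, because 2N - N^2 x = N (2 - y).\<close>
    define Z where "Z = (2 - 2 * y) * a1 + x * a2"
    \<comment> \<open>The first term measures the deviation e of the weight from its quadratic
      model, of relative size 1/sqrt N; the second comes from the cutoff and carries no factor N
      beyond the powers of y.\<close>
    define W where "W = N * a0 * (2 - y) * (1 - exp (- e)) - Z"
    have cm: "cnj (model_kernel \<phi> N w r \<H> \<zeta>) * of_real (exp (- \<phi> \<zeta>)) = exp (- \<H> \<zeta>) * of_real (N / pi * (a0 * (2 - y)) * (exp (- y) * exp (- e)))"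
    proof -
      have "cnj (exp (\<H> \<zeta>)) = exp (- \<H> \<zeta>) * of_real (exp (2 * Re (\<H> \<zeta>)))"
      proof -
        have "cnj (\<H> \<zeta>) = - \<H> \<zeta> + of_real (2 * Re (\<H> \<zeta>))" by (simp add: complex_eq_iff)
        then have "exp (cnj (\<H> \<zeta>)) = exp (- \<H> \<zeta>) * exp (of_real (2 * Re (\<H> \<zeta>)))" by (simp only: exp_add)
        then show ?thesis by (simp only: exp_cnj exp_of_real)
      qed
      moreover have "exp (\<phi> w) * exp (2 * Re (\<H> \<zeta>)) * exp (- \<phi> \<zeta>) = exp (- y) * exp (- e)"
        unfolding e(1) by (simp add: exp_add[symmetric])
      ultimately show ?thesis
        unfolding model_kernel_def x[symmetric] y_def[symmetric] a0_def[symmetric]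
        by (simp add: of_real_mult[symmetric] mult_ac del: of_real_mult) 
    qed
    have T: "2 * ((a1 - N * a0) * exp (- N * x)) + x * ((a2 - 2 * N * a1 + N\<^sup>2 * a0) * exp (- N * x))
       = exp (- y) * (Z - N * a0 * (2 - y))"
      by (simp add: Z_def y_def power2_eq_square algebra_simps)
    have "of_real (exp (\<phi> \<zeta> / 2)) * (- (1 / of_real pi) * exp (- \<H> \<zeta>) * of_real (exp (- y) * (Z - N * a0 * (2 - y)))
       - exp (- \<H> \<zeta>) * of_real (N / pi * (a0 * (2 - y)) * (exp (- y) * exp (- e))))
       = exp (- \<H> \<zeta>) * of_real (exp (\<phi> \<zeta> / 2) * (1 / pi) * exp (- y) * W)"
      by (simp add: W_def field_simps)
    then have "cmod (of_real (exp (\<phi> \<zeta> / 2)) * (- (1 / of_real pi) * exp (- \<H> \<zeta>) * of_real (exp (- y) * (Z - N * a0 * (2 - y)))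
       - exp (- \<H> \<zeta>) * of_real (N / pi * (a0 * (2 - y)) * (exp (- y) * exp (- e)))))
       = exp (- Re (\<H> \<zeta>)) * (exp (\<phi> \<zeta> / 2) * (1 / pi) * exp (- y) * \<bar>W\<bar>)"
      by (simp only: norm_mult norm_exp_eq_Re norm_of_real abs_mult) simp
    also have "\<dots> = (exp (- Re (\<H> \<zeta>)) * exp (\<phi> \<zeta> / 2) * exp (- y)) * (1 / pi * \<bar>W\<bar>)" by simp
    also have "exp (- Re (\<H> \<zeta>)) * exp (\<phi> \<zeta> / 2) * exp (- y) = exp (\<phi> w / 2) * exp (- y / 2 + e / 2)"
      unfolding e(1) by (simp add: exp_add[symmetric] add_divide_distrib)
    also have "exp (\<phi> w / 2) * exp (- y / 2 + e / 2) * (1 / pi * \<bar>W\<bar>) \<le> exp (\<phi> w / 2) * (K * sqrt N * exp (- y / 16))"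
    proof -
      have "\<bar>a0\<bar> \<le> M" using M(2)[of 0 x] by (simp add: a0_def)
      have a1: "\<bar>a1\<bar> \<le> 2 / r\<^sup>2 * M" using M(2)[of 1 x] by (simp add: a1_def)
      have a2: "\<bar>a2\<bar> \<le> (2 / r\<^sup>2)\<^sup>2 * M" using M(2)[of 2 x] by (simp add: a2_def)
      have Z: "\<bar>Z\<bar> \<le> M / r\<^sup>2 * (2 + y) ^ 3"
      proof -
        have "\<bar>Z\<bar> \<le> \<bar>2 - 2 * y\<bar> * \<bar>a1\<bar> + x * \<bar>a2\<bar>"
          unfolding Z_def using x0 by (intro order_trans[OF abs_triangle_ineq]) (simp add: abs_mult)
        also have "\<dots> \<le> (2 + 2 * y) * (2 / r\<^sup>2 * M) + r\<^sup>2 * ((2 / r\<^sup>2)\<^sup>2 * M)"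
          using y0 x0 xr M(1) by (intro add_mono mult_mono a1 a2) auto
        also have "\<dots> = M / r\<^sup>2 * (4 * (2 + y))" using r by (simp add: field_simps power2_eq_square)
        also have "\<dots> \<le> M / r\<^sup>2 * (2 + y) ^ 3"
        proof (rule mult_left_mono)
          have "4 \<le> (2 + y)\<^sup>2" using y0 by (simp add: power2_eq_square algebra_simps)
          then have "4 * (2 + y) \<le> (2 + y)\<^sup>2 * (2 + y)" using y0 by (intro mult_right_mono) auto
          then show "4 * (2 + y) \<le> (2 + y) ^ 3" by (simp add: power3_eq_cube power2_eq_square)
        qed (use M r in auto)
        finally show ?thesis .
      qed
      have E1: "\<bar>N * a0 * (2 - y) * (1 - exp (- e))\<bar> \<le> sqrt N * (M * c) * (2 + y) ^ 3 * exp (y / 4)"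
      proof -
        have "\<bar>1 - exp (- e)\<bar> \<le> \<bar>e\<bar> * exp \<bar>e\<bar>" using abs_exp_minus_1_le[of "- e"] by simp
        also have "\<dots> \<le> (c / sqrt N * ((1 + y) * y)) * exp (y / 4)" using e by (intro mult_mono) auto
        finally have "\<bar>N * a0 * (2 - y) * (1 - exp (- e))\<bar> \<le> N * M * (2 + y) * ((c / sqrt N * ((1 + y) * y)) * exp (y / 4))"
          unfolding abs_mult using N y0 M(1) \<open>\<bar>a0\<bar> \<le> M\<close> by (intro mult_mono) auto
        also have "\<dots> = sqrt N * (M * c) * ((2 + y) * (1 + y) * y) * exp (y / 4)"
        proof -
          have "N / sqrt N = sqrt N" using N by (simp add: real_div_sqrt)
          moreover have "N * M * (2 + y) * ((c / sqrt N * ((1 + y) * y)) * exp (y / 4))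
              = N / sqrt N * (M * c) * ((2 + y) * (1 + y) * y) * exp (y / 4)"
            by (simp add: mult_ac)
          ultimately show ?thesis by (simp only:)
        qed
        also have "\<dots> \<le> sqrt N * (M * c) * (2 + y) ^ 3 * exp (y / 4)"
        proof (intro mult_right_mono mult_left_mono)
          have "(2 + y) * (1 + y) * y \<le> (2 + y) * (2 + y) * (2 + y)" using y0 by (intro mult_mono) auto
          then show "(2 + y) * (1 + y) * y \<le> (2 + y) ^ 3" by (simp add: power3_eq_cube)
        qed (use N M c in auto)
        finally show ?thesis .
      qed
      have "\<bar>W\<bar> \<le> sqrt N * (M * c) * (2 + y) ^ 3 * exp (y / 4) + M / r\<^sup>2 * (2 + y) ^ 3"
        unfolding W_def by (rule order_trans[OF abs_triangle_ineq4 add_mono[OF E1 Z]])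
      also have "\<dots> \<le> sqrt N * (M * c) * (2 + y) ^ 3 * exp (y / 4) + sqrt N * (M / r\<^sup>2) * (2 + y) ^ 3 * exp (y / 4)"
      proof -
        have "1 * 1 \<le> sqrt N * exp (y / 4)" using N y0 by (intro mult_mono) auto
        then have "M / r\<^sup>2 * (2 + y) ^ 3 * 1 \<le> M / r\<^sup>2 * (2 + y) ^ 3 * (sqrt N * exp (y / 4))"
          using M(1) y0 by (intro mult_left_mono) auto
        then show ?thesis by (simp add: mult_ac)
      qed
      also have "\<dots> = sqrt N * (M * c + M / r\<^sup>2) * ((2 + y) ^ 3 * exp (y / 4))" by (simp add: algebra_simps)
      finally have W: "\<bar>W\<bar> \<le> sqrt N * (M * c + M / r\<^sup>2) * ((2 + y) ^ 3 * exp (y / 4))" .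
      have "1 / pi * \<bar>W\<bar> \<le> \<bar>W\<bar>" using pi_ge_two mult_left_le_one_le[of "\<bar>W\<bar>" "1 / pi"] by simp
      then have W': "1 / pi * \<bar>W\<bar> \<le> sqrt N * (M * c + M / r\<^sup>2) * ((2 + y) ^ 3 * exp (y / 4))" using W by linarith
      \<comment> \<open>Since |e| \<le> y/4 the prefactor decays like exp(-3y/8). The loss exp(y/4)
        inside W leaves exp(-y/8), and the cubic factor reduces this to exp(-y/16).\<close>
      have "exp (- y / 2 + e / 2) * (1 / pi * \<bar>W\<bar>) \<le> exp (- 3 * y / 8) * (sqrt N * (M * c + M / r\<^sup>2) * ((2 + y) ^ 3 * exp (y / 4)))"
      proof (rule mult_mono[OF _ W'])
        have "- y / 2 + e / 2 \<le> - 3 * y / 8" using e(2) by linarith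
        then show "exp (- y / 2 + e / 2) \<le> exp (- 3 * y / 8)" by simp
      qed auto
      also have "\<dots> = sqrt N * (M * c + M / r\<^sup>2) * ((2 + y) ^ 3 * (exp (- 3 * y / 8) * exp (y / 4)))" by simp
      also have "exp (- 3 * y / 8) * exp (y / 4) = exp (- y / 8)" by (simp add: exp_add[symmetric])
      also have "sqrt N * (M * c + M / r\<^sup>2) * ((2 + y) ^ 3 * exp (- y / 8)) \<le> sqrt N * (M * c + M / r\<^sup>2) * (K0 * exp (- y / 16))"
        using K0(2)[OF y0] N M c by (intro mult_left_mono) auto
      also have "\<dots> = K * sqrt N * exp (- y / 16)" by (simp add: K_def)
      finally show ?thesis
        using mult_left_mono[of _ _ "exp (\<phi> w / 2)"] by (simp only: mult.assoc exp_ge_zero)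
    qed
    finally show ?thesis
      unfolding cm unfolding a0_def[symmetric] a1_def[symmetric] a2_def[symmetric] unfolding T by (simp add: y_def mult_ac)
  qed
  moreover have "K > 0" using M(1) K0(1) c r by (simp add: K_def add_pos_pos)
  ultimately show ?thesis by (intro exI[of _ K] conjI allI impI) blast+
qed

text \<open>Apply \<open>radial_reproducing\<close> to f exp(-H) and F = rcut exp(-N x): its density
  yields f(w) exactly. It differs from the weighted conjugate of k only by the error already
  estimated, so Cauchy-Schwarz against f finishes.\<close>

lemma model_kernel_pairing:
  assumes r: "r > 0" and c: "c > 0"
  shows "\<exists>K>0. \<forall>S \<phi> N w \<H> f. open S \<longrightarrow> cball w (2 * r) \<subseteq> S \<longrightarrow> continuous_on S \<phi> \<longrightarrow> N \<ge> 1 \<longrightarrow>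
     quadratic_weight \<phi> N w r c \<H> \<longrightarrow> bianalytic_on f S \<longrightarrow>
     set_integrable lborel S (\<lambda>z. (cmod (f z))\<^sup>2 * exp (- \<phi> z)) \<longrightarrow>
     cmod (f w - (LINT z:S|lborel. f z * cnj (model_kernel \<phi> N w r \<H> z) * of_real (exp (- \<phi> z))))
       \<le> K * exp (\<phi> w / 2) * sqrt (LINT z:S|lborel. (cmod (f z))\<^sup>2 * exp (- \<phi> z))"
proof -
  define F where "F N x = rcut r 0 x * exp (- N * x)" for N x :: real
  define F1 where "F1 N x = (rcut r 1 x - N * rcut r 0 x) * exp (- N * x)" for N x :: real
  define F2 where "F2 N x = (rcut r 2 x - 2 * N * rcut r 1 x + N\<^sup>2 * rcut r 0 x) * exp (- N * x)" for N x :: real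
  \<comment> \<open>The factor exp(\<phi>/2) lets Cauchy-Schwarz be used without weight, on \<Theta>
    and f exp(-\<phi>/2).\<close>
  define \<Theta> where "\<Theta> \<phi> N w \<H> \<zeta> = of_real (exp (\<phi> \<zeta> / 2)) * (- (1 / of_real pi) * exp (- \<H> \<zeta>) *
        of_real (2 * F1 N ((cmod (\<zeta> - w))\<^sup>2) + (cmod (\<zeta> - w))\<^sup>2 * F2 N ((cmod (\<zeta> - w))\<^sup>2))
       - cnj (model_kernel \<phi> N w r \<H> \<zeta>) * of_real (exp (- \<phi> \<zeta>)))" for \<phi> N w \<H> \<zeta>
  obtain K0 where K0': "K0 > 0 \<and> (\<forall>\<phi> N w \<H> \<zeta>. N \<ge> 1 \<longrightarrow> quadratic_weight \<phi> N w r c \<H> \<longrightarrow> \<zeta> \<in> cball w r \<longrightarrow>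
     cmod (\<Theta> \<phi> N w \<H> \<zeta>) \<le> K0 * exp (\<phi> w / 2) * sqrt N * exp (- (N * (cmod (\<zeta> - w))\<^sup>2) / 16))"
    unfolding \<Theta>_def F1_def F2_def using model_kernel_error_bound[OF r c] by (rule exE)
  have K0: "K0 > 0" using K0' by simp
  have \<Theta>: "cmod (\<Theta> \<phi> N w \<H> \<zeta>) \<le> K0 * exp (\<phi> w / 2) * sqrt N * exp (- (N * (cmod (\<zeta> - w))\<^sup>2) / 16)"
    if "N \<ge> 1" "quadratic_weight \<phi> N w r c \<H>" "\<zeta> \<in> cball w r" for \<phi> N w \<H> \<zeta>
    using K0' that by simp
  \<comment> \<open>After squaring, the Gaussian has exponent N/8 and mass 8 pi / N, which cancels
    the N coming from (sqrt N)^2; the bound is uniform in N.\<close>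
  define K where "K = K0 * sqrt (8 * pi)"
  have "cmod (f w - (LINT z:S|lborel. f z * cnj (model_kernel \<phi> N w r \<H> z) * of_real (exp (- \<phi> z))))
       \<le> K * exp (\<phi> w / 2) * sqrt (LINT z:S|lborel. (cmod (f z))\<^sup>2 * exp (- \<phi> z))"
    if S: "open S" "cball w (2 * r) \<subseteq> S" and \<phi>: "continuous_on S \<phi>" and N: "N \<ge> 1"
      and q: "quadratic_weight \<phi> N w r c \<H>" and f: "bianalytic_on f S"
      and fi: "set_integrable lborel S (\<lambda>z. (cmod (f z))\<^sup>2 * exp (- \<phi> z))" for S \<phi> N w \<H> f
  proof -
    have \<H>: "\<H> holomorphic_on UNIV" "\<H> w = 0" using q by (auto simp: quadratic_weight_def)
    have subr: "cball w r \<subseteq> S" using subset_cball[of r "2 * r" w] S(2) r by auto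
    let ?x = "\<lambda>\<zeta>. (cmod (\<zeta> - w))\<^sup>2" and ?k = "model_kernel \<phi> N w r \<H>"
    define T where "T \<zeta> = complex_of_real (2 * F1 N (?x \<zeta>) + ?x \<zeta> * F2 N (?x \<zeta>))" for \<zeta>
    define g where "g \<zeta> = f \<zeta> * exp (- \<H> \<zeta>)" for \<zeta>
    have F2c: "continuous_on A (F2 N)" for A
      unfolding F2_def[abs_def] by (intro continuous_intros continuous_rcut)+
    have van: "rcut r i x = 0" if "x \<ge> r\<^sup>2" "i \<le> 3" for i x using rcut_outside[OF r] that by simp
    have "(LINT z|lborel. g z * T z) = - of_real (pi * F N 0) * g w"
      unfolding T_def
    proof (rule radial_reproducing[where r = r and R = "2 * r"])
      show "(F N has_real_derivative F1 N x) (at x)" for x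
        using DERIV_rcut[of 0 r x] unfolding F_def[abs_def] F1_def
        by (auto intro!: derivative_eq_intros simp: algebra_simps)
      show "(F1 N has_real_derivative F2 N x) (at x)" for x
        using DERIV_rcut[of 0 r x] DERIV_rcut[of 1 r x] unfolding F1_def[abs_def] F2_def
        by (auto intro!: derivative_eq_intros simp: algebra_simps power2_eq_square numeral_2_eq_2)
      have "ball w (2 * r) \<subseteq> S" using S(2) ball_subset_cball by blast
      then show "bianalytic_on g (ball w (2 * r))"
        unfolding g_def[abs_def]
        by (intro bianalytic_on_mult_holomorphic bianalytic_on_subset[OF f] open_ball holomorphic_intros holomorphic_on_subset[OF \<H>(1)]) auto
    qed (use r van F2c in \<open>auto simp: F_def F1_def F2_def\<close>)
    moreover have "F N 0 = 1" using rcut_inside[OF r, of 0 0] by (simp add: F_def)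
    ultimately have rep: "(LINT z|lborel. g z * T z) = - of_real pi * f w" by (simp add: g_def \<H>)
    have Tc: "Ckc 0 S T"
      unfolding T_def[abs_def]
      by (rule Ckc_radial[of 0 "\<lambda>i x. 2 * F1 N x + x * F2 N x" r, OF _ _ _ subr r])
         (auto intro!: continuous_intros continuous_rcut simp: F1_def F2_def van)
    have kc: "Ckc 0 S ?k" using Ckc_mono[OF Ckc_model_kernel[OF _ subr r \<H>(1)], of 0 S] S by auto
    have fc: "Ck_on 0 f S" using bianalytic_continuous_on[OF f] by simp
    have e1: "Ck_on 0 (\<lambda>\<zeta>. complex_of_real (exp (\<phi> \<zeta> / 2))) S" "Ck_on 0 (\<lambda>\<zeta>. complex_of_real (exp (- \<phi> \<zeta>))) S"
      "Ck_on 0 (\<lambda>\<zeta>. complex_of_real (exp (- \<phi> \<zeta> / 2))) S"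
      unfolding Ck_on.simps(1) by (intro continuous_intros \<phi>; simp)+
    have expH: "Ck_on 0 (\<lambda>\<zeta>. a * exp (- \<H> \<zeta>)) S" for a
      by (intro Ck_on_exp_holomorphic holomorphic_intros \<H>)
    have gT: "Ckc 0 S (\<lambda>z. g z * T z)"
      unfolding g_def using expH[of 1] by (intro Ckc_mult Ck_on_mult S fc Tc) simp
    let ?\<Theta> = "\<Theta> \<phi> N w \<H>"
    have \<Theta>c: "Ckc 0 S ?\<Theta>"
      unfolding \<Theta>_def[abs_def] T_def[symmetric]
      by (intro Ckc_mult[OF S(1) e1(1)] Ckc_diff Ckc_mult[OF S(1) expH Tc] Ckc_mult_right S Ckc_cnj kc e1)
    have fkc: "Ckc 0 S (\<lambda>z. f z * cnj (?k z) * of_real (exp (- \<phi> z)))"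
      by (intro Ckc_mult_right[OF S(1) e1(2)] Ckc_mult S fc Ckc_cnj kc)
    define ft where "ft z = indicator S z *\<^sub>R (of_real (exp (- \<phi> z / 2)) * f z)" for z
    have ftm: "ft \<in> borel_measurable lborel"
    proof -
      have "(\<lambda>z. indicator S z *\<^sub>R (of_real (exp (- \<phi> z / 2)) * f z)) \<in> borel_measurable borel"
        using S(1) Ck_on_mult[OF S(1) e1(3) fc]
        by (intro borel_measurable_continuous_on_indicator) auto
      then show ?thesis by (simp add: ft_def[abs_def])
    qed
    have ftsq: "(cmod (ft z))\<^sup>2 = indicator S z *\<^sub>R ((cmod (f z))\<^sup>2 * exp (- \<phi> z))" for z
      by (simp add: ft_def norm_mult power_mult_distrib exp_double[symmetric] indicator_def)
    have \<Theta>i: "integrable lborel (\<lambda>z. (cmod (?\<Theta> z))\<^sup>2)"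
      using integrable_weighted_square[OF S(1) \<Theta>c, of "\<lambda>_. 1"] by simp
    have fti: "integrable lborel (\<lambda>z. (cmod (ft z))\<^sup>2)"
      using fi unfolding ftsq set_integrable_def .
    have "cmod (LINT z|lborel. ft z * ?\<Theta> z) \<le> sqrt (LINT z|lborel. (cmod (ft z))\<^sup>2) * sqrt (LINT z|lborel. (cmod (?\<Theta> z))\<^sup>2)"
      using Ckc_integrable[OF \<Theta>c] by (intro Cauchy_Schwarz_integral(3) ftm fti \<Theta>i) auto
    moreover have "(LINT z|lborel. ft z * ?\<Theta> z) = f w - (LINT z:S|lborel. f z * cnj (?k z) * of_real (exp (- \<phi> z)))"
    proof -
      have "ft z * ?\<Theta> z = - (1 / of_real pi) * (g z * T z) - indicator S z *\<^sub>R (f z * cnj (?k z) * of_real (exp (- \<phi> z)))" for z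
      proof (cases "z \<in> S")
        case True
        have "complex_of_real (exp (- \<phi> z / 2)) * of_real (exp (\<phi> z / 2)) = 1"
          by (simp add: of_real_mult[symmetric] exp_add[symmetric] del: of_real_mult)
        then have "ft z * ?\<Theta> z = f z * (- (1 / of_real pi) * exp (- \<H> z) * T z - cnj (?k z) * of_real (exp (- \<phi> z)))"
          using True unfolding ft_def \<Theta>_def T_def by (simp add: mult.assoc[symmetric] mult.commute[of _ "f z"])
        then show ?thesis using True by (simp add: g_def algebra_simps)
      next
        case False
        then show ?thesis using Ckc_outside[OF Tc False] by (simp add: ft_def)
      qed
      then have "(LINT z|lborel. ft z * ?\<Theta> z) = (LINT z|lborel. - (1 / of_real pi) * (g z * T z) - indicator S z *\<^sub>R (f z * cnj (?k z) * of_real (exp (- \<phi> z))))"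
        by (intro Bochner_Integration.integral_cong refl)
      also have "\<dots> = (LINT z|lborel. - (1 / of_real pi) * (g z * T z)) - (LINT z|lborel. indicator S z *\<^sub>R (f z * cnj (?k z) * of_real (exp (- \<phi> z))))"
        using S(1) by (intro Bochner_Integration.integral_diff integrable_mult_right Ckc_integrable[OF gT] integrable_mult_indicator Ckc_integrable[OF fkc]) auto
      also have "(LINT z|lborel. - (1 / of_real pi) * (g z * T z)) = f w"
        unfolding integral_mult_right_zero rep by simp
      finally show ?thesis by (simp add: set_lebesgue_integral_def)
    qed
    moreover have "(LINT z|lborel. (cmod (ft z))\<^sup>2) = (LINT z:S|lborel. (cmod (f z))\<^sup>2 * exp (- \<phi> z))"
      by (simp add: ftsq set_lebesgue_integral_def)
    moreover have "sqrt (LINT z|lborel. (cmod (?\<Theta> z))\<^sup>2) \<le> K * exp (\<phi> w / 2)"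
    proof -
      have "(cmod (?\<Theta> z))\<^sup>2 \<le> (K0\<^sup>2 * exp (\<phi> w) * N) * exp (- (N / 8) * ?x z)" for z
      proof (cases "z \<in> cball w r")
        case True
        have "(cmod (?\<Theta> z))\<^sup>2 \<le> (K0 * exp (\<phi> w / 2) * sqrt N * exp (- (N * ?x z) / 16))\<^sup>2"
          using \<Theta>[OF N q True] by (intro power_mono) auto
        also have "\<dots> = (K0\<^sup>2 * exp (\<phi> w) * N) * exp (- (N / 8) * ?x z)"
          using N by (simp add: power_mult_distrib exp_double[symmetric])
        finally show ?thesis .
      next
        case False
        then have "?x z \<ge> r\<^sup>2" using r by (intro power_mono) (auto simp: dist_norm norm_minus_commute)
        then have "?\<Theta> z = 0" by (simp add: \<Theta>_def F1_def F2_def model_kernel_def van)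
        then show ?thesis using N by simp
      qed
      then have "(\<integral>\<^sup>+z. ennreal ((cmod (?\<Theta> z))\<^sup>2) \<partial>lborel) \<le> (\<integral>\<^sup>+z. ennreal (K0\<^sup>2 * exp (\<phi> w) * N) * ennreal (exp (- (N / 8) * ?x z)) \<partial>lborel)"
        using N by (intro nn_integral_mono) (simp add: ennreal_mult[symmetric] ennreal_leI)
      also have "\<dots> = ennreal (K0\<^sup>2 * exp (\<phi> w) * N) * ennreal (pi / (N / 8))"
        using nn_integral_gaussian[of "N / 8" w] N by (subst nn_integral_cmult) auto
      also have "\<dots> = ennreal (K0\<^sup>2 * exp (\<phi> w) * (8 * pi))"
        using N by (simp add: ennreal_mult[symmetric] mult_ac)
      finally have "ennreal (LINT z|lborel. (cmod (?\<Theta> z))\<^sup>2) \<le> ennreal (K0\<^sup>2 * exp (\<phi> w) * (8 * pi))"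
        using nn_integral_eq_integral[OF \<Theta>i] by simp
      then have "(LINT z|lborel. (cmod (?\<Theta> z))\<^sup>2) \<le> K0\<^sup>2 * exp (\<phi> w) * (8 * pi)" by simp
      also have "\<dots> = (K * exp (\<phi> w / 2))\<^sup>2" by (simp add: K_def power_mult_distrib exp_double[symmetric])
      finally show ?thesis using K0 by (intro real_le_lsqrt) (auto simp: K_def)
    qed
    ultimately have "cmod (f w - (LINT z:S|lborel. f z * cnj (?k z) * of_real (exp (- \<phi> z))))
       \<le> sqrt (LINT z:S|lborel. (cmod (f z))\<^sup>2 * exp (- \<phi> z)) * sqrt (LINT z|lborel. (cmod (?\<Theta> z))\<^sup>2)" by simp
    also have "\<dots> \<le> sqrt (LINT z:S|lborel. (cmod (f z))\<^sup>2 * exp (- \<phi> z)) * (K * exp (\<phi> w / 2))"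
      using \<open>sqrt (LINT z|lborel. (cmod (?\<Theta> z))\<^sup>2) \<le> K * exp (\<phi> w / 2)\<close>
      by (intro mult_left_mono) (simp_all flip: \<open>(LINT z|lborel. (cmod (ft z))\<^sup>2) = (LINT z:S|lborel. (cmod (f z))\<^sup>2 * exp (- \<phi> z))\<close>)
    finally show ?thesis by (simp only: mult_ac)
  qed
  moreover have "K > 0" using K0 by (simp add: K_def)
  ultimately show ?thesis by (intro exI[of _ K] conjI allI impI)
qed

text \<open>Both d-bar derivatives are moved onto k, where only the cutoff annulus survives. There y
  is at least N r^2 / 2, so powers of N are powers of y and fall to the Gaussian. The lower bound l0
  on L is required only near w, where the data live.\<close>

lemma model_kernel_data_bound:
  assumes r: "r > 0" and l0: "l0 > 0"
  shows "\<exists>K>0. \<forall>S \<phi> L N w \<H> c \<psi>. open S \<longrightarrow> cball w r \<subseteq> S \<longrightarrow> continuous_on S \<phi> \<longrightarrow> continuous_on S L \<longrightarrow>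
     (\<forall>z\<in>S. L z > 0) \<longrightarrow> (\<forall>z\<in>cball w r. l0 \<le> L z) \<longrightarrow> N \<ge> 1 \<longrightarrow> quadratic_weight \<phi> N w r c \<H> \<longrightarrow>
     Ckc 3 S \<psi> \<longrightarrow> (LINT z|lborel. (L z)\<^sup>2 * exp (\<phi> z) * (cmod (\<psi> z))\<^sup>2) \<le> wnorm2 \<phi> \<psi> \<longrightarrow>
     cmod (LINT z|lborel. model_kernel \<phi> N w r \<H> z * dbar (dbar \<psi>) z) \<le> K * exp (\<phi> w / 2) * sqrt (wnorm2 \<phi> \<psi>)"
proof -
  obtain M where M': "M > 0 \<and> (\<forall>i\<le>3. \<forall>r x. r > 0 \<longrightarrow> \<bar>rcut r i x\<bar> \<le> (2 / r\<^sup>2) ^ i * M)"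
    using rcut_bounded by (rule exE)
  have M: "M > 0" using M' by simp
  have Mb: "\<bar>rcut r i x\<bar> \<le> (2 / r\<^sup>2) ^ i * M" if "i \<le> 3" for i x
    using M' r that by auto
  obtain K0 where K0': "K0 > 0 \<and> (\<forall>y\<ge>0. (2 + y) ^ 3 * exp (- y / 8) \<le> K0 * exp (- y / 16 :: real))"
    using cubic_exp_bound by (rule exE)
  have K0: "K0 > 0" using K0' by simp
  have K0b: "(2 + y) ^ 3 * exp (- y / 8) \<le> K0" if "y \<ge> 0" for y
  proof -
    have "(2 + y) ^ 3 * exp (- y / 8) \<le> K0 * exp (- y / 16)" using K0' that by simp
    also have "\<dots> \<le> K0 * 1" using K0 that by (intro mult_left_mono) auto
    finally show ?thesis by simp
  qed
  define A where "A = 12 * M / r ^ 4 * K0"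
  have A: "A > 0" using M K0 r by (simp add: A_def)
  define K where "K = A / l0 * sqrt (pi * r\<^sup>2)"
  have "cmod (LINT z|lborel. model_kernel \<phi> N w r \<H> z * dbar (dbar \<psi>) z) \<le> K * exp (\<phi> w / 2) * sqrt (wnorm2 \<phi> \<psi>)"
    if S: "open S" "cball w r \<subseteq> S" and \<phi>: "continuous_on S \<phi>" and L: "continuous_on S L" "\<forall>z\<in>S. L z > 0" "\<forall>z\<in>cball w r. l0 \<le> L z"
      and N: "N \<ge> 1" and q: "quadratic_weight \<phi> N w r c \<H>" and \<psi>: "Ckc 3 S \<psi>"
      and ineq: "(LINT z|lborel. (L z)\<^sup>2 * exp (\<phi> z) * (cmod (\<psi> z))\<^sup>2) \<le> wnorm2 \<phi> \<psi>" for S \<phi> L N w \<H> c \<psi>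
  proof -
    have \<H>: "\<H> holomorphic_on UNIV" using q by (auto simp: quadratic_weight_def)
    let ?k = "model_kernel \<phi> N w r \<H>"
    define Y where "Y = dbar (dbar ?k)"
    have kc: "Ckc (Suc (Suc 0)) S ?k" using Ckc_model_kernel[OF _ S(2) r \<H>] S(1) by (simp add: numeral_2_eq_2)
    have Yc: "Ckc 0 S Y" unfolding Y_def by (rule Ckc_dbar2[OF kc])
    \<comment> \<open>Turns the factor L^2 into part of the exponent, so that the weighted
      Cauchy-Schwarz inequality applies as it stands.\<close>
    define \<phi>' where "\<phi>' z = \<phi> z + 2 * ln (L z)" for z
    have \<phi>'c: "continuous_on S \<phi>'" unfolding \<phi>'_def using L(2) by (intro continuous_intros \<phi> L) (auto simp: less_imp_neq[symmetric])
    have e': "exp (\<phi>' z) = (L z)\<^sup>2 * exp (\<phi> z)" if "z \<in> S" for z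
      using L(2) that by (simp add: \<phi>'_def exp_add exp_double)
    define X where "X z = of_real (exp (- \<phi>' z)) * Y z" for z
    have Xc: "Ckc 0 S X" unfolding X_def[abs_def] using \<phi>'c
      by (intro Ckc_mult S Yc) (auto intro!: continuous_intros)
    have \<psi>0: "Ckc 0 S \<psi>" using Ckc_mono[OF \<psi>] by simp
    have YX: "of_real (exp (\<phi>' z)) * X z = Y z" for z
      by (simp add: X_def mult.assoc[symmetric] of_real_mult[symmetric] exp_add[symmetric] del: of_real_mult)
    have "(LINT z|lborel. ?k z * dbar (dbar \<psi>) z) = (LINT z|lborel. Y z * \<psi> z)"
      unfolding Y_def using Ckc_mono[OF \<psi>, of 2 S] kc
      by (intro integral_dbar2_by_parts[OF S(1)]) (auto simp: numeral_2_eq_2 intro: Ckc_Ck_on)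
    then have "cmod (LINT z|lborel. ?k z * dbar (dbar \<psi>) z) \<le> (LINT z|lborel. cmod (of_real (exp (\<phi>' z)) * X z * \<psi> z))"
      unfolding YX using integral_norm_bound[of lborel "\<lambda>z. Y z * \<psi> z"] by simp
    also have "\<dots> \<le> sqrt (LINT z|lborel. exp (\<phi>' z) * (cmod (X z))\<^sup>2) * sqrt (LINT z|lborel. exp (\<phi>' z) * (cmod (\<psi> z))\<^sup>2)"
      by (rule weighted_Cauchy_Schwarz[OF S(1) \<phi>'c Xc \<psi>0])
    also have "\<dots> \<le> (K * exp (\<phi> w / 2)) * sqrt (wnorm2 \<phi> \<psi>)"
    proof (intro mult_mono)
      have "exp (\<phi>' z) * (cmod (\<psi> z))\<^sup>2 = (L z)\<^sup>2 * exp (\<phi> z) * (cmod (\<psi> z))\<^sup>2" for z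
        using e'[of z] Ckc_outside[OF \<psi>0, of z] by (cases "z \<in> S") auto
      then have "(LINT z|lborel. exp (\<phi>' z) * (cmod (\<psi> z))\<^sup>2) = (LINT z|lborel. (L z)\<^sup>2 * exp (\<phi> z) * (cmod (\<psi> z))\<^sup>2)"
        by (intro Bochner_Integration.integral_cong refl)
      then show "sqrt (LINT z|lborel. exp (\<phi>' z) * (cmod (\<psi> z))\<^sup>2) \<le> sqrt (wnorm2 \<phi> \<psi>)"
        using ineq by (intro real_sqrt_le_mono) simp
      have pt: "exp (\<phi>' z) * (cmod (X z))\<^sup>2 \<le> (A / l0 * exp (\<phi> w / 2))\<^sup>2 * indicator (cball w r) z" for z
      proof (cases "z \<in> cball w r")
        case False
        then have "(cmod (z - w))\<^sup>2 \<ge> r\<^sup>2" using r by (intro power_mono) (auto simp: dist_norm norm_minus_commute)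
        then have "Y z = 0" unfolding Y_def dbar2_model_kernel[OF \<H>] by (simp add: rcut_outside[OF r])
        then show ?thesis using False by (simp add: X_def)
      next
        case True
        define x where "x = (cmod (z - w))\<^sup>2"
        define y where "y = N * x"
        obtain e where e: "\<phi> z = \<phi> w + 2 * Re (\<H> z) + y + e" "\<bar>e\<bar> \<le> y / 4"
          by (rule quadratic_weightD[OF q True, folded x_def, folded y_def])
        have y0: "0 \<le> y" using N by (auto simp: x_def y_def)
        define G where "G = rcut r 2 x * (2 - y) - 2 * N * rcut r 1 x"
        \<comment> \<open>The factor y arises from N |\<zeta> - w|^2 in the modulus of Y. Off the
          inner disc N \<le> 2y/r^2 absorbs the explicit N in G; on it both derivatives of the
          cutoff vanish.\<close>
        have yG: "y * \<bar>G\<bar> \<le> 12 * M / r ^ 4 * (2 + y) ^ 3"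
        proof (cases "x \<le> r\<^sup>2 / 2")
          case True
          then have "G = 0" by (simp add: G_def rcut_inside[OF r])
          then show ?thesis using y0 M by simp
        next
          case False
          then have "r\<^sup>2 / 2 * N \<le> x * N" using N by (intro mult_right_mono) auto
          then have Ny: "N \<le> 2 * y / r\<^sup>2" using r by (simp add: y_def field_simps)
          have "\<bar>G\<bar> \<le> \<bar>rcut r 2 x\<bar> * \<bar>2 - y\<bar> + 2 * N * \<bar>rcut r 1 x\<bar>"
            unfolding G_def using N by (intro order_trans[OF abs_triangle_ineq4]) (simp add: abs_mult)
          also have "\<dots> \<le> ((2 / r\<^sup>2)\<^sup>2 * M) * (2 + y) + 2 * (2 * y / r\<^sup>2) * (2 / r\<^sup>2 * M)"
            using Mb[of 1 x] Mb[of 2 x] N Ny y0 M by (intro add_mono mult_mono) auto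
          also have "\<dots> = (4 * M / r ^ 4) * (2 + y) + (8 * M / r ^ 4) * y"
            by (simp add: power_divide power4_eq_xxxx power2_eq_square mult_ac)
          also have "\<dots> \<le> (4 * M / r ^ 4) * (2 + y) + (8 * M / r ^ 4) * (2 + y)"
            using M r by (intro add_mono mult_left_mono) auto
          also have "\<dots> = 12 * M / r ^ 4 * (2 + y)"
            by (simp only: distrib_right[symmetric] add_divide_distrib[symmetric]) simp
          finally have "y * \<bar>G\<bar> \<le> (2 + y) * (12 * M / r ^ 4 * (2 + y))" using y0 by (intro mult_mono) auto
          also have "\<dots> = 12 * M / r ^ 4 * (2 + y)\<^sup>2" by (simp add: power2_eq_square)
          also have "\<dots> \<le> 12 * M / r ^ 4 * (2 + y) ^ 3" using y0 M by (intro mult_left_mono power_increasing) auto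
          finally show ?thesis .
        qed
        have "cmod (Y z) = (N / pi * exp (\<phi> w)) * exp (Re (\<H> z)) * (\<bar>G\<bar> * x)"
        proof -
          have "Y z = (of_real (N / pi * exp (\<phi> w)) * exp (\<H> z)) * (of_real G * (z - w)\<^sup>2)"
            unfolding Y_def dbar2_model_kernel[OF \<H>] G_def y_def x_def ..
          then have "cmod (Y z) = \<bar>N / pi * exp (\<phi> w)\<bar> * exp (Re (\<H> z)) * (\<bar>G\<bar> * (cmod (z - w))\<^sup>2)"
            by (simp only: norm_mult norm_power norm_of_real norm_exp_eq_Re)
          then show ?thesis using N by (simp add: x_def)
        qed
        also have "\<dots> = exp (\<phi> w) * exp (Re (\<H> z)) * (1 / pi * (y * \<bar>G\<bar>))" by (simp add: y_def)
        also have "\<dots> \<le> exp (\<phi> w) * exp (Re (\<H> z)) * (1 * (12 * M / r ^ 4 * (2 + y) ^ 3))"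
        proof (rule mult_left_mono)
          have "1 / pi \<le> 1" using pi_ge_two by (simp add: divide_le_eq)
          then show "1 / pi * (y * \<bar>G\<bar>) \<le> 1 * (12 * M / r ^ 4 * (2 + y) ^ 3)"
            using yG y0 by (rule_tac mult_mono) auto
        qed auto
        finally have Yb: "cmod (Y z) \<le> exp (\<phi> w) * exp (Re (\<H> z)) * (12 * M / r ^ 4 * (2 + y) ^ 3)" by simp
        have "exp (\<phi>' z) * (cmod (X z))\<^sup>2 = (exp (- \<phi>' z / 2) * cmod (Y z))\<^sup>2"
          by (simp add: X_def norm_mult power_mult_distrib exp_double[symmetric]) (simp add: mult.assoc[symmetric] exp_add[symmetric])
        also have "\<dots> \<le> (A / l0 * exp (\<phi> w / 2))\<^sup>2"
        proof (rule power_mono)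
          have Lz: "l0 \<le> L z" using L(3) True by blast
          have "exp (- \<phi>' z / 2) = exp (- \<phi> z / 2) / L z"
          proof -
            have "- \<phi>' z / 2 = - \<phi> z / 2 - ln (L z)" by (simp add: \<phi>'_def field_simps)
            then show ?thesis using Lz l0 by (simp add: exp_diff)
          qed
          also have "\<dots> \<le> exp (- \<phi> z / 2) / l0" using Lz l0 by (intro divide_left_mono) auto
          finally have "exp (- \<phi>' z / 2) * cmod (Y z) \<le> (exp (- \<phi> z / 2) / l0) * (exp (\<phi> w) * exp (Re (\<H> z)) * (12 * M / r ^ 4 * (2 + y) ^ 3))"
            using Yb l0 by (intro mult_mono) auto
          also have "\<dots> = (exp (- \<phi> z / 2) * exp (\<phi> w) * exp (Re (\<H> z))) * (12 * M / r ^ 4 * (2 + y) ^ 3) / l0" by (simp add: mult_ac)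
          also have "exp (- \<phi> z / 2) * exp (\<phi> w) * exp (Re (\<H> z)) = exp (\<phi> w / 2) * exp (- y / 2 - e / 2)"
            unfolding e(1) by (simp add: exp_add[symmetric]) (simp add: field_simps)
          also have "(exp (\<phi> w / 2) * exp (- y / 2 - e / 2)) * (12 * M / r ^ 4 * (2 + y) ^ 3) / l0
              = exp (\<phi> w / 2) / l0 * (12 * M / r ^ 4) * ((2 + y) ^ 3 * exp (- y / 2 - e / 2))" by (simp add: mult_ac)
          also have "\<dots> \<le> exp (\<phi> w / 2) / l0 * (12 * M / r ^ 4) * K0"
          proof (rule mult_left_mono)
            have "- y / 2 - e / 2 \<le> - y / 8" using e(2) y0 by linarith
            then have "(2 + y) ^ 3 * exp (- y / 2 - e / 2) \<le> (2 + y) ^ 3 * exp (- y / 8)" using y0 by (intro mult_left_mono) auto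
            then show "(2 + y) ^ 3 * exp (- y / 2 - e / 2) \<le> K0" using K0b[OF y0] by linarith
          qed (use M l0 in auto)
          also have "\<dots> = A / l0 * exp (\<phi> w / 2)" by (simp add: A_def mult_ac)
          finally show "exp (- \<phi>' z / 2) * cmod (Y z) \<le> A / l0 * exp (\<phi> w / 2)" .
        qed auto
        finally show ?thesis using True by simp
      qed
      have "(LINT z|lborel. exp (\<phi>' z) * (cmod (X z))\<^sup>2) \<le> (LINT z|lborel. (A / l0 * exp (\<phi> w / 2))\<^sup>2 * indicator (cball w r) z)"
      proof (rule integral_mono[OF _ _ pt])
        show "integrable lborel (\<lambda>z. exp (\<phi>' z) * (cmod (X z))\<^sup>2)"
          by (rule integrable_weighted_square[OF S(1) Xc]) (intro continuous_intros \<phi>'c)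
        show "integrable lborel (\<lambda>z. (A / l0 * exp (\<phi> w / 2))\<^sup>2 * indicator (cball w r) z)"
          using emeasure_cball_complex[of r w] r by (intro integrable_mult_right integrable_real_indicator) auto
      qed
      also have "\<dots> = (A / l0 * exp (\<phi> w / 2))\<^sup>2 * (pi * r\<^sup>2)"
        using emeasure_cball_complex[of r w] r by (simp add: measure_def)
      also have "\<dots> = (K * exp (\<phi> w / 2))\<^sup>2"
      proof -
        have "(sqrt (pi * r\<^sup>2))\<^sup>2 = pi * r\<^sup>2" by (rule real_sqrt_pow2) simp
        then show ?thesis unfolding K_def by (simp only: power_mult_distrib power_divide times_divide_eq_left) (simp only: mult_ac)
      qed
      finally show "sqrt (LINT z|lborel. exp (\<phi>' z) * (cmod (X z))\<^sup>2) \<le> K * exp (\<phi> w / 2)"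
        using A l0 r by (intro real_le_lsqrt) (auto simp: K_def)
      show "0 \<le> K * exp (\<phi> w / 2)" using A l0 r by (simp add: K_def)
    qed (simp add: wnorm2_nonneg)
    finally show ?thesis by simp
  qed
  moreover have "K > 0" using A l0 r by (simp add: K_def)
  ultimately show ?thesis by (intro exI[of _ K] conjI allI impI)
qed

section \<open>Comparison with the Bergman kernel\<close>

lemma weighted_inner_product:
  fixes f g :: "complex \<Rightarrow> complex" and \<phi> :: "complex \<Rightarrow> real"
  assumes S: "open S" and \<phi>: "continuous_on S \<phi>" and f: "continuous_on S f" and g: "continuous_on S g"
    and fi: "set_integrable lborel S (\<lambda>z. (cmod (f z))\<^sup>2 * exp (- \<phi> z))"
    and gi: "set_integrable lborel S (\<lambda>z. (cmod (g z))\<^sup>2 * exp (- \<phi> z))"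
  shows "set_integrable lborel S (\<lambda>z. f z * cnj (g z) * of_real (exp (- \<phi> z)))"
    and "cmod (LINT z:S|lborel. f z * cnj (g z) * of_real (exp (- \<phi> z)))
      \<le> sqrt (LINT z:S|lborel. (cmod (f z))\<^sup>2 * exp (- \<phi> z)) * sqrt (LINT z:S|lborel. (cmod (g z))\<^sup>2 * exp (- \<phi> z))"
    and "set_integrable lborel S (\<lambda>z. (cmod (f z - g z))\<^sup>2 * exp (- \<phi> z))"
proof -
  define E where "E z = complex_of_real (exp (- \<phi> z / 2))" for z
  have E: "continuous_on S E" unfolding E_def by (intro continuous_intros \<phi>) simp
  have EE: "E z * E z = of_real (exp (- \<phi> z))" for z
    by (simp add: E_def of_real_mult[symmetric] exp_add[symmetric] del: of_real_mult)
  define F where "F h z = indicator S z *\<^sub>R (E z * h z)" for h z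
  have Fm: "F h \<in> borel_measurable lborel" if "continuous_on S h" for h
    using borel_measurable_continuous_on_indicator[of S "\<lambda>z. E z * h z"] S that E
    by (simp add: F_def[abs_def] continuous_intros)
  have sq: "(cmod (F h z))\<^sup>2 = indicator S z *\<^sub>R ((cmod (h z))\<^sup>2 * exp (- \<phi> z))" for h z
    by (simp add: F_def E_def norm_mult power_mult_distrib exp_double[symmetric] indicator_def)
  have fm: "F f \<in> borel_measurable lborel" and gm: "(\<lambda>z. cnj (F g z)) \<in> borel_measurable lborel"
    using Fm[OF f] measurable_compose[OF Fm[OF g] borel_measurable_continuous_onI[OF continuous_on_cnj[OF continuous_on_id]]] by auto
  have i: "integrable lborel (\<lambda>z. (cmod (F f z))\<^sup>2)" "integrable lborel (\<lambda>z. (cmod (cnj (F g z)))\<^sup>2)"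
    using fi gi unfolding set_integrable_def complex_mod_cnj sq by auto
  have eq: "F f z * cnj (F g z) = indicator S z *\<^sub>R (f z * cnj (g z) * of_real (exp (- \<phi> z)))" for z
    by (simp add: F_def EE[symmetric] E_def indicator_def mult_ac)
  show "set_integrable lborel S (\<lambda>z. f z * cnj (g z) * of_real (exp (- \<phi> z)))"
    using Cauchy_Schwarz_integral(1)[OF fm gm i] unfolding eq set_integrable_def .
  show "cmod (LINT z:S|lborel. f z * cnj (g z) * of_real (exp (- \<phi> z)))
      \<le> sqrt (LINT z:S|lborel. (cmod (f z))\<^sup>2 * exp (- \<phi> z)) * sqrt (LINT z:S|lborel. (cmod (g z))\<^sup>2 * exp (- \<phi> z))"
    using Cauchy_Schwarz_integral(3)[OF fm gm i] unfolding eq complex_mod_cnj sq set_lebesgue_integral_def .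
  have "integrable lborel (\<lambda>z. (cmod (F (\<lambda>z. f z - g z) z))\<^sup>2)"
  proof (rule Bochner_Integration.integrable_bound)
    show "integrable lborel (\<lambda>z. 2 * (cmod (F f z))\<^sup>2 + 2 * (cmod (F g z))\<^sup>2)" using i by simp
    have "F (\<lambda>z. f z - g z) \<in> borel_measurable lborel" by (rule Fm) (intro continuous_intros f g)
    then show "(\<lambda>z. (cmod (F (\<lambda>z. f z - g z) z))\<^sup>2) \<in> borel_measurable lborel" by measurable
    have "(cmod (F (\<lambda>z. f z - g z) z))\<^sup>2 \<le> 2 * (cmod (F f z))\<^sup>2 + 2 * (cmod (F g z))\<^sup>2" for z
    proof -
      have "F (\<lambda>z. f z - g z) z = F f z - F g z" by (simp add: F_def algebra_simps)
      then have "cmod (F (\<lambda>z. f z - g z) z) \<le> cmod (F f z) + cmod (F g z)" by (simp add: norm_triangle_ineq4)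
      then have "(cmod (F (\<lambda>z. f z - g z) z))\<^sup>2 \<le> (cmod (F f z) + cmod (F g z))\<^sup>2" by (intro power_mono) auto
      also have "\<dots> \<le> 2 * (cmod (F f z))\<^sup>2 + 2 * (cmod (F g z))\<^sup>2"
        using sum_squares_bound[of "cmod (F f z)" "cmod (F g z)"] by (simp add: power2_sum)
      finally show ?thesis .
    qed
    then show "AE z in lborel. norm ((cmod (F (\<lambda>z. f z - g z) z))\<^sup>2) \<le> norm (2 * (cmod (F f z))\<^sup>2 + 2 * (cmod (F g z))\<^sup>2)"
      by simp
  qed
  then show "set_integrable lborel S (\<lambda>z. (cmod (f z - g z))\<^sup>2 * exp (- \<phi> z))"
    unfolding sq set_integrable_def .
qed

lemma set_integrable_from_nn_integral:
  fixes f :: "complex \<Rightarrow> complex" and \<phi> :: "complex \<Rightarrow> real"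
  assumes S: "open S" and \<phi>: "continuous_on S \<phi>" and f: "continuous_on S f" and B: "B \<ge> 0"
    and le: "(\<integral>\<^sup>+z. ennreal ((cmod (f z))\<^sup>2 * exp (- \<phi> z)) * indicator S z \<partial>lborel) \<le> ennreal B"
  shows "set_integrable lborel S (\<lambda>z. (cmod (f z))\<^sup>2 * exp (- \<phi> z))"
    and "(LINT z:S|lborel. (cmod (f z))\<^sup>2 * exp (- \<phi> z)) \<le> B"
proof -
  let ?h = "\<lambda>z. indicator S z *\<^sub>R ((cmod (f z))\<^sup>2 * exp (- \<phi> z))"
  have m: "?h \<in> borel_measurable lborel"
    using borel_measurable_continuous_on_indicator[of S "\<lambda>z. (cmod (f z))\<^sup>2 * exp (- \<phi> z)"] S f \<phi>
    by (simp add: continuous_intros)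
  have eq: "ennreal (?h z) = ennreal ((cmod (f z))\<^sup>2 * exp (- \<phi> z)) * indicator S z" for z
    by (simp add: indicator_def)
  have i: "integrable lborel ?h"
  proof (rule integrableI_nonneg[OF m])
    show "(\<integral>\<^sup>+z. ennreal (?h z) \<partial>lborel) < \<infinity>" unfolding eq using le by (simp add: order_le_less_trans)
  qed simp
  then show "set_integrable lborel S (\<lambda>z. (cmod (f z))\<^sup>2 * exp (- \<phi> z))" by (simp add: set_integrable_def)
  have "ennreal (LINT z|lborel. ?h z) \<le> ennreal B"
    using nn_integral_eq_integral[OF i] le unfolding eq by simp
  then show "(LINT z:S|lborel. (cmod (f z))\<^sup>2 * exp (- \<phi> z)) \<le> B"
    using B by (simp add: set_lebesgue_integral_def)
qed

lemma weighted_point_bound_domain: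
  "\<exists>K>0. \<forall>S u z R \<phi> N r c \<H>. quadratic_weight \<phi> N z r c \<H> \<longrightarrow> N > 0 \<longrightarrow> 1 / sqrt N \<le> r \<longrightarrow> 2 / sqrt N < R \<longrightarrow>
     bianalytic_on u (ball z R) \<longrightarrow> cball z (1 / sqrt N) \<subseteq> S \<longrightarrow>
     set_integrable lborel S (\<lambda>\<zeta>. (cmod (u \<zeta>))\<^sup>2 * exp (- \<phi> \<zeta>)) \<longrightarrow>
     cmod (u z) * exp (- \<phi> z / 2) \<le> K * sqrt N * sqrt (LINT \<zeta>:S|lborel. (cmod (u \<zeta>))\<^sup>2 * exp (- \<phi> \<zeta>))"
proof -
  obtain K where K': "K > 0 \<and> (\<forall>u z R \<phi> N r c \<H>. quadratic_weight \<phi> N z r c \<H> \<longrightarrow> N > 0 \<longrightarrow> 1 / sqrt N \<le> r \<longrightarrow> 2 / sqrt N < R \<longrightarrow>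
     bianalytic_on u (ball z R) \<longrightarrow>
     ennreal ((cmod (u z))\<^sup>2 * exp (- \<phi> z)) \<le> ennreal (K * N) *
       (\<integral>\<^sup>+\<zeta>. ennreal ((cmod (u \<zeta>))\<^sup>2 * exp (- \<phi> \<zeta>)) * indicator (cball z (1 / sqrt N)) \<zeta> \<partial>lborel))"
    using weighted_point_bound by (rule exE)
  have K: "K > 0" using K' by simp
  have "cmod (u z) * exp (- \<phi> z / 2) \<le> sqrt K * sqrt N * sqrt (LINT \<zeta>:S|lborel. (cmod (u \<zeta>))\<^sup>2 * exp (- \<phi> \<zeta>))"
    if "quadratic_weight \<phi> N z r c \<H>" and N: "N > 0" and "1 / sqrt N \<le> r" "2 / sqrt N < R"
     "bianalytic_on u (ball z R)" and sub: "cball z (1 / sqrt N) \<subseteq> S"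
     and i: "set_integrable lborel S (\<lambda>\<zeta>. (cmod (u \<zeta>))\<^sup>2 * exp (- \<phi> \<zeta>))" for S u z R \<phi> N r c \<H>
  proof -
    let ?J = "LINT \<zeta>:S|lborel. (cmod (u \<zeta>))\<^sup>2 * exp (- \<phi> \<zeta>)"
    have J: "?J \<ge> 0" unfolding set_lebesgue_integral_def by (rule Bochner_Integration.integral_nonneg) simp
    have "ennreal ((cmod (u z))\<^sup>2 * exp (- \<phi> z)) \<le> ennreal (K * N) *
       (\<integral>\<^sup>+\<zeta>. ennreal ((cmod (u \<zeta>))\<^sup>2 * exp (- \<phi> \<zeta>)) * indicator (cball z (1 / sqrt N)) \<zeta> \<partial>lborel)"
      using K' that by blast
    also have "\<dots> \<le> ennreal (K * N) * (\<integral>\<^sup>+\<zeta>. ennreal (indicator S \<zeta> *\<^sub>R ((cmod (u \<zeta>))\<^sup>2 * exp (- \<phi> \<zeta>))) \<partial>lborel)"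
      using sub by (intro mult_left_mono nn_integral_mono) (auto simp: indicator_def)
    also have "\<dots> = ennreal (K * N) * ennreal ?J"
      using nn_integral_eq_integral[OF i[unfolded set_integrable_def]] by (simp add: set_lebesgue_integral_def)
    also have "\<dots> = ennreal (K * N * ?J)" using K N J by (simp add: ennreal_mult)
    finally have "(cmod (u z))\<^sup>2 * exp (- \<phi> z) \<le> K * N * ?J" using K N J by simp
    then have "(cmod (u z) * exp (- \<phi> z / 2))\<^sup>2 \<le> K * N * ?J"
      by (simp add: power_mult_distrib exp_double[symmetric])
    then have "cmod (u z) * exp (- \<phi> z / 2) \<le> sqrt (K * N * ?J)" by (rule real_le_rsqrt)
    then show ?thesis by (simp add: real_sqrt_mult)
  qed
  moreover have "sqrt K > 0" using K by simp
  ultimately show ?thesis by (intro exI[of _ "sqrt K"] conjI allI impI)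
qed

text \<open>The cutoff radius r and the constants are fixed before m, and only the model kernel
  moves with w and N. The difference of K and k is V - f, with V = U - k and f = U - K(\<cdot>, w);
  both have norm O(exp(\<phi>(w)/2)) and each is evaluated at z separately.\<close>

lemma Bergman_kernel_near_model:
  fixes Q :: "complex \<Rightarrow> real"
  assumes S: "open S" and Q: "Ck_on 4 Q S" and pos: "\<And>z. z \<in> S \<Longrightarrow> qlaplacian Q z > 0"
    and B: "\<And>z. z \<in> S \<Longrightarrow> 1 / qlaplacian Q z * qlaplacian (\<lambda>u. ln (1 / qlaplacian Q u)) z \<le> B"
    and z0: "z0 \<in> S" and A: "A > 0"
  shows "\<exists>r>0. \<exists>c>0. \<exists>C>0. \<exists>m1>0. \<forall>m\<ge>m1. \<forall>K w z N. N = 2 * m * qlaplacian Q z0 \<longrightarrow> is_PA2_kernel S Q m K \<longrightarrow>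
     cmod (w - z0) \<le> A / sqrt N \<longrightarrow> cmod (z - z0) \<le> A / sqrt N \<longrightarrow>
     w \<in> S \<and> z \<in> S \<and> z \<in> ball w (r / 2) \<and> (\<exists>\<H>. quadratic_weight (\<lambda>z. 2 * m * Q z) N w r c \<H> \<and>
       cmod (K z w - model_kernel (\<lambda>z. 2 * m * Q z) N w r \<H> z) * exp (- m * Q z - m * Q w) \<le> C * sqrt N)"
proof -
  let ?D = "qlaplacian Q z0"
  have D: "?D > 0" using pos z0 by blast
  have Q3: "Ck_on 3 Q S" by (rule Ck_on_mono[OF Q]) simp
  have Qc: "continuous_on S Q" by (rule Ck_on_continuous[OF Q])
  have Lc: "continuous_on S (qlaplacian Q)"
    using Ck_on_continuous[OF Ck_on_qlaplacian[OF S, of 2 Q]] Q by simp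
  have "isCont (qlaplacian Q) z0" using Lc S z0 by (simp add: continuous_on_eq_continuous_at)
  then obtain d where d: "d > 0" "\<And>z. dist z z0 < d \<Longrightarrow> dist (qlaplacian Q z) ?D < ?D / 2"
    unfolding continuous_at_eps_delta using D by (metis half_gt_zero)
  obtain d' where d': "d' > 0" "cball z0 d' \<subseteq> S" using S z0 open_contains_cball by blast
  obtain r0 where r0: "r0 > 0" "\<And>r. 0 < r \<Longrightarrow> r \<le> r0 \<Longrightarrow> (\<exists>c>0. \<exists>m0>0. \<forall>m\<ge>m0. \<forall>w. cmod (w - z0) \<le> A / sqrt (2 * m * ?D) \<longrightarrow>
     cmod (w - z0) \<le> r \<and> (\<exists>\<H>. quadratic_weight (\<lambda>z. 2 * m * Q z) (2 * m * ?D) w r c \<H>))"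
    using quadratic_weight_exists[OF S Q3 z0 D A] by blast
  \<comment> \<open>The points w and z will lie within r/9 of z0, so discs of radius 2r about them
    stay within 3r of z0; the quarter leaves room for this inside both d and d'.\<close>
  define r where "r = min r0 (min d d' / 4)"
  have r: "r > 0" "r \<le> r0" "3 * r < d" "3 * r \<le> d'" using r0(1) d(1) d'(1) by (auto simp: r_def)
  obtain c m0 where c: "c > 0" "m0 > 0" and qw: "\<And>m w. m \<ge> m0 \<Longrightarrow> cmod (w - z0) \<le> A / sqrt (2 * m * ?D) \<Longrightarrow>
     cmod (w - z0) \<le> r \<and> (\<exists>\<H>. quadratic_weight (\<lambda>z. 2 * m * Q z) (2 * m * ?D) w r c \<H>)"
    using r0(2)[OF r(1,2)] by blast
  obtain K1 where K1': "K1 > 0 \<and> (\<forall>S \<phi> N w \<H> f. open S \<longrightarrow> cball w (2 * r) \<subseteq> S \<longrightarrow> continuous_on S \<phi> \<longrightarrow> N \<ge> 1 \<longrightarrow>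
     quadratic_weight \<phi> N w r c \<H> \<longrightarrow> bianalytic_on f S \<longrightarrow>
     set_integrable lborel S (\<lambda>z. (cmod (f z))\<^sup>2 * exp (- \<phi> z)) \<longrightarrow>
     cmod (f w - (LINT z:S|lborel. f z * cnj (model_kernel \<phi> N w r \<H> z) * of_real (exp (- \<phi> z))))
       \<le> K1 * exp (\<phi> w / 2) * sqrt (LINT z:S|lborel. (cmod (f z))\<^sup>2 * exp (- \<phi> z)))"
    using model_kernel_pairing[OF r(1) c(1)] by (rule exE)
  obtain K2 where K2': "K2 > 0 \<and> (\<forall>S \<phi> L N w \<H> c \<psi>. open S \<longrightarrow> cball w r \<subseteq> S \<longrightarrow> continuous_on S \<phi> \<longrightarrow> continuous_on S L \<longrightarrow>
     (\<forall>z\<in>S. L z > 0) \<longrightarrow> (\<forall>z\<in>cball w r. ?D / 2 \<le> L z) \<longrightarrow> N \<ge> 1 \<longrightarrow> quadratic_weight \<phi> N w r c \<H> \<longrightarrow>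
     Ckc 3 S \<psi> \<longrightarrow> (LINT z|lborel. (L z)\<^sup>2 * exp (\<phi> z) * (cmod (\<psi> z))\<^sup>2) \<le> wnorm2 \<phi> \<psi> \<longrightarrow>
     cmod (LINT z|lborel. model_kernel \<phi> N w r \<H> z * dbar (dbar \<psi>) z) \<le> K2 * exp (\<phi> w / 2) * sqrt (wnorm2 \<phi> \<psi>))"
    using model_kernel_data_bound[OF r(1), of "?D / 2"] D by (auto elim!: exE)
  obtain M where M': "M > 0 \<and> (\<forall>S (\<phi> :: complex \<Rightarrow> real) k c. open S \<longrightarrow> continuous_on S \<phi> \<longrightarrow> Ckc 0 S k \<longrightarrow> c \<ge> 0 \<longrightarrow>
    (\<forall>\<psi>. Ckc 3 S \<psi> \<longrightarrow> cmod (LINT z|lborel. k z * dbar (dbar \<psi>) z) \<le> c * sqrt (wnorm2 \<phi> \<psi>)) \<longrightarrow>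
    (\<exists>U. bianalytic_on U S \<and>
      (\<integral>\<^sup>+z. ennreal ((cmod (U z - k z))\<^sup>2 * exp (- \<phi> z)) * indicator S z \<partial>lborel) \<le> ennreal (M * c\<^sup>2)))"
    using weighted_bianalytic_approximation by (rule exE)
  obtain K3 where K3': "K3 > 0 \<and> (\<forall>S u z R \<phi> N r c \<H>. quadratic_weight \<phi> N z r c \<H> \<longrightarrow> N > 0 \<longrightarrow> 1 / sqrt N \<le> r \<longrightarrow> 2 / sqrt N < R \<longrightarrow>
     bianalytic_on u (ball z R) \<longrightarrow> cball z (1 / sqrt N) \<subseteq> S \<longrightarrow>
     set_integrable lborel S (\<lambda>\<zeta>. (cmod (u \<zeta>))\<^sup>2 * exp (- \<phi> \<zeta>)) \<longrightarrow>
     cmod (u z) * exp (- \<phi> z / 2) \<le> K3 * sqrt N * sqrt (LINT \<zeta>:S|lborel. (cmod (u \<zeta>))\<^sup>2 * exp (- \<phi> \<zeta>)))"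
    using weighted_point_bound_domain by (rule exE)
  have Kpos: "K1 > 0" "K2 > 0" "M > 0" "K3 > 0" using K1' K2' M' K3' by auto
  define V0 where "V0 = sqrt M * K2"
  define C where "C = K3 * (V0 + (K1 + V0))"
  have V0: "V0 > 0" using Kpos by (simp add: V0_def)
  have C: "C > 0" using Kpos V0 by (simp add: C_def)
  \<comment> \<open>The last entry forces N \<ge> 1 and sqrt N \<ge> 9 (1 + A) / r, hence both
    1/sqrt N and A/sqrt N are at most r/9.\<close>
  define m1 where "m1 = Max {m0, B, 1, (1 + (9 * (1 + A) / r)\<^sup>2) / (2 * ?D)}"
  have m1: "m1 \<ge> m0" "m1 \<ge> B" "m1 \<ge> 1" "m1 \<ge> (1 + (9 * (1 + A) / r)\<^sup>2) / (2 * ?D)" by (auto simp: m1_def)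
  have main: "w \<in> S \<and> z \<in> S \<and> z \<in> ball w (r / 2) \<and> (\<exists>\<H>. quadratic_weight (\<lambda>z. 2 * m * Q z) N w r c \<H> \<and>
       cmod (K z w - model_kernel (\<lambda>z. 2 * m * Q z) N w r \<H> z) * exp (- m * Q z - m * Q w) \<le> C * sqrt N)"
    if m: "m \<ge> m1" and N_def: "N = 2 * m * ?D" and K: "is_PA2_kernel S Q m K"
      and w: "cmod (w - z0) \<le> A / sqrt N" and z: "cmod (z - z0) \<le> A / sqrt N" for m K w z N
  proof -
    have mm: "m \<ge> m0" "m \<ge> B" "m \<ge> 1" using m m1 by auto
    have "(1 + (9 * (1 + A) / r)\<^sup>2) / (2 * ?D) \<le> m" using m m1(4) by linarith
    then have "1 + (9 * (1 + A) / r)\<^sup>2 \<le> m * (2 * ?D)" using D by (subst (asm) pos_divide_le_eq) auto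
    then have N9: "1 + (9 * (1 + A) / r)\<^sup>2 \<le> N" by (simp add: N_def mult_ac)
    have N: "N \<ge> 1" using N9 zero_le_power2[of "9 * (1 + A) / r"] by linarith
    have "9 * (1 + A) / r \<le> sqrt N" by (rule real_le_rsqrt) (use N9 in linarith)
    then have sN: "(1 + A) / sqrt N \<le> r / 9" using r(1) N A by (simp add: field_simps)
    have sN1: "1 / sqrt N \<le> (1 + A) / sqrt N" "A / sqrt N \<le> (1 + A) / sqrt N"
      using A N by (auto intro!: divide_right_mono)
    have small: "1 / sqrt N \<le> r / 9" "A / sqrt N \<le> r / 9" using order_trans[OF sN1(1) sN] order_trans[OF sN1(2) sN] by blast+
    have "2 / sqrt N = 2 * (1 / sqrt N)" by simp
    then have small2: "2 / sqrt N \<le> 2 * r / 9" using small by linarith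
    obtain \<H> where \<H>: "quadratic_weight (\<lambda>z. 2 * m * Q z) N w r c \<H>" using qw[OF mm(1)] w N_def by blast
    obtain \<H>z where \<H>z: "quadratic_weight (\<lambda>z. 2 * m * Q z) N z r c \<H>z" using qw[OF mm(1)] z N_def by blast
    have wz0: "dist w z0 \<le> r / 9" "dist z z0 \<le> r / 9" using order_trans[OF w small(2)] order_trans[OF z small(2)] by (auto simp: dist_norm)
    have wz: "dist w z \<le> 2 * r / 9" using dist_triangle2[of w z z0] wz0 by linarith
    have near: "cball x (2 * r) \<subseteq> S \<and> (\<forall>y\<in>cball x (2 * r). dist y z0 < d)" if "dist x z0 \<le> r / 9" for x
    proof -
      have "dist y z0 < 3 * r" if "y \<in> cball x (2 * r)" for y
        using dist_triangle[of y z0 x] that \<open>dist x z0 \<le> r / 9\<close> r(1) by (simp add: dist_commute)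
      then show ?thesis using r(3,4) d'(2) by (force simp: subset_eq dist_commute)
    qed
    have wS: "cball w (2 * r) \<subseteq> S" and zS: "cball z (2 * r) \<subseteq> S" using near wz0 by auto
    have wS': "cball w r \<subseteq> S" using subset_cball[of r "2 * r" w] wS r(1) by auto
    have memb: "w \<in> S" "z \<in> S" using wS zS r(1) by auto
    have Lw: "\<forall>x\<in>cball w r. ?D / 2 \<le> qlaplacian Q x"
    proof
      fix x assume "x \<in> cball w r"
      then have "x \<in> cball w (2 * r)" using r(1) by simp
      then have "dist (qlaplacian Q x) ?D < ?D / 2" using near[OF wz0(1)] d(2) by blast
      then show "?D / 2 \<le> qlaplacian Q x" unfolding dist_real_def by linarith
    qed
    define \<phi> where "\<phi> = (\<lambda>z. 2 * m * Q z)"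
    have \<phi>c: "continuous_on S \<phi>" unfolding \<phi>_def by (intro continuous_intros Qc)
    have q: "quadratic_weight \<phi> N w r c \<H>" "quadratic_weight \<phi> N z r c \<H>z" using \<H> \<H>z by (simp_all add: \<phi>_def)
    have hol: "\<H> holomorphic_on UNIV" using q(1) by (simp add: quadratic_weight_def)
    define k where "k = model_kernel \<phi> N w r \<H>"
    have kc: "Ckc 0 S k" unfolding k_def using Ckc_mono[OF Ckc_model_kernel[OF _ wS' r(1) hol], of 0 S] S by auto
    have ineq: "(LINT x|lborel. (qlaplacian Q x)\<^sup>2 * exp (\<phi> x) * (cmod (\<psi> x))\<^sup>2) \<le> wnorm2 \<phi> \<psi>" if \<psi>: "Ckc 3 S \<psi>" for \<psi>
    proof -
      let ?I = "LINT x|lborel. (qlaplacian Q x)\<^sup>2 * exp (\<phi> x) * (cmod (\<psi> x))\<^sup>2"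
      have "0 \<le> ?I" by (rule Bochner_Integration.integral_nonneg) simp
      \<comment> \<open>Because m \<ge> 1 the factor 2 m^2 is at least 1, which gives the
        normalisation expected by the data bound.\<close>
      moreover have "1 \<le> 2 * m\<^sup>2" using one_le_power[OF mm(3), of 2] by linarith
      ultimately have "1 * ?I \<le> 2 * m\<^sup>2 * ?I" by (rule mult_right_mono[rotated])
      also have "\<dots> \<le> wnorm2 \<phi> \<psi>"
        unfolding wnorm2_def \<phi>_def by (rule weighted_dbar2_inequality[OF S Q pos B _ mm(2) \<psi>]) (use mm in auto)
      finally show ?thesis by simp
    qed
    define c' where "c' = K2 * exp (\<phi> w / 2)"
    have c': "c' \<ge> 0" using Kpos by (simp add: c'_def)
    have "cmod (LINT x|lborel. k x * dbar (dbar \<psi>) x) \<le> c' * sqrt (wnorm2 \<phi> \<psi>)" if \<psi>: "Ckc 3 S \<psi>" for \<psi>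
    proof -
      have "\<forall>x\<in>S. qlaplacian Q x > 0" using pos by blast
      then show ?thesis unfolding k_def c'_def
        using conjunct2[OF K2'] S wS' \<phi>c Lc Lw N q(1) \<psi> ineq[OF \<psi>] by blast
    qed
    then obtain U where U: "bianalytic_on U S"
      "(\<integral>\<^sup>+z. ennreal ((cmod (U z - k z))\<^sup>2 * exp (- \<phi> z)) * indicator S z \<partial>lborel) \<le> ennreal (M * c'\<^sup>2)"
      using conjunct2[OF M'] S \<phi>c kc c' by blast
    have Uc: "continuous_on S U" and kcont: "continuous_on S k"
      using bianalytic_continuous_on[OF U(1)] Ckc_continuous[OF kc] by auto
    define V where "V x = U x - k x" for x
    have Vc: "continuous_on S V" unfolding V_def by (intro continuous_intros Uc kcont)
    have "0 \<le> M * c'\<^sup>2" using Kpos by simp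
    note Vi = set_integrable_from_nn_integral[OF S \<phi>c Vc this U(2)[folded V_def]]
    have "sqrt (LINT x:S|lborel. (cmod (V x))\<^sup>2 * exp (- \<phi> x)) \<le> sqrt (M * c'\<^sup>2)" by (rule real_sqrt_le_mono[OF Vi(2)])
    then have Vn: "sqrt (LINT x:S|lborel. (cmod (V x))\<^sup>2 * exp (- \<phi> x)) \<le> V0 * exp (\<phi> w / 2)"
      using c' by (simp add: real_sqrt_mult V0_def c'_def)
    have ki: "set_integrable lborel S (\<lambda>x. (cmod (k x))\<^sup>2 * exp (- \<phi> x))"
    proof -
      have "continuous_on S (\<lambda>x. exp (- \<phi> x))" by (intro continuous_intros \<phi>c)
      from Ckc_integrable[OF Ckc_weighted_square[OF S kc this]]
      have "integrable lborel (\<lambda>x. (cmod (k x))\<^sup>2 * exp (- \<phi> x))" by (simp add: mult.commute)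
      then show ?thesis unfolding set_integrable_def using S by (intro integrable_mult_indicator) auto
    qed
    have ex: "exp (- (2 * m * Q x)) = exp (- \<phi> x)" for x by (simp add: \<phi>_def)
    define Kw where "Kw x = K x w" for x
    have KPA: "Kw \<in> PA2 S Q m" and rep: "\<And>f. f \<in> PA2 S Q m \<Longrightarrow> f w = (LINT x:S|lborel. f x * cnj (Kw x) * complex_of_real (exp (- 2 * m * Q x)))"
      using K memb(1) unfolding is_PA2_kernel_def Kw_def by auto
    have Kb: "bianalytic_on Kw S" and Ki: "set_integrable lborel S (\<lambda>x. (cmod (Kw x))\<^sup>2 * exp (- \<phi> x))"
      using KPA by (auto simp: PA2_def ex)
    have Kc: "continuous_on S Kw" by (rule bianalytic_continuous_on[OF Kb])
    define f where "f x = U x - Kw x" for x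
    have fb: "bianalytic_on f S" unfolding f_def by (rule bianalytic_on_diff[OF U(1) Kb S])
    have fc: "continuous_on S f" by (rule bianalytic_continuous_on[OF fb])
    have Ki': "set_integrable lborel S (\<lambda>x. (cmod (Kw x - k x))\<^sup>2 * exp (- \<phi> x))"
      by (rule weighted_inner_product(3)[OF S \<phi>c Kc kcont Ki ki])
    have "set_integrable lborel S (\<lambda>x. (cmod (V x - (Kw x - k x)))\<^sup>2 * exp (- \<phi> x))"
      by (rule weighted_inner_product(3)[OF S \<phi>c Vc _ Vi(1) Ki']) (intro continuous_intros Kc kcont)
    then have fi: "set_integrable lborel S (\<lambda>x. (cmod (f x))\<^sup>2 * exp (- \<phi> x))" by (simp add: V_def f_def)
    have fPA: "f \<in> PA2 S Q m" using fb fi by (simp add: PA2_def ex)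
    let ?J = "LINT x:S|lborel. (cmod (f x))\<^sup>2 * exp (- \<phi> x)"
    have J0: "?J \<ge> 0" unfolding set_lebesgue_integral_def by (rule Bochner_Integration.integral_nonneg) simp
    note ip = weighted_inner_product(1,2)[OF S \<phi>c fc]
    let ?w = "\<lambda>x. complex_of_real (exp (- \<phi> x))"
    \<comment> \<open>Expand the norm with f = k + V - K(\<cdot>, w) in the conjugated slot. The
      pairing with K is f(w) exactly and the pairing with k is f(w) up to a small error; these
      cancel and leave the term with V.\<close>
    have "complex_of_real ?J = (LINT x:S|lborel. f x * cnj (k x) * ?w x + f x * cnj (V x) * ?w x - f x * cnj (Kw x) * ?w x)"
    proof -
      have "complex_of_real ?J = (LINT x:S|lborel. complex_of_real ((cmod (f x))\<^sup>2 * exp (- \<phi> x)))"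
        unfolding set_lebesgue_integral_def by (simp flip: integral_complex_of_real add: scaleR_conv_of_real)
      also have "\<dots> = (LINT x:S|lborel. f x * cnj (k x) * ?w x + f x * cnj (V x) * ?w x - f x * cnj (Kw x) * ?w x)"
      proof -
        have "complex_of_real ((cmod (f x))\<^sup>2 * exp (- \<phi> x)) = f x * cnj (k x) * ?w x + f x * cnj (V x) * ?w x - f x * cnj (Kw x) * ?w x" for x
        proof -
          have "complex_of_real ((cmod (f x))\<^sup>2 * exp (- \<phi> x)) = f x * cnj (f x) * ?w x"
            by (simp only: of_real_mult complex_norm_square)
          also have "f x = k x + V x - Kw x" by (simp add: f_def V_def)
          then have "f x * cnj (f x) = f x * cnj (k x + V x - Kw x)" by simp
          finally show ?thesis by (simp add: algebra_simps)
        qed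
        then show ?thesis by simp
      qed
      finally show ?thesis .
    qed
    also have "\<dots> = (LINT x:S|lborel. f x * cnj (k x) * ?w x) + (LINT x:S|lborel. f x * cnj (V x) * ?w x) - (LINT x:S|lborel. f x * cnj (Kw x) * ?w x)"
      using ip(1)[OF kcont fi ki] ip(1)[OF Vc fi Vi(1)] ip(1)[OF Kc fi Ki] by (simp add: set_integral_add set_integral_diff)
    also have "(LINT x:S|lborel. f x * cnj (Kw x) * ?w x) = f w" using rep[OF fPA] by (simp add: ex)
    finally have Jeq: "complex_of_real ?J = (LINT x:S|lborel. f x * cnj (V x) * ?w x) - (f w - (LINT x:S|lborel. f x * cnj (k x) * ?w x))" by simp
    have "cmod (f w - (LINT x:S|lborel. f x * cnj (k x) * ?w x)) \<le> K1 * exp (\<phi> w / 2) * sqrt ?J"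
      unfolding k_def using conjunct2[OF K1'] S wS \<phi>c N q(1) fb fi by blast
    moreover have "cmod (LINT x:S|lborel. f x * cnj (V x) * ?w x) \<le> sqrt ?J * (V0 * exp (\<phi> w / 2))"
      by (rule order_trans[OF ip(2)[OF Vc fi Vi(1)] mult_left_mono[OF Vn]]) (use J0 in simp)
    ultimately have "cmod (complex_of_real ?J) \<le> ((K1 + V0) * exp (\<phi> w / 2)) * sqrt ?J"
      unfolding Jeq by (intro order_trans[OF norm_triangle_ineq4]) (simp add: algebra_simps)
    then have "sqrt ?J * sqrt ?J \<le> ((K1 + V0) * exp (\<phi> w / 2)) * sqrt ?J" using J0 by simp
    then have fn: "sqrt ?J \<le> (K1 + V0) * exp (\<phi> w / 2)"
    proof (cases "?J = 0")
      case False
      then have "sqrt ?J > 0" using J0 by simp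
      then show ?thesis using \<open>sqrt ?J * sqrt ?J \<le> ((K1 + V0) * exp (\<phi> w / 2)) * sqrt ?J\<close> mult_right_le_imp_le by blast
    qed (use Kpos V0 in simp)
    have N0: "N > 0" and t1: "1 / sqrt N \<le> r" using N small(1) r(1) by auto
    have csub: "cball z (1 / sqrt N) \<subseteq> S" using subset_cball[of "1 / sqrt N" "2 * r" z] zS t1 r(1) by auto
    have fz: "cmod (f z) * exp (- \<phi> z / 2) \<le> K3 * sqrt N * ((K1 + V0) * exp (\<phi> w / 2))"
    proof -
      have "2 / sqrt N < 2 * r" using small2 r(1) by linarith
      moreover have "bianalytic_on f (ball z (2 * r))" using bianalytic_on_subset[OF fb] zS ball_subset_cball by blast
      ultimately have "cmod (f z) * exp (- \<phi> z / 2) \<le> K3 * sqrt N * sqrt ?J"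
        using conjunct2[OF K3'] q(2) N0 t1 csub fi by blast
      also have "\<dots> \<le> K3 * sqrt N * ((K1 + V0) * exp (\<phi> w / 2))" using fn Kpos N by (intro mult_left_mono) auto
      finally show ?thesis .
    qed
    have Vz: "cmod (V z) * exp (- \<phi> z / 2) \<le> K3 * sqrt N * (V0 * exp (\<phi> w / 2))"
    proof -
      \<comment> \<open>V is bianalytic only where k is. Since |w - z| \<le> 2r/9, the disc of
        radius r/4 about z stays inside the disc of radius r/2 about w, and 2/sqrt N \<le> 2r/9 <
        r/4 fits the evaluation scale.\<close>
      have "2 / sqrt N < r / 4" using small2 r(1) by linarith
      moreover have "bianalytic_on V (ball z (r / 4))"
      proof -
        have "ball z (r / 4) \<subseteq> ball w (r / 2)"
        proof
          fix x assume "x \<in> ball z (r / 4)"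
          then show "x \<in> ball w (r / 2)" using dist_triangle[of w x z] wz r(1) by simp
        qed
        moreover have "ball z (r / 4) \<subseteq> S"
        proof -
          have "ball z (r / 4) \<subseteq> cball z (2 * r)" using r(1) by auto
          then show ?thesis using zS by blast
        qed
        ultimately show ?thesis unfolding V_def[abs_def] k_def
          by (intro bianalytic_on_diff bianalytic_on_subset[OF U(1)] bianalytic_on_subset[OF model_kernel_bianalytic[OF r(1) hol]] open_ball)
      qed
      ultimately have "cmod (V z) * exp (- \<phi> z / 2) \<le> K3 * sqrt N * sqrt (LINT x:S|lborel. (cmod (V x))\<^sup>2 * exp (- \<phi> x))"
        using conjunct2[OF K3'] q(2) N0 t1 csub Vi(1) by blast
      also have "\<dots> \<le> K3 * sqrt N * (V0 * exp (\<phi> w / 2))" using Vn Kpos N by (intro mult_left_mono) auto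
      finally show ?thesis .
    qed
    have "K z w - k z = V z - f z" by (simp add: V_def f_def Kw_def)
    then have "cmod (K z w - k z) * exp (- \<phi> z / 2) \<le> cmod (V z) * exp (- \<phi> z / 2) + cmod (f z) * exp (- \<phi> z / 2)"
      using norm_triangle_ineq4[of "V z" "f z"] by (simp add: distrib_right[symmetric])
    also have "\<dots> \<le> (C * sqrt N) * exp (\<phi> w / 2)" using fz Vz by (simp add: C_def algebra_simps)
    finally have "cmod (K z w - k z) * exp (- \<phi> z / 2) * exp (- \<phi> w / 2) \<le> (C * sqrt N) * exp (\<phi> w / 2) * exp (- \<phi> w / 2)"
      by (rule mult_right_mono) simp
    moreover have "(C * sqrt N) * exp (\<phi> w / 2) * exp (- \<phi> w / 2) = C * sqrt N" by (simp add: mult.assoc exp_add[symmetric])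
    moreover have "exp (- \<phi> z / 2) * exp (- \<phi> w / 2) = exp (- m * Q z - m * Q w)" by (simp add: \<phi>_def exp_add[symmetric])
    ultimately have "cmod (K z w - k z) * exp (- m * Q z - m * Q w) \<le> C * sqrt N" by (simp only: mult.assoc)
    moreover have "z \<in> ball w (r / 2)" using wz r(1) by simp
    ultimately show ?thesis using memb \<H> unfolding k_def \<phi>_def by blast
  qed
  have m1pos: "m1 > 0" using m1 by linarith
  show ?thesis
    by (rule exI[of _ r], rule conjI[OF r(1)], rule exI[of _ c], rule conjI[OF c(1)], rule exI[of _ C], rule conjI[OF C],
        rule exI[of _ m1], rule conjI[OF m1pos], intro allI impI, rule main)
qed

section \<open>Rescaling and the limit kernel\<close>

theorem theorem5p1:
  fixes \<Omega> :: "complex set" and Q :: "complex \<Rightarrow> real" and z0 :: complex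
    and K :: "real \<Rightarrow> complex \<Rightarrow> complex \<Rightarrow> complex"
    and S :: "(complex \<times> complex) set"
  assumes "open \<Omega>" and "connected \<Omega>"
    and "Ck_on 4 Q \<Omega>"
    and "\<And>z. z \<in> \<Omega> \<Longrightarrow> qlaplacian Q z > 0"
    and "bdd_above ((\<lambda>z. 1 / qlaplacian Q z * qlaplacian (\<lambda>u. ln (1 / qlaplacian Q u)) z) ` \<Omega>)"
    and "z0 \<in> \<Omega>"
    and "\<exists>U. open U \<and> z0 \<in> U \<and> U \<subseteq> \<Omega> \<and> real_analytic_on Q U"
    and "\<And>m. m > 0 \<Longrightarrow> is_PA2_kernel \<Omega> Q m (K m)"
    and "compact S"
  shows "\<exists>m0>0. \<exists>C>0. \<forall>m\<ge>m0. \<forall>(\<xi>, \<eta>)\<in>S.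
    (let z = z0 + complex_of_real ((2 * m * qlaplacian Q z0) powr (- 1 / 2)) * \<xi>;
         w = z0 + complex_of_real ((2 * m * qlaplacian Q z0) powr (- 1 / 2)) * \<eta>
     in z \<in> \<Omega> \<and> w \<in> \<Omega> \<and>
        \<bar>1 / (2 * m * qlaplacian Q z0) * cmod (K m z w) * exp (- m * Q z - m * Q w)
          - \<bar>2 - (cmod (\<xi> - \<eta>))\<^sup>2\<bar> / pi * exp (- (1 / 2) * (cmod (\<xi> - \<eta>))\<^sup>2)\<bar>
        \<le> C * m powr (- 1 / 2))"
proof -
  let ?D = "qlaplacian Q z0"
  have D: "?D > 0" using assms(4,6) by blast
  obtain B where B: "\<And>z. z \<in> \<Omega> \<Longrightarrow> 1 / qlaplacian Q z * qlaplacian (\<lambda>u. ln (1 / qlaplacian Q u)) z \<le> B"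
    using assms(5) unfolding bdd_above_def by blast
  obtain A0 where A0: "\<And>p. p \<in> S \<Longrightarrow> norm p \<le> A0"
    using compact_imp_bounded[OF assms(9)] unfolding bounded_iff by blast
  define A where "A = max 1 A0"
  have A: "A > 0" by (simp add: A_def)
  have \<xi>\<eta>: "cmod \<xi> \<le> A" "cmod \<eta> \<le> A" if "(\<xi>, \<eta>) \<in> S" for \<xi> \<eta>
    using A0[OF that] norm_fst_le[of \<xi> \<eta>] norm_snd_le[of \<eta> \<xi>] unfolding A_def by linarith+
  obtain r c C1 m1 where pos: "r > 0" "c > 0" "C1 > 0" "m1 > 0"
    and near: "\<And>m K w z N. m \<ge> m1 \<Longrightarrow> N = 2 * m * ?D \<Longrightarrow> is_PA2_kernel \<Omega> Q m K \<Longrightarrow>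
     cmod (w - z0) \<le> A / sqrt N \<Longrightarrow> cmod (z - z0) \<le> A / sqrt N \<Longrightarrow>
     w \<in> \<Omega> \<and> z \<in> \<Omega> \<and> z \<in> ball w (r / 2) \<and> (\<exists>\<H>. quadratic_weight (\<lambda>z. 2 * m * Q z) N w r c \<H> \<and>
       cmod (K z w - model_kernel (\<lambda>z. 2 * m * Q z) N w r \<H> z) * exp (- m * Q z - m * Q w) \<le> C1 * sqrt N)"
    using Bergman_kernel_near_model[OF assms(1,3,4) B assms(6) A] by metis
  \<comment> \<open>An upper bound for |\<xi> - \<eta>|^2 on S, since both components of a pair have
    modulus at most A.\<close>
  define Y where "Y = 4 * A\<^sup>2"
  define C2 where "C2 = (2 + Y) / pi * (c * ((1 + Y) * Y) * exp (Y / 4))"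
  have Y: "Y \<ge> 0" by (simp add: Y_def)
  have C2: "C2 \<ge> 0" using Y pos by (simp add: C2_def)
  \<comment> \<open>The power of 2 \<Delta>Q(z0) converts 1/sqrt N into
    \<open>m powr (- 1 / 2)\<close>.\<close>
  define C where "C = (C1 + C2) * (2 * ?D) powr (- 1 / 2)"
  have C: "C > 0" using pos C2 D by (simp add: C_def)
  have main: "z \<in> \<Omega> \<and> w \<in> \<Omega> \<and>
        \<bar>1 / (2 * m * ?D) * cmod (K m z w) * exp (- m * Q z - m * Q w)
          - \<bar>2 - (cmod (\<xi> - \<eta>))\<^sup>2\<bar> / pi * exp (- (1 / 2) * (cmod (\<xi> - \<eta>))\<^sup>2)\<bar>
        \<le> C * m powr (- 1 / 2)"
    if m: "m \<ge> m1" and S: "(\<xi>, \<eta>) \<in> S"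
      and z: "z = z0 + complex_of_real ((2 * m * ?D) powr (- 1 / 2)) * \<xi>"
      and w: "w = z0 + complex_of_real ((2 * m * ?D) powr (- 1 / 2)) * \<eta>" for m \<xi> \<eta> z w
  proof -
    define N where "N = 2 * m * ?D"
    have m0: "m > 0" using m pos by linarith
    have N: "N > 0" using m0 D by (simp add: N_def)
    have t: "(2 * m * ?D) powr (- 1 / 2) = 1 / sqrt N"
      using N powr_minus_divide[of N "1 / 2"] by (simp add: N_def[symmetric] powr_half_sqrt)
    have cz: "cmod (z - z0) \<le> A / sqrt N" and cw: "cmod (w - z0) \<le> A / sqrt N"
      using \<xi>\<eta>[OF S] N unfolding z w t by (auto simp: norm_mult norm_divide divide_right_mono)
    define \<phi> where "\<phi> = (\<lambda>z. 2 * m * Q z)"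
    obtain \<H> where mem: "w \<in> \<Omega>" "z \<in> \<Omega>" "z \<in> ball w (r / 2)" and q: "quadratic_weight \<phi> N w r c \<H>"
      and err: "cmod (K m z w - model_kernel \<phi> N w r \<H> z) * exp (- m * Q z - m * Q w) \<le> C1 * sqrt N"
      using near[OF m N_def assms(8)[OF m0] cw cz] unfolding \<phi>_def by blast
    define y where "y = (cmod (\<xi> - \<eta>))\<^sup>2"
    have y0: "y \<ge> 0" by (simp add: y_def)
    have "cmod (\<xi> - \<eta>) \<le> 2 * A" using norm_triangle_ineq4[of \<xi> \<eta>] \<xi>\<eta>[OF S] by linarith
    then have "y \<le> (2 * A)\<^sup>2" unfolding y_def by (intro power_mono) auto
    then have yY: "y \<le> Y" by (simp add: Y_def power_mult_distrib)
    have "z - w = complex_of_real (1 / sqrt N) * (\<xi> - \<eta>)" unfolding z w t by (simp add: right_diff_distrib)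
    then have "cmod (z - w) = cmod (\<xi> - \<eta>) / sqrt N" using N by (simp add: norm_mult norm_divide)
    then have yN: "N * (cmod (z - w))\<^sup>2 = y" using N by (simp add: y_def power_divide)
    have "z \<in> cball w r" using mem(3) pos by simp
    then obtain e where e: "\<phi> z = \<phi> w + 2 * Re (\<H> z) + y + e" "\<bar>e\<bar> \<le> y / 4" "\<bar>e\<bar> \<le> c / sqrt N * ((1 + y) * y)"
      using quadratic_weightD[OF q, of z] unfolding yN by metis
    define E where "E = exp (- m * Q z - m * Q w)"
    define P where "P = model_kernel \<phi> N w r \<H> z"
    have EP: "E = exp (- \<phi> z / 2 - \<phi> w / 2)" by (simp add: E_def \<phi>_def)
    have "cmod P = N / pi * exp (\<phi> w) * exp (Re (\<H> z)) * \<bar>2 - y\<bar>"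
      unfolding P_def model_kernel_inside[OF pos(1) mem(3)] yN using N
      by (simp add: norm_mult norm_divide del: of_real_mult of_real_diff of_real_divide)
    \<comment> \<open>By the expansion of \<phi>(z), the exponent \<phi>(w) + Re H - \<phi>(z)/2 -
      \<phi>(w)/2 equals -(y + e)/2. The pluriharmonic part disappears and the limit Gaussian
      appears, perturbed only by e.\<close>
    moreover have "exp (\<phi> w) * exp (Re (\<H> z)) * E = exp (- y / 2) * exp (- e / 2)"
      unfolding EP exp_add[symmetric] using e(1) by (simp add: field_simps)
    ultimately have "cmod P * E = N / pi * \<bar>2 - y\<bar> * (exp (- y / 2) * exp (- e / 2))"
      by (simp add: mult_ac)
    then have PE: "cmod P * E / N = \<bar>2 - y\<bar> / pi * exp (- y / 2) * exp (- e / 2)" using N by simp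
    have E: "E > 0" by (simp add: E_def)
    have "\<bar>cmod (K m z w) * E / N - cmod P * E / N\<bar> = \<bar>cmod (K m z w) - cmod P\<bar> * E / N"
      using E N by (simp add: abs_mult left_diff_distrib[symmetric] diff_divide_distrib[symmetric])
    also have "\<dots> \<le> cmod (K m z w - P) * E / N"
      using E N norm_triangle_ineq3[of "K m z w" P] by (intro divide_right_mono mult_right_mono) auto
    also have "\<dots> \<le> C1 * sqrt N / N" using err N unfolding E_def P_def by (intro divide_right_mono) auto
    also have "\<dots> = C1 / sqrt N" using N by (simp add: field_simps)
    finally have first: "\<bar>cmod (K m z w) * E / N - cmod P * E / N\<bar> \<le> C1 / sqrt N" .
    have "\<bar>cmod P * E / N - \<bar>2 - y\<bar> / pi * exp (- y / 2)\<bar> = \<bar>2 - y\<bar> / pi * exp (- y / 2) * \<bar>1 - exp (- e / 2)\<bar>"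
    proof -
      have "cmod P * E / N - \<bar>2 - y\<bar> / pi * exp (- y / 2) = - (\<bar>2 - y\<bar> / pi * exp (- y / 2) * (1 - exp (- e / 2)))"
        unfolding PE right_diff_distrib by simp
      then show ?thesis by (simp only: abs_minus_cancel) (simp add: abs_mult)
    qed
    also have "\<dots> \<le> (2 + Y) / pi * (c / sqrt N * ((1 + Y) * Y) * exp (Y / 4))"
    proof (rule mult_mono)
      have "\<bar>2 - y\<bar> / pi * exp (- y / 2) \<le> \<bar>2 - y\<bar> / pi * 1" using y0 by (intro mult_left_mono) auto
      also have "\<dots> \<le> (2 + Y) / pi" using y0 yY by (simp add: divide_right_mono)
      finally show "\<bar>2 - y\<bar> / pi * exp (- y / 2) \<le> (2 + Y) / pi" .
      have "\<bar>1 - exp (- e / 2)\<bar> \<le> \<bar>- e / 2\<bar> * exp \<bar>- e / 2\<bar>" by (rule abs_exp_minus_1_le)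
      also have "\<dots> \<le> \<bar>e\<bar> * exp (Y / 4)" using e(2) yY y0 by (intro mult_mono) auto
      also have "\<dots> \<le> c / sqrt N * ((1 + Y) * Y) * exp (Y / 4)"
      proof (rule mult_right_mono)
        have "c / sqrt N * ((1 + y) * y) \<le> c / sqrt N * ((1 + Y) * Y)"
          using y0 yY pos N by (intro mult_left_mono mult_mono) auto
        then show "\<bar>e\<bar> \<le> c / sqrt N * ((1 + Y) * Y)" using e(3) by linarith
      qed simp
      finally show "\<bar>1 - exp (- e / 2)\<bar> \<le> c / sqrt N * ((1 + Y) * Y) * exp (Y / 4)" .
    qed (use Y in auto)
    also have "\<dots> = C2 / sqrt N" by (simp add: C2_def)
    finally have second: "\<bar>cmod P * E / N - \<bar>2 - y\<bar> / pi * exp (- y / 2)\<bar> \<le> C2 / sqrt N" .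
    have "C * m powr (- 1 / 2) = (C1 + C2) * (1 / sqrt N)"
      using m0 D by (simp add: C_def t[symmetric] powr_mult[symmetric] mult_ac)
    then have "\<bar>cmod (K m z w) * E / N - \<bar>2 - y\<bar> / pi * exp (- y / 2)\<bar> \<le> C * m powr (- 1 / 2)"
      using abs_triangle_ineq[of "cmod (K m z w) * E / N - cmod P * E / N" "cmod P * E / N - \<bar>2 - y\<bar> / pi * exp (- y / 2)"]
        first second by (simp add: add_divide_distrib)
    then show ?thesis using mem unfolding E_def N_def y_def by simp
  qed
  show ?thesis
    using pos(4) C main by (intro exI[of _ m1] exI[of _ C] conjI allI impI ballI) (auto simp: Let_def)
qed

end
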